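(* Let $p$ be a prime, $M\in\omega$, and let $\mathcal{A}$ be a computable reduced Abelian $p$-group of length greater than $\omega M$. Then for any $\Delta^0_{2M+1}$ set $S$, there is a uniformly computable sequence $(\mathcal{A}_n)_{n\in\omega}$ of structures such that $\mathcal{A}_n\cong\mathcal{A}$ iff $n\in S$. That is, $I(\mathcal{A})$ is $\Delta^0_{2M+1}$-hard.
   Context: For a countable Abelian $p$-group $G$: $G_0=G$, $G_{\alpha+1}=pG_\alpha$, $G_\alpha=\bigcap_{\beta<\alpha}G_\beta$ for limit $\alpha$; the length is the least $\alpha$ with $G_\alpha=G_{\alpha+1}$; $G$ is reduced if $G_{\text{length}}=\{0\}$. A structure (universe $\subseteq\omega$) is computable if its atomic diagram is computable; a sequence is uniformly computable if the atomic diagrams are uniformly computable. $I(\mathcal{A})$ is the set of indices $a$ (i.e. $\varphi_a$ is the characteristic function of the atomic diagram) of computable copies of $\mathcal{A}$. *)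

theory Defs
  imports "HOL-Algebra.Group" "HOL-Computational_Algebra.Primes"
begin

inductive total_rec :: "nat \<Rightarrow> (nat list \<Rightarrow> nat) \<Rightarrow> bool" where
  rec_zero: "total_rec n (\<lambda>xs. 0)"
| rec_succ: "total_rec 1 (\<lambda>xs. Suc (hd xs))"
| rec_proj: "i < n \<Longrightarrow> total_rec n (\<lambda>xs. xs ! i)"
| rec_comp: "total_rec m g \<Longrightarrow> length fs = m \<Longrightarrow> (\<forall>f\<in>set fs. total_rec n f)
     \<Longrightarrow> total_rec n (\<lambda>xs. g (map (\<lambda>f. f xs) fs))"
| rec_prec: "total_rec n g \<Longrightarrow> total_rec (Suc (Suc n)) h
     \<Longrightarrow> total_rec (Suc n) (\<lambda>xs. rec_nat (g (tl xs)) (\<lambda>k r. h (k # r # tl xs)) (hd xs))"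
| rec_mu: "total_rec (Suc n) g \<Longrightarrow> (\<forall>xs. length xs = n \<longrightarrow> (\<exists>y. g (y # xs) = 0))
     \<Longrightarrow> total_rec n (\<lambda>xs. LEAST y. g (y # xs) = 0)"

definition computable_fn :: "nat \<Rightarrow> (nat list \<Rightarrow> nat) \<Rightarrow> bool" where
  "computable_fn n f \<longleftrightarrow> (\<exists>g. total_rec n g \<and> (\<forall>xs. length xs = n \<longrightarrow> f xs = g xs))"

definition decidable_rel :: "nat \<Rightarrow> (nat list \<Rightarrow> bool) \<Rightarrow> bool" where
  "decidable_rel n P \<longleftrightarrow> computable_fn n (\<lambda>xs. if P xs then 1 else 0)"

fun sigma_rel :: "nat \<Rightarrow> nat \<Rightarrow> (nat list \<Rightarrow> bool) \<Rightarrow> bool" where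
  "sigma_rel 0 k P = decidable_rel k P"
| "sigma_rel (Suc m) k P =
     (\<exists>Q. sigma_rel m (Suc k) Q \<and> (\<forall>xs. length xs = k \<longrightarrow> (P xs \<longleftrightarrow> (\<exists>y. \<not> Q (y # xs)))))"

definition pi_rel :: "nat \<Rightarrow> nat \<Rightarrow> (nat list \<Rightarrow> bool) \<Rightarrow> bool" where
  "pi_rel m k P \<longleftrightarrow> sigma_rel m k (\<lambda>xs. \<not> P xs)"

definition Delta_set :: "nat \<Rightarrow> nat set \<Rightarrow> bool" where
  "Delta_set m S \<longleftrightarrow> sigma_rel m 1 (\<lambda>xs. hd xs \<in> S) \<and> pi_rel m 1 (\<lambda>xs. hd xs \<in> S)"

record struc =
  univ :: "nat set"
  plus :: "nat \<Rightarrow> nat \<Rightarrow> nat"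

definition is_struc :: "struc \<Rightarrow> bool" where
  "is_struc A \<longleftrightarrow> (\<forall>x\<in>univ A. \<forall>y\<in>univ A. plus A x y \<in> univ A)"

definition computable_struc :: "struc \<Rightarrow> bool" where
  "computable_struc A \<longleftrightarrow>
     decidable_rel 1 (\<lambda>xs. hd xs \<in> univ A) \<and>
     (\<exists>g. computable_fn 2 g \<and>
        (\<forall>x\<in>univ A. \<forall>y\<in>univ A. g [x, y] = plus A x y))"

definition unif_computable :: "(nat \<Rightarrow> struc) \<Rightarrow> bool" where
  "unif_computable As \<longleftrightarrow>
     decidable_rel 2 (\<lambda>xs. xs ! 1 \<in> univ (As (xs ! 0))) \<and>
     (\<exists>g. computable_fn 3 g \<and>
        (\<forall>n. \<forall>x\<in>univ (As n). \<forall>y\<in>univ (As n). g [n, x, y] = plus (As n) x y))"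

definition struc_iso :: "struc \<Rightarrow> struc \<Rightarrow> bool" where
  "struc_iso A B \<longleftrightarrow> (\<exists>h. bij_betw h (univ A) (univ B) \<and>
     (\<forall>x\<in>univ A. \<forall>y\<in>univ A. h (plus A x y) = plus B (h x) (h y)))"

definition grp :: "struc \<Rightarrow> nat monoid" where
  "grp A = \<lparr>carrier = univ A, monoid.mult = plus A,
            one = (THE e. e \<in> univ A \<and> (\<forall>x\<in>univ A. plus A e x = x))\<rparr>"

definition abelian_p_group :: "nat \<Rightarrow> struc \<Rightarrow> bool" where
  "abelian_p_group p A \<longleftrightarrow> is_struc A \<and> comm_group (grp A) \<and>
     (\<forall>x\<in>univ A. \<exists>n. x [^]\<^bsub>grp A\<^esub> (p ^ n) = \<one>\<^bsub>grp A\<^esub>)"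

definition pmul :: "nat \<Rightarrow> struc \<Rightarrow> nat set \<Rightarrow> nat set" where
  "pmul p A X = (\<lambda>x. x [^]\<^bsub>grp A\<^esub> p) ` X"

text \<open>The family of all Ulm subgroups G_alpha (alpha any ordinal): the least family containing G,
  closed under X \<mapsto> pX and under intersections of nonempty subfamilies.\<close>
inductive_set ulm_family :: "nat \<Rightarrow> struc \<Rightarrow> nat set set" for p A where
  ulm_base: "univ A \<in> ulm_family p A"
| ulm_succ: "X \<in> ulm_family p A \<Longrightarrow> pmul p A X \<in> ulm_family p A"
| ulm_lim: "F \<noteq> {} \<Longrightarrow> (\<forall>X\<in>F. X \<in> ulm_family p A) \<Longrightarrow> \<Inter>F \<in> ulm_family p A"

text \<open>Reduced: G_length = {0}, where G_length is the last (smallest) Ulm subgroup.\<close>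
definition reduced :: "nat \<Rightarrow> struc \<Rightarrow> bool" where
  "reduced p A \<longleftrightarrow> \<Inter>(ulm_family p A) = {\<one>\<^bsub>grp A\<^esub>}"

primrec ulm_omega :: "nat \<Rightarrow> struc \<Rightarrow> nat \<Rightarrow> nat set" where
  "ulm_omega p A 0 = univ A"
| "ulm_omega p A (Suc k) = (\<Inter>n. (pmul p A ^^ n) (ulm_omega p A k))"

text \<open>length > omega*M iff G_{omega M} \<noteq> G_{omega M + 1} (the Ulm sequence stabilises once two
  consecutive terms agree).\<close>
definition length_gt_omega_times :: "nat \<Rightarrow> struc \<Rightarrow> nat \<Rightarrow> bool" where
  "length_gt_omega_times p A M \<longleftrightarrow> pmul p A (ulm_omega p A M) \<noteq> ulm_omega p A M"

end

theory Submission
  imports Defs "HOL-Library.Nat_Bijection" "HOL-Library.Equipollence" "HOL-Computational_Algebra.Polynomial"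
    "HOL-Library.Product_Lexorder" "HOL-Algebra.FiniteProduct"
begin

text \<open>By induction on \<open>M\<close>, relative to an arbitrary class of functions closed under recursion: a \<open>\<Delta>\<^sup>0\<^sub>2\<^sub>M\<^sub>+\<^sub>1\<close> set is decidable in
  the \<open>M\<close>-fold double jump.  For \<open>M = 0\<close> one outputs the given group or the trivial one.  In the step, the induction
  hypothesis applied to the subgroup \<open>A\<^sub>\<omega>\<close>, which is computable in the double jump, yields presentations \<open>G\<^sub>n\<close>
  computable in the double jump.  A \<open>\<Pi>\<^sub>2\<close> guessing procedure turns each \<open>G\<^sub>n\<close> into a computable group \<open>H\<^sub>n\<close> whose elements
  of infinite height form a copy of \<open>G\<^sub>n\<close> and whose finite Ulm invariants are those of \<open>A\<close>: generators of \<open>G\<^sub>n\<close> get roots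
  of ever larger order, while wrong guesses become cyclic summands, of orders taken from an infinite set of
  nonzero Ulm invariants of \<open>A\<close>; that set exists because the length exceeds \<open>\<omega>\<close>.  A back-and-forth argument in
  the style of Zippin shows \<open>H\<^sub>n \<cong> A\<close> if \<open>G\<^sub>n \<cong> A\<^sub>\<omega>\<close>.  For \<open>n \<notin> S\<close> the \<open>\<omega>M\<close>-th Ulm subgroup of the \<open>n\<close>-th group is
  \<open>p\<close>-divisible, which distinguishes it from \<open>A\<close>.\<close>

subsection \<open>Clones of recursive functions and the limit jump\<close>

text \<open>Having infinite height means that for every exponent there is a root, so deciding
  \<open>A\<^sub>\<omega>\<close> takes two jumps; this fixes the exchange rate of two jumps for
  \<omega>. The obstacle is the finite Ulm invariants, which may be 1 wherever they are nonzero. A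
  wrong guess cannot be erased, so its cyclic summand must be one that \<open>A\<close> has anyway,
  and no summand may be charged twice; moreover the invariants are known only in the limit. The
  remedy starts from an element of \<open>A\<^sub>\<omega>\<close> without \<open>p\<close>-th root
  in \<open>A\<^sub>\<omega>\<close>. Its \<open>p\<close>-th roots in \<open>A\<close> have finite
  unbounded heights, and the Ulm invariants at these heights are nonzero. Heights are approximable
  from below, which suits chains that can only grow. They yield a strictly increasing sequence of
  orders, one slot for each piece of waste. One unit of each invariant in this sequence is withheld;
  the other units come from guessing a basis of the Ulm quotient. An abandoned basis guess is waste
  with a slot of its own, and slots left empty are filled on purpose. Jumps are taken as limits,
  which avoids universal machines.\<close>

definition pr :: "nat \<Rightarrow> nat \<Rightarrow> nat" where "pr a b = prod_encode (a, b)"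
definition p1 :: "nat \<Rightarrow> nat" where "p1 z = fst (prod_decode z)"
definition p2 :: "nat \<Rightarrow> nat" where "p2 z = snd (prod_decode z)"

lemma p1_pr [simp]: "p1 (pr a b) = a" and p2_pr [simp]: "p2 (pr a b) = b"
  by (simp_all add: pr_def p1_def p2_def)

lemma pr_p1_p2 [simp]: "pr (p1 z) (p2 z) = z"
  by (simp add: pr_def p1_def p2_def)

lemma pr_eq_iff [simp]: "pr a b = pr c d \<longleftrightarrow> a = c \<and> b = d"
  by (auto simp: pr_def)

lemma le_pr1: "a \<le> pr a b" and le_pr2: "b \<le> pr a b"
  by (simp_all add: pr_def le_prod_encode_1 le_prod_encode_2)

lemma p1_le: "p1 z \<le> z" and p2_le: "p2 z \<le> z"
  using le_pr1[of "p1 z" "p2 z"] le_pr2[of "p2 z" "p1 z"] by simp_all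

lemma triangle_mono: "a \<le> b \<Longrightarrow> triangle a \<le> triangle b"
  unfolding triangle_def by (intro div_le_mono mult_le_mono) auto

lemma pr_mono: "a \<le> a' \<Longrightarrow> b \<le> b' \<Longrightarrow> pr a b \<le> pr a' b'"
  by (auto simp: pr_def prod_encode_def intro!: add_le_mono triangle_mono)

lemma pr_less: "a \<le> a' \<Longrightarrow> b \<le> b' \<Longrightarrow> (a, b) \<noteq> (a', b') \<Longrightarrow> pr a b < pr a' b'"
  using pr_mono[of a a' b b'] by (metis le_neq_implies_less pr_eq_iff)

text \<open>The pairing function lists the diagonals one after another, each by increasing first
  component. The slots of guessed chains rely on this: for one visited string, the shorter prefix
  receives the larger slot.\<close>

lemma pr_less_diagonal:
  assumes "a + b < a' + b' \<or> a + b = a' + b' \<and> a < a'"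
  shows "pr a b < pr a' b'"
  using assms
proof
  assume "a + b < a' + b'"
  then have "triangle (Suc (a + b)) \<le> triangle (a' + b')"
    by (intro triangle_mono) simp
  then show ?thesis by (simp add: pr_def prod_encode_def)
qed (simp add: pr_def prod_encode_def)

named_theorems rec_intros

locale clone =
  fixes C :: "(nat \<Rightarrow> nat) set"
  assumes id_in: "(\<lambda>x. x) \<in> C"
    and zero_in: "(\<lambda>x. 0) \<in> C"
    and Suc_in: "Suc \<in> C"
    and p1_in: "p1 \<in> C"
    and p2_in: "p2 \<in> C"
    and pair_in: "f \<in> C \<Longrightarrow> g \<in> C \<Longrightarrow> (\<lambda>x. pr (f x) (g x)) \<in> C"
    and comp_in: "f \<in> C \<Longrightarrow> g \<in> C \<Longrightarrow> (\<lambda>x. f (g x)) \<in> C"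
    and prec_in: "g \<in> C \<Longrightarrow> h \<in> C \<Longrightarrow>
      (\<lambda>z. rec_nat (g (p2 z)) (\<lambda>k r. h (pr k (pr r (p2 z)))) (p1 z)) \<in> C"
    and mu_in: "g \<in> C \<Longrightarrow> (\<forall>x. \<exists>y. g (pr y x) = 0) \<Longrightarrow> (\<lambda>x. LEAST y. g (pr y x) = 0) \<in> C"
begin

declare id_in [rec_intros] pair_in [rec_intros]

definition decid :: "(nat \<Rightarrow> bool) \<Rightarrow> bool" where
  "decid P \<longleftrightarrow> (\<lambda>x. if P x then 1 else 0) \<in> C"

lemma const_in [rec_intros]: "(\<lambda>x. k) \<in> C"
proof (induction k)
  case (Suc k)
  then show ?case using comp_in[OF Suc_in] by simp
qed (rule zero_in)

lemma Suc_comp_in [rec_intros]: "f \<in> C \<Longrightarrow> (\<lambda>x. Suc (f x)) \<in> C"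
  and p1_comp_in [rec_intros]: "f \<in> C \<Longrightarrow> (\<lambda>x. p1 (f x)) \<in> C"
  and p2_comp_in [rec_intros]: "f \<in> C \<Longrightarrow> (\<lambda>x. p2 (f x)) \<in> C"
  by (erule comp_in[OF Suc_in], erule comp_in[OF p1_in], erule comp_in[OF p2_in])

lemma rec_in [rec_intros]:
  assumes "g \<in> C" "(\<lambda>z. h (p2 (p2 z)) (p1 z) (p1 (p2 z))) \<in> C" "n \<in> C"
  shows "(\<lambda>x. rec_nat (g x) (h x) (n x)) \<in> C"
proof -
  let ?F = "\<lambda>z. rec_nat (g (p2 z)) (\<lambda>k r. (\<lambda>z. h (p2 (p2 z)) (p1 z) (p1 (p2 z))) (pr k (pr r (p2 z)))) (p1 z)"
  have "(\<lambda>x. ?F (pr (n x) x)) \<in> C"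
    by (intro comp_in[OF prec_in[OF assms(1,2)]] pair_in assms(3) id_in)
  then show ?thesis by simp
qed

lemma app2_in: "(\<lambda>z. F (p1 z) (p2 z)) \<in> C \<Longrightarrow> f \<in> C \<Longrightarrow> g \<in> C \<Longrightarrow> (\<lambda>x. F (f x) (g x)) \<in> C"
  using comp_in[of "\<lambda>z. F (p1 z) (p2 z)" "\<lambda>x. pr (f x) (g x)"] by (simp add: pair_in)

lemma app3_in: "(\<lambda>z. F (p1 z) (p1 (p2 z)) (p2 (p2 z))) \<in> C \<Longrightarrow> f \<in> C \<Longrightarrow> g \<in> C \<Longrightarrow> h \<in> C \<Longrightarrow>
    (\<lambda>x. F (f x) (g x) (h x)) \<in> C"
  using comp_in[of "\<lambda>z. F (p1 z) (p1 (p2 z)) (p2 (p2 z))" "\<lambda>x. pr (f x) (pr (g x) (h x))"]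
  by (simp add: pair_in)

lemma decid_app: "decid P \<Longrightarrow> f \<in> C \<Longrightarrow> decid (\<lambda>x. P (f x))"
  unfolding decid_def using comp_in[of "\<lambda>x. if P x then 1 else 0" f] by simp

lemma decid_app2: "decid (\<lambda>z. P (p1 z) (p2 z)) \<Longrightarrow> f \<in> C \<Longrightarrow> g \<in> C \<Longrightarrow> decid (\<lambda>x. P (f x) (g x))"
  using decid_app[of "\<lambda>z. P (p1 z) (p2 z)" "\<lambda>x. pr (f x) (g x)"] by (simp add: pair_in)

lemma decid_app3: "decid (\<lambda>z. P (p1 z) (p1 (p2 z)) (p2 (p2 z))) \<Longrightarrow> f \<in> C \<Longrightarrow> g \<in> C \<Longrightarrow> h \<in> C \<Longrightarrow>
    decid (\<lambda>x. P (f x) (g x) (h x))"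
  using decid_app[of "\<lambda>z. P (p1 z) (p1 (p2 z)) (p2 (p2 z))" "\<lambda>x. pr (f x) (pr (g x) (h x))"]
  by (simp add: pair_in)

lemma if_nz_in:
  assumes "f \<in> C" "g \<in> C" "h \<in> C"
  shows "(\<lambda>x. if f x = 0 then g x else h x) \<in> C"
proof -
  have "(\<lambda>x. rec_nat (g x) (\<lambda>k r. h x) (f x)) \<in> C"
    by (intro rec_intros assms comp_in[OF assms(3)])
  moreover have "rec_nat (g x) (\<lambda>k r. h x) (f x) = (if f x = 0 then g x else h x)" for x
    by (cases "f x") auto
  ultimately show ?thesis by simp
qed

lemma if_in [rec_intros]:
  assumes "decid P" "g \<in> C" "h \<in> C"
  shows "(\<lambda>x. if P x then g x else h x) \<in> C"
proof -
  have "(\<lambda>x. if (if P x then 1 else 0::nat) = 0 then h x else g x) \<in> C"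
    using assms unfolding decid_def by (intro if_nz_in)
  moreover have "(if (if P x then 1 else 0::nat) = 0 then h x else g x) = (if P x then g x else h x)" for x
    by simp
  ultimately show ?thesis by simp
qed

lemma decid_not [rec_intros]: "decid P \<Longrightarrow> decid (\<lambda>x. \<not> P x)"
proof -
  assume "decid P"
  then have "(\<lambda>x. if P x then 0 else 1) \<in> C" by (intro rec_intros)
  moreover have "(if P x then 0 else 1) = (if \<not> P x then 1 else (0::nat))" for x by simp
  ultimately show ?thesis unfolding decid_def by simp
qed

lemma decid_conj [rec_intros]: "decid P \<Longrightarrow> decid Q \<Longrightarrow> decid (\<lambda>x. P x \<and> Q x)"
proof -
  assume "decid P" "decid Q"
  then have "(\<lambda>x. if P x then (if Q x then 1 else 0) else 0) \<in> C" by (intro rec_intros)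
  moreover have "(if P x then (if Q x then 1 else 0) else 0) = (if P x \<and> Q x then 1 else (0::nat))" for x
    by simp
  ultimately show ?thesis unfolding decid_def by simp
qed

lemma decid_disj [rec_intros]:
  assumes "decid P" "decid Q" shows "decid (\<lambda>x. P x \<or> Q x)"
  using decid_not[OF decid_conj[OF assms[THEN decid_not]]] by simp

lemma decid_imp [rec_intros]:
  assumes "decid P" "decid Q" shows "decid (\<lambda>x. P x \<longrightarrow> Q x)"
  using decid_disj[OF decid_not[OF assms(1)] assms(2)] by simp

section \<open>Arithmetic, bounded quantifiers and searches inside a clone\<close>

lemma add_in [rec_intros]:
  assumes "f \<in> C" "g \<in> C" shows "(\<lambda>x. f x + g x) \<in> C"
proof -
  have "(\<lambda>x. rec_nat (f x) (\<lambda>k r. Suc r) (g x)) \<in> C"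
    by (intro rec_intros assms)
  moreover have "rec_nat a (\<lambda>k r. Suc r) b = a + b" for a b by (induction b) auto
  ultimately show ?thesis by simp
qed

lemma mult_in [rec_intros]:
  assumes "f \<in> C" "g \<in> C" shows "(\<lambda>x. f x * g x) \<in> C"
proof -
  have "(\<lambda>x. rec_nat 0 (\<lambda>k r. r + f x) (g x)) \<in> C"
    by (intro rec_intros assms comp_in[OF assms(1)])
  moreover have "rec_nat 0 (\<lambda>k r. r + a) b = a * b" for a b :: nat by (induction b) auto
  ultimately show ?thesis by simp
qed

lemma power_in [rec_intros]:
  assumes "f \<in> C" "g \<in> C" shows "(\<lambda>x. f x ^ g x) \<in> C"
proof -
  have "(\<lambda>x. rec_nat 1 (\<lambda>k r. r * f x) (g x)) \<in> C"
    by (intro rec_intros assms comp_in[OF assms(1)])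
  moreover have "rec_nat 1 (\<lambda>k r. r * a) b = a ^ b" for a b :: nat by (induction b) auto
  ultimately show ?thesis by simp
qed

lemma pred_in:
  assumes "f \<in> C" shows "(\<lambda>x. f x - Suc 0) \<in> C"
proof -
  have "(\<lambda>x. rec_nat 0 (\<lambda>k r. k) (f x)) \<in> C"
    by (intro rec_intros assms)
  moreover have "rec_nat 0 (\<lambda>k r. k) b = b - Suc 0" for b :: nat by (induction b) auto
  ultimately show ?thesis by simp
qed

lemma diff_in [rec_intros]:
  assumes "f \<in> C" "g \<in> C" shows "(\<lambda>x. f x - g x) \<in> C"
proof -
  have "(\<lambda>x. rec_nat (f x) (\<lambda>k r. r - Suc 0) (g x)) \<in> C"
    by (intro rec_intros pred_in assms)
  moreover have "rec_nat a (\<lambda>k r. r - Suc 0) b = a - b" for a b :: nat by (induction b) auto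
  ultimately show ?thesis by simp
qed

lemma decid_zero:
  assumes "f \<in> C" shows "decid (\<lambda>x. f x = 0)"
  unfolding decid_def by (intro if_nz_in assms rec_intros)

lemma decid_le [rec_intros]:
  assumes "f \<in> C" "g \<in> C" shows "decid (\<lambda>x. f x \<le> g x)"
  using decid_zero[OF diff_in[OF assms]] by simp

lemma decid_less [rec_intros]:
  assumes "f \<in> C" "g \<in> C" shows "decid (\<lambda>x. f x < g x)"
  using decid_not[OF decid_le[OF assms(2,1)]] by (simp add: not_le)

lemma decid_eq [rec_intros]:
  assumes "f \<in> C" "g \<in> C" shows "decid (\<lambda>x. f x = g x)"
proof -
  have "(\<lambda>x. f x = g x) = (\<lambda>x. f x \<le> g x \<and> g x \<le> f x)" by auto
  then show ?thesis using decid_conj[OF decid_le[OF assms] decid_le[OF assms(2,1)]] by simp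
qed

lemma decid_bex [rec_intros]:
  assumes "decid (\<lambda>z. P (p2 z) (p1 z))" "n \<in> C"
  shows "decid (\<lambda>x. \<exists>y<n x. P x y)"
proof -
  let ?h = "\<lambda>x k r. if P x k then 1 else (r::nat)"
  have *: "decid (\<lambda>z. P (p2 (p2 z)) (p1 z))"
    using decid_app[OF assms(1), of "\<lambda>z. pr (p1 z) (p2 (p2 z))"] by (simp add: pair_in p1_in p2_comp_in p2_in)
  have "(\<lambda>x. rec_nat 0 (?h x) (n x)) \<in> C"
    by (intro rec_intros assms *)
  moreover have "rec_nat 0 (?h x) m = (if \<exists>y<m. P x y then 1 else 0)" for x m
    by (induction m) (auto simp: less_Suc_eq)
  ultimately show ?thesis unfolding decid_def by simp
qed

lemma decid_ball [rec_intros]: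
  assumes "decid (\<lambda>z. P (p2 z) (p1 z))" "n \<in> C"
  shows "decid (\<lambda>x. \<forall>y<n x. P x y)"
  using decid_not[OF decid_bex[OF decid_not[OF assms(1)] assms(2)]] by simp

lemma decid_bex_le [rec_intros]:
  assumes "decid (\<lambda>z. P (p2 z) (p1 z))" "n \<in> C"
  shows "decid (\<lambda>x. \<exists>y\<le>n x. P x y)"
  using decid_bex[OF assms(1) Suc_comp_in[OF assms(2)]] by (simp add: less_Suc_eq_le)

lemma Least_in:
  assumes "decid (\<lambda>z. P (p2 z) (p1 z))" "\<And>x. \<exists>y. P x y"
  shows "(\<lambda>x. LEAST y. P x y) \<in> C"
proof -
  let ?g = "\<lambda>z. if P (p2 z) (p1 z) then 0 else 1::nat"
  have "?g \<in> C" by (intro rec_intros assms)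
  moreover have "\<forall>x. \<exists>y. ?g (pr y x) = 0" using assms(2) by simp
  ultimately have "(\<lambda>x. LEAST y. ?g (pr y x) = 0) \<in> C" by (rule mu_in)
  moreover have "(?g (pr y x) = 0) = P x y" for x y by simp
  ultimately show ?thesis by simp
qed

text \<open>The second disjunct makes the search total; the value is \<open>n x\<close> when nothing
  is found below it.\<close>

lemma bounded_Least_in:
  assumes "decid (\<lambda>z. P (p2 z) (p1 z))" "n \<in> C"
  shows "(\<lambda>x. LEAST y. P x y \<or> n x \<le> y) \<in> C"
proof (rule Least_in)
  show "decid (\<lambda>z. P (p2 z) (p1 z) \<or> n (p2 z) \<le> p1 z)"
    by (intro decid_disj decid_le assms comp_in[OF assms(2)] p1_in p2_in)
  show "\<exists>y. P x y \<or> n x \<le> y" for x by blast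
qed

lemma sum_in [rec_intros]:
  assumes "(\<lambda>z. f (p2 z) (p1 z)) \<in> C" "n \<in> C"
  shows "(\<lambda>x. \<Sum>i<n x. f x i) \<in> C"
proof -
  have *: "(\<lambda>z. f (p2 (p2 z)) (p1 z)) \<in> C"
    using comp_in[OF assms(1), of "\<lambda>z. pr (p1 z) (p2 (p2 z))"] by (simp add: pair_in p1_in p2_comp_in p2_in)
  have "(\<lambda>x. rec_nat 0 (\<lambda>k r. r + f x k) (n x)) \<in> C"
    by (intro rec_intros assms *)
  moreover have "rec_nat 0 (\<lambda>k r. r + f x k) m = (\<Sum>i<m. f x i)" for x m
    by (induction m) auto
  ultimately show ?thesis by simp
qed

lemma div_in [rec_intros]:
  assumes "f \<in> C" "g \<in> C" shows "(\<lambda>x. f x div g x) \<in> C"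
proof -
  have "(\<lambda>x. if g x = 0 then 0 else LEAST q. f x < Suc q * g x \<or> f x \<le> q) \<in> C"
    by (intro rec_intros decid_zero bounded_Least_in assms comp_in[OF assms(1)] comp_in[OF assms(2)])
  moreover have "(if b = 0 then 0 else LEAST q. a < Suc q * b \<or> a \<le> q) = a div b" for a b :: nat
  proof (cases "b = 0")
    case False
    have "(LEAST q. a < Suc q * b \<or> a \<le> q) = a div b"
    proof (rule Least_equality)
      show "a < Suc (a div b) * b \<or> a \<le> a div b"
        using False dividend_less_times_div[of b a] by (simp add: mult.commute)
    next
      fix y assume "a < Suc y * b \<or> a \<le> y"
      then show "a div b \<le> y"
      proof
        assume "a < Suc y * b"
        then show ?thesis by (simp add: False less_mult_imp_div_less flip: less_Suc_eq_le)
      next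
        assume "a \<le> y" then show ?thesis using div_le_dividend le_trans by blast
      qed
    qed
    then show ?thesis using False by simp
  qed simp
  ultimately show ?thesis by simp
qed

lemma mod_in [rec_intros]:
  assumes "f \<in> C" "g \<in> C" shows "(\<lambda>x. f x mod g x) \<in> C"
proof -
  have "(\<lambda>x. f x - f x div g x * g x) \<in> C" by (intro rec_intros assms)
  then show ?thesis by (simp add: minus_div_mult_eq_mod)
qed

end

text \<open>A coding of finite sequences that needs nothing but pairing; a sequence has many codes.\<close>

definition nthc :: "nat \<Rightarrow> nat \<Rightarrow> nat" where
  "nthc z i = p1 (rec_nat z (\<lambda>k r. p2 r) i)"

lemma ex_nthc: "\<exists>z. \<forall>i<n. nthc z i = f i"
proof (induction n arbitrary: f)
  case (Suc n)
  from Suc[of "\<lambda>i. f (Suc i)"] obtain z where z: "\<forall>i<n. nthc z i = f (Suc i)" by blast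
  have shift: "rec_nat (pr a z) (\<lambda>k r. p2 r) (Suc i) = rec_nat z (\<lambda>k r. p2 r) i" for a i
    by (induction i) auto
  have "nthc (pr (f 0) z) i = f i" if "i < Suc n" for i
    using that z shift by (cases i) (auto simp: nthc_def)
  then show ?case by blast
qed simp

lemma (in clone) nthc_in [rec_intros]:
  assumes "f \<in> C" "g \<in> C" shows "(\<lambda>x. nthc (f x) (g x)) \<in> C"
  unfolding nthc_def by (intro rec_intros assms)

text \<open>By the limit lemma, pointwise limits of functions computable from an oracle are the
  functions computable from its Turing jump. Taking limits as the definition requires no enumeration
  of programs.\<close>

definition jump :: "(nat \<Rightarrow> nat) set \<Rightarrow> (nat \<Rightarrow> nat) set" where
  "jump C = {f. \<exists>g\<in>C. \<forall>x. \<exists>s0. \<forall>s\<ge>s0. g (pr x s) = f x}"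

lemma jumpI: "g \<in> C \<Longrightarrow> (\<And>x. \<exists>s0. \<forall>s\<ge>s0. g (pr x s) = f x) \<Longrightarrow> f \<in> jump C"
  unfolding jump_def mem_Collect_eq by (rule bexI) simp_all

lemma (in clone) subset_jump: "f \<in> C \<Longrightarrow> f \<in> jump C"
  by (rule jumpI[of "\<lambda>z. f (p1 z)"]) (auto intro: comp_in p1_in)

lemma jumpE:
  assumes "f \<in> jump C"
  obtains g where "g \<in> C" "\<And>x. \<exists>s0. \<forall>s\<ge>s0. g (pr x s) = f x"
proof -
  from assms obtain g where "g \<in> C" "\<forall>x. \<exists>s0. \<forall>s\<ge>s0. g (pr x s) = f x"
    unfolding jump_def mem_Collect_eq by (elim bexE)
  then show ?thesis using that by simp
qed

lemma (in clone) clone_jump: "clone (jump C)"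
proof
  show "(\<lambda>x. x) \<in> jump C" "(\<lambda>x. 0) \<in> jump C" "Suc \<in> jump C" "p1 \<in> jump C" "p2 \<in> jump C"
    by (auto intro!: subset_jump id_in zero_in Suc_in p1_in p2_in)
next
  fix f g assume "f \<in> jump C" "g \<in> jump C"
  then obtain f' g' where f': "f' \<in> C" "\<And>x. \<exists>s0. \<forall>s\<ge>s0. f' (pr x s) = f x"
    and g': "g' \<in> C" "\<And>x. \<exists>s0. \<forall>s\<ge>s0. g' (pr x s) = g x"
    by (metis jumpE)
  show "(\<lambda>x. pr (f x) (g x)) \<in> jump C"
  proof (rule jumpI)
    show "(\<lambda>z. pr (f' z) (g' z)) \<in> C" by (intro pair_in f' g')
    fix x
    obtain s0 s1 where "\<forall>s\<ge>s0. f' (pr x s) = f x" "\<forall>s\<ge>s1. g' (pr x s) = g x"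
      using f'(2) g'(2) by metis
    then show "\<exists>s0. \<forall>s\<ge>s0. pr (f' (pr x s)) (g' (pr x s)) = pr (f x) (g x)"
      by (intro exI[of _ "max s0 s1"]) auto
  qed
  show "(\<lambda>x. f (g x)) \<in> jump C"
  proof (rule jumpI)
    show "(\<lambda>z. f' (pr (g' z) (p2 z))) \<in> C" by (intro rec_intros comp_in[OF f'(1)] g'(1))
    fix x
    obtain s0 s1 where "\<forall>s\<ge>s0. f' (pr (g x) s) = f (g x)" "\<forall>s\<ge>s1. g' (pr x s) = g x"
      using f'(2) g'(2) by metis
    then show "\<exists>s0. \<forall>s\<ge>s0. f' (pr (g' (pr x s)) (p2 (pr x s))) = f (g x)"
      by (intro exI[of _ "max s0 s1"]) auto
  qed
  show "(\<lambda>z. rec_nat (f (p2 z)) (\<lambda>k r. g (pr k (pr r (p2 z)))) (p1 z)) \<in> jump C"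
  proof (rule jumpI)
    \<comment> \<open>The whole recursion is run on the stage-\<open>s\<close> approximations. For a
      fixed argument only finitely many values are queried, so all of them have settled from some
      stage on.\<close>
    let ?G = "\<lambda>y s. rec_nat (f' (pr y s)) (\<lambda>k r. g' (pr (pr k (pr r y)) s))"
    show "(\<lambda>w. ?G (p2 (p1 w)) (p2 w) (p1 (p1 w))) \<in> C"
      by (intro rec_intros comp_in[OF f'(1)] comp_in[OF g'(1)])
    fix x
    have "\<exists>s0. \<forall>s\<ge>s0. ?G y s m = rec_nat (f y) (\<lambda>k r. g (pr k (pr r y))) m" for y m
    proof (induction m)
      case 0 then show ?case using f'(2) by simp
    next
      case (Suc m)
      let ?r = "rec_nat (f y) (\<lambda>k r. g (pr k (pr r y))) m"
      obtain s0 where "\<forall>s\<ge>s0. ?G y s m = ?r" using Suc by blast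
      moreover obtain s1 where "\<forall>s\<ge>s1. g' (pr (pr m (pr ?r y)) s) = g (pr m (pr ?r y))"
        using g'(2) by blast
      ultimately show ?case by (intro exI[of _ "max s0 s1"]) auto
    qed
    then show "\<exists>s0. \<forall>s\<ge>s0. ?G (p2 (p1 (pr x s))) (p2 (pr x s)) (p1 (p1 (pr x s)))
        = rec_nat (f (p2 x)) (\<lambda>k r. g (pr k (pr r (p2 x)))) (p1 x)" by simp
  qed
next
  fix g assume "g \<in> jump C" and ex: "\<forall>x. \<exists>y. g (pr y x) = 0"
  then obtain g' where g': "g' \<in> C" "\<And>x. \<exists>s0. \<forall>s\<ge>s0. g' (pr x s) = g x"
    by (metis jumpE)
  show "(\<lambda>x. LEAST y. g (pr y x) = 0) \<in> jump C"
  proof (rule jumpI)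
    \<comment> \<open>An approximation need not have any zero, so the stage itself bounds the
      search. Once the stage exceeds the true minimum and all values up to it have settled, the
      bound has no effect.\<close>
    show "(\<lambda>w. LEAST y. g' (pr (pr y (p1 w)) (p2 w)) = 0 \<or> p2 w \<le> y) \<in> C"
      by (intro bounded_Least_in rec_intros comp_in[OF g'(1)])
    fix x
    let ?m = "LEAST y. g (pr y x) = 0"
    have m: "g (pr ?m x) = 0" "\<And>y. y < ?m \<Longrightarrow> g (pr y x) \<noteq> 0"
      using ex not_less_Least by (auto intro: LeastI_ex)
    have "\<exists>s0. \<forall>s\<ge>s0. \<forall>y\<le>n. g' (pr (pr y x) s) = g (pr y x)" for n
    proof (induction n)
      case 0 then show ?case using g'(2) by simp
    next
      case (Suc n)
      then obtain s0 where "\<forall>s\<ge>s0. \<forall>y\<le>n. g' (pr (pr y x) s) = g (pr y x)" by blast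
      moreover obtain s1 where "\<forall>s\<ge>s1. g' (pr (pr (Suc n) x) s) = g (pr (Suc n) x)"
        using g'(2) by blast
      ultimately show ?case by (intro exI[of _ "max s0 s1"]) (auto simp: le_Suc_eq)
    qed
    then obtain s0 where s0: "\<forall>s\<ge>s0. \<forall>y\<le>?m. g' (pr (pr y x) s) = g (pr y x)" by blast
    have "(LEAST y. g' (pr (pr y x) s) = 0 \<or> s \<le> y) = ?m" if "s \<ge> max s0 ?m" for s
    proof (rule Least_equality)
      show "g' (pr (pr ?m x) s) = 0 \<or> s \<le> ?m" using s0 m(1) that by auto
      fix y assume y: "g' (pr (pr y x) s) = 0 \<or> s \<le> y"
      show "?m \<le> y"
      proof (rule ccontr)
        assume "\<not> ?m \<le> y"
        then show False using y s0 m(2)[of y] that by auto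
      qed
    qed
    then show "\<exists>s0. \<forall>s\<ge>s0. (LEAST y. g' (pr (pr y (p1 (pr x s))) (p2 (pr x s))) = 0 \<or> p2 (pr x s) \<le> y) = ?m"
      by (intro exI[of _ "max s0 ?m"]) simp
  qed
qed

text \<open>The guess at stage \<open>s\<close> looks for a witness below \<open>s\<close>. It
  changes at most once, from no to yes, and hence converges.\<close>

lemma (in clone) decid_jump_ex:
  assumes "decid (\<lambda>z. P (p2 z) (p1 z))"
  shows "clone.decid (jump C) (\<lambda>x. \<exists>y. P x y)"
  unfolding clone.decid_def[OF clone_jump]
proof (rule jumpI)
    have "decid (\<lambda>z. P (p1 (p2 z)) (p1 z))"
      using decid_app[OF assms, of "\<lambda>z. pr (p1 z) (p1 (p2 z))"]
      by (simp add: pair_in p1_in p1_comp_in p2_in)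
    then have "decid (\<lambda>w. \<exists>y<p2 w. P (p1 w) y)"
      by (intro decid_bex p2_in)
    then show "(\<lambda>w. if \<exists>y<p2 w. P (p1 w) y then 1 else 0) \<in> C" unfolding decid_def .
    fix x
    show "\<exists>s0. \<forall>s\<ge>s0. (if \<exists>y<p2 (pr x s). P (p1 (pr x s)) y then 1 else 0) = (if \<exists>y. P x y then 1 else 0::nat)"
    proof (cases "\<exists>y. P x y")
      case True
      then obtain y where "P x y" by blast
      then show ?thesis by (intro exI[of _ "Suc y"]) auto
    qed auto
qed

lemma (in clone) decid_subset_jump: "decid P \<Longrightarrow> clone.decid (jump C) P"
  unfolding decid_def clone.decid_def[OF clone_jump] by (rule subset_jump)

subsection \<open>Computable functions form a clone\<close>

lemma computable_fn_ext:
  "computable_fn n f \<Longrightarrow> (\<And>xs. length xs = n \<Longrightarrow> g xs = f xs) \<Longrightarrow> computable_fn n g"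
  unfolding computable_fn_def by metis

lemma computable_fn_comp:
  assumes "computable_fn m g" "length fs = m" "\<And>f. f \<in> set fs \<Longrightarrow> computable_fn n f"
  shows "computable_fn n (\<lambda>xs. g (map (\<lambda>f. f xs) fs))"
proof -
  obtain g' where g': "total_rec m g'" "\<And>xs. length xs = m \<Longrightarrow> g xs = g' xs"
    using assms(1) unfolding computable_fn_def by blast
  have "\<exists>k. \<forall>f\<in>set fs. total_rec n (k f) \<and> (\<forall>xs. length xs = n \<longrightarrow> f xs = k f xs)"
    using assms(3) unfolding computable_fn_def by (intro bchoice) blast
  then obtain k where k: "\<And>f. f \<in> set fs \<Longrightarrow> total_rec n (k f)"
    "\<And>f xs. f \<in> set fs \<Longrightarrow> length xs = n \<Longrightarrow> f xs = k f xs" by blast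
  have "total_rec n (\<lambda>xs. g' (map (\<lambda>f. f xs) (map k fs)))"
    by (rule rec_comp[OF g'(1)]) (auto simp: assms(2) k(1))
  moreover have "g (map (\<lambda>f. f xs) fs) = g' (map (\<lambda>f. f xs) (map k fs))" if "length xs = n" for xs
  proof -
    have "map (\<lambda>f. f xs) fs = map (\<lambda>f. f xs) (map k fs)" using k(2) that by simp
    then have "g (map (\<lambda>f. f xs) fs) = g (map (\<lambda>f. f xs) (map k fs))" by (rule arg_cong)
    then show ?thesis using g'(2)[of "map (\<lambda>f. f xs) (map k fs)"] assms(2) by simp
  qed
  ultimately show ?thesis unfolding computable_fn_def by blast
qed

lemma computable_fn_app1:
  assumes "computable_fn 1 (\<lambda>xs. F (xs ! 0))" "computable_fn n f"
  shows "computable_fn n (\<lambda>xs. F (f xs))"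
  using computable_fn_comp[OF assms(1), of "[f]" n] assms(2) by simp

lemma computable_fn_app2:
  assumes "computable_fn 2 (\<lambda>xs. F (xs ! 0) (xs ! 1))" "computable_fn n f" "computable_fn n g"
  shows "computable_fn n (\<lambda>xs. F (f xs) (g xs))"
  using computable_fn_comp[OF assms(1), of "[f, g]" n] assms(2,3) by fastforce

lemma computable_fn_nth: "i < n \<Longrightarrow> computable_fn n (\<lambda>xs. xs ! i)"
  unfolding computable_fn_def using rec_proj by blast

lemma computable_fn_zero: "computable_fn n (\<lambda>xs. 0)"
  unfolding computable_fn_def using rec_zero by blast

lemma hd_nth0: "length xs = Suc n \<Longrightarrow> hd xs = xs ! 0"
  by (cases xs) auto

lemma computable_fn_Suc:
  assumes "computable_fn n f" shows "computable_fn n (\<lambda>xs. Suc (f xs))"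
proof (rule computable_fn_app1[OF _ assms])
  show "computable_fn 1 (\<lambda>xs. Suc (xs ! 0))"
    unfolding computable_fn_def using rec_succ hd_nth0 by fastforce
qed

lemma computable_fn_prec:
  assumes "computable_fn n g" "computable_fn (Suc (Suc n)) h"
  shows "computable_fn (Suc n) (\<lambda>xs. rec_nat (g (tl xs)) (\<lambda>k r. h (k # r # tl xs)) (hd xs))"
proof -
  obtain g' h' where g': "total_rec n g'" "\<And>xs. length xs = n \<Longrightarrow> g xs = g' xs"
    and h': "total_rec (Suc (Suc n)) h'" "\<And>xs. length xs = Suc (Suc n) \<Longrightarrow> h xs = h' xs"
    using assms unfolding computable_fn_def by blast
  have "rec_nat (g (tl xs)) (\<lambda>k r. h (k # r # tl xs)) m = rec_nat (g' (tl xs)) (\<lambda>k r. h' (k # r # tl xs)) m"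
    if "length xs = Suc n" for xs m
    using that g'(2) h'(2) by (induction m) auto
  then show ?thesis unfolding computable_fn_def using rec_prec[OF g'(1) h'(1)] by blast
qed

lemma computable_fn_mu:
  assumes "computable_fn (Suc n) g" "\<And>xs. length xs = n \<Longrightarrow> \<exists>y. g (y # xs) = 0"
  shows "computable_fn n (\<lambda>xs. LEAST y. g (y # xs) = 0)"
proof -
  obtain g' where g': "total_rec (Suc n) g'" "\<And>xs. length xs = Suc n \<Longrightarrow> g xs = g' xs"
    using assms unfolding computable_fn_def by blast
  have "total_rec n (\<lambda>xs. LEAST y. g' (y # xs) = 0)"
    using assms(2) g'(2) by (intro rec_mu[OF g'(1)]) auto
  then show ?thesis unfolding computable_fn_def using g'(2) by (intro exI conjI) auto
qed

lemma computable_fn_rec1: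
  assumes "computable_fn 2 (\<lambda>xs. h (xs ! 0) (xs ! 1))"
  shows "computable_fn 1 (\<lambda>xs. rec_nat 0 h (xs ! 0))"
proof -
  have "computable_fn (Suc 0) (\<lambda>xs. rec_nat ((\<lambda>_. 0) (tl xs)) (\<lambda>k r. (\<lambda>xs. h (xs ! 0) (xs ! 1)) (k # r # tl xs)) (hd xs))"
    using assms by (intro computable_fn_prec computable_fn_zero) (simp add: numeral_2_eq_2)
  then show ?thesis unfolding One_nat_def by (rule computable_fn_ext) (simp add: hd_nth0)
qed

lemma computable_fn_rec2:
  assumes "computable_fn 1 (\<lambda>xs. g (xs ! 0))" "computable_fn 3 (\<lambda>xs. h (xs ! 0) (xs ! 1) (xs ! 2))"
  shows "computable_fn 2 (\<lambda>xs. rec_nat (g (xs ! 1)) (\<lambda>k r. h k r (xs ! 1)) (xs ! 0))"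
proof -
  have "computable_fn (Suc 1) (\<lambda>xs. rec_nat ((\<lambda>xs. g (xs ! 0)) (tl xs))
      (\<lambda>k r. (\<lambda>xs. h (xs ! 0) (xs ! 1) (xs ! 2)) (k # r # tl xs)) (hd xs))"
    using assms by (intro computable_fn_prec) (simp_all add: numeral_3_eq_3)
  then show ?thesis
    unfolding Suc_1 by (rule computable_fn_ext) (auto simp: hd_nth0 nth_tl)
qed

section \<open>Arithmetic for functions of several arguments, leading to the pairing
  functions\<close>

lemma computable_fn_add:
  assumes "computable_fn n f" "computable_fn n g" shows "computable_fn n (\<lambda>xs. f xs + g xs)"
proof (rule computable_fn_app2[OF _ assms])
  have "rec_nat b (\<lambda>k r. Suc r) a = a + b" for a b by (induction a) auto
  then show "computable_fn 2 (\<lambda>xs. xs ! 0 + xs ! 1)"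
    using computable_fn_rec2[of "\<lambda>x. x" "\<lambda>k r y. Suc r"]
    by (simp add: computable_fn_nth computable_fn_Suc)
qed

lemma computable_fn_pred:
  assumes "computable_fn n f" shows "computable_fn n (\<lambda>xs. f xs - 1)"
proof (rule computable_fn_app1[OF _ assms])
  have "rec_nat 0 (\<lambda>k r. k) a = a - 1" for a :: nat by (induction a) auto
  then show "computable_fn 1 (\<lambda>xs. xs ! 0 - 1)"
    using computable_fn_rec1[of "\<lambda>k r. k"] by (simp add: computable_fn_nth)
qed

lemma computable_fn_diff:
  assumes "computable_fn n f" "computable_fn n g" shows "computable_fn n (\<lambda>xs. f xs - g xs)"
proof (rule computable_fn_app2[OF _ assms(2,1), of "\<lambda>a b. b - a"])
  have *: "rec_nat b (\<lambda>k r. r - 1) a = b - a" for a b :: nat by (induction a) auto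
  have "computable_fn 3 (\<lambda>xs. xs ! 1 - 1)" by (intro computable_fn_pred computable_fn_nth) simp
  then show "computable_fn 2 (\<lambda>xs. xs ! 1 - xs ! 0)"
    using computable_fn_rec2[of "\<lambda>x. x" "\<lambda>k r y. r - 1"] unfolding *
    by (simp add: computable_fn_nth)
qed

lemma computable_fn_triangle:
  assumes "computable_fn n f" shows "computable_fn n (\<lambda>xs. triangle (f xs))"
proof (rule computable_fn_app1[OF _ assms])
  have *: "rec_nat 0 (\<lambda>k r. r + Suc k) a = triangle a" for a by (induction a) auto
  have "computable_fn 2 (\<lambda>xs. xs ! 1 + Suc (xs ! 0))"
    by (intro computable_fn_add computable_fn_Suc computable_fn_nth) auto
  then show "computable_fn 1 (\<lambda>xs. triangle (xs ! 0))"
    using computable_fn_rec1[of "\<lambda>k r. r + Suc k"] unfolding * by simp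
qed

lemma computable_fn_pr:
  assumes "computable_fn n f" "computable_fn n g" shows "computable_fn n (\<lambda>xs. pr (f xs) (g xs))"
  unfolding pr_def prod_encode_def prod.case
  by (intro computable_fn_add computable_fn_triangle assms)

text \<open>The index of the diagonal on which \<open>z\<close> lies, that is the inverse of
  \<open>triangle\<close> rounded down. Truncated subtraction makes the recursion add 1 exactly when
  the argument reaches the next triangular number.\<close>

definition diag :: "nat \<Rightarrow> nat" where
  "diag z = rec_nat 0 (\<lambda>k r. r + (1 - (triangle (Suc r) - Suc k))) z"

lemma diag_bounds: "triangle (diag z) \<le> z \<and> z < triangle (Suc (diag z))"
proof (induction z)
  case (Suc z)
  let ?d = "diag z"
  have s: "diag (Suc z) = ?d + (1 - (triangle (Suc ?d) - Suc z))" by (simp add: diag_def)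
  show ?case
  proof (cases "triangle (Suc ?d) = Suc z")
    case True
    then have "diag (Suc z) = Suc ?d" using s by simp
    then show ?thesis using True by simp
  next
    case False
    then have "diag (Suc z) = ?d" using s Suc by simp
    then show ?thesis using Suc False by simp
  qed
qed (simp add: diag_def)

lemma diag_eq: "diag z = p1 z + p2 z"
proof -
  have z: "z = triangle (p1 z + p2 z) + p1 z"
    using pr_p1_p2[of z] by (simp add: pr_def prod_encode_def)
  have "\<not> diag z < p1 z + p2 z"
    using triangle_mono[of "Suc (diag z)" "p1 z + p2 z"] diag_bounds[of z] z by linarith
  moreover have "\<not> p1 z + p2 z < diag z"
    using triangle_mono[of "Suc (p1 z + p2 z)" "diag z"] diag_bounds[of z] z by auto
  ultimately show ?thesis by simp
qed

lemma computable_fn_diag: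
  assumes "computable_fn n f" shows "computable_fn n (\<lambda>xs. diag (f xs))"
proof (rule computable_fn_app1[OF _ assms])
  have "computable_fn 2 (\<lambda>xs. xs ! 1 + (Suc 0 - (triangle (Suc (xs ! 1)) - Suc (xs ! 0))))"
    by (intro computable_fn_add computable_fn_diff computable_fn_triangle computable_fn_Suc
        computable_fn_nth computable_fn_zero) auto
  then show "computable_fn 1 (\<lambda>xs. diag (xs ! 0))"
    unfolding diag_def using computable_fn_rec1[of "\<lambda>k r. r + (1 - (triangle (Suc r) - Suc k))"] by simp
qed

lemma p1_diag: "p1 z = z - triangle (diag z)"
  using pr_p1_p2[of z] unfolding diag_eq by (simp add: pr_def prod_encode_def)

lemma computable_fn_p1:
  assumes "computable_fn n f" shows "computable_fn n (\<lambda>xs. p1 (f xs))"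
  unfolding p1_diag by (intro computable_fn_diff computable_fn_triangle computable_fn_diag assms)

lemma computable_fn_p2:
  assumes "computable_fn n f" shows "computable_fn n (\<lambda>xs. p2 (f xs))"
proof -
  have "p2 z = diag z - p1 z" for z by (simp add: diag_eq)
  then show ?thesis by (simp add: computable_fn_diff computable_fn_diag computable_fn_p1 assms)
qed

definition comp_fns :: "(nat \<Rightarrow> nat) set" where
  "comp_fns = {f. computable_fn 1 (\<lambda>xs. f (xs ! 0))}"

lemma computable_fn_comp_fns: "f \<in> comp_fns \<Longrightarrow> computable_fn n g \<Longrightarrow> computable_fn n (\<lambda>xs. f (g xs))"
  unfolding comp_fns_def using computable_fn_app1 by blast

lemma clone_comp_fns: "clone comp_fns"
proof
  show "(\<lambda>x. x) \<in> comp_fns" "(\<lambda>x. 0) \<in> comp_fns" "Suc \<in> comp_fns" "p1 \<in> comp_fns" "p2 \<in> comp_fns"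
    by (simp_all add: comp_fns_def computable_fn_nth computable_fn_zero computable_fn_Suc
        computable_fn_p1 computable_fn_p2)
next
  fix f g assume fg: "f \<in> comp_fns" "g \<in> comp_fns"
  show "(\<lambda>x. pr (f x) (g x)) \<in> comp_fns"
    using fg by (simp add: comp_fns_def computable_fn_pr)
  show "(\<lambda>x. f (g x)) \<in> comp_fns"
    using fg computable_fn_comp_fns[OF fg(1)] by (simp add: comp_fns_def)
  have "computable_fn 2 (\<lambda>xs. rec_nat (f (xs ! 1)) (\<lambda>k r. g (pr k (pr r (xs ! 1)))) (xs ! 0))"
    using fg by (intro computable_fn_rec2 computable_fn_comp_fns[OF fg(2)] computable_fn_pr computable_fn_nth)
      (auto simp: comp_fns_def)
  from computable_fn_app2[OF this, of 1 "\<lambda>xs. p1 (xs ! 0)" "\<lambda>xs. p2 (xs ! 0)"]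
  show "(\<lambda>z. rec_nat (f (p2 z)) (\<lambda>k r. g (pr k (pr r (p2 z)))) (p1 z)) \<in> comp_fns"
    by (simp add: comp_fns_def computable_fn_p1 computable_fn_p2 computable_fn_nth)
next
  fix g assume g: "g \<in> comp_fns" "\<forall>x. \<exists>y. g (pr y x) = 0"
  have "computable_fn (Suc 1) (\<lambda>xs. g (pr (xs ! 0) (xs ! 1)))"
    by (intro computable_fn_comp_fns[OF g(1)] computable_fn_pr computable_fn_nth) auto
  from computable_fn_mu[OF this] g(2)
  show "(\<lambda>x. LEAST y. g (pr y x) = 0) \<in> comp_fns" by (simp add: comp_fns_def)
qed

subsection \<open>The arithmetical hierarchy and iterated jumps\<close>

text \<open>Reads a number as a \<open>k\<close>-tuple and discards what remains. Through it the
  relations of the hierarchy, which take lists, become unary predicates to which a clone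
  applies.\<close>

fun dlist :: "nat \<Rightarrow> nat \<Rightarrow> nat list" where
  "dlist 0 x = []"
| "dlist (Suc k) x = p1 x # dlist k (p2 x)"

lemma length_dlist [simp]: "length (dlist k x) = k"
  by (induction k arbitrary: x) auto

lemma computable_fn_dlist_nth:
  assumes "i < k" shows "(\<lambda>x. dlist k x ! i) \<in> comp_fns"
  using assms
proof (induction k arbitrary: i)
  case (Suc k)
  interpret clone comp_fns by (rule clone_comp_fns)
  show ?case
  proof (cases i)
    case 0
    then show ?thesis using p1_in by simp
  next
    case (Suc j)
    then show ?thesis using Suc.IH[of j] Suc.prems comp_in[OF _ p2_in] by simp
  qed
qed simp

lemma comp_fns_dlist:
  assumes "computable_fn k g" shows "(\<lambda>x. g (dlist k x)) \<in> comp_fns"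
proof -
  let ?fs = "map (\<lambda>i xs. dlist k (xs ! 0) ! i) [0..<k]"
  have "computable_fn 1 (\<lambda>xs. g (map (\<lambda>f. f xs) ?fs))"
    using computable_fn_dlist_nth by (intro computable_fn_comp[OF assms]) (auto simp: comp_fns_def)
  moreover have "map (\<lambda>f. f xs) ?fs = dlist k (xs ! 0)" for xs
    by (rule nth_equalityI) auto
  ultimately show ?thesis by (simp add: comp_fns_def)
qed

lemma clone_funpow_jump: "clone C \<Longrightarrow> clone ((jump ^^ m) C)"
  by (induction m) (auto intro: clone.clone_jump)

text \<open>Each level contributes one existential quantifier over a negation, and each such
  quantifier is paid for by one limit.\<close>

lemma sigma_rel_decid:
  "sigma_rel m k P \<Longrightarrow> clone.decid ((jump ^^ m) comp_fns) (\<lambda>x. P (dlist k x))"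
proof (induction m arbitrary: k P)
  case 0
  interpret clone comp_fns by (rule clone_comp_fns)
  show ?case using 0 comp_fns_dlist by (simp add: decidable_rel_def decid_def)
next
  case (Suc m)
  let ?C = "(jump ^^ m) comp_fns"
  interpret clone ?C by (rule clone_funpow_jump[OF clone_comp_fns])
  from Suc.prems obtain Q where Q: "sigma_rel m (Suc k) Q"
    "\<And>xs. length xs = k \<Longrightarrow> P xs \<longleftrightarrow> (\<exists>y. \<not> Q (y # xs))" by auto
  from Suc.IH[OF Q(1)] have "decid (\<lambda>z. \<not> Q (p1 z # dlist k (p2 z)))"
    by (intro decid_not) simp
  from decid_jump_ex[of "\<lambda>x y. \<not> Q (y # dlist k x)", OF this]
  show ?case using Q(2) by simp
qed

text \<open>Search simultaneously for a witness of membership and one of non-membership; the first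
  one found decides.\<close>

lemma (in clone) decid_both_ex:
  assumes "decid (\<lambda>z. P (p2 z) (p1 z))" "decid (\<lambda>z. Q (p2 z) (p1 z))"
    "\<And>x. x \<in> S \<longleftrightarrow> (\<exists>y. P x y)" "\<And>x. x \<notin> S \<longleftrightarrow> (\<exists>y. Q x y)"
  shows "decid (\<lambda>x. x \<in> S)"
proof -
  let ?m = "\<lambda>x. LEAST y. P x y \<or> Q x y"
  have "\<exists>y. P x y \<or> Q x y" for x using assms(3,4) by blast
  then have "?m \<in> C" using assms by (intro Least_in decid_disj)
  then have "decid (\<lambda>x. P x (?m x))"
    using decid_app[OF assms(1), of "\<lambda>x. pr (?m x) x"] by (simp add: pair_in id_in)
  moreover have "P x (?m x) \<longleftrightarrow> x \<in> S" for x
  proof -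
    have "P x (?m x) \<or> Q x (?m x)" by (rule LeastI_ex) (use assms(3,4) in blast)
    then show ?thesis using assms(3,4) by blast
  qed
  ultimately show ?thesis by simp
qed

text \<open>Only the inner \<open>2 * M\<close> levels are absorbed by jumps. The outermost
  quantifiers of the two definitions are searched in parallel at no cost, so \<open>M\<close> double
  jumps suffice.\<close>

lemma Delta_set_decid:
  assumes "Delta_set (2 * M + 1) S"
  shows "clone.decid (((jump \<circ> jump) ^^ M) comp_fns) (\<lambda>x. x \<in> S)"
proof -
  have eq: "(jump \<circ> jump) ^^ M = jump ^^ (2 * M)"
    by (induction M) (auto simp: fun_eq_iff)
  let ?C = "(jump ^^ (2 * M)) comp_fns"
  interpret clone ?C by (rule clone_funpow_jump[OF clone_comp_fns])
  obtain Q1 Q2 where Q: "sigma_rel (2 * M) 2 Q1" "\<And>x. x \<in> S \<longleftrightarrow> (\<exists>y. \<not> Q1 [y, x])"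
    "sigma_rel (2 * M) 2 Q2" "\<And>x. x \<notin> S \<longleftrightarrow> (\<exists>y. \<not> Q2 [y, x])"
  proof -
    have "\<exists>Q. sigma_rel (2 * M) 2 Q \<and> (\<forall>x. P [x] \<longleftrightarrow> (\<exists>y. \<not> Q [y, x]))"
      if "sigma_rel (2 * M + 1) 1 P" for P
      using that by (auto simp: numeral_2_eq_2 length_Suc_conv)
    from this[of "\<lambda>xs. hd xs \<in> S"] this[of "\<lambda>xs. hd xs \<notin> S"] show ?thesis
      using assms that unfolding Delta_set_def pi_rel_def by force
  qed
  have "dlist 2 z = [p1 z, p1 (p2 z)]" for z by (simp add: numeral_2_eq_2)
  then have D: "decid (\<lambda>z. \<not> Q1 [p1 z, p1 (p2 z)])" "decid (\<lambda>z. \<not> Q2 [p1 z, p1 (p2 z)])"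
    using sigma_rel_decid[OF Q(1)] sigma_rel_decid[OF Q(3)] by (auto intro: decid_not)
  have "(\<lambda>z. pr (p1 z) (pr (p2 z) 0)) \<in> ?C" by (intro rec_intros)
  from decid_app[OF D(1) this] decid_app[OF D(2) this]
  have "decid (\<lambda>x. x \<in> S)" using Q(2,4)
    by (intro decid_both_ex[of "\<lambda>x y. \<not> Q1 [y, x]" "\<lambda>x y. \<not> Q2 [y, x]"]) auto
  then show ?thesis unfolding eq .
qed

subsection \<open>Quotients of the free abelian group and their heights\<close>

text \<open>Countable abelian groups are treated as quotients of the free abelian group \<^typ>\<open>int poly\<close>
  by a subgroup \<^term>\<open>R\<close>; all statements are about representatives modulo \<^term>\<open>R\<close>.\<close>

definition subgrp :: "int poly set \<Rightarrow> bool" where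
  "subgrp R \<longleftrightarrow> 0 \<in> R \<and> (\<forall>a\<in>R. \<forall>b\<in>R. a - b \<in> R)"

lemma subgrp_zero: "subgrp R \<Longrightarrow> 0 \<in> R"
  and subgrp_diff: "subgrp R \<Longrightarrow> a \<in> R \<Longrightarrow> b \<in> R \<Longrightarrow> a - b \<in> R"
  by (auto simp: subgrp_def)

lemma subgrp_uminus: "subgrp R \<Longrightarrow> a \<in> R \<Longrightarrow> - a \<in> R"
  using subgrp_diff[of R 0 a] subgrp_zero by simp

lemma subgrp_add: "subgrp R \<Longrightarrow> a \<in> R \<Longrightarrow> b \<in> R \<Longrightarrow> a + b \<in> R"
  using subgrp_diff[of R a "- b"] subgrp_uminus by simp

lemma subgrp_of_nat_mult: "subgrp R \<Longrightarrow> a \<in> R \<Longrightarrow> of_nat n * a \<in> R"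
  by (induction n) (auto simp: algebra_simps subgrp_zero subgrp_add)

lemma subgrp_of_int_mult: "subgrp R \<Longrightarrow> a \<in> R \<Longrightarrow> of_int i * a \<in> R"
  using subgrp_of_nat_mult[of R a "nat \<bar>i\<bar>"] subgrp_uminus[of R "of_nat (nat \<bar>i\<bar>) * a"]
  by (cases "i \<ge> 0") auto

lemma subgrp_power_mult: "subgrp R \<Longrightarrow> a \<in> R \<Longrightarrow> of_nat n ^ k * a \<in> R"
  using subgrp_of_nat_mult[of R a "n ^ k"] by simp

lemma subgrp_sum: "subgrp R \<Longrightarrow> (\<And>i. i \<in> I \<Longrightarrow> f i \<in> R) \<Longrightarrow> sum f I \<in> R"
  by (induction I rule: infinite_finite_induct) (auto simp: subgrp_zero subgrp_add)

lemma subgrp_add_cancel: "subgrp R \<Longrightarrow> a \<in> R \<Longrightarrow> a + b \<in> R \<longleftrightarrow> b \<in> R"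
  using subgrp_add[of R a b] subgrp_diff[of R "a + b" a] by auto

lemma subgrp_diff_cancel: "subgrp R \<Longrightarrow> a - b \<in> R \<Longrightarrow> a \<in> R \<longleftrightarrow> b \<in> R"
  using subgrp_add[of R "a - b" b] subgrp_diff[of R a "a - b"] by auto

text \<open>The preimage in the free group of \<open>p ^ k\<close> times the quotient by
  \<open>R\<close>: representatives of elements of height at least \<open>k\<close>.\<close>

definition pdiv :: "nat \<Rightarrow> int poly set \<Rightarrow> nat \<Rightarrow> int poly set" where
  "pdiv p R k = {v. \<exists>y. v - of_nat p ^ k * y \<in> R}"

definition pdivw :: "nat \<Rightarrow> int poly set \<Rightarrow> int poly set" where
  "pdivw p R = (\<Inter>k. pdiv p R k)"

context
  fixes p :: nat and R :: "int poly set"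
  assumes R: "subgrp R"
begin

lemma pdiv_0: "v \<in> pdiv p R 0"
  using subgrp_zero[OF R] by (auto simp: pdiv_def intro: exI[of _ v])

lemma subgrp_pdiv: "subgrp (pdiv p R k)"
  unfolding subgrp_def
proof (intro conjI ballI)
  show "0 \<in> pdiv p R k" using subgrp_zero[OF R] by (auto simp: pdiv_def intro: exI[of _ 0])
  fix a b assume "a \<in> pdiv p R k" "b \<in> pdiv p R k"
  then obtain x y where "a - of_nat p ^ k * x \<in> R" "b - of_nat p ^ k * y \<in> R"
    by (auto simp: pdiv_def)
  from subgrp_diff[OF R this] have "a - b - of_nat p ^ k * (x - y) \<in> R" by (simp add: algebra_simps)
  then show "a - b \<in> pdiv p R k" by (auto simp: pdiv_def)
qed

lemma subset_pdiv: "v \<in> R \<Longrightarrow> v \<in> pdiv p R k"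
  by (auto simp: pdiv_def intro: exI[of _ 0])

lemma power_in_pdiv: "of_nat p ^ k * y \<in> pdiv p R k"
  using subgrp_zero[OF R] by (auto simp: pdiv_def intro: exI[of _ y])

lemma pdiv_antimono: "j \<le> k \<Longrightarrow> v \<in> pdiv p R k \<Longrightarrow> v \<in> pdiv p R j"
proof -
  assume "j \<le> k" "v \<in> pdiv p R k"
  then obtain y d where "v - of_nat p ^ k * y \<in> R" "k = j + d" by (auto simp: pdiv_def le_iff_add)
  then have "v - of_nat p ^ j * (of_nat p ^ d * y) \<in> R" by (simp add: power_add mult.assoc)
  then show ?thesis by (auto simp: pdiv_def)
qed

lemma pdiv_mult: "v \<in> pdiv p R k \<Longrightarrow> of_nat p ^ j * v \<in> pdiv p R (j + k)"
proof -
  assume "v \<in> pdiv p R k"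
  then obtain y where "v - of_nat p ^ k * y \<in> R" by (auto simp: pdiv_def)
  from subgrp_power_mult[OF R this, of p j]
  have "of_nat p ^ j * v - of_nat p ^ (j + k) * y \<in> R" by (simp add: algebra_simps power_add)
  then show ?thesis by (auto simp: pdiv_def)
qed

lemma pdiv_mult1: "v \<in> pdiv p R k \<Longrightarrow> of_nat p * v \<in> pdiv p R (Suc k)"
  using pdiv_mult[of v k 1] by simp

lemma subgrp_pdivw: "subgrp (pdivw p R)"
  using subgrp_pdiv unfolding pdivw_def by (auto simp: subgrp_def)

lemma subset_pdivw: "v \<in> R \<Longrightarrow> v \<in> pdivw p R"
  by (simp add: pdivw_def subset_pdiv)

end

subsection \<open>Extending an isomorphism of the subgroups of infinite height\<close>

definition psocle :: "nat \<Rightarrow> int poly set \<Rightarrow> nat \<Rightarrow> int poly set" where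
  "psocle p R k = {v \<in> pdiv p R k. of_nat p * v \<in> R}"

definition pclass :: "nat \<Rightarrow> int poly set \<Rightarrow> nat \<Rightarrow> int poly \<Rightarrow> int poly set" where
  "pclass p R k v = {u. u - v \<in> pdiv p R (Suc k)}"

text \<open>The \<open>k\<close>-th Ulm quotient: elements of height at least \<open>k\<close>
  killed by \<open>p\<close>, modulo those of height at least \<open>Suc k\<close>. The classes
  \<open>pclass\<close> are full cosets of \<open>pdiv p R (Suc k)\<close>, which identify the same
  socle elements and are easier to handle.\<close>

definition ulm_quot :: "nat \<Rightarrow> int poly set \<Rightarrow> nat \<Rightarrow> int poly set set" where
  "ulm_quot p R k = pclass p R k ` psocle p R k"

lemma pclass_eq_iff:
  assumes "subgrp R"
  shows "pclass p R k u = pclass p R k v \<longleftrightarrow> u - v \<in> pdiv p R (Suc k)"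
proof
  note S = subgrp_pdiv[OF assms, of p "Suc k"]
  assume "pclass p R k u = pclass p R k v"
  moreover have "u \<in> pclass p R k u" using subgrp_zero[OF S] by (simp add: pclass_def)
  ultimately show "u - v \<in> pdiv p R (Suc k)" by (simp add: pclass_def)
next
  note S = subgrp_pdiv[OF assms, of p "Suc k"]
  assume uv: "u - v \<in> pdiv p R (Suc k)"
  have "w - u \<in> pdiv p R (Suc k) \<longleftrightarrow> w - v \<in> pdiv p R (Suc k)" for w
    using subgrp_add_cancel[OF S uv, of "w - u"] by (simp add: algebra_simps)
  then show "pclass p R k u = pclass p R k v" by (simp add: pclass_def)
qed

text \<open>A correspondence is the graph, modulo \<^term>\<open>R\<close> and \<^term>\<open>R'\<close>, of an isomorphism between
  subgroups of the two quotients which preserves finite heights and whose domain is finite modulo the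
  elements of infinite height.\<close>

definition corr :: "nat \<Rightarrow> int poly set \<Rightarrow> int poly set \<Rightarrow> (int poly \<times> int poly) set \<Rightarrow> bool" where
  "corr p R R' T \<longleftrightarrow>
    (\<forall>a b c d. (a, b) \<in> T \<longrightarrow> (c, d) \<in> T \<longrightarrow> (a - c, b - d) \<in> T) \<and>
    (\<forall>a\<in>R. \<forall>b\<in>R'. (a, b) \<in> T) \<and>
    (\<forall>a b. (a, b) \<in> T \<longrightarrow> (a \<in> R \<longleftrightarrow> b \<in> R') \<and> (\<forall>k. a \<in> pdiv p R k \<longleftrightarrow> b \<in> pdiv p R' k)) \<and>
    (\<forall>a\<in>pdivw p R. \<exists>b. (a, b) \<in> T) \<and> (\<forall>b\<in>pdivw p R'. \<exists>a. (a, b) \<in> T) \<and>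
    (\<exists>F. finite F \<and> (\<forall>a b. (a, b) \<in> T \<longrightarrow> (\<exists>f\<in>F. a - f \<in> pdivw p R))) \<and>
    (\<exists>F. finite F \<and> (\<forall>a b. (a, b) \<in> T \<longrightarrow> (\<exists>f\<in>F. b - f \<in> pdivw p R')))"

lemma corr_diff: "corr p R R' T \<Longrightarrow> (a, b) \<in> T \<Longrightarrow> (c, d) \<in> T \<Longrightarrow> (a - c, b - d) \<in> T"
  by (simp add: corr_def)

lemma eqpoll_image_image:
  assumes "\<And>x y. x \<in> Z \<Longrightarrow> y \<in> Z \<Longrightarrow> f x = f y \<longleftrightarrow> g x = g y"
  shows "f ` Z \<approx> g ` Z"
proof -
  define h where "h c = g (SOME x. x \<in> Z \<and> f x = c)" for c
  have h: "h (f x) = g x" if "x \<in> Z" for x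
  proof -
    have "(SOME y. y \<in> Z \<and> f y = f x) \<in> Z \<and> f (SOME y. y \<in> Z \<and> f y = f x) = f x"
      by (rule someI[of _ x]) (use that in simp)
    then show ?thesis unfolding h_def using assms that by blast
  qed
  have "bij_betw h (f ` Z) (g ` Z)"
    unfolding bij_betw_def inj_on_def using h assms by (auto simp: image_iff)
  then show ?thesis unfolding eqpoll_def by blast
qed

section \<open>Extension of height-preserving correspondences in the style of Zippin\<close>

locale ulm_pair =
  fixes p :: nat and R R' :: "int poly set"
  assumes p: "prime p" and R: "subgrp R" and R': "subgrp R'"
begin

lemma swap: "ulm_pair p R' R"
  by unfold_locales (use p R R' in auto)

context
  fixes T assumes T: "corr p R R' T"
begin

lemma T_diff: "(a, b) \<in> T \<Longrightarrow> (c, d) \<in> T \<Longrightarrow> (a - c, b - d) \<in> T"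
  by (rule corr_diff[OF T])

lemma T_R: "a \<in> R \<Longrightarrow> b \<in> R' \<Longrightarrow> (a, b) \<in> T"
  using T unfolding corr_def by (elim conjE) blast

lemma T_in_R: "(a, b) \<in> T \<Longrightarrow> a \<in> R \<longleftrightarrow> b \<in> R'"
  and T_pdiv: "(a, b) \<in> T \<Longrightarrow> a \<in> pdiv p R k \<longleftrightarrow> b \<in> pdiv p R' k"
proof -
  have "\<forall>a b. (a, b) \<in> T \<longrightarrow> (a \<in> R \<longleftrightarrow> b \<in> R') \<and> (\<forall>k. a \<in> pdiv p R k \<longleftrightarrow> b \<in> pdiv p R' k)"
    using T unfolding corr_def by (elim conjE)
  then show "(a, b) \<in> T \<Longrightarrow> a \<in> R \<longleftrightarrow> b \<in> R'"
    "(a, b) \<in> T \<Longrightarrow> a \<in> pdiv p R k \<longleftrightarrow> b \<in> pdiv p R' k" by blast+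
qed

lemma T_dom: "a \<in> pdivw p R \<Longrightarrow> \<exists>b. (a, b) \<in> T"
  using T unfolding corr_def by (elim conjE) blast

lemma T_ran: "b \<in> pdivw p R' \<Longrightarrow> \<exists>a. (a, b) \<in> T"
  using T unfolding corr_def by (elim conjE) blast

lemma T_fin: "\<exists>F. finite F \<and> (\<forall>a b. (a, b) \<in> T \<longrightarrow> (\<exists>f\<in>F. a - f \<in> pdivw p R))"
  using T unfolding corr_def by (elim conjE)

lemma T_fin': "\<exists>F. finite F \<and> (\<forall>a b. (a, b) \<in> T \<longrightarrow> (\<exists>f\<in>F. b - f \<in> pdivw p R'))"
  using T unfolding corr_def by (elim conjE)

lemma corr_converse: "corr p R' R (T\<inverse>)"
  unfolding corr_def converse_iff
proof (intro conjI)
  show "\<forall>a b c d. (b, a) \<in> T \<longrightarrow> (d, c) \<in> T \<longrightarrow> (b - d, a - c) \<in> T" using T_diff by blast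
  show "\<forall>a\<in>R'. \<forall>b\<in>R. (b, a) \<in> T" using T_R by blast
  show "\<forall>a b. (b, a) \<in> T \<longrightarrow> (a \<in> R' \<longleftrightarrow> b \<in> R) \<and> (\<forall>k. a \<in> pdiv p R' k \<longleftrightarrow> b \<in> pdiv p R k)"
    using T_in_R T_pdiv by blast
  show "\<forall>a\<in>pdivw p R'. \<exists>b. (b, a) \<in> T" using T_ran by blast
  show "\<forall>b\<in>pdivw p R. \<exists>a. (b, a) \<in> T" using T_dom by blast
  show "\<exists>F. finite F \<and> (\<forall>a b. (b, a) \<in> T \<longrightarrow> (\<exists>f\<in>F. a - f \<in> pdivw p R'))" using T_fin' by blast
  show "\<exists>F. finite F \<and> (\<forall>a b. (b, a) \<in> T \<longrightarrow> (\<exists>f\<in>F. b - f \<in> pdivw p R))" using T_fin by blast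
qed

lemma T_zero: "(0, 0) \<in> T"
  using T_R subgrp_zero R R' by blast

lemma T_uminus: "(a, b) \<in> T \<Longrightarrow> (- a, - b) \<in> T"
  using T_diff[OF T_zero, of a b] by simp

lemma T_add: "(a, b) \<in> T \<Longrightarrow> (c, d) \<in> T \<Longrightarrow> (a + c, b + d) \<in> T"
  using T_diff[of a b "- c" "- d"] T_uminus by simp

lemma T_of_nat: "(a, b) \<in> T \<Longrightarrow> (of_nat n * a, of_nat n * b) \<in> T"
  by (induction n) (auto simp: algebra_simps T_zero T_add)

lemma T_of_int: "(a, b) \<in> T \<Longrightarrow> (of_int i * a, of_int i * b) \<in> T"
  using T_of_nat[of a b "nat \<bar>i\<bar>"] T_uminus[of "of_nat (nat \<bar>i\<bar>) * a" "of_nat (nat \<bar>i\<bar>) * b"]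
  by (cases "i \<ge> 0") auto

text \<open>Consider \<open>s + i a\<close>. If \<open>p\<close> divides \<open>i\<close>, it
  already lies in the domain. Otherwise Bezout turns a multiple of it into a translate of
  \<open>a\<close>, which by assumption has height at most \<open>k\<close>, and likewise on the
  other side. Up to height \<open>k\<close> the summands \<open>i a\<close> and \<open>i a'\<close>
  do not affect divisibility, so heights correspond.\<close>

lemma corr_glue:
  assumes pa: "(of_nat p * a, of_nat p * a') \<in> T"
    and a: "a \<in> pdiv p R k" and a': "a' \<in> pdiv p R' k"
    and proper: "\<And>s s'. (s, s') \<in> T \<Longrightarrow> a + s \<notin> pdiv p R (Suc k)"
    and proper': "\<And>s s'. (s, s') \<in> T \<Longrightarrow> a' + s' \<notin> pdiv p R' (Suc k)"
  shows "\<exists>T'. T \<subseteq> T' \<and> corr p R R' T' \<and> (a, a') \<in> T'"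
proof -
  define T' where "T' = {(s + of_int i * a, s' + of_int i * a') |s s' i. (s, s') \<in> T}"
  have memI: "(s + of_int i * a, s' + of_int i * a') \<in> T'" if "(s, s') \<in> T" for s s' i
    using that unfolding T'_def by blast
  have sub: "T \<subseteq> T'"
  proof
    fix x assume "x \<in> T"
    then show "x \<in> T'" using memI[of "fst x" "snd x" 0] by simp
  qed
  have mult: "(of_int i * a, of_int i * a') \<in> T" if d: "int p dvd i" for i
  proof -
    obtain q where "i = int p * q" using d unfolding dvd_def by blast
    then show ?thesis using T_of_int[OF pa, of q] by (simp add: algebra_simps)
  qed
  have unit: "\<exists>x s1 s1'. (s1, s1') \<in> T \<and> of_int x * (s + of_int i * a) = a + s1
      \<and> of_int x * (s' + of_int i * a') = a' + s1'"
    if "\<not> int p dvd i" "(s, s') \<in> T" for i s s'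
  proof -
    have "coprime (int p) i" using p that(1) by (simp add: prime_imp_coprime)
    then obtain x y where xy: "x * i + y * int p = 1"
      using bezout_int[of i "int p"] by (auto simp: coprime_iff_gcd_eq_1 gcd.commute)
    have "(of_int x * s - of_int y * (of_nat p * a), of_int x * s' - of_int y * (of_nat p * a')) \<in> T"
      by (intro T_diff T_of_int that(2) pa)
    moreover have "of_int x * (s + of_int i * b) = b + (of_int x * s - of_int y * (of_nat p * b))"
      for s b :: "int poly"
    proof -
      have "of_int x * of_int i * b + of_int y * of_nat p * b = of_int (x * i + y * int p) * b"
        by (simp add: algebra_simps)
      then show ?thesis unfolding xy by (simp add: algebra_simps)
    qed
    ultimately show ?thesis by blast
  qed
  have not_high: "s + of_int i * a \<notin> pdiv p R l \<and> s' + of_int i * a' \<notin> pdiv p R' l"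
    if np: "\<not> int p dvd i" and s: "(s, s') \<in> T" and l: "Suc k \<le> l" for i s s' l
  proof -
    obtain x s1 s1' where 1: "(s1, s1') \<in> T" "of_int x * (s + of_int i * a) = a + s1"
      "of_int x * (s' + of_int i * a') = a' + s1'" using unit[OF np s] by blast
    show ?thesis
      using proper[OF 1(1)] proper'[OF 1(1)] subgrp_of_int_mult[OF subgrp_pdiv[OF R]]
        subgrp_of_int_mult[OF subgrp_pdiv[OF R']] pdiv_antimono[OF R l] pdiv_antimono[OF R' l]
      unfolding 1(2,3)[symmetric] by metis
  qed
  have hts: "(u \<in> R \<longleftrightarrow> u' \<in> R') \<and> (\<forall>l. u \<in> pdiv p R l \<longleftrightarrow> u' \<in> pdiv p R' l)" if uu: "(u, u') \<in> T'" for u u'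
  proof -
    obtain s s' i where u: "u = s + of_int i * a" "u' = s' + of_int i * a'" and s: "(s, s') \<in> T"
      using uu unfolding T'_def by blast
    show ?thesis
    proof (cases "int p dvd i")
      case True
      then have "(u, u') \<in> T" unfolding u using T_add[OF s mult] by simp
      then show ?thesis using T_in_R T_pdiv by blast
    next
      case False
      note nh = not_high[OF False s]
      have "u \<notin> R" "u' \<notin> R'" using nh[of "Suc k"] subset_pdiv[of R _ p] subset_pdiv[of R' _ p] R R'
        unfolding u by auto
      moreover have "u \<in> pdiv p R l \<longleftrightarrow> u' \<in> pdiv p R' l" for l
      proof (cases "l \<le> k")
        case True
        have "of_int i * a \<in> pdiv p R l" "of_int i * a' \<in> pdiv p R' l"
          by (intro subgrp_of_int_mult subgrp_pdiv R R' pdiv_antimono[OF _ True] a a')+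
        then have "u \<in> pdiv p R l \<longleftrightarrow> s \<in> pdiv p R l" "u' \<in> pdiv p R' l \<longleftrightarrow> s' \<in> pdiv p R' l"
          unfolding u using subgrp_add_cancel[OF subgrp_pdiv[OF R]] subgrp_add_cancel[OF subgrp_pdiv[OF R']]
          by (metis add.commute)+
        then show ?thesis using T_pdiv[OF s] by simp
      next
        case False
        then show ?thesis using nh[of l] unfolding u by simp
      qed
      ultimately show ?thesis by blast
    qed
  qed
  have fin: "\<exists>F. finite F \<and> (\<forall>u u'. (u, u') \<in> T' \<longrightarrow> (\<exists>f\<in>F. pi (u, u') - f \<in> W))"
    if W: "subgrp W" and F: "\<exists>F. finite F \<and> (\<forall>u u'. (u, u') \<in> T \<longrightarrow> (\<exists>f\<in>F. pi (u, u') - f \<in> W))"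
      and lin: "\<And>s s' i. pi (s + of_int i * a, s' + of_int i * a') = pi (s, s') + of_int i * pi (a, a')"
    for pi and W :: "int poly set"
  proof -
    obtain F where F: "finite F" "\<And>u u'. (u, u') \<in> T \<Longrightarrow> \<exists>f\<in>F. pi (u, u') - f \<in> W"
      using F by blast
    \<comment> \<open>Since \<open>p\<close> times \<open>a\<close> lies in the old domain, residues
      of \<open>i\<close> modulo \<open>p\<close> suffice and the new domain is still finite modulo
      \<open>W\<close>.\<close>
    let ?F = "(\<lambda>(f, i). f + of_int i * pi (a, a')) ` (F \<times> {0..<int p})"
    have "\<exists>f\<in>?F. pi (u, u') - f \<in> W" if uu: "(u, u') \<in> T'" for u u'
    proof -
      obtain s s' i where u: "u = s + of_int i * a" "u' = s' + of_int i * a'" and s: "(s, s') \<in> T"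
        using uu unfolding T'_def by blast
      define r where "r = i mod int p"
      have r: "r \<in> {0..<int p}" using prime_gt_0_nat[OF p] by (simp add: r_def)
      have "(s + of_int (i - r) * a, s' + of_int (i - r) * a') \<in> T"
        by (intro T_add s mult) (simp add: r_def minus_mod_eq_mult_div)
      from F(2)[OF this] obtain f where f: "f \<in> F" "pi (s, s') + of_int (i - r) * pi (a, a') - f \<in> W"
        unfolding lin by blast
      then have "pi (u, u') - (f + of_int r * pi (a, a')) \<in> W"
        unfolding u lin by (simp add: algebra_simps)
      then show ?thesis using f(1) r by force
    qed
    then show ?thesis using F(1) by (intro exI[of _ ?F]) auto
  qed
  have "corr p R R' T'"
    unfolding corr_def
  proof (intro conjI allI impI ballI)
    fix u v x y assume "(u, v) \<in> T'" "(x, y) \<in> T'"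
    then obtain s s' i t t' j where "u = s + of_int i * a" "v = s' + of_int i * a'" "(s, s') \<in> T"
      "x = t + of_int j * a" "y = t' + of_int j * a'" "(t, t') \<in> T"
      unfolding T'_def by blast
    then show "(u - x, v - y) \<in> T'"
      using memI[of "s - t" "s' - t'" "i - j"] T_diff[of s s' t t'] by (simp add: algebra_simps)
  next
    show "\<exists>F. finite F \<and> (\<forall>a b. (a, b) \<in> T' \<longrightarrow> (\<exists>f\<in>F. a - f \<in> pdivw p R))"
      using fin[of "pdivw p R" fst] T_fin subgrp_pdivw[OF R] by simp
    show "\<exists>F. finite F \<and> (\<forall>a b. (a, b) \<in> T' \<longrightarrow> (\<exists>f\<in>F. b - f \<in> pdivw p R'))"
      using fin[of "pdivw p R'" snd] T_fin' subgrp_pdivw[OF R'] by simp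
  qed (use hts sub T_R T_dom T_ran in blast)+
  moreover have "(a, a') \<in> T'" using memI[OF T_zero, of 1] by simp
  ultimately show ?thesis using sub by blast
qed

text \<open>A counting argument. If every socle element on the right could be moved to height
  \<open>Suc k\<close> by the range of \<open>T\<close>, then \<open>Z\<close> would match all of
  the right Ulm quotient bijectively with a part of the left one. That part is finite, because the
  domain of \<open>T\<close> is finite modulo infinite height, and it misses the class of
  \<open>e\<close>. This contradicts equal cardinality.\<close>

lemma ex_proper_socle:
  assumes eq: "ulm_quot p R k \<approx> ulm_quot p R' k"
    and e: "e \<in> psocle p R k" and proper: "\<And>s s'. (s, s') \<in> T \<Longrightarrow> e + s \<notin> pdiv p R (Suc k)"
  shows "\<exists>e'\<in>psocle p R' k. \<forall>s s'. (s, s') \<in> T \<longrightarrow> e' + s' \<notin> pdiv p R' (Suc k)"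
proof (rule ccontr)
  note D = subgrp_pdiv[OF R, of p] and D' = subgrp_pdiv[OF R', of p]
  assume neg: "\<not> ?thesis"
  define Z where "Z = {(e, e'). e \<in> psocle p R k \<and> e' \<in> psocle p R' k \<and>
    (\<exists>s s'. (s, s') \<in> T \<and> e + s \<in> pdiv p R (Suc k) \<and> e' + s' \<in> pdiv p R' (Suc k))}"
  let ?f = "\<lambda>z. pclass p R k (fst z)" and ?g = "\<lambda>z. pclass p R' k (snd z)"
  have "?f ` Z \<approx> ?g ` Z"
  proof (rule eqpoll_image_image)
    fix z1 z2 assume "z1 \<in> Z" "z2 \<in> Z"
    then obtain e1 e1' s1 s1' e2 e2' s2 s2' where z: "z1 = (e1, e1')" "z2 = (e2, e2')"
      and s: "(s1, s1') \<in> T" "(s2, s2') \<in> T"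
      and m: "e1 + s1 \<in> pdiv p R (Suc k)" "e1' + s1' \<in> pdiv p R' (Suc k)"
      "e2 + s2 \<in> pdiv p R (Suc k)" "e2' + s2' \<in> pdiv p R' (Suc k)"
      unfolding Z_def by blast
    have "e1 - e2 - (s2 - s1) \<in> pdiv p R (Suc k)"
      using subgrp_diff[OF D m(1,3)] by (simp add: algebra_simps)
    moreover have "e1' - e2' - (s2' - s1') \<in> pdiv p R' (Suc k)"
      using subgrp_diff[OF D' m(2,4)] by (simp add: algebra_simps)
    ultimately show "?f z1 = ?f z2 \<longleftrightarrow> ?g z1 = ?g z2"
      unfolding z fst_conv snd_conv pclass_eq_iff[OF R] pclass_eq_iff[OF R']
      using subgrp_diff_cancel[OF D] subgrp_diff_cancel[OF D'] T_pdiv[OF T_diff[OF s(2,1)]] by blast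
  qed
  moreover have "?g ` Z = ulm_quot p R' k"
  proof
    show "?g ` Z \<subseteq> ulm_quot p R' k" unfolding Z_def ulm_quot_def by auto
    show "ulm_quot p R' k \<subseteq> ?g ` Z"
    proof
      fix c assume "c \<in> ulm_quot p R' k"
      then obtain e' where e': "c = pclass p R' k e'" "e' \<in> psocle p R' k" by (auto simp: ulm_quot_def)
      then obtain s s' where s: "(s, s') \<in> T" "e' + s' \<in> pdiv p R' (Suc k)" using neg by blast
      have "s' \<in> pdiv p R' k"
        using subgrp_diff[OF D' pdiv_antimono[OF R' _ s(2), of k]] e'(2)
        by (metis (no_types, lifting) add_diff_cancel_left' le_add2 mem_Collect_eq plus_1_eq_Suc psocle_def)
      then have sk: "s \<in> pdiv p R k" using T_pdiv[OF s(1)] by simp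
      have "of_nat p * e' + of_nat p * s' \<in> pdiv p R' (Suc (Suc k))"
        using pdiv_mult1[OF R' s(2)] by (simp add: algebra_simps)
      moreover have "of_nat p * e' \<in> pdiv p R' (Suc (Suc k))"
        using e'(2) subset_pdiv[OF R'] by (simp add: psocle_def)
      ultimately have "of_nat p * s' \<in> pdiv p R' (Suc (Suc k))" using subgrp_add_cancel[OF D'] by blast
      then have "of_nat p * s \<in> pdiv p R (Suc (Suc k))" using T_pdiv[OF T_of_nat[OF s(1)]] by simp
      then obtain y where y: "of_nat p * s - of_nat p ^ Suc (Suc k) * y \<in> R" by (auto simp: pdiv_def)
      \<comment> \<open>As \<open>p\<close> times \<open>s\<close> has height at least
        \<open>k + 2\<close>, there is a \<open>y\<close> for which \<open>s\<close> and
        \<open>p ^ (k + 1) y\<close> have the same \<open>p\<close>-multiple; their difference is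
        the required socle element.\<close>
      define e where "e = of_nat p ^ Suc k * y - s"
      have "of_nat p * e = - (of_nat p * s - of_nat p ^ Suc (Suc k) * y)" by (simp add: e_def algebra_simps)
      then have "of_nat p * e \<in> R" using subgrp_uminus[OF R y] by simp
      moreover have "e \<in> pdiv p R k"
        unfolding e_def by (intro subgrp_diff[OF D] sk pdiv_antimono[OF R _ power_in_pdiv[OF R]]) simp
      moreover have "e + s \<in> pdiv p R (Suc k)" unfolding e_def using power_in_pdiv[OF R, of p "Suc k"] by simp
      ultimately have "(e, e') \<in> Z" unfolding Z_def psocle_def using e'(2) s by (auto simp: psocle_def)
      then show "c \<in> ?g ` Z" using e'(1) by force
    qed
  qed
  ultimately have eq2: "?f ` Z \<approx> ulm_quot p R k" using eq eqpoll_sym eqpoll_trans by metis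
  have "finite (?f ` Z)"
  proof -
    obtain F where F: "finite F" "\<And>u u'. (u, u') \<in> T \<Longrightarrow> \<exists>f\<in>F. u - f \<in> pdivw p R" using T_fin by blast
    have "?f ` Z \<subseteq> (\<lambda>f. pclass p R k (- f)) ` F"
    proof
      fix c assume "c \<in> ?f ` Z"
      then obtain e1 s s' where 1: "c = pclass p R k e1" "(s, s') \<in> T" "e1 + s \<in> pdiv p R (Suc k)"
        unfolding Z_def by auto
      obtain f where f: "f \<in> F" "s - f \<in> pdiv p R (Suc k)" using F(2)[OF 1(2)] by (auto simp: pdivw_def)
      have "e1 - (- f) \<in> pdiv p R (Suc k)" using subgrp_diff[OF D 1(3) f(2)] by simp
      then show "c \<in> (\<lambda>f. pclass p R k (- f)) ` F"
        using f(1) 1(1) pclass_eq_iff[OF R, of p k e1 "- f"] by blast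
    qed
    then show ?thesis using F(1) finite_surj by blast
  qed
  moreover have "?f ` Z \<subset> ulm_quot p R k"
  proof
    show "?f ` Z \<subseteq> ulm_quot p R k" unfolding Z_def ulm_quot_def by auto
    have "pclass p R k e \<notin> ?f ` Z"
    proof
      assume "pclass p R k e \<in> ?f ` Z"
      then obtain e1 s s' where 1: "pclass p R k e = pclass p R k e1" "(s, s') \<in> T" "e1 + s \<in> pdiv p R (Suc k)"
        unfolding Z_def by auto
      then have "e - e1 \<in> pdiv p R (Suc k)" using pclass_eq_iff[OF R] by blast
      from subgrp_add[OF D this 1(3)] show False using proper[OF 1(2)] by (simp add: algebra_simps)
    qed
    moreover have "pclass p R k e \<in> ulm_quot p R k" using e by (simp add: ulm_quot_def)
    ultimately show "?f ` Z \<noteq> ulm_quot p R k" by blast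
  qed
  ultimately show False
    using eqpoll_finite_iff[OF eq2] eqpoll_iff_card[of "?f ` Z" "ulm_quot p R k"] eq2 psubset_card_mono
    by (metis less_irrefl)
qed

text \<open>The coset of \<open>a\<close> modulo the domain of \<open>T\<close> contains an element
  of greatest height \<open>k\<close>, and it is enough to extend \<open>T\<close> to that
  representative. Its image must be a \<open>p\<close>-th root of a prescribed element, of height at
  least \<open>k\<close>, with no translate of greater height. The Ulm invariants are needed only if
  multiplication by \<open>p\<close> can raise the height of some such representative by more than
  one.\<close>

lemma corr_step:
  assumes eq: "\<And>k. ulm_quot p R k \<approx> ulm_quot p R' k" and pa: "(of_nat p * a, z) \<in> T"
  shows "\<exists>T' b. T \<subseteq> T' \<and> corr p R R' T' \<and> (a, b) \<in> T'"
proof (cases "\<exists>b. (a, b) \<in> T")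
  case True then show ?thesis using T by blast
next
  case False
  note D = subgrp_pdiv[OF R, of p] and D' = subgrp_pdiv[OF R', of p]
  \<comment> \<open>The heights in the coset are bounded: modulo infinite height there are finitely
    many translates, and unbounded heights near one of them would give \<open>a + s\<close> infinite
    height, hence place \<open>a\<close> in the domain.\<close>
  have "\<exists>K. \<forall>s s'. (s, s') \<in> T \<longrightarrow> a + s \<notin> pdiv p R K"
  proof -
    obtain F where F: "finite F" "\<And>u u'. (u, u') \<in> T \<Longrightarrow> \<exists>f\<in>F. u - f \<in> pdivw p R" using T_fin by blast
    have "\<exists>k. \<forall>s s'. (s, s') \<in> T \<longrightarrow> s - f \<in> pdivw p R \<longrightarrow> a + s \<notin> pdiv p R k" for f
    proof (rule ccontr)
      assume "\<not> ?thesis"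
      then have neg: "\<And>k. \<exists>s s'. (s, s') \<in> T \<and> s - f \<in> pdivw p R \<and> a + s \<in> pdiv p R k" by blast
      obtain s s' where s: "(s, s') \<in> T" "s - f \<in> pdivw p R" using neg by blast
      have "a + s \<in> pdiv p R k" for k
      proof -
        obtain t t' where t: "(t, t') \<in> T" "t - f \<in> pdivw p R" "a + t \<in> pdiv p R k" using neg by blast
        have "(s - f) - (t - f) \<in> pdiv p R k" using s(2) t(2) by (intro subgrp_diff[OF D, of "s - f"]) (simp_all add: pdivw_def)
        from subgrp_add[OF D t(3) this] show ?thesis by (simp add: algebra_simps)
      qed
      then obtain b where "(a + s, b) \<in> T" using T_dom[of "a + s"] by (auto simp: pdivw_def)
      from T_diff[OF this s(1)] show False using False by auto
    qed
    then obtain kf where kf: "\<And>f s s'. (s, s') \<in> T \<Longrightarrow> s - f \<in> pdivw p R \<Longrightarrow> a + s \<notin> pdiv p R (kf f)" by metis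
    have "a + s \<notin> pdiv p R (Max (kf ` F))" if s: "(s, s') \<in> T" for s s'
    proof
      assume as: "a + s \<in> pdiv p R (Max (kf ` F))"
      obtain f where f: "f \<in> F" "s - f \<in> pdivw p R" using F(2)[OF s] by blast
      have "kf f \<le> Max (kf ` F)" using f(1) F(1) by simp
      then show False using kf[OF s f(2)] pdiv_antimono[OF R _ as] by blast
    qed
    then show ?thesis by blast
  qed
  then obtain K where K: "\<And>s s'. (s, s') \<in> T \<Longrightarrow> a + s \<notin> pdiv p R K"
    and K_min: "\<And>j. j < K \<Longrightarrow> \<exists>s s'. (s, s') \<in> T \<and> a + s \<in> pdiv p R j"
    using exists_least_iff[of "\<lambda>K. \<forall>s s'. (s, s') \<in> T \<longrightarrow> a + s \<notin> pdiv p R K"] by auto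
  have "K \<noteq> 0" using K[OF T_zero] pdiv_0[OF R, of "a + 0" p] by (intro notI) simp
  then obtain k where k: "K = Suc k" by (cases K) auto
  note top = K[unfolded k]
  have good: ?thesis if g: "\<exists>T' b. T \<subseteq> T' \<and> corr p R R' T' \<and> (a + s, b) \<in> T'" and s: "(s, s') \<in> T" for s s'
  proof -
    obtain T' b where T': "T \<subseteq> T'" "corr p R R' T'" "(a + s, b) \<in> T'" using g by blast
    have "(s, s') \<in> T'" using s T'(1) by blast
    from corr_diff[OF T'(2) T'(3) this] have "(a, b - s') \<in> T'" by simp
    then show ?thesis using T'(1,2) by blast
  qed
  have top_add: "(a + s) + t \<notin> pdiv p R (Suc k)" if "(s, s') \<in> T" "(t, t') \<in> T" for s s' t t'
    using top[OF T_add[OF that]] by (simp add: add.assoc)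
  show ?thesis
  proof (cases "\<exists>s s'. (s, s') \<in> T \<and> a + s \<in> pdiv p R k \<and> of_nat p * (a + s) \<in> pdiv p R (Suc (Suc k))")
    case True
    then obtain s s' where s: "(s, s') \<in> T" and as: "a + s \<in> pdiv p R k"
      "of_nat p * (a + s) \<in> pdiv p R (Suc (Suc k))" by blast
    obtain y where y: "of_nat p * (a + s) - of_nat p ^ Suc (Suc k) * y \<in> R" using as(2) by (auto simp: pdiv_def)
    \<comment> \<open>Subtracting \<open>p ^ (k + 1) y\<close> from the representative leaves an
      element killed by \<open>p\<close>, still of height at least \<open>k\<close> and with no
      translate of height \<open>k + 1\<close>; this is what the counting argument can match on the
      right.\<close>
    let ?e = "a + s - of_nat p ^ Suc k * y"
    have py: "of_nat p ^ Suc k * y \<in> pdiv p R (Suc k)" by (rule power_in_pdiv[OF R])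
    have "?e \<in> psocle p R k"
      unfolding psocle_def mem_Collect_eq
      using y subgrp_diff[OF D as(1) pdiv_antimono[OF R _ py, of k]] by (auto simp: algebra_simps)
    moreover have "?e + t \<notin> pdiv p R (Suc k)" if "(t, t') \<in> T" for t t'
    proof
      assume "?e + t \<in> pdiv p R (Suc k)"
      from subgrp_add[OF D this py] show False using top_add[OF s that] by (simp add: algebra_simps)
    qed
    ultimately obtain e' where e': "e' \<in> psocle p R' k"
      "\<And>s s'. (s, s') \<in> T \<Longrightarrow> e' + s' \<notin> pdiv p R' (Suc k)"
      using ex_proper_socle[OF eq, of ?e k] by blast
    have ps: "(of_nat p * (a + s), z + of_nat p * s') \<in> T"
      using T_add[OF pa T_of_nat[OF s, of p]] by (simp add: algebra_simps)
    then have "z + of_nat p * s' \<in> pdiv p R' (Suc (Suc k))" using as(2) T_pdiv by blast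
    then obtain x where x: "z + of_nat p * s' - of_nat p ^ Suc (Suc k) * x \<in> R'" by (auto simp: pdiv_def)
    let ?a' = "e' + of_nat p ^ Suc k * x"
    have px: "of_nat p ^ Suc k * x \<in> pdiv p R' (Suc k)" by (rule power_in_pdiv[OF R'])
    have "of_nat p * e' - (z + of_nat p * s' - of_nat p ^ Suc (Suc k) * x) \<in> R'"
      using e'(1) by (intro subgrp_diff[OF R' _ x]) (simp add: psocle_def)
    then have "(of_nat p * (a + s) + 0, z + of_nat p * s' +
        (of_nat p * e' - (z + of_nat p * s' - of_nat p ^ Suc (Suc k) * x))) \<in> T"
      by (intro T_add[OF ps] T_R subgrp_zero R)
    then have "(of_nat p * (a + s), of_nat p * ?a') \<in> T" by (simp add: algebra_simps)
    moreover have "?a' \<in> pdiv p R' k"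
      using e'(1) by (intro subgrp_add[OF D'] pdiv_antimono[OF R' _ px]) (auto simp: psocle_def)
    moreover have "?a' + t' \<notin> pdiv p R' (Suc k)" if "(t, t') \<in> T" for t t'
    proof
      assume "?a' + t' \<in> pdiv p R' (Suc k)"
      from subgrp_diff[OF D' this px] show False using e'(2)[OF that] by (simp add: algebra_simps)
    qed
    ultimately have "\<exists>T'. T \<subseteq> T' \<and> corr p R R' T' \<and> (a + s, ?a') \<in> T'"
      using as(1) top_add[OF s] by (intro corr_glue[of _ _ k])
    then show ?thesis using good[OF _ s] by blast
  next
    case False
    obtain s s' where s: "(s, s') \<in> T" and as: "a + s \<in> pdiv p R k" using K_min[of k] k by auto
    have ps: "(of_nat p * (a + s), z + of_nat p * s') \<in> T"
      using T_add[OF pa T_of_nat[OF s, of p]] by (simp add: algebra_simps)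
    then have "z + of_nat p * s' \<in> pdiv p R' (Suc k)" using pdiv_mult1[OF R as] T_pdiv by blast
    then obtain x where x: "z + of_nat p * s' - of_nat p ^ Suc k * x \<in> R'" by (auto simp: pdiv_def)
    \<comment> \<open>Here every root of height at least \<open>k\<close> is good. If a translate of
      \<open>?a'\<close> had height \<open>k + 1\<close>, its \<open>p\<close>-multiple would have
      height \<open>k + 2\<close>, and the corresponding element on the left would fall under the
      excluded case.\<close>
    let ?a' = "of_nat p ^ k * x"
    have "(of_nat p * (a + s) - 0, z + of_nat p * s' - (z + of_nat p * s' - of_nat p ^ Suc k * x)) \<in> T"
      by (intro T_diff[OF ps] T_R x subgrp_zero R)
    then have pa': "(of_nat p * (a + s), of_nat p * ?a') \<in> T" by (simp add: algebra_simps)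
    have a'k: "?a' \<in> pdiv p R' k" by (rule power_in_pdiv[OF R'])
    have "?a' + t' \<notin> pdiv p R' (Suc k)" if t: "(t, t') \<in> T" for t t'
    proof
      assume at: "?a' + t' \<in> pdiv p R' (Suc k)"
      have "?a' + t' - ?a' \<in> pdiv p R' k" by (intro subgrp_diff[OF D'] a'k pdiv_antimono[OF R' _ at]) simp
      then have "t \<in> pdiv p R k" using T_pdiv[OF t] by simp
      then have "a + (s + t) \<in> pdiv p R k" using subgrp_add[OF D as] by (simp add: add.assoc)
      moreover have "(of_nat p * (a + (s + t)), of_nat p * (?a' + t')) \<in> T"
        using T_add[OF pa' T_of_nat[OF t, of p]] by (simp add: algebra_simps)
      then have "of_nat p * (a + (s + t)) \<in> pdiv p R (Suc (Suc k))" using pdiv_mult1[OF R' at] T_pdiv by blast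
      ultimately show False using False T_add[OF s t] by blast
    qed
    then have "\<exists>T'. T \<subseteq> T' \<and> corr p R R' T' \<and> (a + s, ?a') \<in> T'"
      using as top_add[OF s] a'k pa' by (intro corr_glue[of _ _ k])
    then show ?thesis using good[OF _ s] by blast
  qed
qed

end

lemma corr_extend:
  assumes eq: "\<And>k. ulm_quot p R k \<approx> ulm_quot p R' k" and T: "corr p R R' T" and v: "of_nat p ^ n * v \<in> R"
  shows "\<exists>T' b. T \<subseteq> T' \<and> corr p R R' T' \<and> (v, b) \<in> T'"
  using v
proof (induction n arbitrary: v)
  case 0
  have "(v, 0) \<in> T" using 0 subgrp_zero[OF R'] by (intro T_R[OF T]) simp_all
  then show ?case using T by blast
next
  case (Suc n)
  have "of_nat p ^ n * (of_nat p * v) \<in> R" using Suc.prems by (simp add: ac_simps)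
  from Suc.IH[OF this] obtain T' b where T': "T \<subseteq> T'" "corr p R R' T'" "(of_nat p * v, b) \<in> T'"
    by (elim exE conjE)
  obtain T'' b' where "T' \<subseteq> T''" "corr p R R' T''" "(v, b') \<in> T''"
    using corr_step[OF T'(2) eq T'(3)] by (elim exE conjE)
  moreover have "T \<subseteq> T''" using T'(1) calculation(1) by (rule subset_trans)
  ultimately show ?case by (intro exI conjI)
qed

text \<open>Back and forth along an enumeration of the free group: each round puts
  \<open>e n\<close> into the domain and then, through the converse, into the range. Only properties
  that survive increasing unions are claimed of the result; finiteness modulo infinite height does
  not.\<close>

lemma corr_total:
  assumes eq: "\<And>k. ulm_quot p R k \<approx> ulm_quot p R' k" and T: "corr p R R' T"
    and pg: "\<And>v. \<exists>n. of_nat p ^ n * v \<in> R" and pg': "\<And>v. \<exists>n. of_nat p ^ n * v \<in> R'"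
  shows "\<exists>T'. T \<subseteq> T' \<and> (\<forall>a b c d. (a, b) \<in> T' \<longrightarrow> (c, d) \<in> T' \<longrightarrow> (a - c, b - d) \<in> T') \<and>
    (\<forall>a b. (a, b) \<in> T' \<longrightarrow> (a \<in> R \<longleftrightarrow> b \<in> R')) \<and> (\<forall>a. \<exists>b. (a, b) \<in> T') \<and> (\<forall>b. \<exists>a. (a, b) \<in> T')"
proof -
  interpret S: ulm_pair p R' R by (rule swap)
  have "countable (UNIV :: int poly set)"
    by (rule countableI'[of coeffs]) (metis Poly_coeffs injI)
  then obtain e :: "nat \<Rightarrow> int poly" where "surj e" using uncountable_def by blast
  then have e: "\<exists>n. e n = v" for v by (metis surjD)
  have step: "\<exists>T2. (corr p R R' T2) \<and> (T1 \<subseteq> T2 \<and> (\<exists>b. (e n, b) \<in> T2) \<and> (\<exists>a. (a, e n) \<in> T2))"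
    if T1: "corr p R R' T1" for T1 n
  proof -
    obtain i j where ij: "of_nat p ^ i * e n \<in> R" "of_nat p ^ j * e n \<in> R'"
      using pg[of "e n"] pg'[of "e n"] by (elim exE)
    obtain T2 b where T2: "T1 \<subseteq> T2" "corr p R R' T2" "(e n, b) \<in> T2"
      using corr_extend[OF eq T1 ij(1)] by (elim exE conjE)
    obtain T3 a where T3: "T2\<inverse> \<subseteq> T3" "corr p R' R T3" "(e n, a) \<in> T3"
      using S.corr_extend[OF eqpoll_sym[OF eq] corr_converse[OF T2(2)] ij(2)] by (elim exE conjE)
    have "T1 \<subseteq> T3\<inverse>" "(e n, b) \<in> T3\<inverse>" using T2(1,3) T3(1) by auto
    moreover have "(a, e n) \<in> T3\<inverse>" using T3(3) by simp
    ultimately show ?thesis using S.corr_converse[OF T3(2)] by blast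
  qed
  have "\<exists>f. \<forall>n. (corr p R R' (f n) \<and> T \<subseteq> f n) \<and>
      (f n \<subseteq> f (Suc n) \<and> (\<exists>b. (e n, b) \<in> f (Suc n)) \<and> (\<exists>a. (a, e n) \<in> f (Suc n)))"
  proof (rule dependent_nat_choice)
    show "\<exists>x. corr p R R' x \<and> T \<subseteq> x" using T by blast
    fix x n assume x: "corr p R R' x \<and> T \<subseteq> x"
    from step[of x n] x obtain y where "corr p R R' y" "x \<subseteq> y" "\<exists>b. (e n, b) \<in> y" "\<exists>a. (a, e n) \<in> y"
      by (elim conjE) (drule_tac meta_mp, assumption, elim exE conjE, blast)
    then show "\<exists>y. (corr p R R' y \<and> T \<subseteq> y) \<and> x \<subseteq> y \<and> (\<exists>b. (e n, b) \<in> y) \<and> (\<exists>a. (a, e n) \<in> y)"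
      using x by (intro exI[of _ y]) auto
  qed
  then obtain f where F: "\<forall>n. (corr p R R' (f n) \<and> T \<subseteq> f n) \<and>
      (f n \<subseteq> f (Suc n) \<and> (\<exists>b. (e n, b) \<in> f (Suc n)) \<and> (\<exists>a. (a, e n) \<in> f (Suc n)))" by (elim exE)
  have f: "corr p R R' (f n)" "f n \<subseteq> f (Suc n)" "\<exists>b. (e n, b) \<in> f (Suc n)"
    "\<exists>a. (a, e n) \<in> f (Suc n)" "T \<subseteq> f n" for n
    using F[THEN spec[of _ n]] by simp_all
  have mono: "f m \<subseteq> f n" if "m \<le> n" for m n using lift_Suc_mono_le[of f, OF f(2) that] .
  let ?T = "\<Union>n. f n"
  have "(a - c, b - d) \<in> ?T" if ab: "(a, b) \<in> ?T" "(c, d) \<in> ?T" for a b c d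
  proof -
    obtain m n where "(a, b) \<in> f m" "(c, d) \<in> f n" using ab by blast
    then have "(a, b) \<in> f (max m n)" "(c, d) \<in> f (max m n)" using mono[of m "max m n"] mono[of n "max m n"] by auto
    then show ?thesis using T_diff[OF f(1)] by blast
  qed
  moreover have "a \<in> R \<longleftrightarrow> b \<in> R'" if "(a, b) \<in> ?T" for a b using that T_in_R[OF f(1)] by blast
  moreover have "\<exists>b. (a, b) \<in> ?T" for a using e[of a] f(3) by blast
  moreover have "\<exists>a. (a, b) \<in> ?T" for b using e[of b] f(4) by blast
  moreover have "T \<subseteq> ?T" using f(5) by (rule SUP_upper2[OF UNIV_I])
  ultimately show ?thesis by (intro exI[of _ ?T] conjI allI impI) assumption+
qed

end

subsection \<open>Bases modulo the elements of infinite height\<close>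

lemma of_int_mult_poly: "of_int c * (q :: int poly) = smult c q"
  by (simp add: of_int_poly)

lemma coeff_of_int_mult [simp]: "coeff (of_int c * (q :: int poly)) j = c * coeff q j"
  by (simp add: of_int_mult_poly)

lemma coeff_of_nat_mult [simp]: "coeff (of_nat c * (q :: int poly)) j = int c * coeff q j"
  using coeff_of_int_mult[of "int c" q j] by simp

lemma subgrp_UNIV:
  assumes "subgrp S" "\<And>i. monom 1 i \<in> S"
  shows "v \<in> S"
proof -
  have "(\<Sum>i\<le>degree v. of_int (coeff v i) * monom 1 i) \<in> S"
    using assms by (intro subgrp_sum subgrp_of_int_mult)
  moreover have "of_int c * monom (1::int) i = monom c i" for c i
    by (simp add: of_int_mult_poly smult_monom)
  ultimately show ?thesis by (simp add: poly_as_sum_of_monoms)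
qed

text \<open>The underlying set of a vector space over the field with \<open>p\<close> elements with
  basis \<open>K\<close>. Ulm invariants are compared only through equinumerosity with such sets, so
  no dimension theory is involved.\<close>

definition finsupp :: "nat \<Rightarrow> 'c set \<Rightarrow> ('c \<Rightarrow> nat) set" where
  "finsupp p K = {f. finite {c. f c \<noteq> 0} \<and> (\<forall>c. f c < p) \<and> (\<forall>c. f c \<noteq> 0 \<longrightarrow> c \<in> K)}"

lemma finsupp_eqpoll:
  fixes K :: "'c set" and K' :: "'d set"
  assumes "K \<approx> K'" "p > 0" shows "finsupp p K \<approx> finsupp p K'"
proof -
  obtain h where h: "bij_betw h K K'" using assms(1) by (auto simp: eqpoll_def)
  define g where "g = the_inv_into K h"
  have g: "bij_betw g K' K" unfolding g_def by (rule bij_betw_the_inv_into[OF h])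
  have gh: "g (h c) = c" "h c \<in> K'" if "c \<in> K" for c
    using that h by (auto simp: g_def bij_betw_def the_inv_into_f_f)
  have hg: "h (g c) = c" "g c \<in> K" if "c \<in> K'" for c
    using that h bij_betwE[OF g] by (auto simp: g_def bij_betw_def f_the_inv_into_f)
  define F where "F f c' = (if c' \<in> K' then f (g c') else 0)" for f :: "'c \<Rightarrow> nat" and c'
  define H where "H f c = (if c \<in> K then f (h c) else 0)" for f :: "'d \<Rightarrow> nat" and c
  have "bij_betw F (finsupp p K) (finsupp p K')"
  proof (rule bij_betw_byWitness[where f' = H])
    show "\<forall>f\<in>finsupp p K. H (F f) = f" by (auto simp: finsupp_def fun_eq_iff F_def H_def gh)
    show "\<forall>f\<in>finsupp p K'. F (H f) = f" by (auto simp: finsupp_def fun_eq_iff F_def H_def hg)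
    show "F ` finsupp p K \<subseteq> finsupp p K'"
    proof
      fix x assume "x \<in> F ` finsupp p K"
      then obtain f where f: "x = F f" "f \<in> finsupp p K" by blast
      have "{c. F f c \<noteq> 0} \<subseteq> h ` {c. f c \<noteq> 0}"
      proof
        fix c assume "c \<in> {c. F f c \<noteq> 0}"
        then have "c \<in> K'" "f (g c) \<noteq> 0" by (auto simp: F_def split: if_splits)
        then show "c \<in> h ` {c. f c \<noteq> 0}" using hg(1)[of c] by (intro image_eqI[of _ _ "g c"]) auto
      qed
      then have "finite {c. F f c \<noteq> 0}" using f(2) finite_surj unfolding finsupp_def by blast
      then show "x \<in> finsupp p K'" using f assms(2) by (auto simp: finsupp_def F_def)
    qed
    show "H ` finsupp p K' \<subseteq> finsupp p K"
    proof
      fix x assume "x \<in> H ` finsupp p K'"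
      then obtain f where f: "x = H f" "f \<in> finsupp p K'" by blast
      have "{c. H f c \<noteq> 0} \<subseteq> g ` {c. f c \<noteq> 0}"
      proof
        fix c assume "c \<in> {c. H f c \<noteq> 0}"
        then have "c \<in> K" "f (h c) \<noteq> 0" by (auto simp: H_def split: if_splits)
        then show "c \<in> g ` {c. f c \<noteq> 0}" using gh(1)[of c] by (intro image_eqI[of _ _ "h c"]) auto
      qed
      then have "finite {c. H f c \<noteq> 0}" using f(2) finite_surj unfolding finsupp_def by blast
      then show "x \<in> finsupp p K" using f assms(2) by (auto simp: finsupp_def H_def)
    qed
  qed
  then show ?thesis unfolding eqpoll_def by blast
qed

lemma sum_of_int_extend:
  fixes b :: "'c \<Rightarrow> int poly"
  assumes "finite I'" "I \<subseteq> I'"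
  shows "(\<Sum>c\<in>I. of_int (f c) * b c) = (\<Sum>c\<in>I'. of_int (if c \<in> I then f c else 0) * b c)"
proof -
  have "(\<Sum>c\<in>I'. of_int (if c \<in> I then f c else 0) * b c) = (\<Sum>c\<in>I. of_int (if c \<in> I then f c else 0) * b c)"
    using assms by (intro sum.mono_neutral_right) auto
  then show ?thesis by simp
qed

lemma subgrp_combinations:
  fixes b :: "'c \<Rightarrow> int poly"
  assumes "subgrp W"
  shows "subgrp {v. \<exists>I g. finite I \<and> I \<subseteq> J \<and> v - (\<Sum>s\<in>I. of_int (g s) * b s) \<in> W}" (is "subgrp ?S")
  unfolding subgrp_def
proof (intro conjI ballI)
  show "0 \<in> ?S" using subgrp_zero[OF assms] by (auto intro!: exI[of _ "{}"])
  fix u v assume "u \<in> ?S" "v \<in> ?S"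
  then obtain I g I' h where I: "finite I" "I \<subseteq> J" "u - (\<Sum>s\<in>I. of_int (g s) * b s) \<in> W"
    and I': "finite I'" "I' \<subseteq> J" "v - (\<Sum>s\<in>I'. of_int (h s) * b s) \<in> W" by blast
  have fin: "finite (I \<union> I')" using I I' by simp
  let ?f = "\<lambda>s. (if s \<in> I then g s else 0) - (if s \<in> I' then h s else 0)"
  have "(u - (\<Sum>s\<in>I. of_int (g s) * b s)) - (v - (\<Sum>s\<in>I'. of_int (h s) * b s)) \<in> W"
    by (rule subgrp_diff[OF assms I(3) I'(3)])
  also have "(u - (\<Sum>s\<in>I. of_int (g s) * b s)) - (v - (\<Sum>s\<in>I'. of_int (h s) * b s)) =
      (u - v) - (\<Sum>s\<in>I \<union> I'. of_int (?f s) * b s)"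
    unfolding sum_of_int_extend[OF fin, of I g b, simplified] sum_of_int_extend[OF fin, of I' h b, simplified]
    by (simp add: sum_subtractf algebra_simps)
  finally have "(u - v) - (\<Sum>s\<in>I \<union> I'. of_int (?f s) * b s) \<in> W" .
  moreover have "finite (I \<union> I')" "I \<union> I' \<subseteq> J" using I I' by auto
  ultimately show "u - v \<in> ?S" unfolding mem_Collect_eq by (intro exI conjI)
qed

text \<open>Modulo \<open>pdiv p R (Suc k)\<close> the coefficients matter only modulo
  \<open>p\<close>, because \<open>p\<close> kills each \<open>e c\<close>. Reduced coefficients are
  therefore unique coordinates of the classes.\<close>

lemma ulm_quot_eqpoll:
  fixes e :: "'c \<Rightarrow> int poly"
  assumes p: "prime p" and R: "subgrp R"
    and e: "\<And>c. c \<in> K \<Longrightarrow> e c \<in> psocle p R k"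
    and indep: "\<And>I f c. finite I \<Longrightarrow> I \<subseteq> K \<Longrightarrow> (\<Sum>c\<in>I. of_int (f c) * e c) \<in> pdiv p R (Suc k) \<Longrightarrow>
      c \<in> I \<Longrightarrow> int p dvd f c"
    and span: "\<And>v. v \<in> psocle p R k \<Longrightarrow> \<exists>I f. finite I \<and> I \<subseteq> K \<and>
      v - (\<Sum>c\<in>I. of_int (f c) * e c) \<in> pdiv p R (Suc k)"
  shows "ulm_quot p R k \<approx> finsupp p K"
proof -
  note D = subgrp_pdiv[OF R, of p]
  let ?s = "\<lambda>f :: 'c \<Rightarrow> nat. \<Sum>c | f c \<noteq> 0. of_int (int (f c)) * e c"
  have pe: "of_int (int p * i) * e c \<in> pdiv p R (Suc k)" if "c \<in> K" for i c
  proof -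
    have "of_int i * (of_nat p * e c) \<in> R"
      using e[OF that] by (intro subgrp_of_int_mult R) (simp add: psocle_def)
    then show ?thesis using subset_pdiv[OF R] by (simp add: ac_simps)
  qed
  have "(pclass p R k \<circ> ?s) ` finsupp p K \<approx> (\<lambda>f. f) ` finsupp p K"
  proof (rule eqpoll_image_image)
    fix f g assume fg: "f \<in> finsupp p K" "g \<in> finsupp p K"
    let ?I = "{c. f c \<noteq> 0} \<union> {c. g c \<noteq> 0}"
    have I: "finite ?I" "?I \<subseteq> K" using fg by (auto simp: finsupp_def)
    have "?s h = (\<Sum>c\<in>?I. of_int (int (h c)) * e c)" if "h = f \<or> h = g" for h
      using I(1) that by (intro sum.mono_neutral_left) auto
    then have diff: "?s f - ?s g = (\<Sum>c\<in>?I. of_int (int (f c) - int (g c)) * e c)"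
      by (simp add: sum_subtractf[symmetric] left_diff_distrib)
    show "(pclass p R k \<circ> ?s) f = (pclass p R k \<circ> ?s) g \<longleftrightarrow> f = g"
    proof
      assume "(pclass p R k \<circ> ?s) f = (pclass p R k \<circ> ?s) g"
      then have "(\<Sum>c\<in>?I. of_int (int (f c) - int (g c)) * e c) \<in> pdiv p R (Suc k)"
        unfolding diff[symmetric] comp_def pclass_eq_iff[OF R] .
      note dvd = indep[OF I this]
      show "f = g"
      proof
        fix c
        show "f c = g c"
        proof (cases "c \<in> ?I")
          case True
          have "int (f c) < int p" "int (g c) < int p" using fg by (auto simp: finsupp_def)
          then show ?thesis using dvd[OF True] dvd_imp_le_int[of "int (f c) - int (g c)" "int p"]
            by fastforce
        qed auto
      qed
    qed simp
  qed
  moreover have "(pclass p R k \<circ> ?s) ` finsupp p K = ulm_quot p R k"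
  proof (intro equalityI subsetI)
    fix x assume "x \<in> (pclass p R k \<circ> ?s) ` finsupp p K"
    then obtain f where f: "x = pclass p R k (?s f)" "f \<in> finsupp p K" by auto
    have "?s f \<in> psocle p R k"
    proof -
      have "?s f \<in> pdiv p R k" using f(2) e
        by (intro subgrp_sum[OF D] subgrp_of_int_mult[OF D]) (auto simp: finsupp_def psocle_def)
      moreover have "(\<Sum>c | f c \<noteq> 0. of_int (int (f c)) * (of_nat p * e c)) \<in> R" using f(2) e
        by (intro subgrp_sum[OF R] subgrp_of_int_mult[OF R]) (auto simp: finsupp_def psocle_def)
      ultimately show ?thesis by (simp add: psocle_def sum_distrib_left ac_simps)
    qed
    then show "x \<in> ulm_quot p R k" using f(1) by (simp add: ulm_quot_def)
  next
    fix x assume "x \<in> ulm_quot p R k"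
    then obtain v where v: "x = pclass p R k v" "v \<in> psocle p R k" by (auto simp: ulm_quot_def)
    obtain I f where I: "finite I" "I \<subseteq> K" "v - (\<Sum>c\<in>I. of_int (f c) * e c) \<in> pdiv p R (Suc k)"
      using span[OF v(2)] by (elim exE conjE)
    define g where "g c = (if c \<in> I then nat (f c mod int p) else 0)" for c
    have p0: "int p > 0" using prime_gt_0_nat[OF p] by simp
    have g: "g \<in> finsupp p K" unfolding finsupp_def
    proof (intro CollectI conjI allI impI)
      show "finite {c. g c \<noteq> 0}" using I(1) by (rule finite_subset[rotated]) (auto simp: g_def)
      show "g c < p" for c using p0 by (auto simp: g_def nat_less_iff)
      show "g c \<noteq> 0 \<Longrightarrow> c \<in> K" for c using I(2) by (auto simp: g_def split: if_splits)
    qed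
    have gs: "?s g = (\<Sum>c\<in>I. of_int (int (g c)) * e c)"
      using I(1) by (intro sum.mono_neutral_left) (auto simp: g_def)
    have "(\<Sum>c\<in>I. of_int (f c) * e c) - ?s g = (\<Sum>c\<in>I. of_int (int p * (f c div int p)) * e c)"
      unfolding gs sum_subtractf[symmetric] left_diff_distrib[symmetric] of_int_diff[symmetric]
      using p0 by (intro sum.cong) (auto simp: g_def minus_mod_eq_mult_div)
    also have "\<dots> \<in> pdiv p R (Suc k)" using I(2) pe by (intro subgrp_sum[OF D]) auto
    finally have "v - ?s g \<in> pdiv p R (Suc k)" using subgrp_add[OF D I(3)] by fastforce
    then have "x = (pclass p R k \<circ> ?s) g" using v(1) pclass_eq_iff[OF R, of p k v "?s g"] by simp
    then show "x \<in> (pclass p R k \<circ> ?s) ` finsupp p K" using g by blast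
  qed
  ultimately show ?thesis by simp
qed

text \<open>The quotient by \<open>G\<close> is a direct sum of cyclic groups of orders
  \<open>p ^ n c\<close>, and everything in \<open>G\<close> is infinitely divisible modulo
  \<open>R\<close>. This determines both the elements of infinite height and the finite Ulm
  invariants, without any complement of \<open>G\<close>.\<close>

locale basis_over =
  fixes p :: nat and R G :: "int poly set" and J :: "'c set" and b :: "'c \<Rightarrow> int poly" and n :: "'c \<Rightarrow> nat"
  assumes p: "prime p" and R: "subgrp R" and G: "subgrp G" and RG: "R \<subseteq> G"
    and order: "\<And>c. c \<in> J \<Longrightarrow> of_nat p ^ n c * b c \<in> G"
    and span: "\<And>v. \<exists>I f. finite I \<and> I \<subseteq> J \<and> v - (\<Sum>c\<in>I. of_int (f c) * b c) \<in> G"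
    and indep: "\<And>I f c. finite I \<Longrightarrow> I \<subseteq> J \<Longrightarrow> (\<Sum>c\<in>I. of_int (f c) * b c) \<in> G \<Longrightarrow> c \<in> I \<Longrightarrow>
      int p ^ n c dvd f c"
    and divis: "G \<subseteq> pdivw p R"
begin

text \<open>Expanding the \<open>p ^ k\<close>-th root in the basis changes coefficients only by
  multiples of \<open>p ^ k\<close> and produces a relation modulo \<open>G\<close>, where
  independence applies.\<close>

lemma coeff_mod_power:
  assumes I: "finite I" "I \<subseteq> J" "(\<Sum>c\<in>I. of_int (f c) * b c) \<in> pdiv p R k" and c: "c \<in> I" "n c \<le> k"
  shows "int p ^ n c dvd f c"
proof -
  obtain y where y: "(\<Sum>c\<in>I. of_int (f c) * b c) - of_nat p ^ k * y \<in> R" using I(3) by (auto simp: pdiv_def)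
  obtain I' g where I': "finite I'" "I' \<subseteq> J" "y - (\<Sum>c\<in>I'. of_int (g c) * b c) \<in> G"
    using span[of y] by (elim exE conjE)
  let ?J = "I \<union> I'"
  have J: "finite ?J" "?J \<subseteq> J" using I I' by auto
  let ?h = "\<lambda>c. (if c \<in> I then f c else 0) - int p ^ k * (if c \<in> I' then g c else 0)"
  have "(\<Sum>c\<in>I. of_int (f c) * b c) - of_nat p ^ k * y +
      of_nat p ^ k * (y - (\<Sum>c\<in>I'. of_int (g c) * b c)) \<in> G"
    using y RG I'(3) by (intro subgrp_add[OF G] subgrp_power_mult[OF G]) auto
  then have "(\<Sum>c\<in>I. of_int (f c) * b c) - of_nat p ^ k * (\<Sum>c\<in>I'. of_int (g c) * b c) \<in> G"
    by (simp add: algebra_simps)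
  also have "(\<Sum>c\<in>I. of_int (f c) * b c) - of_nat p ^ k * (\<Sum>c\<in>I'. of_int (g c) * b c) =
      (\<Sum>c\<in>?J. of_int (?h c) * b c)"
    unfolding sum_of_int_extend[OF J(1), of I f b, simplified] sum_of_int_extend[OF J(1), of I' g b, simplified]
      sum_distrib_left sum_subtractf[symmetric]
    by (intro sum.cong) (auto simp: algebra_simps)
  finally have s: "(\<Sum>c\<in>?J. of_int (?h c) * b c) \<in> G" .
  have "int p ^ n c dvd ?h c" by (rule indep[OF J s]) (use c in simp)
  moreover have "int p ^ n c dvd int p ^ k * (if c \<in> I' then g c else 0)"
    using c(2) by (intro dvd_mult2 le_imp_power_dvd)
  ultimately have "int p ^ n c dvd ?h c + int p ^ k * (if c \<in> I' then g c else 0)" by (rule dvd_add)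
  then show ?thesis using c(1) by simp
qed

lemma pdivw_eq: "pdivw p R = G"
proof (rule antisym[OF _ divis], rule subsetI)
  fix v assume v: "v \<in> pdivw p R"
  obtain I f where I: "finite I" "I \<subseteq> J" "v - (\<Sum>c\<in>I. of_int (f c) * b c) \<in> G"
    using span[of v] by (elim exE conjE)
  have "(\<Sum>c\<in>I. of_int (f c) * b c) \<in> pdivw p R"
    using subgrp_diff[OF subgrp_pdivw[OF R] v] I(3) divis by (metis diff_diff_eq2 add_diff_cancel_left' subsetD)
  then have s: "(\<Sum>c\<in>I. of_int (f c) * b c) \<in> pdiv p R k" for k by (simp add: pdivw_def)
  have "of_int (f c) * b c \<in> G" if c: "c \<in> I" for c
  proof -
    obtain q where "f c = int p ^ n c * q" using coeff_mod_power[OF I(1,2) s c order_refl] unfolding dvd_def by blast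
    then have *: "of_int (f c) * b c = of_int q * (of_nat p ^ n c * b c)" by (simp add: ac_simps)
    show ?thesis unfolding * using order[of c] c I(2) by (intro subgrp_of_int_mult[OF G]) auto
  qed
  then have "(\<Sum>c\<in>I. of_int (f c) * b c) \<in> G" by (rule subgrp_sum[OF G])
  then show "v \<in> G" using subgrp_diff_cancel[OF G I(3)] by blast
qed

text \<open>A summand of order \<open>p ^ (k + 1)\<close> contributes one dimension to the
  \<open>k\<close>-th Ulm quotient, whence \<open>Suc k\<close>.\<close>

lemma ulm_quot_finsupp: "ulm_quot p R k \<approx> finsupp p {c \<in> J. n c = Suc k}"
proof -
  note D = subgrp_pdiv[OF R, of p]
  let ?K = "{c \<in> J. n c = Suc k}"
  have Gdiv: "v \<in> pdiv p R j" if "v \<in> G" for v j using divis that by (auto simp: pdivw_def)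
  have "\<exists>y. of_nat p ^ Suc k * b c - of_nat p ^ Suc (Suc k) * y \<in> R" if "c \<in> ?K" for c
    using Gdiv[of "of_nat p ^ Suc k * b c" "Suc (Suc k)"] order[of c] that by (auto simp: pdiv_def)
  then obtain y where y: "\<And>c. c \<in> ?K \<Longrightarrow> of_nat p ^ Suc k * b c - of_nat p ^ Suc (Suc k) * y c \<in> R" by metis
  \<comment> \<open>\<open>p ^ (k + 1) b c\<close> vanishes only modulo \<open>G\<close>. Being
    divisible by \<open>p ^ (k + 2)\<close> modulo \<open>R\<close>, it is cancelled by a correction
    of height at least \<open>k + 1\<close>, after which \<open>p\<close> really kills
    \<open>e c\<close>.\<close>
  define e where "e c = of_nat p ^ k * b c - of_nat p ^ Suc k * y c" for c
  have be: "of_nat p ^ k * b c - e c \<in> pdiv p R (Suc k)" for c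
    unfolding e_def using power_in_pdiv[OF R, of p "Suc k"] by simp
  show ?thesis
  proof (rule ulm_quot_eqpoll[OF p R, of ?K e])
    fix c assume "c \<in> ?K"
    then have "of_nat p * e c \<in> R" using y[of c] by (simp add: e_def algebra_simps)
    moreover have "e c \<in> pdiv p R k"
      unfolding e_def by (intro subgrp_diff[OF D] power_in_pdiv[OF R] pdiv_antimono[OF R _ power_in_pdiv[OF R]]) simp
    ultimately show "e c \<in> psocle p R k" by (simp add: psocle_def)
  next
    fix I f c assume I: "finite I" "I \<subseteq> ?K" "(\<Sum>c\<in>I. of_int (f c) * e c) \<in> pdiv p R (Suc k)" and c: "c \<in> I"
    have "(\<Sum>c\<in>I. of_int (f c) * (of_nat p ^ k * b c - e c)) \<in> pdiv p R (Suc k)"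
      by (intro subgrp_sum[OF D] subgrp_of_int_mult[OF D] be)
    from subgrp_add[OF D this I(3)] have s: "(\<Sum>c\<in>I. of_int (f c * int p ^ k) * b c) \<in> pdiv p R (Suc k)"
      by (simp add: sum.distrib[symmetric] algebra_simps)
    have IJ: "I \<subseteq> J" "n c = Suc k" using I(2) c by auto
    have "int p ^ Suc k dvd f c * int p ^ k" using coeff_mod_power[OF I(1) IJ(1) s c] IJ(2) by simp
    then show "int p dvd f c" using prime_gt_0_nat[OF p] by simp
  next
    fix v assume v: "v \<in> psocle p R k"
    then obtain x where x: "v - of_nat p ^ k * x \<in> R" by (auto simp: psocle_def pdiv_def)
    obtain I f where I: "finite I" "I \<subseteq> J" "x - (\<Sum>c\<in>I. of_int (f c) * b c) \<in> G"
      using span[of x] by (elim exE conjE)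
    let ?s = "\<Sum>c\<in>I. of_int (f c) * b c"
    have "v - of_nat p ^ k * x + of_nat p ^ k * (x - ?s) \<in> G"
      using x RG I(3) by (intro subgrp_add[OF G] subgrp_power_mult[OF G]) auto
    then have vs: "v - of_nat p ^ k * ?s \<in> G" by (simp add: algebra_simps)
    have "of_nat p * v \<in> G" using v RG by (auto simp: psocle_def)
    from subgrp_diff[OF G this subgrp_of_nat_mult[OF G vs, of p]] have "(\<Sum>c\<in>I. of_int (int p ^ Suc k * f c) * b c) \<in> G"
      by (simp add: algebra_simps sum_distrib_left)
    note dvd = indep[OF I(1,2) this]
    let ?I = "I \<inter> ?K"
    have "of_int (f c) * (of_nat p ^ k * b c) - (if c \<in> ?K then of_int (f c) * e c else 0) \<in> pdiv p R (Suc k)"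
      if c: "c \<in> I" for c
    proof -
      \<comment> \<open>Summands of smaller order are already in \<open>G\<close> after
        multiplication by \<open>p ^ k\<close>. For summands of larger order, \<open>p v\<close>
        being a relation forces \<open>p\<close> to divide the coefficient, so the term has height
        at least \<open>k + 1\<close>.\<close>
      consider "n c = Suc k" | "n c \<le> k" | "n c \<ge> Suc (Suc k)" by linarith
      then show ?thesis
      proof cases
        case 1
        then show ?thesis using subgrp_of_int_mult[OF D be[of c], of "f c"] c I(2)
          by (auto simp: algebra_simps)
      next
        case 2
        have "of_nat p ^ (k - n c) * (of_nat p ^ n c * b c) \<in> G"
          using subgrp_power_mult[OF G order[of c], of p "k - n c"] c I(2) by blast
        then have "of_nat p ^ k * b c \<in> G" using 2 by (simp add: mult.assoc[symmetric] power_add[symmetric])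
        then show ?thesis using Gdiv 2 subgrp_of_int_mult[OF D] by auto
      next
        case 3
        have "int p ^ Suc (Suc k) dvd int p ^ Suc k * f c" using dvd[OF c] 3 power_le_dvd by blast
        then have "int p dvd f c" using prime_gt_0_nat[OF p] by simp
        then obtain q where "f c = int p * q" unfolding dvd_def by blast
        then have "of_int (f c) * (of_nat p ^ k * b c) = of_nat p ^ Suc k * (of_int q * b c)"
          by (simp add: ac_simps)
        then have "of_int (f c) * (of_nat p ^ k * b c) \<in> pdiv p R (Suc k)" by (metis power_in_pdiv[OF R])
        then show ?thesis using 3 by simp
      qed
    qed
    then have "(\<Sum>c\<in>I. of_int (f c) * (of_nat p ^ k * b c) - (if c \<in> ?K then of_int (f c) * e c else 0))
        \<in> pdiv p R (Suc k)" by (rule subgrp_sum[OF D])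
    moreover have "(\<Sum>c\<in>I. if c \<in> ?K then of_int (f c) * e c else 0) = (\<Sum>c\<in>?I. of_int (f c) * e c)"
      using I(1) by (simp add: sum.inter_restrict)
    ultimately have "of_nat p ^ k * ?s - (\<Sum>c\<in>?I. of_int (f c) * e c) \<in> pdiv p R (Suc k)"
      by (simp add: sum_subtractf sum_distrib_left ac_simps)
    from subgrp_add[OF D Gdiv[OF vs] this]
    have "v - (\<Sum>c\<in>?I. of_int (f c) * e c) \<in> pdiv p R (Suc k)" by (simp add: algebra_simps)
    then show "\<exists>I f. finite I \<and> I \<subseteq> ?K \<and> v - (\<Sum>c\<in>I. of_int (f c) * e c) \<in> pdiv p R (Suc k)"
      using I(1) by (intro exI[of _ ?I] exI[of _ f]) auto
  qed
qed

end

subsection \<open>Triangular presentations\<close>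

text \<open>The generators are the monomials; a dead generator is zero and a live generator \<^term>\<open>i\<close> satisfies
  \<^term>\<open>p\<close> times it equals the combination of the earlier generators with coefficients \<^term>\<open>w i\<close>.\<close>

definition relv :: "nat \<Rightarrow> (nat \<Rightarrow> bool) \<Rightarrow> (nat \<Rightarrow> nat \<Rightarrow> nat) \<Rightarrow> nat \<Rightarrow> int poly" where
  "relv p al w i = (if al i then of_nat p * monom 1 i - (\<Sum>j<i. of_nat (w i j) * monom 1 j) else monom 1 i)"

definition rels :: "nat \<Rightarrow> (nat \<Rightarrow> bool) \<Rightarrow> (nat \<Rightarrow> nat \<Rightarrow> nat) \<Rightarrow> int poly set" where
  "rels p al w = {v. \<exists>N z. v = (\<Sum>i<N. of_int (z i) * relv p al w i)}"

lemma subgrp_rels: "subgrp (rels p al w)"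
  unfolding subgrp_def
proof (intro conjI ballI)
  show "0 \<in> rels p al w" unfolding rels_def by (auto intro: exI[of _ 0])
  fix a b assume "a \<in> rels p al w" "b \<in> rels p al w"
  then obtain N z M y where ab: "a = (\<Sum>i<N. of_int (z i) * relv p al w i)" "b = (\<Sum>i<M. of_int (y i) * relv p al w i)"
    unfolding rels_def by blast
  let ?K = "{..<max N M}"
  have "a = (\<Sum>i\<in>?K. of_int (if i \<in> {..<N} then z i else 0) * relv p al w i)"
    "b = (\<Sum>i\<in>?K. of_int (if i \<in> {..<M} then y i else 0) * relv p al w i)"
    unfolding ab by (rule sum_of_int_extend; auto)+
  then have "a - b = (\<Sum>i<max N M. of_int ((if i \<in> {..<N} then z i else 0) - (if i \<in> {..<M} then y i else 0)) * relv p al w i)"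
    by (simp add: sum_subtractf[symmetric] algebra_simps)
  then show "a - b \<in> rels p al w" unfolding rels_def mem_Collect_eq by (intro exI)
qed

lemma relv_in_rels: "relv p al w i \<in> rels p al w"
proof -
  have "relv p al w i = (\<Sum>j<Suc i. of_int (if j = i then 1 else 0) * relv p al w j)"
    by (subst sum.remove[of _ i]) auto
  then show ?thesis unfolding rels_def mem_Collect_eq by (intro exI)
qed

lemma rels_live: "al i \<Longrightarrow> of_nat p * monom 1 i - (\<Sum>j<i. of_nat (w i j) * monom 1 j) \<in> rels p al w"
  and rels_dead: "\<not> al i \<Longrightarrow> monom 1 i \<in> rels p al w"
  using relv_in_rels[of p al w i] by (simp_all add: relv_def)

lemma coeff_relv:
  assumes "al j"
  shows "coeff (relv p al w i) j = (if al i then (if i = j then int p else 0) - (if j < i then int (w i j) else 0) else 0)"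
proof -
  have "coeff (\<Sum>j<i. of_nat (w i j) * monom (1::int) j) j = (\<Sum>j'<i. if j' = j then int (w i j') else 0)"
    unfolding coeff_sum by (intro sum.cong) auto
  also have "\<dots> = (if j < i then int (w i j) else 0)" by simp
  finally show ?thesis using assms by (auto simp: relv_def)
qed

text \<open>Among the live relations used, the one of greatest rank contributes \<open>p\<close>
  times its coefficient at its own generator, where no other one interferes. Thus a leading
  coefficient is a multiple of \<open>p\<close>. The rank is arbitrary because two orders are
  needed: the numbering of the generators and a block order adapted to chains.\<close>

lemma rels_triangular:
  fixes rk :: "nat \<Rightarrow> 'o :: linorder"
  assumes inj: "inj_on rk {i. al i}"
    and low: "\<And>i j. al i \<Longrightarrow> al j \<Longrightarrow> j < i \<Longrightarrow> w i j \<noteq> 0 \<Longrightarrow> rk j < rk i"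
    and v: "v \<in> rels p al w" and e: "al e" and top: "\<And>j. al j \<Longrightarrow> rk e < rk j \<Longrightarrow> coeff v j = 0"
    and p: "p > 0"
  shows "int p dvd coeff v e"
proof -
  obtain N z where vz: "v = (\<Sum>i<N. of_int (z i) * relv p al w i)" using v unfolding rels_def by blast
  let ?I = "{i. i < N \<and> al i \<and> z i \<noteq> 0}"
  have cf: "coeff v j = (\<Sum>i\<in>?I. z i * coeff (relv p al w i) j)" if "al j" for j
    unfolding vz coeff_sum coeff_of_int_mult
    by (intro sum.mono_neutral_right) (auto simp: coeff_relv[of al, OF that])
  show ?thesis
  proof (cases "?I = {}")
    case True
    then show ?thesis using cf[OF e] by simp
  next
    case False
    have fin: "finite ?I" by simp
    obtain m where m: "m \<in> ?I" "\<And>i. i \<in> ?I \<Longrightarrow> rk i \<le> rk m"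
    proof -
      have "Max (rk ` ?I) \<in> rk ` ?I" using False by (intro Max_in) auto
      then obtain m where "m \<in> ?I" "rk m = Max (rk ` ?I)" by (metis (no_types, lifting) imageE)
      then show ?thesis using that[of m] fin by simp
    qed
    have zero: "coeff (relv p al w i) j = 0" if ij: "i \<in> ?I" "al j" "i \<noteq> j" "rk m \<le> rk j" for i j
    proof (rule ccontr)
      assume "coeff (relv p al w i) j \<noteq> 0"
      then have "j < i" "w i j \<noteq> 0" using ij by (auto simp: coeff_relv split: if_splits)
      then have "rk j < rk i" using low[of i j] ij by simp
      then show False using m(2)[OF ij(1)] ij(4) by simp
    qed
    have vm: "coeff v m = z m * int p"
    proof -
      have "coeff v m = z m * coeff (relv p al w m) m"
        using m(1) cf[of m] zero fin by (simp add: sum.remove[of ?I m])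
      then show ?thesis using m(1) by (simp add: coeff_relv)
    qed
    then have "coeff v m \<noteq> 0" using m(1) p by simp
    then have le: "rk m \<le> rk e" using top[of m] m(1) by force
    show ?thesis
    proof (cases "m = e")
      case True then show ?thesis using vm by simp
    next
      case ne: False
      then have "rk m < rk e" using le inj m(1) e by (auto simp: inj_on_def order.strict_iff_order)
      then have "e \<notin> ?I" using m(2)[of e] by fastforce
      then have "coeff v e = 0"
        unfolding cf[OF e] using zero[OF _ e _ le] by (intro sum.neutral) auto
      then show ?thesis by simp
    qed
  qed
qed

lemma rels_torsion: "\<exists>n. of_nat p ^ n * v \<in> rels p al w"
proof -
  let ?R = "rels p al w"
  let ?S = "{v. \<exists>n. of_nat p ^ n * v \<in> ?R}"
  note R = subgrp_rels[of p al w]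
  have S: "subgrp ?S" unfolding subgrp_def
  proof (intro conjI ballI)
    show "0 \<in> ?S" using subgrp_zero[OF R] by simp
    fix a b assume "a \<in> ?S" "b \<in> ?S"
    then obtain m n where "of_nat p ^ m * a \<in> ?R" "of_nat p ^ n * b \<in> ?R" by blast
    then have "of_nat p ^ n * (of_nat p ^ m * a) - of_nat p ^ m * (of_nat p ^ n * b) \<in> ?R"
      using subgrp_diff[OF R subgrp_power_mult[OF R, of _ p n] subgrp_power_mult[OF R, of _ p m]] by blast
    then have "of_nat p ^ (m + n) * (a - b) \<in> ?R" by (simp add: algebra_simps power_add)
    then show "a - b \<in> ?S" by blast
  qed
  have "monom 1 i \<in> ?S" for i
  proof (induction i rule: less_induct)
    case (less i)
    show ?case
    proof (cases "al i")
      case True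
      have "(\<Sum>j<i. of_nat (w i j) * monom 1 j) \<in> ?S"
        using less by (intro subgrp_sum[OF S] subgrp_of_nat_mult[OF S]) auto
      then obtain n where n: "of_nat p ^ n * (\<Sum>j<i. of_nat (w i j) * monom 1 j) \<in> ?R" by blast
      have "of_nat p ^ n * (of_nat p * monom 1 i - (\<Sum>j<i. of_nat (w i j) * monom 1 j)) \<in> ?R"
        using subgrp_power_mult[OF R rels_live] True by blast
      from subgrp_add[OF R this n] have "of_nat p ^ Suc n * monom 1 i \<in> ?R" by (simp add: algebra_simps)
      then show ?thesis by blast
    next
      case False
      have "of_nat p ^ 0 * monom 1 i \<in> ?R" using rels_dead[of al i] False by simp
      then show ?thesis by blast
    qed
  qed
  from subgrp_UNIV[OF S this, of v] show ?thesis by simp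
qed

text \<open>From the top generator downwards: reduce its coefficient modulo \<open>p\<close> and let
  the live relation carry the quotient to earlier generators; a dead generator is deleted
  altogether.\<close>

lemma normal_form_exists:
  assumes p: "p > 0" and v: "\<And>j. j \<ge> n \<Longrightarrow> coeff v j = 0"
  shows "\<exists>d. (\<forall>j. d j < p) \<and> (\<forall>j. d j \<noteq> 0 \<longrightarrow> al j \<and> j < n) \<and>
    v - (\<Sum>j<n. of_nat (d j) * monom 1 j) \<in> rels p al w"
  using v
proof (induction n arbitrary: v)
  case 0
  then have "v = 0" by (simp add: poly_eq_iff)
  then show ?case using p subgrp_zero[OF subgrp_rels] by (intro exI[of _ "\<lambda>_. 0"]) auto
next
  case (Suc n)
  note R = subgrp_rels[of p al w]
  define c where "c = coeff v n"
  define q where "q = (if al n then c div int p else c)"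
  define r where "r = (if al n then nat (c mod int p) else 0)"
  define v' where "v' = v - of_int q * relv p al w n - of_nat r * monom 1 n"
  have "coeff v' j = 0" if "j \<ge> n" for j
  proof -
    have top: "coeff (\<Sum>j<n. of_nat (w n j) * monom (1::int) j) j = 0"
      using that by (auto simp: coeff_sum intro!: sum.neutral)
    show ?thesis
    proof (cases "j = n")
      case True
      then show ?thesis using top p by (auto simp: v'_def relv_def q_def r_def c_def minus_div_mult_eq_mod)
    next
      case False
      then show ?thesis using that Suc.prems[of j] top by (auto simp: v'_def relv_def)
    qed
  qed
  from Suc.IH[OF this] obtain d where d: "\<And>j. d j < p" "\<And>j. d j \<noteq> 0 \<Longrightarrow> al j \<and> j < n"
    "v' - (\<Sum>j<n. of_nat (d j) * monom 1 j) \<in> rels p al w" by blast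
  let ?d = "d(n := r)"
  have rp: "r < p" using p by (auto simp: r_def nat_less_iff)
  have "(\<Sum>j<Suc n. of_nat (?d j) * monom 1 j) = (\<Sum>j<n. of_nat (d j) * monom (1::int) j) + of_nat r * monom 1 n"
    by simp
  then have "v - (\<Sum>j<Suc n. of_nat (?d j) * monom 1 j) =
      (v' - (\<Sum>j<n. of_nat (d j) * monom 1 j)) + of_int q * relv p al w n"
    by (simp add: v'_def algebra_simps)
  also have "\<dots> \<in> rels p al w" by (intro subgrp_add[OF R] d(3) subgrp_of_int_mult[OF R] relv_in_rels)
  finally show ?case using d(1,2) rp
    by (intro exI[of _ ?d] conjI) (auto simp: r_def less_Suc_eq split: if_splits)
qed

lemma normal_form_unique:
  assumes d: "\<And>j. d j < p" "\<And>j. d j \<noteq> 0 \<Longrightarrow> al j \<and> j < n"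
    and z: "(\<Sum>j<n. of_nat (d j) * monom 1 j) - (\<Sum>j<n. of_nat (d' j) * monom 1 j) \<in> rels p al w"
    and d': "\<And>j. d' j < p" "\<And>j. d' j \<noteq> 0 \<Longrightarrow> al j \<and> j < n" and p: "p > 0"
  shows "d = d'"
proof (rule ccontr)
  assume "d \<noteq> d'"
  then have ne: "{j. d j \<noteq> d' j} \<noteq> {}" by (auto simp: fun_eq_iff)
  have fin: "finite {j. d j \<noteq> d' j}" 
  proof (rule finite_subset[of _ "{..<n}"])
    show "{j. d j \<noteq> d' j} \<subseteq> {..<n}"
    proof
      fix j assume "j \<in> {j. d j \<noteq> d' j}"
      then have "d j \<noteq> 0 \<or> d' j \<noteq> 0" by auto
      then show "j \<in> {..<n}" using d(2)[of j] d'(2)[of j] by blast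
    qed
  qed simp
  define e where "e = Max {j. d j \<noteq> d' j}"
  have e: "d e \<noteq> d' e" using Max_in[OF fin ne] by (simp add: e_def)
  then have ale: "al e" "e < n" using d(2)[of e] d'(2)[of e] by fastforce+
  have cf: "coeff (\<Sum>j<n. of_nat (d j) * monom (1::int) j) j = int (d j)" if "\<And>j. d j \<noteq> 0 \<Longrightarrow> al j \<and> j < n" for d :: "nat \<Rightarrow> nat" and j
  proof -
    have "coeff (\<Sum>j<n. of_nat (d j) * monom (1::int) j) j = (\<Sum>i<n. if i = j then int (d i) else 0)"
      unfolding coeff_sum by (intro sum.cong) auto
    then show ?thesis using that[of j] by auto
  qed
  have "int p dvd coeff ((\<Sum>j<n. of_nat (d j) * monom 1 j) - (\<Sum>j<n. of_nat (d' j) * monom 1 j)) e"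
  proof (rule rels_triangular[where rk = "\<lambda>i. i", OF _ _ z ale(1)])
    fix j assume "e < j"
    then have "d j = d' j" using Max_ge[OF fin, of j] unfolding e_def by fastforce
    then show "coeff ((\<Sum>j<n. of_nat (d j) * monom 1 j) - (\<Sum>j<n. of_nat (d' j) * monom 1 j)) j = (0::int)"
      using cf[of d, OF d(2)] cf[of d', OF d'(2)] by simp
  qed (auto simp: inj_on_def p)
  then have "int p dvd int (d e) - int (d' e)" using cf[of d, OF d(2)] cf[of d', OF d'(2)] by simp
  moreover have "\<bar>int (d e) - int (d' e)\<bar> < int p" using d(1)[of e] d'(1)[of e] by linarith
  ultimately show False using e dvd_imp_le_int[of "int (d e) - int (d' e)" "int p"] by fastforce
qed

subsection \<open>Groups built from growing chains\<close>

text \<open>A chain \<^term>\<open>c\<close> belongs to the node named by its first chain \<^term>\<open>fs c\<close>.  The node has a generator \<open>X\<close>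
  with \<open>p X\<close> given by \<^term>\<open>ww\<close>, and each of its chains adds a root of \<open>X\<close> whose order \<^term>\<open>Lt c t\<close> grows with
  the stage \<^term>\<open>t\<close>.  A node with infinitely many chains has infinite height.  The last chain of any other
  node is one step shorter than the others, so that together with \<open>X\<close> it forms a cyclic summand of
  the order prescribed by \<^term>\<open>Q\<close>.\<close>

definition ch_live :: "(nat \<Rightarrow> bool) \<Rightarrow> (nat \<Rightarrow> nat) \<Rightarrow> (nat \<Rightarrow> nat \<Rightarrow> nat) \<Rightarrow> nat \<Rightarrow> bool" where
  "ch_live Ch fs Lt i \<longleftrightarrow> Ch (p1 i) \<and>
    (if p1 (p2 i) = 0 then p2 (p2 i) = 0 \<and> fs (p1 i) = p1 i
     else p1 (p2 i) \<le> Lt (p1 i) (p2 (p2 i)) \<and>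
       (p2 (p2 i) = 0 \<or> Lt (p1 i) (p2 (p2 i) - 1) < p1 (p2 i)))"

text \<open>A generator is named \<open>pr c (pr l t)\<close>: level \<open>l\<close> of chain
  \<open>c\<close>, with \<open>t\<close> the first stage at which the length reaches
  \<open>l\<close>. Recording \<open>t\<close> makes liveness decidable although the final length is
  only a limit. Level 0 is live once per node, and level 1 of all chains of the node hangs from
  it.\<close>

definition ch_rel :: "(nat \<Rightarrow> bool) \<Rightarrow> (nat \<Rightarrow> nat) \<Rightarrow> (nat \<Rightarrow> nat \<Rightarrow> nat) \<Rightarrow> (nat \<Rightarrow> nat \<Rightarrow> nat) \<Rightarrow> nat \<Rightarrow> nat \<Rightarrow> nat" where
  "ch_rel Ch fs ww Lt i j =
    (if p1 (p2 i) = 0 then (if p2 j = pr 0 0 then ww (p1 i) (p1 j) else 0)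
     else if p1 (p2 i) = 1 then (if j = pr (fs (p1 i)) (pr 0 0) then 1 else 0)
     else if p1 j = p1 i \<and> p1 (p2 j) = p1 (p2 i) - 1 \<and> ch_live Ch fs Lt j then 1 else 0)"

text \<open>\<open>tr\<close> singles out the nodes with infinitely many chains. The last assumption
  is what lets a finite node split off: if the relation of \<open>s\<close> mentions a finite node
  \<open>t\<close>, then \<open>s\<close> is finite too and its last chain is shorter than that of
  \<open>t\<close>, so the term can be absorbed by a change of basis.\<close>

locale chains =
  fixes p :: nat and Ch :: "nat \<Rightarrow> bool" and fs :: "nat \<Rightarrow> nat" and ww :: "nat \<Rightarrow> nat \<Rightarrow> nat"
    and Lt :: "nat \<Rightarrow> nat \<Rightarrow> nat" and Q :: "nat \<Rightarrow> nat" and tr :: "nat \<Rightarrow> bool" and last :: "nat \<Rightarrow> nat"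
  assumes p: "prime p"
    and fs: "\<And>c. Ch c \<Longrightarrow> Ch (fs c) \<and> fs c \<le> c \<and> fs (fs c) = fs c"
    and ww: "\<And>c c'. Ch c \<Longrightarrow> fs c = c \<Longrightarrow> ww c c' \<noteq> 0 \<Longrightarrow> c' < c \<and> Ch c' \<and> fs c' = c'"
    and Lt_mono: "\<And>c t t'. t \<le> t' \<Longrightarrow> Lt c t \<le> Lt c t'"
    and Lt_lim: "\<And>c. Ch c \<Longrightarrow> \<exists>t0. \<forall>t\<ge>t0. Lt c t = Q c + (if \<exists>c'>c. Ch c' \<and> fs c' = fs c then 1 else 0)"
    and Q_mono: "\<And>c c'. Ch c \<Longrightarrow> Ch c' \<Longrightarrow> fs c = fs c' \<Longrightarrow> c < c' \<Longrightarrow> Q c < Q c'"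
    and tr_def: "\<And>c. tr c \<longleftrightarrow> infinite {c'. Ch c' \<and> fs c' = c}"
    and last_def: "\<And>c. last c = Max {c'. Ch c' \<and> fs c' = c}"
    and ww_false: "\<And>s t. Ch s \<Longrightarrow> fs s = s \<Longrightarrow> ww s t \<noteq> 0 \<Longrightarrow> \<not> tr t \<Longrightarrow> \<not> tr s \<and> Q (last s) < Q (last t)"
begin

abbreviation "al \<equiv> ch_live Ch fs Lt"
abbreviation "w \<equiv> ch_rel Ch fs ww Lt"
abbreviation "R \<equiv> rels p al w"

lemma R: "subgrp R" by (rule subgrp_rels)

lemma p0: "p > 0" using p prime_gt_0_nat by blast

definition L :: "nat \<Rightarrow> nat" where
  "L c = Q c + (if \<exists>c'>c. Ch c' \<and> fs c' = fs c then 1 else 0)"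

definition gi :: "nat \<Rightarrow> nat \<Rightarrow> nat" where
  "gi c l = (if l = 0 then pr (fs c) (pr 0 0) else pr c (pr l (LEAST t. l \<le> Lt c t)))"

abbreviation "X c \<equiv> monom (1::int) (pr c (pr 0 0))"

definition B :: "nat \<Rightarrow> int poly" where "B c = monom 1 (gi c (L c))"

definition fin_node :: "nat \<Rightarrow> bool" where "fin_node s \<longleftrightarrow> Ch s \<and> fs s = s \<and> \<not> tr s"
definition inf_node :: "nat \<Rightarrow> bool" where "inf_node s \<longleftrightarrow> Ch s \<and> fs s = s \<and> tr s"

lemma last_in:
  assumes "fin_node s"
  shows "Ch (last s)" "fs (last s) = s" "\<And>c. Ch c \<Longrightarrow> fs c = s \<Longrightarrow> c \<le> last s"
proof -
  let ?M = "{c'. Ch c' \<and> fs c' = s}"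
  have "finite ?M" "s \<in> ?M" using assms tr_def by (auto simp: fin_node_def)
  then have "last s \<in> ?M" "\<And>c. c \<in> ?M \<Longrightarrow> c \<le> last s" using Max_in[of ?M] last_def[of s] by auto
  then show "Ch (last s)" "fs (last s) = s" "\<And>c. Ch c \<Longrightarrow> fs c = s \<Longrightarrow> c \<le> last s" by auto
qed

lemma node_cases: "Ch c \<Longrightarrow> (inf_node (fs c) \<and> tr (fs c)) \<or> (fin_node (fs c) \<and> \<not> tr (fs c))"
  using fs[of c] by (auto simp: inf_node_def fin_node_def)

lemma L_last: "fin_node s \<Longrightarrow> L (last s) = Q (last s)"
  using last_in[of s] unfolding L_def by fastforce

lemma L_not_last:
  assumes "Ch c" "tr (fs c) \<or> c \<noteq> last (fs c)" shows "L c = Suc (Q c)"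
proof -
  have "\<exists>c'>c. Ch c' \<and> fs c' = fs c"
  proof (cases "tr (fs c)")
    case True
    then have "infinite {c'. Ch c' \<and> fs c' = fs c}" using tr_def by blast
    then show ?thesis unfolding infinite_nat_iff_unbounded by auto
  next
    case False
    then have "fin_node (fs c)" using node_cases[OF assms(1)] by simp
    from last_in[OF this] show ?thesis using assms False by (metis le_neq_implies_less)
  qed
  then show ?thesis by (simp add: L_def)
qed

lemma Lt_reach: assumes "Ch c" "l \<le> L c" shows "\<exists>t. l \<le> Lt c t"
proof -
  obtain t0 where "\<forall>t\<ge>t0. Lt c t = L c" using Lt_lim[OF assms(1)] unfolding L_def by blast
  then show ?thesis using assms(2) by (intro exI[of _ t0]) simp
qed

lemma Lt_le_L: assumes "Ch c" shows "Lt c t \<le> L c"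
proof -
  obtain t0 where t0: "\<forall>t\<ge>t0. Lt c t = L c" using Lt_lim[OF assms] unfolding L_def by blast
  have "Lt c t \<le> Lt c (max t t0)" by (rule Lt_mono) simp
  then show ?thesis using t0 by simp
qed

lemma gi_live:
  assumes "Ch c" "l \<le> L c" shows "al (gi c l)"
proof (cases "l = 0")
  case True
  then show ?thesis using fs[OF assms(1)] by (simp add: gi_def ch_live_def)
next
  case False
  let ?t = "LEAST t. l \<le> Lt c t"
  have "l \<le> Lt c ?t" by (rule LeastI_ex[OF Lt_reach[OF assms]])
  moreover have "?t = 0 \<or> Lt c (?t - 1) < l"
    using not_less_Least[of "?t - 1" "\<lambda>t. l \<le> Lt c t"] by (cases ?t) auto
  ultimately show ?thesis using assms(1) False by (simp add: gi_def ch_live_def)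
qed

lemma live_gi:
  assumes "al i" shows "Ch (p1 i)" "p1 (p2 i) \<le> L (p1 i)" "i = gi (p1 i) (p1 (p2 i))"
proof -
  let ?c = "p1 i" and ?l = "p1 (p2 i)" and ?t = "p2 (p2 i)"
  show Ch: "Ch ?c" using assms by (simp add: ch_live_def)
  have i: "i = pr ?c (pr ?l ?t)" by simp
  show "?l \<le> L ?c"
  proof (cases "?l = 0")
    case False
    then have "?l \<le> Lt ?c ?t" using assms by (auto simp: ch_live_def split: if_splits)
    then show ?thesis using Lt_le_L[OF Ch, of ?t] by simp
  qed simp
  show "i = gi ?c ?l"
  proof (cases "?l = 0")
    case True
    then have "?t = 0" "fs ?c = ?c" using assms by (auto simp: ch_live_def)
    then show ?thesis using i True by (metis gi_def)
  next
    case False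
    have t: "?l \<le> Lt ?c ?t" "?t = 0 \<or> Lt ?c (?t - 1) < ?l" using assms False by (auto simp: ch_live_def split: if_splits)
    have "(LEAST t. ?l \<le> Lt ?c t) = ?t"
    proof (rule Least_equality)
      show "?l \<le> Lt ?c ?t" by (rule t(1))
      fix y assume y: "?l \<le> Lt ?c y"
      show "?t \<le> y"
      proof (rule ccontr)
        assume "\<not> ?t \<le> y"
        then have "Lt ?c y \<le> Lt ?c (?t - 1)" by (intro Lt_mono) auto
        then show False using t(2) y \<open>\<not> ?t \<le> y\<close> by auto
      qed
    qed
    then show ?thesis using i False unfolding gi_def by simp
  qed
qed

lemma gi_less:
  assumes "Ch c" "Suc l \<le> L c" shows "gi c l < gi c (Suc l)"
proof (cases "l = 0")
  case True
  then show ?thesis using fs[OF assms(1)] unfolding gi_def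
    by (auto intro!: pr_less pr_mono)
next
  case False
  have "Suc l \<le> Lt c (LEAST t. Suc l \<le> Lt c t)" by (rule LeastI_ex[OF Lt_reach[OF assms]])
  then have "(LEAST t. l \<le> Lt c t) \<le> (LEAST t. Suc l \<le> Lt c t)" by (intro Least_le) simp
  then have "pr l (LEAST t. l \<le> Lt c t) < pr (Suc l) (LEAST t. Suc l \<le> Lt c t)" by (intro pr_less) auto
  then show ?thesis using False unfolding gi_def by (auto intro!: pr_less)
qed

lemma rel_gi:
  assumes "Ch c" "Suc l \<le> L c"
  shows "of_nat p * monom 1 (gi c (Suc l)) - monom 1 (gi c l) \<in> R"
proof -
  let ?i = "gi c (Suc l)"
  have i: "p1 ?i = c" "p1 (p2 ?i) = Suc l" by (simp_all add: gi_def)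
  have w: "w ?i j = (if j = gi c l then 1 else 0)" for j
  proof (cases "l = 0")
    case True
    then show ?thesis using i by (simp add: ch_rel_def gi_def)
  next
    case False
    have "(p1 j = c \<and> p1 (p2 j) = l \<and> al j) \<longleftrightarrow> j = gi c l"
    proof
      assume "p1 j = c \<and> p1 (p2 j) = l \<and> al j"
      then show "j = gi c l" using live_gi(3)[of j] by simp
    next
      assume "j = gi c l"
      then show "p1 j = c \<and> p1 (p2 j) = l \<and> al j" using gi_live[of c l] assms False by (simp add: gi_def)
    qed
    then show ?thesis using i False by (simp add: ch_rel_def)
  qed
  have "(\<Sum>j<?i. of_nat (w ?i j) * monom (1::int) j) = (\<Sum>j<?i. if j = gi c l then monom 1 j else 0)"
    unfolding w by (intro sum.cong) auto
  also have "\<dots> = monom 1 (gi c l)" using gi_less[OF assms] by simp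
  finally show ?thesis using rels_live[of al ?i p w] gi_live[OF assms] by simp
qed

lemma rel_power:
  assumes "Ch c" "a \<le> L c"
  shows "of_nat p ^ a * B c - monom 1 (gi c (L c - a)) \<in> R"
  using assms(2)
proof (induction a)
  case 0
  then show ?case using subgrp_zero[OF R] by (simp add: B_def)
next
  case (Suc a)
  have "of_nat p * (of_nat p ^ a * B c - monom 1 (gi c (L c - a))) \<in> R"
    using Suc by (intro subgrp_of_nat_mult[OF R]) simp
  moreover have "of_nat p * monom 1 (gi c (L c - a)) - monom 1 (gi c (L c - Suc a)) \<in> R"
    using rel_gi[OF assms(1), of "L c - Suc a"] Suc.prems by (simp add: Suc_diff_Suc)
  ultimately show ?case using subgrp_add[OF R] by (fastforce simp: algebra_simps)
qed

lemma rel_power_X: "Ch c \<Longrightarrow> of_nat p ^ L c * B c - X (fs c) \<in> R"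
  using rel_power[of c "L c"] by (simp add: gi_def)

lemma rel_X:
  assumes "Ch s" "fs s = s"
  shows "of_nat p * X s - (\<Sum>t | ww s t \<noteq> 0. of_nat (ww s t) * X t) \<in> R"
proof -
  let ?i = "pr s (pr 0 0)" and ?x = "\<lambda>t. pr t (pr 0 0)"
  have live: "al ?i" using assms by (simp add: ch_live_def)
  let ?S = "{t. ww s t \<noteq> 0}"
  have inj: "inj_on ?x ?S" by (auto simp: inj_on_def)
  have sub: "?x ` ?S \<subseteq> {..<?i}" using ww[OF assms] by (auto intro!: pr_less dest: less_imp_le)
  have "(\<Sum>j<?i. of_nat (w ?i j) * monom (1::int) j) = (\<Sum>j\<in>?x ` ?S. of_nat (w ?i j) * monom (1::int) j)"
  proof (rule sum.mono_neutral_right[OF _ sub])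
    show "\<forall>j\<in>{..<?i} - ?x ` ?S. of_nat (w ?i j) * monom (1::int) j = 0"
    proof
      fix j assume j: "j \<in> {..<?i} - ?x ` ?S"
      have "w ?i j = 0"
      proof (rule ccontr)
        assume "w ?i j \<noteq> 0"
        then have *: "p2 j = pr 0 0" "ww s (p1 j) \<noteq> 0" by (auto simp: ch_rel_def split: if_splits)
        have "j = ?x (p1 j)" using pr_p1_p2[of j] *(1) by simp
        moreover have "p1 j \<in> ?S" using *(2) by simp
        ultimately show False using j by blast
      qed
      then show "of_nat (w ?i j) * monom (1::int) j = 0" by simp
    qed
  qed simp
  also have "\<dots> = (\<Sum>t\<in>?S. of_nat (ww s t) * X t)"
    unfolding sum.reindex[OF inj] by (intro sum.cong) (auto simp: ch_rel_def)
  finally show ?thesis using rels_live[of al ?i p w] live by simp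
qed

text \<open>The subgroup generated by the elements \<open>X\<close> of infinite nodes, a candidate
  for the elements of infinite height.\<close>

definition G :: "int poly set" where
  "G = {v. \<exists>I g. finite I \<and> I \<subseteq> {s. inf_node s} \<and> v - (\<Sum>s\<in>I. of_int (g s) * X s) \<in> R}"

lemma G: "subgrp G" unfolding G_def by (rule subgrp_combinations[OF R])

lemma R_G: "v \<in> R \<Longrightarrow> v \<in> G"
  unfolding G_def by (auto intro!: exI[of _ "{}"])

lemma X_G: "inf_node s \<Longrightarrow> X s \<in> G"
  unfolding G_def using subgrp_zero[OF R] by (auto intro!: exI[of _ "{s}"] exI[of _ "\<lambda>_. 1"])

text \<open>Along the infinitely many chains of an infinite node \<open>Q\<close> is injective,
  hence unbounded, so \<open>X\<close> has roots of arbitrarily large \<open>p\<close>-power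
  order.\<close>

lemma G_pdivw: "v \<in> G \<Longrightarrow> v \<in> pdivw p R"
proof -
  have X: "X s \<in> pdivw p R" if s: "inf_node s" for s
    unfolding pdivw_def
  proof
    fix k
    let ?M = "{c. Ch c \<and> fs c = s}"
    have "infinite ?M" using s tr_def by (auto simp: inf_node_def)
    moreover have "inj_on Q ?M"
    proof (rule inj_onI)
      fix c c' assume c: "c \<in> ?M" "c' \<in> ?M" "Q c = Q c'"
      then show "c = c'" using Q_mono[of c c'] Q_mono[of c' c] by (cases c c' rule: linorder_cases) auto
    qed
    ultimately have "infinite (Q ` ?M)" by (simp add: finite_image_iff)
    then obtain c where c: "Ch c" "fs c = s" "Q c \<ge> k" unfolding infinite_nat_iff_unbounded_le by auto
    have "of_nat p ^ L c * B c \<in> pdiv p R (L c)" by (rule power_in_pdiv[OF R])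
    then have "X s \<in> pdiv p R (L c)"
      using subgrp_diff_cancel[OF subgrp_pdiv[OF R] subset_pdiv[OF R rel_power_X[OF c(1)]]] c(2) by simp
    then show "X s \<in> pdiv p R k" using c(3) by (intro pdiv_antimono[OF R, of k "L c"]) (auto simp: L_def)
  qed
  assume "v \<in> G"
  then obtain I g where I: "finite I" "I \<subseteq> {s. inf_node s}" "v - (\<Sum>s\<in>I. of_int (g s) * X s) \<in> R"
    unfolding G_def by blast
  note W = subgrp_pdivw[OF R, of p]
  have "(\<Sum>s\<in>I. of_int (g s) * X s) \<in> pdivw p R"
    using I(2) X by (intro subgrp_sum[OF W] subgrp_of_int_mult[OF W]) auto
  then show ?thesis using subgrp_diff_cancel[OF W subset_pdivw[OF R I(3)]] by blast
qed

text \<open>The top \<open>B c\<close> corrected so that its order modulo \<open>G\<close> becomes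
  \<open>p ^ Suc (Q c)\<close>. For a non-last chain of a finite node, both
  \<open>p ^ L c * B c\<close> and the corresponding multiple of the last top equal
  \<open>X\<close>, so a multiple of the last top is subtracted. For the last chain,
  \<open>p ^ Suc (Q c) * B c\<close> equals \<open>p X\<close>, a combination of other
  \<open>X t\<close>. Those with \<open>t\<close> infinite lie in \<open>G\<close>, the others are
  multiples of \<open>B (last t)\<close> by a power of \<open>p\<close> with exponent at least
  \<open>Suc (Q c)\<close>.\<close>

definition bt :: "nat \<Rightarrow> int poly" where
  "bt c = (if tr (fs c) then B c
    else if c = last (fs c) then
      B c - (\<Sum>t | ww (fs c) t \<noteq> 0 \<and> \<not> tr t. of_nat (ww (fs c) t) * (of_nat p ^ (L (last t) - Suc (Q c)) * B (last t)))
    else B c - of_nat p ^ (L (last (fs c)) - L c) * B (last (fs c)))"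

section \<open>The corrected tops: orders and generation\<close>

lemma ww_finite: assumes "Ch s" "fs s = s" shows "finite {t. ww s t \<noteq> 0 \<and> P t}"
proof (rule finite_subset)
  show "{t. ww s t \<noteq> 0 \<and> P t} \<subseteq> {..<s}"
  proof
    fix t assume "t \<in> {t. ww s t \<noteq> 0 \<and> P t}"
    then show "t \<in> {..<s}" using ww[OF assms, of t] by simp
  qed
qed simp

lemma ww_fin_node:
  assumes s: "fin_node s" and t: "ww s t \<noteq> 0" "\<not> tr t"
  shows "fin_node t \<and> t < s \<and> Q (last s) < Q (last t)"
proof -
  have "Ch s" "fs s = s" using s unfolding fin_node_def by blast+
  from ww[OF this t(1)] ww_false[OF this t] show ?thesis unfolding fin_node_def using t(2) by blast
qed

lemma bt_order: assumes c: "Ch c" shows "of_nat p ^ Suc (Q c) * bt c \<in> G"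
proof (cases "tr (fs c)")
  case True
  then have "inf_node (fs c)" using node_cases[OF c] by blast
  moreover have "of_nat p ^ Suc (Q c) * bt c - X (fs c) \<in> G"
    using R_G[OF rel_power_X[OF c]] L_not_last[OF c] True by (simp add: bt_def)
  ultimately show ?thesis using subgrp_diff_cancel[OF G] X_G by blast
next
  case False
  then have s: "fin_node (fs c)" using node_cases[OF c] by blast
  let ?s = "fs c" and ?l = "last (fs c)"
  note l = last_in[OF s]
  have Ll: "L ?l = Q ?l" using L_last[OF s] .
  show ?thesis
  proof (cases "c = ?l")
    case True
    let ?T = "{t. ww ?s t \<noteq> 0}" and ?F = "{t. ww ?s t \<noteq> 0 \<and> \<not> tr t}"
    have fin: "finite ?T" "finite ?F" using ww_finite[of ?s "\<lambda>_. True"] ww_finite[of ?s] s by (auto simp: fin_node_def)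
    have LQ: "L c = Q c" using Ll True by simp
    have XG: "of_nat p ^ Suc (Q c) * B c - (\<Sum>t\<in>?T. of_nat (ww ?s t) * X t) \<in> G"
    proof -
      have "of_nat p * (of_nat p ^ L c * B c - X ?s) \<in> R"
        by (intro subgrp_of_nat_mult[OF R] rel_power_X[OF c])
      moreover have "of_nat p * X ?s - (\<Sum>t\<in>?T. of_nat (ww ?s t) * X t) \<in> R"
        using rel_X[of ?s] s by (simp add: fin_node_def)
      ultimately have "of_nat p * (of_nat p ^ L c * B c - X ?s) + (of_nat p * X ?s - (\<Sum>t\<in>?T. of_nat (ww ?s t) * X t)) \<in> R"
        by (rule subgrp_add[OF R])
      then show ?thesis using R_G LQ by (simp add: algebra_simps)
    qed
    have G1: "(\<Sum>t\<in>?T - ?F. of_nat (ww ?s t) * X t) \<in> G"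
    proof (rule subgrp_sum[OF G], rule subgrp_of_nat_mult[OF G], rule X_G)
      fix t assume "t \<in> ?T - ?F"
      then have "ww ?s t \<noteq> 0" "tr t" by auto
      then show "inf_node t" using ww[of ?s t] s by (simp add: fin_node_def inf_node_def)
    qed
    have G2: "(\<Sum>t\<in>?F. of_nat (ww ?s t) * (X t - of_nat p ^ L (last t) * B (last t))) \<in> G"
    proof (rule subgrp_sum[OF G], rule subgrp_of_nat_mult[OF G])
      fix t assume "t \<in> ?F"
      then have t: "fin_node t" using ww_fin_node[OF s] by blast
      show "X t - of_nat p ^ L (last t) * B (last t) \<in> G"
        using subgrp_uminus[OF G R_G[OF rel_power_X[OF last_in(1)[OF t]]]] last_in(2)[OF t] by simp
    qed
    have split: "(\<Sum>t\<in>?T. of_nat (ww ?s t) * X t) =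
        (\<Sum>t\<in>?T - ?F. of_nat (ww ?s t) * X t) + (\<Sum>t\<in>?F. of_nat (ww ?s t) * X t)"
      using fin by (intro sum.subset_diff) auto
    have "of_nat p ^ Suc (Q c) * B c - (\<Sum>t\<in>?F. of_nat (ww ?s t) * (of_nat p ^ L (last t) * B (last t))) \<in> G"
      using subgrp_add[OF G subgrp_add[OF G XG G1] G2]
      unfolding split right_diff_distrib sum_subtractf by (simp add: algebra_simps)
    moreover have "of_nat p ^ Suc (Q c) * (of_nat (ww ?s t) * (of_nat p ^ (L (last t) - Suc (Q c)) * B (last t)))
        = of_nat (ww ?s t) * (of_nat p ^ L (last t) * B (last t))" if t: "t \<in> ?F" for t
    proof -
      have "fin_node t" "Q ?l < Q (last t)" using ww_fin_node[OF s] t by blast+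
      then have "Suc (Q c) \<le> L (last t)" using True L_last by simp
      then have "(of_nat p :: int poly) ^ L (last t) = of_nat p ^ Suc (Q c) * of_nat p ^ (L (last t) - Suc (Q c))"
        unfolding power_add[symmetric] by simp
      then show ?thesis by (simp add: ac_simps)
    qed
    then have "of_nat p ^ Suc (Q c) * (\<Sum>t\<in>?F. of_nat (ww ?s t) * (of_nat p ^ (L (last t) - Suc (Q c)) * B (last t)))
        = (\<Sum>t\<in>?F. of_nat (ww ?s t) * (of_nat p ^ L (last t) * B (last t)))"
      unfolding sum_distrib_left by (intro sum.cong) auto
    ultimately show ?thesis using False True by (simp add: bt_def right_diff_distrib)
  next
    case ne: False
    have "c < ?l" using l(3)[OF c] ne by simp
    then have "Q c < Q ?l" using Q_mono[OF c l(1)] l(2) by simp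
    moreover have Lc: "L c = Suc (Q c)" using L_not_last[OF c] ne by simp
    ultimately have "(of_nat p :: int poly) ^ L ?l = of_nat p ^ L c * of_nat p ^ (L ?l - L c)"
      unfolding power_add[symmetric] using Ll by simp
    moreover have "(of_nat p ^ L c * B c - X ?s) - (of_nat p ^ L ?l * B ?l - X ?s) \<in> R"
      using subgrp_diff[OF R rel_power_X[OF c] rel_power_X[OF l(1)]] l(2) by simp
    ultimately have "of_nat p ^ L c * (B c - of_nat p ^ (L ?l - L c) * B ?l) \<in> R" by (simp add: algebra_simps)
    then show ?thesis using R_G False ne Lc by (simp add: bt_def)
  qed
qed

text \<open>The corrections to last chains involve only last tops of smaller nodes, so these tops
  are recovered by induction over nodes; all other tops follow from the last one of their
  node.\<close>

lemma bt_span: "\<exists>I f. finite I \<and> I \<subseteq> {c. Ch c} \<and> v - (\<Sum>c\<in>I. of_int (f c) * bt c) \<in> G"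
proof -
  define Sp where "Sp = {v. \<exists>I f. finite I \<and> I \<subseteq> {c. Ch c} \<and> v - (\<Sum>c\<in>I. of_int (f c) * bt c) \<in> G}"
  have S: "subgrp Sp" unfolding Sp_def by (rule subgrp_combinations[OF G])
  have GS: "v \<in> Sp" if "v \<in> G" for v using that unfolding Sp_def by (auto intro!: exI[of _ "{}"])
  have btS: "bt c \<in> Sp" if "Ch c" for c
    unfolding Sp_def using that subgrp_zero[OF G] by (auto intro!: exI[of _ "{c}"] exI[of _ "\<lambda>_. 1"])
  have last: "B (last s) \<in> Sp" if "fin_node s" for s
    using that
  proof (induction s rule: less_induct)
    case (less s)
    note l = last_in[OF less.prems]
    let ?Z = "\<Sum>t | ww s t \<noteq> 0 \<and> \<not> tr t. of_nat (ww s t) * (of_nat p ^ (L (last t) - Suc (Q (last s))) * B (last t))"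
    have z: "?Z \<in> Sp"
    proof (rule subgrp_sum[OF S], rule subgrp_of_nat_mult[OF S], rule subgrp_power_mult[OF S])
      fix t assume "t \<in> {t. ww s t \<noteq> 0 \<and> \<not> tr t}"
      then have "fin_node t" "t < s" using ww_fin_node[OF less.prems, of t] by simp_all
      then show "B (last t) \<in> Sp" using less.IH[of t] by simp
    qed
    have b: "bt (last s) = B (last s) - ?Z" using l(2) less.prems by (simp add: bt_def fin_node_def)
    have "bt (last s) + ?Z \<in> Sp" by (rule subgrp_add[OF S btS[OF l(1)] z])
    then show ?case unfolding b by (simp only: diff_add_cancel)
  qed
  have BS: "B c \<in> Sp" if c: "Ch c" for c
  proof (cases "tr (fs c)")
    case True
    then show ?thesis using btS[OF c] by (simp add: bt_def)
  next
    case False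
    then have s: "fin_node (fs c)" using node_cases[OF c] by blast
    show ?thesis
    proof (cases "c = last (fs c)")
      case True
      show ?thesis by (subst True) (rule last[OF s])
    next
      case ne: False
      have "bt c + of_nat p ^ (L (last (fs c)) - L c) * B (last (fs c)) \<in> Sp"
        by (rule subgrp_add[OF S btS[OF c] subgrp_power_mult[OF S last[OF s]]])
      moreover have "bt c + of_nat p ^ (L (last (fs c)) - L c) * B (last (fs c)) = B c"
        using False ne by (simp add: bt_def)
      ultimately show ?thesis by (simp only:)
    qed
  qed
  have "monom 1 i \<in> Sp" for i
  proof (cases "al i")
    case True
    let ?c = "p1 i" and ?l = "p1 (p2 i)"
    note g = live_gi[OF True]
    have "of_nat p ^ (L ?c - ?l) * B ?c - monom 1 i \<in> Sp"
      using rel_power[OF g(1), of "L ?c - ?l"] g(2,3) R_G by (intro GS) simp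
    then show ?thesis using subgrp_diff_cancel[OF S] subgrp_power_mult[OF S BS[OF g(1)]] by blast
  next
    case False
    then show ?thesis using GS R_G rels_dead by blast
  qed
  from subgrp_UNIV[OF S this, of v] show ?thesis unfolding Sp_def mem_Collect_eq .
qed

text \<open>Blocks for a second ordering of the generators: at the bottom the elements
  \<open>X\<close> of infinite nodes, then each finite node together with its last chain, then every
  other chain by itself. All relations point downwards in it, and \<open>bt c - B c\<close> lives
  strictly below the block of \<open>c\<close>.\<close>

definition blk :: "nat \<Rightarrow> nat \<times> nat" where
  "blk c = (if \<not> tr (fs c) \<and> c = last (fs c) then (1, fs c) else (2, c))"

definition rk :: "nat \<Rightarrow> nat \<times> nat \<times> nat" where
  "rk i = (if p1 (p2 i) = 0 then (if tr (p1 i) then 0 else 1, p1 i, 0)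
    else (fst (blk (p1 i)), snd (blk (p1 i)), p1 (p2 i)))"

section \<open>Independence of the corrected tops by leading coefficients\<close>

lemma blk_inj: assumes "blk c = blk c'" shows "c = c'"
proof -
  define q where "q c \<longleftrightarrow> \<not> tr (fs c) \<and> c = last (fs c)" for c
  have b: "blk c = (if q c then (1, fs c) else (2, c))" for c unfolding blk_def q_def by (rule refl)
  consider "q c" "q c'" "fs c = fs c'" | "c = c'" using assms unfolding b by (auto split: if_splits)
  then show ?thesis
  proof cases
    case 1
    then have "c = last (fs c)" "c' = last (fs c)" by (simp_all only: q_def)
    then show ?thesis by (rule trans[OF _ sym])
  qed
qed

lemma rk_gi:
  assumes "Ch c" "l \<le> L c" "l \<noteq> 0 \<or> \<not> tr (fs c) \<and> c = last (fs c)"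
  shows "rk (gi c l) = (fst (blk c), snd (blk c), l)"
proof (cases "l = 0")
  case True
  then have "\<not> tr (fs c)" "blk c = (1, fs c)" using assms(3) by (simp_all add: blk_def)
  then show ?thesis using True by (simp add: rk_def gi_def)
next
  case False
  then show ?thesis by (simp add: rk_def gi_def)
qed

lemma rk_inj: "inj_on rk {i. al i}"
proof (rule inj_onI, unfold mem_Collect_eq)
  fix i j assume ij: "al i" "al j" "rk i = rk j"
  note gi = live_gi[OF ij(1)] and gj = live_gi[OF ij(2)]
  have "p1 (p2 i) = p1 (p2 j)" using ij(3) by (auto simp: rk_def split: if_splits)
  moreover have "p1 i = p1 j"
  proof (cases "p1 (p2 i) = 0")
    case True
    then show ?thesis using ij(3) calculation by (auto simp: rk_def)
  next
    case False
    then have "blk (p1 i) = blk (p1 j)" using ij(3) calculation by (auto simp: rk_def prod_eq_iff)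
    then show ?thesis using blk_inj by blast
  qed
  ultimately show "i = j" using gi(3) gj(3) by metis
qed

lemma rk_low:
  assumes "al i" "al j" "w i j \<noteq> 0" shows "rk j < rk i"
proof -
  note gi = live_gi[OF assms(1)] and gj = live_gi[OF assms(2)]
  consider "p1 (p2 i) = 0" | "p1 (p2 i) = 1" | "p1 (p2 i) > 1" by linarith
  then show ?thesis
  proof cases
    case 1
    then have j: "p2 j = pr 0 0" "ww (p1 i) (p1 j) \<noteq> 0" using assms(3) by (auto simp: ch_rel_def split: if_splits)
    have i: "Ch (p1 i)" "fs (p1 i) = p1 i" using assms(1) 1 by (auto simp: ch_live_def)
    have "p1 j < p1 i" "\<not> tr (p1 j) \<Longrightarrow> \<not> tr (p1 i)" using ww[OF i j(2)] ww_false[OF i j(2)] by auto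
    then show ?thesis using 1 j(1) by (auto simp: rk_def)
  next
    case 2
    then have j: "j = pr (fs (p1 i)) (pr 0 0)" using assms(3) by (auto simp: ch_rel_def split: if_splits)
    show ?thesis unfolding rk_def j using 2 by (auto simp: blk_def)
  next
    case 3
    then have j: "p1 j = p1 i" "p1 (p2 j) = p1 (p2 i) - 1" using assms(3) by (auto simp: ch_rel_def split: if_splits)
    then show ?thesis using 3 by (auto simp: rk_def)
  qed
qed

definition low :: "nat \<times> nat \<Rightarrow> int poly set" where
  "low b = {v. \<forall>j. al j \<longrightarrow> (fst b, snd b, 0) \<le> rk j \<longrightarrow> coeff v j = 0}"

lemma subgrp_low: "subgrp (low b)"
  by (auto simp: subgrp_def low_def)

lemma monom_low: "rk i < (fst b, snd b, 0) \<Longrightarrow> monom 1 i \<in> low b"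
  by (auto simp: low_def)

lemma B_low:
  assumes "Ch c" "blk c < b" shows "B c \<in> low b"
proof -
  have "rk (gi c (L c)) = (fst (blk c), snd (blk c), L c)"
  proof (rule rk_gi[OF assms(1) order_refl])
    show "L c \<noteq> 0 \<or> \<not> tr (fs c) \<and> c = last (fs c)"
      using L_not_last[OF assms(1)] by (cases "tr (fs c) \<or> c \<noteq> last (fs c)") simp_all
  qed
  then have "rk (gi c (L c)) < (fst b, snd b, 0)" using assms(2) by (auto simp: less_prod_def)
  then show ?thesis unfolding B_def by (rule monom_low)
qed

lemma bt_B_low: assumes c: "Ch c" shows "bt c - B c \<in> low (blk c)"
proof (cases "tr (fs c)")
  case True
  then show ?thesis using subgrp_zero[OF subgrp_low] by (simp add: bt_def)
next
  case False
  note low = subgrp_low[of "blk c"]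
  have s: "fin_node (fs c)" using node_cases[OF c] False by blast
  show ?thesis
  proof (cases "c = last (fs c)")
    case True
    have "B (last t) \<in> low (blk c)" if t: "ww (fs c) t \<noteq> 0" "\<not> tr t" for t
    proof -
      have f: "fin_node t" "t < fs c" using ww_fin_node[OF s] t by blast+
      have "blk (last t) = (1, t)" using last_in[OF f(1)] f(1) by (simp add: blk_def fin_node_def)
      moreover have "blk c = (1, fs c)" using True False by (simp add: blk_def)
      ultimately show ?thesis using f(2) by (intro B_low last_in(1)[OF f(1)]) simp
    qed
    then have "(\<Sum>t | ww (fs c) t \<noteq> 0 \<and> \<not> tr t. of_nat (ww (fs c) t) * (of_nat p ^ (L (last t) - Suc (Q c)) * B (last t))) \<in> low (blk c)"
      by (intro subgrp_sum[OF low] subgrp_of_nat_mult[OF low] subgrp_power_mult[OF low]) blast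
    then show ?thesis using subgrp_uminus[OF low] False True by (simp add: bt_def)
  next
    case ne: False
    have "blk (last (fs c)) = (1, fs c)" using last_in[OF s] False by (simp add: blk_def)
    moreover have "blk c = (2, c)" using ne by (simp add: blk_def)
    ultimately have "B (last (fs c)) \<in> low (blk c)" by (intro B_low last_in(1)[OF s]) simp
    then show ?thesis using subgrp_uminus[OF low subgrp_power_mult[OF low]] False ne by (simp add: bt_def)
  qed
qed

lemma bt_low: "Ch c \<Longrightarrow> blk c < b \<Longrightarrow> bt c \<in> low b"
proof -
  assume c: "Ch c" "blk c < b"
  have "v \<in> low b" if "v \<in> low (blk c)" for v
  proof -
    have "(fst (blk c), snd (blk c), 0) \<le> rk j" if "(fst b, snd b, 0) \<le> rk j" for j
      using that c(2) by (cases "rk j"; cases b; cases "blk c") (auto simp: less_eq_prod_def less_prod_def)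
    then show ?thesis using that by (auto simp: low_def)
  qed
  then have "(bt c - B c) + B c \<in> low b"
    using bt_B_low[OF c(1)] B_low[OF c] by (intro subgrp_add[OF subgrp_low])
  then show ?thesis by simp
qed

text \<open>Of the coefficients violating divisibility take the one in the highest block and write
  it as \<open>p ^ a * m\<close> with \<open>m\<close> prime to \<open>p\<close>. Then
  \<open>p ^ a\<close> times the top is a single live generator, whose coefficient \<open>m\<close>
  would be leading in a relation; but leading coefficients are multiples of
  \<open>p\<close>.\<close>

lemma bt_indep:
  assumes I: "finite I" "I \<subseteq> {c. Ch c}" and s: "(\<Sum>c\<in>I. of_int (f c) * bt c) \<in> G" and c: "c \<in> I"
  shows "int p ^ Suc (Q c) dvd f c"
proof (rule ccontr)
  assume neg: "\<not> ?thesis"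
  let ?bad = "{c \<in> I. \<not> int p ^ Suc (Q c) dvd f c}"
  have fin: "finite ?bad" using I(1) by simp
  have ne: "?bad \<noteq> {}" using neg c by blast
  obtain d where d: "d \<in> ?bad" "\<And>c. c \<in> ?bad \<Longrightarrow> blk c \<le> blk d"
  proof -
    have "Max (blk ` ?bad) \<in> blk ` ?bad" using fin ne by (intro Max_in) auto
    then obtain d where "d \<in> ?bad" "blk d = Max (blk ` ?bad)" by (metis (no_types, lifting) imageE)
    then show ?thesis using that[of d] fin by simp
  qed
  have Chd: "Ch d" using d(1) I(2) by blast
  have good: "(\<Sum>c\<in>I - ?bad. of_int (f c) * bt c) \<in> G"
  proof (rule subgrp_sum[OF G])
    fix c assume "c \<in> I - ?bad"
    then have c: "Ch c" and "int p ^ Suc (Q c) dvd f c" using I(2) by auto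
    then obtain q where "f c = int p ^ Suc (Q c) * q" unfolding dvd_def by blast
    then have *: "of_int (f c) * bt c = of_int q * (of_nat p ^ Suc (Q c) * bt c)" by (simp add: ac_simps)
    show "of_int (f c) * bt c \<in> G" unfolding * by (rule subgrp_of_int_mult[OF G bt_order[OF c]])
  qed
  have split: "(\<Sum>c\<in>I. of_int (f c) * bt c) = (\<Sum>c\<in>I - ?bad. of_int (f c) * bt c) + (\<Sum>c\<in>?bad. of_int (f c) * bt c)"
    using I(1) by (intro sum.subset_diff) auto
  have "(\<Sum>c\<in>?bad. of_int (f c) * bt c) \<in> G" using s unfolding split subgrp_add_cancel[OF G good] .
  then obtain K g where K: "finite K" "K \<subseteq> {s. inf_node s}"
    "(\<Sum>c\<in>?bad. of_int (f c) * bt c) - (\<Sum>s\<in>K. of_int (g s) * X s) \<in> R" unfolding G_def by blast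
  obtain a m where am: "f d = int p ^ a * m" "\<not> int p dvd m" "a \<le> Q d"
  proof -
    have "f d \<noteq> 0" using d(1) by auto
    moreover have "\<not> is_unit (int p)" using prime_gt_1_nat[OF p] by simp
    ultimately obtain m where m: "f d = int p ^ multiplicity (int p) (f d) * m" "\<not> int p dvd m"
      by (rule multiplicity_decompose')
    have "multiplicity (int p) (f d) \<le> Q d"
    proof (rule ccontr)
      assume "\<not> ?thesis"
      then have "int p ^ Suc (Q d) dvd f d" by (intro multiplicity_dvd') simp
      then show False using d(1) by simp
    qed
    then show ?thesis using that m by blast
  qed
  have aL: "a \<le> L d" using am(3) by (simp add: L_def)
  \<comment> \<open>The level \<open>L d - a\<close> stays inside the block of \<open>d\<close>. For
    \<open>a \<le> Q d\<close> it is positive unless \<open>d\<close> is the last chain of a finite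
    node, and then level 0 belongs to the block as well.\<close>
  let ?e = "gi d (L d - a)"
  have live: "al ?e" by (rule gi_live[OF Chd]) simp
  have rke: "rk ?e = (fst (blk d), snd (blk d), L d - a)"
  proof (rule rk_gi[OF Chd])
    show "L d - a \<noteq> 0 \<or> \<not> tr (fs d) \<and> d = last (fs d)"
      using L_not_last[OF Chd] am(3) by (cases "tr (fs d) \<or> d \<noteq> last (fs d)") simp_all
  qed simp
  define u where "u = (\<Sum>c\<in>?bad - {d}. of_int (f c) * bt c) + of_int (f d) * (bt d - B d) - (\<Sum>s\<in>K. of_int (g s) * X s)"
  have sum_bad: "(\<Sum>c\<in>?bad. of_int (f c) * bt c) = of_int (f d) * bt d + (\<Sum>c\<in>?bad - {d}. of_int (f c) * bt c)"
    by (rule sum.remove[OF fin d(1)])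
  have "(\<Sum>c\<in>?bad. of_int (f c) * bt c) - (\<Sum>s\<in>K. of_int (g s) * X s) - of_int m * (of_nat p ^ a * B d - monom 1 ?e) \<in> R"
    by (intro subgrp_diff[OF R K(3)] subgrp_of_int_mult[OF R] rel_power[OF Chd aL])
  then have uR: "u + of_int m * monom 1 ?e \<in> R" unfolding sum_bad u_def using am(1) by (simp add: algebra_simps)
  have "u \<in> low (blk d)"
  proof -
    note low = subgrp_low[of "blk d"]
    have "(\<Sum>c\<in>?bad - {d}. of_int (f c) * bt c) \<in> low (blk d)"
    proof (intro subgrp_sum[OF low] subgrp_of_int_mult[OF low] bt_low)
      fix c assume c: "c \<in> ?bad - {d}"
      then show Chc: "Ch c" using I(2) by blast
      show "blk c < blk d" using d(2)[of c] blk_inj[of c d] c by (auto simp: order.strict_iff_order)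
    qed
    moreover have "(\<Sum>s\<in>K. of_int (g s) * X s) \<in> low (blk d)"
    proof (intro subgrp_sum[OF low] subgrp_of_int_mult[OF low] monom_low)
      fix s assume "s \<in> K"
      then have "tr s" using K(2) by (auto simp: inf_node_def)
      then show "rk (pr s (pr 0 0)) < (fst (blk d), snd (blk d), 0)" by (simp add: rk_def blk_def)
    qed
    ultimately show ?thesis unfolding u_def
      by (intro subgrp_diff[OF low] subgrp_add[OF low] subgrp_of_int_mult[OF low] bt_B_low[OF Chd])
  qed
  moreover have le: "(fst (blk d), snd (blk d), 0) \<le> rk ?e" unfolding rke by (simp add: less_eq_prod_def)
  ultimately have u0: "coeff u j = 0" if "al j" "rk ?e \<le> rk j" for j
    using that(1) order_trans[OF le that(2)] unfolding low_def by blast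
  have "int p dvd coeff (u + of_int m * monom 1 ?e) ?e"
  proof (rule rels_triangular[where rk = rk, OF rk_inj _ uR live _ p0])
    show "rk j < rk i" if "al i" "al j" "w i j \<noteq> 0" for i j using rk_low that by blast
    show "coeff (u + of_int m * monom 1 ?e) j = 0" if "al j" "rk ?e < rk j" for j
    proof -
      have "j \<noteq> ?e" using that(2) by auto
      then show ?thesis using u0[OF that(1)] that(2) by simp
    qed
  qed
  then show False using u0[OF live] am(2) by simp
qed

text \<open>The exponent \<open>Suc (Q c)\<close> means that the chains with \<open>Q c = k\<close>
  account for the \<open>k\<close>-th Ulm invariant.\<close>

sublocale basis_over p R G "{c. Ch c}" bt "\<lambda>c. Suc (Q c)"
proof (rule basis_over.intro)
  show "prime p" "subgrp R" "subgrp G" by (rule p R G)+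
  show "R \<subseteq> G" by (rule subsetI) (rule R_G)
  show "G \<subseteq> pdivw p R" by (rule subsetI) (rule G_pdivw)
  show "of_nat p ^ Suc (Q c) * bt c \<in> G" if "c \<in> {c. Ch c}" for c using bt_order that by simp
  show "\<exists>I f. finite I \<and> I \<subseteq> {c. Ch c} \<and> v - (\<Sum>c\<in>I. of_int (f c) * bt c) \<in> G" for v by (rule bt_span)
  show "int p ^ Suc (Q c) dvd f c"
    if "finite I" "I \<subseteq> {c. Ch c}" "(\<Sum>c\<in>I. of_int (f c) * bt c) \<in> G" "c \<in> I" for I f c
    by (rule bt_indep[OF that])
qed

end

subsection \<open>Presentations of structures\<close>

text \<open>A surjective homomorphism from the free abelian group onto \<open>A\<close> with kernel
  \<open>R\<close>. All group theory is done with \<open>R\<close>; two structures presented by the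
  same \<open>R\<close> are isomorphic.\<close>

definition presents :: "(int poly \<Rightarrow> nat) \<Rightarrow> struc \<Rightarrow> int poly set \<Rightarrow> bool" where
  "presents f A R \<longleftrightarrow> range f = univ A \<and> (\<forall>u v. f (u + v) = plus A (f u) (f v)) \<and>
    (\<forall>u v. f u = f v \<longleftrightarrow> u - v \<in> R)"

lemma presents_subgrp: "presents f A R \<Longrightarrow> subgrp R"
proof -
  assume f: "presents f A R"
  then have eq: "\<And>u v. f u = f v \<longleftrightarrow> u - v \<in> R" by (simp add: presents_def)
  have "0 \<in> R" using eq[of 0 0] by simp
  moreover have "a - b \<in> R" if "a \<in> R" "b \<in> R" for a b
    using that eq[of a 0] eq[of b 0] eq[of a b] by simp
  ultimately show ?thesis by (simp add: subgrp_def)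
qed

lemma presents_one:
  assumes "presents f A R" shows "\<one>\<^bsub>grp A\<^esub> = f 0"
proof -
  have add: "\<And>u v. f (u + v) = plus A (f u) (f v)" and ran: "univ A = range f" using assms by (auto simp: presents_def)
  have "(THE e. e \<in> univ A \<and> (\<forall>x\<in>univ A. plus A e x = x)) = f 0"
  proof (rule the_equality)
    show "f 0 \<in> univ A \<and> (\<forall>x\<in>univ A. plus A (f 0) x = x)" unfolding ran by (auto simp flip: add)
    fix e assume e: "e \<in> univ A \<and> (\<forall>x\<in>univ A. plus A e x = x)"
    then obtain u where u: "e = f u" unfolding ran by blast
    then show "e = f 0" using e add[of u 0] unfolding ran by auto
  qed
  then show ?thesis by (simp add: grp_def)
qed

lemma presents_pow:
  assumes "presents f A R" shows "f v [^]\<^bsub>grp A\<^esub> n = f (of_nat n * v)"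
proof -
  have add: "\<And>u v. f (u + v) = plus A (f u) (f v)" using assms by (auto simp: presents_def)
  show ?thesis
  proof (induction n)
    case 0
    then show ?case using presents_one[OF assms] by (simp add: nat_pow_def)
  next
    case (Suc n)
    have "f v [^]\<^bsub>grp A\<^esub> Suc n = plus A (f v [^]\<^bsub>grp A\<^esub> n) (f v)" by (simp add: nat_pow_def grp_def)
    then show ?case unfolding Suc add[symmetric] by (simp add: algebra_simps)
  qed
qed

section \<open>Ulm subgroups at multiples of \<omega>, on representatives\<close>

primrec uw :: "nat \<Rightarrow> int poly set \<Rightarrow> nat \<Rightarrow> int poly set" where
  "uw p R 0 = UNIV"
| "uw p R (Suc k) = {v. \<forall>n. \<exists>y\<in>uw p R k. v - of_nat p ^ n * y \<in> R}"

text \<open>The Ulm subgroup at \<omega>\<open>k\<close> is \<open>p\<close>-divisible, the negation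
  of having length greater than \<omega>\<open>k\<close>. Being a property of the relations alone,
  it is easy to carry through constructions and isomorphisms.\<close>

definition pfix :: "nat \<Rightarrow> int poly set \<Rightarrow> nat \<Rightarrow> bool" where
  "pfix p R k \<longleftrightarrow> (\<forall>v\<in>uw p R k. \<exists>y\<in>uw p R k. v - of_nat p * y \<in> R)"

lemma uw_Suc_0: "uw p R (Suc 0) = pdivw p R"
  by (auto simp: pdivw_def pdiv_def)

lemma subgrp_uw: assumes R: "subgrp R" shows "subgrp (uw p R k)"
proof (induction k)
  case 0 then show ?case by (simp add: subgrp_def)
next
  case (Suc k)
  show ?case unfolding subgrp_def
  proof (intro conjI ballI)
    show "0 \<in> uw p R (Suc k)" using subgrp_zero[OF Suc] subgrp_zero[OF R] by (auto intro!: bexI[of _ 0])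
    fix a b assume ab: "a \<in> uw p R (Suc k)" "b \<in> uw p R (Suc k)"
    have "\<exists>z\<in>uw p R k. a - b - of_nat p ^ n * z \<in> R" for n
    proof -
      obtain x y where xy: "x \<in> uw p R k" "y \<in> uw p R k" "a - of_nat p ^ n * x \<in> R" "b - of_nat p ^ n * y \<in> R"
        using ab by (auto dest!: spec[of _ n])
      then show ?thesis using subgrp_diff[OF Suc xy(1,2)] subgrp_diff[OF R xy(3,4)]
        by (intro bexI[of _ "x - y"]) (simp_all add: algebra_simps)
    qed
    then show "a - b \<in> uw p R (Suc k)" by simp
  qed
qed

lemma uw_sat: assumes R: "subgrp R" and uv: "u - v \<in> R" shows "u \<in> uw p R k \<longleftrightarrow> v \<in> uw p R k"
proof (cases k)
  case (Suc j)
  have "u - x \<in> R \<longleftrightarrow> v - x \<in> R" for x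
    using subgrp_add_cancel[OF R uv, of "v - x"] by (simp add: algebra_simps)
  then show ?thesis using Suc by simp
qed simp

lemma pmul_presents:
  assumes "presents f A R" shows "pmul p A (f ` X) = f ` ((*) (of_nat p) ` X)"
  unfolding pmul_def using presents_pow[OF assms] by (auto simp: image_image)

lemma funpow_pmul_presents:
  assumes "presents f A R" shows "(pmul p A ^^ n) (f ` X) = f ` ((*) (of_nat p ^ n) ` X)"
proof (induction n)
  case (Suc n)
  have "(pmul p A ^^ Suc n) (f ` X) = pmul p A (f ` ((*) (of_nat p ^ n) ` X))" using Suc by simp
  then show ?case unfolding pmul_presents[OF assms] by (simp add: image_image mult.assoc)
qed simp

lemma ulm_omega_presents:
  assumes f: "presents f A R" shows "ulm_omega p A k = f ` uw p R k"
proof (induction k)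
  case 0 then show ?case using f by (simp add: presents_def)
next
  case (Suc k)
  have eq: "\<And>u v. f u = f v \<longleftrightarrow> u - v \<in> R" using f by (simp add: presents_def)
  have *: "ulm_omega p A (Suc k) = (\<Inter>n. f ` ((*) (of_nat p ^ n) ` uw p R k))"
    using Suc funpow_pmul_presents[OF f] by simp
  show ?case
  proof (intro equalityI subsetI)
    fix x assume x: "x \<in> ulm_omega p A (Suc k)"
    then obtain v where v: "x = f v" unfolding * by blast
    have "\<exists>y\<in>uw p R k. v - of_nat p ^ n * y \<in> R" for n
    proof -
      have "f v \<in> f ` ((*) (of_nat p ^ n) ` uw p R k)" using x v unfolding * by blast
      then obtain y where "y \<in> uw p R k" "f v = f (of_nat p ^ n * y)" by blast
      then show ?thesis using eq by blast
    qed
    then show "x \<in> f ` uw p R (Suc k)" using v by simp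
  next
    fix x assume "x \<in> f ` uw p R (Suc k)"
    then obtain v where v: "x = f v" "\<And>n. \<exists>y\<in>uw p R k. v - of_nat p ^ n * y \<in> R" by auto
    have "x \<in> f ` ((*) (of_nat p ^ n) ` uw p R k)" for n
    proof -
      obtain y where y: "y \<in> uw p R k" "v - of_nat p ^ n * y \<in> R" using v(2) by blast
      then have "x = f (of_nat p ^ n * y)" using eq v(1) by simp
      then show ?thesis using y(1) by blast
    qed
    then show "x \<in> ulm_omega p A (Suc k)" unfolding * by blast
  qed
qed

lemma length_gt_pfix:
  assumes f: "presents f A R" and "length_gt_omega_times p A k" shows "\<not> pfix p R k"
proof
  assume fx: "pfix p R k"
  note R = presents_subgrp[OF f]
  have eq: "\<And>u v. f u = f v \<longleftrightarrow> u - v \<in> R" using f by (simp add: presents_def)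
  have "f ` ((*) (of_nat p) ` uw p R k) = f ` uw p R k"
  proof (intro equalityI subsetI)
    fix x assume "x \<in> f ` ((*) (of_nat p) ` uw p R k)"
    then show "x \<in> f ` uw p R k" using subgrp_of_nat_mult[OF subgrp_uw[OF R]] by blast
  next
    fix x assume "x \<in> f ` uw p R k"
    then obtain v where v: "x = f v" "v \<in> uw p R k" by blast
    then obtain y where "y \<in> uw p R k" "v - of_nat p * y \<in> R" using fx unfolding pfix_def by blast
    then show "x \<in> f ` ((*) (of_nat p) ` uw p R k)" using v eq by blast
  qed
  then show False using assms(2) unfolding length_gt_omega_times_def ulm_omega_presents[OF f] pmul_presents[OF f] by blast
qed

lemma uw_antimono1: assumes R: "subgrp R" shows "uw p R (Suc k) \<subseteq> uw p R k"
proof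
  fix v assume "v \<in> uw p R (Suc k)"
  then obtain y where "y \<in> uw p R k" "v - of_nat p ^ 0 * y \<in> R" by (auto dest: spec[of _ 0])
  then show "v \<in> uw p R k" using uw_sat[OF R, of v y] by simp
qed

text \<open>If the Ulm subgroup at \<omega> is divisible, it contains roots of all orders of its
  elements, so nothing is lost at later steps. In contrapositive form, length beyond
  \<omega>\<open>(k + 1)\<close> already provides an element of infinite height with no
  \<open>p\<close>-th root of infinite height.\<close>

lemma pfix_stable:
  assumes R: "subgrp R" and fx: "pfix p R (Suc 0)" shows "pfix p R (Suc k)"
proof -
  have div: "\<exists>y\<in>uw p R (Suc 0). v - of_nat p ^ n * y \<in> R" if "v \<in> uw p R (Suc 0)" for v n
    using that
  proof (induction n arbitrary: v)
    case 0
    then show ?case using subgrp_zero[OF R] by (intro bexI[of _ v]) simp_all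
  next
    case (Suc n)
    obtain x where x: "x \<in> uw p R (Suc 0)" "v - of_nat p * x \<in> R" using fx Suc.prems unfolding pfix_def by blast
    obtain y where y: "y \<in> uw p R (Suc 0)" "x - of_nat p ^ n * y \<in> R" using Suc.IH[OF x(1)] by blast
    have "v - of_nat p * x + of_nat p * (x - of_nat p ^ n * y) \<in> R"
      by (intro subgrp_add[OF R x(2)] subgrp_of_nat_mult[OF R y(2)])
    then show ?case using y(1) by (intro bexI[of _ y]) (simp_all add: algebra_simps)
  qed
  have "uw p R (Suc k) = uw p R (Suc 0)"
  proof (induction k)
    case (Suc k)
    have "uw p R (Suc 0) \<subseteq> uw p R (Suc (Suc k))"
      using div unfolding uw.simps(2)[of p R "Suc k"] Suc by blast
    then show ?case using uw_antimono1[OF R, of p "Suc k"] Suc by blast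
  qed simp
  then show ?thesis using fx unfolding pfix_def by simp
qed

text \<open>\<open>h\<close> induces an isomorphism from the quotient by \<open>R1\<close> onto the
  elements of infinite height of the quotient by \<open>R\<close>, so the Ulm sequences agree up to
  a shift by \<omega>. This serves both for descending to the subgroup of infinite height and for
  lifting a presentation.\<close>

lemma uw_pullback:
  assumes diff: "\<And>u v. h (u - v) = h u - h v" and mult: "\<And>n v. h (of_nat n * v) = of_nat n * h v"
    and R: "subgrp R" and ker: "\<And>v. v \<in> R1 \<longleftrightarrow> h v \<in> R" and onto: "\<And>u. u \<in> pdivw p R \<Longrightarrow> \<exists>v. u - h v \<in> R"
    and into: "\<And>v. h v \<in> pdivw p R"
  shows "v \<in> uw p R1 k \<longleftrightarrow> h v \<in> uw p R (Suc k)" and "pfix p R1 k \<longleftrightarrow> pfix p R (Suc k)"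
proof -
  have multp: "h (of_nat p ^ n * y) = of_nat p ^ n * h y" for n y using mult[of "p ^ n" y] by simp
  have sub: "uw p R (Suc k) \<subseteq> pdivw p R" for k
  proof (induction k)
    case 0 show ?case by (simp only: uw_Suc_0 order_refl)
  next
    case (Suc k) then show ?case using uw_antimono1[OF R, of p "Suc k"] by (rule order_trans[rotated])
  qed
  have lift: "\<exists>y. z - h y \<in> R" if "z \<in> uw p R (Suc k)" for z k using that sub onto by blast
  have uw: "v \<in> uw p R1 k \<longleftrightarrow> h v \<in> uw p R (Suc k)" for v k
  proof (induction k arbitrary: v)
    case 0
    show ?case using into[of v] unfolding uw_Suc_0 by simp
  next
    case (Suc k)
    have "(\<exists>y\<in>uw p R1 k. v - of_nat p ^ n * y \<in> R1) \<longleftrightarrow> (\<exists>z\<in>uw p R (Suc k). h v - of_nat p ^ n * z \<in> R)" for n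
    proof
      assume "\<exists>y\<in>uw p R1 k. v - of_nat p ^ n * y \<in> R1"
      then obtain y where "y \<in> uw p R1 k" "v - of_nat p ^ n * y \<in> R1" by blast
      then show "\<exists>z\<in>uw p R (Suc k). h v - of_nat p ^ n * z \<in> R"
        using Suc[of y] ker by (intro bexI[of _ "h y"]) (simp_all only: diff multp)
    next
      assume "\<exists>z\<in>uw p R (Suc k). h v - of_nat p ^ n * z \<in> R"
      then obtain z where z: "z \<in> uw p R (Suc k)" "h v - of_nat p ^ n * z \<in> R" by blast
      obtain y where y: "z - h y \<in> R" using lift[OF z(1)] by blast
      have "h y \<in> uw p R (Suc k)" using uw_sat[OF R y] z(1) by blast
      moreover have "h v - of_nat p ^ n * z + of_nat p ^ n * (z - h y) \<in> R"
        by (intro subgrp_add[OF R z(2)] subgrp_power_mult[OF R y])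
      then have "h (v - of_nat p ^ n * y) \<in> R" unfolding diff multp by (simp add: algebra_simps)
      ultimately show "\<exists>y\<in>uw p R1 k. v - of_nat p ^ n * y \<in> R1" using Suc[of y] ker by blast
    qed
    then show ?case unfolding uw.simps(2)[of p R1 k] uw.simps(2)[of p R "Suc k"] mem_Collect_eq by blast
  qed
  then show "v \<in> uw p R1 k \<longleftrightarrow> h v \<in> uw p R (Suc k)" .
  show "pfix p R1 k \<longleftrightarrow> pfix p R (Suc k)"
  proof
    assume fx: "pfix p R1 k"
    show "pfix p R (Suc k)" unfolding pfix_def
    proof
      fix z assume z: "z \<in> uw p R (Suc k)"
      obtain v where v: "z - h v \<in> R" using lift[OF z] by blast
      then have "v \<in> uw p R1 k" using uw_sat[OF R v] z uw by blast
      then obtain y where y: "y \<in> uw p R1 k" "v - of_nat p * y \<in> R1" using fx unfolding pfix_def by blast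
      have "z - h v + (h v - of_nat p * h y) \<in> R"
        using y(2) unfolding ker diff mult by (rule subgrp_add[OF R v])
      then show "\<exists>y\<in>uw p R (Suc k). z - of_nat p * y \<in> R"
        using y(1) uw by (intro bexI[of _ "h y"]) simp_all
    qed
  next
    assume fx: "pfix p R (Suc k)"
    show "pfix p R1 k" unfolding pfix_def
    proof
      fix v assume "v \<in> uw p R1 k"
      then obtain z where z: "z \<in> uw p R (Suc k)" "h v - of_nat p * z \<in> R" using fx uw unfolding pfix_def by blast
      obtain y where y: "z - h y \<in> R" using lift[OF z(1)] by blast
      have "h v - of_nat p * z + of_nat p * (z - h y) \<in> R"
        by (intro subgrp_add[OF R z(2)] subgrp_of_nat_mult[OF R y])
      then have "h (v - of_nat p * y) \<in> R" unfolding diff mult by (simp add: algebra_simps)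
      moreover have "y \<in> uw p R1 k" using uw uw_sat[OF R y] z(1) by blast
      ultimately show "\<exists>y\<in>uw p R1 k. v - of_nat p * y \<in> R1" using ker by blast
    qed
  qed
qed

section \<open>Homomorphisms out of the free abelian group\<close>

definition lin :: "(nat \<Rightarrow> int poly) \<Rightarrow> int poly \<Rightarrow> int poly" where
  "lin s v = (\<Sum>i\<le>degree v. of_int (coeff v i) * s i)"

lemma lin_bound: assumes "\<And>i. i \<ge> n \<Longrightarrow> coeff v i = 0" shows "lin s v = (\<Sum>i<n. of_int (coeff v i) * s i)"
proof -
  let ?S = "{i. coeff v i \<noteq> 0}"
  have "lin s v = (\<Sum>i\<in>?S. of_int (coeff v i) * s i)"
    unfolding lin_def by (rule sum.mono_neutral_right) (auto simp: le_degree)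
  also have "\<dots> = (\<Sum>i<n. of_int (coeff v i) * s i)"
    using assms by (intro sum.mono_neutral_left) (auto simp: not_less[symmetric])
  finally show ?thesis .
qed

lemma lin_diff: "lin s (u - v) = lin s u - lin s v"
proof -
  let ?n = "Suc (max (degree u) (degree v))"
  have "lin s x = (\<Sum>i<?n. of_int (coeff x i) * s i)" if "\<And>i. i \<ge> ?n \<Longrightarrow> coeff x i = 0" for x
    using that by (rule lin_bound)
  then have "lin s u = (\<Sum>i<?n. of_int (coeff u i) * s i)" "lin s v = (\<Sum>i<?n. of_int (coeff v i) * s i)"
    "lin s (u - v) = (\<Sum>i<?n. of_int (coeff (u - v) i) * s i)"
    by (simp_all add: coeff_eq_0)
  then show ?thesis by (simp add: sum_subtractf algebra_simps)
qed

lemma lin_0: "lin s 0 = 0" by (simp add: lin_def)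

lemma lin_add: "lin s (u + v) = lin s u + lin s v"
  using lin_diff[of s "u + v" v] by simp

lemma lin_monom: "lin s (monom 1 i) = s i"
proof -
  have "lin s (monom 1 i) = (\<Sum>j<Suc i. if j = i then s j else 0)"
    by (subst lin_bound[of "Suc i"]) (auto intro!: sum.cong)
  then show ?thesis by simp
qed

lemma lin_of_nat: "lin s (of_nat n * v) = of_nat n * lin s v"
  by (induction n) (simp_all add: lin_0 lin_add algebra_simps)

lemma lin_in: "subgrp S \<Longrightarrow> (\<And>i. s i \<in> S) \<Longrightarrow> lin s v \<in> S"
  unfolding lin_def by (intro subgrp_sum subgrp_of_int_mult)

lemma ex_hom:
  assumes "comm_group H" and g: "\<And>i. g i \<in> carrier H"
  shows "\<exists>f. (\<forall>v. f v \<in> carrier H) \<and> (\<forall>u v. f (u + v) = f u \<otimes>\<^bsub>H\<^esub> f v) \<and> (\<forall>i. f (monom (1::int) i) = g i)"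
proof -
  interpret comm_group H by fact
  define f where "f v = finprod H (\<lambda>i. g i [^]\<^bsub>H\<^esub> (coeff v i :: int)) {..degree v}" for v :: "int poly"
  have cl: "g i [^]\<^bsub>H\<^esub> (c::int) \<in> carrier H" for i c using g by simp
  have bound: "f v = finprod H (\<lambda>i. g i [^]\<^bsub>H\<^esub> (coeff v i :: int)) {..n}" if n: "degree v \<le> n" for v n
    unfolding f_def using n cl by (intro finprod_mono_neutral_cong_left) (auto simp: coeff_eq_0)
  have "f (u + v) = f u \<otimes>\<^bsub>H\<^esub> f v" for u v
  proof -
    let ?n = "max (degree u) (degree v)"
    have "f (u + v) = finprod H (\<lambda>i. g i [^]\<^bsub>H\<^esub> (coeff u i + coeff v i :: int)) {..?n}"
      using bound[of "u + v" ?n] by (simp add: degree_add_le_max)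
    also have "\<dots> = finprod H (\<lambda>i. g i [^]\<^bsub>H\<^esub> (coeff u i :: int) \<otimes>\<^bsub>H\<^esub> g i [^]\<^bsub>H\<^esub> (coeff v i :: int)) {..?n}"
      using g by (intro finprod_cong) (auto simp: int_pow_mult)
    also have "\<dots> = f u \<otimes>\<^bsub>H\<^esub> f v"
      using bound[of u ?n] bound[of v ?n] cl by (simp add: finprod_multf Pi_def)
    finally show ?thesis .
  qed
  moreover have "f (monom 1 i) = g i" for i
  proof -
    have "f (monom 1 i) = finprod H (\<lambda>j. if i = j then g j else \<one>\<^bsub>H\<^esub>) {..i}"
      unfolding bound[of "monom 1 i" i, OF degree_monom_le] using g by (intro finprod_cong) (auto simp: simp_implies_def)
    then show ?thesis using g by (simp add: finprod_singleton[of i "{..i}" g])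
  qed
  moreover have "f v \<in> carrier H" for v unfolding f_def using cl by (intro finprod_closed) auto
  ultimately show ?thesis by blast
qed

lemma abelian_p_group_presents:
  assumes "abelian_p_group p A"
  shows "\<exists>f R. presents f A R \<and> (\<forall>v. \<exists>n. of_nat p ^ n * v \<in> R)"
proof -
  have G: "comm_group (grp A)" and tor: "\<And>x. x \<in> univ A \<Longrightarrow> \<exists>n. x [^]\<^bsub>grp A\<^esub> (p ^ n) = \<one>\<^bsub>grp A\<^esub>"
    using assms by (auto simp: abelian_p_group_def)
  interpret comm_group "grp A" by fact
  have car: "carrier (grp A) = univ A" and pl: "(\<otimes>\<^bsub>grp A\<^esub>) = plus A" by (simp_all add: grp_def)
  \<comment> \<open>Every number names a generator; those outside the universe are sent to the
    identity.\<close>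
  define g where "g i = (if i \<in> univ A then i else \<one>\<^bsub>grp A\<^esub>)" for i
  have gc: "g i \<in> carrier (grp A)" for i using one_closed by (simp add: g_def car)
  obtain f where F: "(\<forall>v. f v \<in> carrier (grp A)) \<and> (\<forall>u v. f (u + v) = f u \<otimes>\<^bsub>grp A\<^esub> f v) \<and>
      (\<forall>i. f (monom (1::int) i) = g i)" using ex_hom[of "grp A" g, OF G gc] by (elim exE)
  have f: "f v \<in> carrier (grp A)" "f (u + v) = f u \<otimes>\<^bsub>grp A\<^esub> f v" "f (monom (1::int) i) = g i" for u v i
    using F by simp_all
  define R where "R = {v. f v = \<one>\<^bsub>grp A\<^esub>}"
  have f0: "f 0 = \<one>\<^bsub>grp A\<^esub>" using f(1)[of 0] f(2)[of 0 0] by (metis add.left_neutral r_cancel_one')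
  have "presents f A R" unfolding presents_def
  proof (intro conjI allI)
    show "range f = univ A"
    proof (intro equalityI subsetI)
      fix x assume "x \<in> univ A"
      then have "x = f (monom 1 x)" using f(3) by (simp add: g_def)
      then show "x \<in> range f" by blast
    qed (use f(1) car in auto)
    show "f (u + v) = plus A (f u) (f v)" for u v using f(2) pl by simp
    show "f u = f v \<longleftrightarrow> u - v \<in> R" for u v
    proof -
      have "f u = f (u - v) \<otimes>\<^bsub>grp A\<^esub> f v" using f(2)[of "u - v" v] by simp
      then show ?thesis unfolding R_def mem_Collect_eq
        using right_cancel[OF f(1)[of v] f(1)[of "u - v"] one_closed] f(1)[of v] by simp
    qed
  qed
  moreover have "\<exists>n. of_nat p ^ n * v \<in> R" for v
  proof -
    obtain n where "f v [^]\<^bsub>grp A\<^esub> (p ^ n) = \<one>\<^bsub>grp A\<^esub>" using tor f(1) car by blast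
    then have "of_nat (p ^ n) * v \<in> R" unfolding R_def mem_Collect_eq presents_pow[OF calculation] by simp
    then show ?thesis by auto
  qed
  ultimately show ?thesis by blast
qed

subsection \<open>Ulm invariants of a computable group\<close>

definition dig :: "nat \<Rightarrow> nat \<Rightarrow> nat \<Rightarrow> nat" where "dig p m j = (m div p ^ j) mod p"

lemma ex_dig:
  assumes "\<And>j. j < n \<Longrightarrow> d j < p"
  shows "\<exists>m<p ^ n. \<forall>j<n. dig p m j = d j"
  using assms
proof (induction n arbitrary: d)
  case (Suc n)
  from Suc.IH[of "\<lambda>j. d (Suc j)"] Suc.prems obtain m where m: "m < p ^ n" "\<And>j. j < n \<Longrightarrow> dig p m j = d (Suc j)" by auto
  have d0: "d 0 < p" using Suc.prems by simp
  let ?m = "d 0 + p * m"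
  have "dig p ?m j = d j" if "j < Suc n" for j
  proof (cases j)
    case 0
    then show ?thesis using d0 by (simp add: dig_def)
  next
    case (Suc i)
    have "?m div p ^ Suc i = m div p ^ i" using d0 by (simp add: div_mult2_eq)
    then show ?thesis using m(2)[of i] Suc that by (simp add: dig_def)
  qed
  moreover have "?m < p ^ Suc n"
  proof -
    have "?m < p + p * m" using d0 by simp
    also have "\<dots> = p * Suc m" by simp
    also have "\<dots> \<le> p * p ^ n" using m(1) by (intro mult_le_mono2) simp
    finally show ?thesis by simp
  qed
  ultimately show ?case by blast
qed simp

lemma (in clone) dig_in [rec_intros]: "f \<in> C \<Longrightarrow> g \<in> C \<Longrightarrow> (\<lambda>x. dig p (f x) (g x)) \<in> C"
  unfolding dig_def by (intro rec_intros)

lemma (in clone) lim_seq_in_jump: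
  assumes "(\<lambda>z. f (p1 z) (p2 z)) \<in> C" "\<And>x. \<exists>s0. \<forall>s\<ge>s0. f x s = l x"
  shows "l \<in> jump C"
  by (rule jumpI[OF assms(1)]) (simp add: assms(2))

text \<open>The computable data are the universe and \<open>g\<close>. The presentation carries no
  computability assumption; together with \<open>rep\<close> it only translates statements about
  numbers into the free group.\<close>

locale cgroup = clone C for C :: "(nat \<Rightarrow> nat) set" +
  fixes p :: nat and A :: struc and f :: "int poly \<Rightarrow> nat" and R :: "int poly set" and g :: "nat \<Rightarrow> nat"
  assumes p: "prime p" and pres: "presents f A R"
    and dec_univ: "decid (\<lambda>x. x \<in> univ A)" and g_in: "g \<in> C"
    and g_plus: "\<And>x y. x \<in> univ A \<Longrightarrow> y \<in> univ A \<Longrightarrow> g (pr x y) = plus A x y"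
begin

lemma R: "subgrp R" by (rule presents_subgrp[OF pres])

lemma f_eq: "f u = f v \<longleftrightarrow> u - v \<in> R" using pres by (simp add: presents_def)

lemma f_univ: "f v \<in> univ A" using pres by (auto simp: presents_def)

lemma g_f: "g (pr (f u) (f v)) = f (u + v)"
  using pres g_plus[OF f_univ f_univ] by (simp add: presents_def)

definition rep :: "nat \<Rightarrow> int poly" where "rep x = (SOME v. f v = x)"

lemma f_rep: "x \<in> univ A \<Longrightarrow> f (rep x) = x"
proof -
  assume "x \<in> univ A"
  then have "x \<in> range f" using pres by (simp add: presents_def)
  then have "\<exists>v. f v = x" by blast
  then show ?thesis unfolding rep_def by (rule someI_ex)
qed

definition mul :: "nat \<Rightarrow> nat \<Rightarrow> nat" where "mul n x = rec_nat (f 0) (\<lambda>_ r. g (pr x r)) n"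

lemma mul_f: "mul n (f v) = f (of_nat n * v)"
  by (induction n) (simp_all add: mul_def g_f algebra_simps)

lemma mul_in [rec_intros]:
  assumes "h \<in> C" "k \<in> C" shows "(\<lambda>x. mul (h x) (k x)) \<in> C"
  unfolding mul_def by (intro rec_intros comp_in[OF g_in] comp_in[OF assms(2)] assms(1))

lemma dec_univ_app [rec_intros]: "h \<in> C \<Longrightarrow> decid (\<lambda>x. h x \<in> univ A)"
  by (rule decid_app[OF dec_univ])

lemma ex_root: "(\<exists>y. y \<in> univ A \<and> mul (p ^ k) y = f v) \<longleftrightarrow> v \<in> pdiv p R k"
proof
  assume "\<exists>y. y \<in> univ A \<and> mul (p ^ k) y = f v"
  then obtain y where y: "y \<in> univ A" "mul (p ^ k) y = f v" by blast
  have "f v = f (of_nat (p ^ k) * rep y)" using y f_rep mul_f[of "p ^ k" "rep y"] by simp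
  then have "v - of_nat p ^ k * rep y \<in> R" unfolding f_eq by simp
  then show "v \<in> pdiv p R k" by (auto simp: pdiv_def)
next
  assume "v \<in> pdiv p R k"
  then obtain y where "v - of_nat p ^ k * y \<in> R" by (auto simp: pdiv_def)
  then have "f v = f (of_nat p ^ k * y)" unfolding f_eq .
  then have "mul (p ^ k) (f y) = f v" unfolding mul_f by simp
  then show "\<exists>y. y \<in> univ A \<and> mul (p ^ k) y = f v" using f_univ by blast
qed

text \<open>Existence of a root takes one jump, the universal quantifier over exponents a second
  one.\<close>

lemma decid_ulm_omega: "clone.decid (jump (jump C)) (\<lambda>x. x \<in> ulm_omega p A (Suc 0))"
proof -
  interpret J: clone "jump C" by (rule clone_jump)
  interpret J2: clone "jump (jump C)" by (rule J.clone_jump)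
  have "decid (\<lambda>z. p1 z \<in> univ A \<and> mul (p ^ p1 (p2 z)) (p1 z) = p2 (p2 z))"
    by (intro rec_intros)
  from decid_jump_ex[of "\<lambda>x y. y \<in> univ A \<and> mul (p ^ p1 x) y = p2 x", OF this]
  have "J.decid (\<lambda>x. \<not> (\<exists>y. y \<in> univ A \<and> mul (p ^ p1 x) y = p2 x))" by (rule J.decid_not)
  from J.decid_jump_ex[of "\<lambda>x k. \<not> (\<exists>y. y \<in> univ A \<and> mul (p ^ k) y = x)"] this
  have 1: "J2.decid (\<lambda>x. \<exists>k. \<not> (\<exists>y. y \<in> univ A \<and> mul (p ^ k) y = x))" by simp
  have 2: "J2.decid (\<lambda>x. x \<in> univ A)"
    by (rule J.decid_subset_jump[OF decid_subset_jump[OF dec_univ]])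
  have "J2.decid (\<lambda>x. x \<in> univ A \<and> \<not> (\<exists>k. \<not> (\<exists>y. y \<in> univ A \<and> mul (p ^ k) y = x)))"
    by (intro J2.decid_conj J2.decid_not 1 2)
  moreover have "(x \<in> univ A \<and> \<not> (\<exists>k. \<not> (\<exists>y. y \<in> univ A \<and> mul (p ^ k) y = x))) \<longleftrightarrow> x \<in> ulm_omega p A (Suc 0)" for x
  proof -
    have o: "ulm_omega p A (Suc 0) = f ` pdivw p R" using ulm_omega_presents[OF pres, of p "Suc 0"] by (simp only: uw_Suc_0)
    show ?thesis
    proof
      assume h: "x \<in> univ A \<and> \<not> (\<exists>k. \<not> (\<exists>y. y \<in> univ A \<and> mul (p ^ k) y = x))"
      then have "rep x \<in> pdiv p R k" for k using ex_root[of k "rep x"] f_rep[of x] by simp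
      then have "rep x \<in> pdivw p R" by (simp add: pdivw_def)
      then show "x \<in> ulm_omega p A (Suc 0)" unfolding o using f_rep[of x] h by force
    next
      assume "x \<in> ulm_omega p A (Suc 0)"
      then obtain v where v: "x = f v" "v \<in> pdivw p R" unfolding o by blast
      then have "\<exists>y. y \<in> univ A \<and> mul (p ^ k) y = x" for k using ex_root[of k v] by (simp add: pdivw_def)
      then show "x \<in> univ A \<and> \<not> (\<exists>k. \<not> (\<exists>y. y \<in> univ A \<and> mul (p ^ k) y = x))" using v(1) f_univ by blast
    qed
  qed
  ultimately show ?thesis by simp
qed

section \<open>A greedy basis of the Ulm quotients, decidable in one jump\<close>

definition soc :: "nat \<Rightarrow> nat \<Rightarrow> bool" where
  "soc k e \<longleftrightarrow> e \<in> univ A \<and> mul p e = f 0 \<and> (\<exists>y. y \<in> univ A \<and> mul (p ^ k) y = e)"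

lemma soc_iff: "e \<in> univ A \<Longrightarrow> soc k e \<longleftrightarrow> rep e \<in> psocle p R k"
proof -
  assume e: "e \<in> univ A"
  have "mul p e = f 0 \<longleftrightarrow> of_nat p * rep e \<in> R"
    using mul_f[of p "rep e"] f_rep[OF e] f_eq[of "of_nat p * rep e" 0] by simp
  moreover have "(\<exists>y. y \<in> univ A \<and> mul (p ^ k) y = e) \<longleftrightarrow> rep e \<in> pdiv p R k"
    using ex_root[of k "rep e"] f_rep[OF e] by simp
  ultimately show ?thesis using e by (auto simp: soc_def psocle_def)
qed

definition combo :: "nat \<Rightarrow> nat \<Rightarrow> nat" where
  "combo m e = rec_nat (f 0) (\<lambda>j r. if j \<in> univ A then g (pr r (mul (dig p m j) j)) else r) e"

definition combop :: "nat \<Rightarrow> nat \<Rightarrow> int poly" where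
  "combop m e = (\<Sum>j | j < e \<and> j \<in> univ A. of_nat (dig p m j) * rep j)"

lemma combo_f: "combo m e = f (combop m e)"
proof (induction e)
  case (Suc e)
  have "combo m (Suc e) = (if e \<in> univ A then g (pr (combo m e) (mul (dig p m e) e)) else combo m e)"
    by (simp add: combo_def)
  also have "\<dots> = f (combop m (Suc e))"
  proof (cases "e \<in> univ A")
    case True
    have *: "{j. j < Suc e \<and> j \<in> univ A} = insert e {j. j < e \<and> j \<in> univ A}" using True by auto
    have "mul (dig p m e) e = f (of_nat (dig p m e) * rep e)" using mul_f[of _ "rep e"] f_rep[OF True] by simp
    then show ?thesis using True Suc by (simp add: g_f combop_def * add.commute)
  next
    case False
    then have "{j. j < Suc e \<and> j \<in> univ A} = {j. j < e \<and> j \<in> univ A}" by (auto simp: less_Suc_eq)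
    then show ?thesis using False Suc by (simp add: combop_def)
  qed
  finally show ?case .
qed (simp add: combo_def combop_def)

lemma combo_in [rec_intros]:
  assumes "h \<in> C" "k \<in> C" shows "(\<lambda>x. combo (h x) (k x)) \<in> C"
  unfolding combo_def by (intro rec_intros comp_in[OF g_in] comp_in[OF assms(1)] assms(2))

definition depd :: "nat \<Rightarrow> nat \<Rightarrow> nat \<Rightarrow> bool" where
  "depd k m e \<longleftrightarrow> (\<exists>y. y \<in> univ A \<and> g (pr (combo m e) (mul (p ^ Suc k) y)) = e)"

lemma depd_iff: "e \<in> univ A \<Longrightarrow> depd k m e \<longleftrightarrow> rep e - combop m e \<in> pdiv p R (Suc k)"
proof -
  assume e: "e \<in> univ A"
  have *: "g (pr (combo m e) (mul (p ^ Suc k) (f y))) = e \<longleftrightarrow> rep e - combop m e - of_nat p ^ Suc k * y \<in> R" for y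
  proof -
    let ?v = "combop m e + of_nat (p ^ Suc k) * y"
    have "f ?v = e \<longleftrightarrow> f (rep e) = f ?v" using f_rep[OF e] by auto
    also have "\<dots> \<longleftrightarrow> rep e - ?v \<in> R" by (rule f_eq)
    also have "rep e - ?v = rep e - combop m e - of_nat p ^ Suc k * y" by simp
    finally show ?thesis unfolding combo_f mul_f g_f .
  qed
  show ?thesis
  proof
    assume "depd k m e"
    then obtain y where "y \<in> univ A" "g (pr (combo m e) (mul (p ^ Suc k) y)) = e" by (auto simp: depd_def)
    then have "rep e - combop m e - of_nat p ^ Suc k * rep y \<in> R" using *[of "rep y"] f_rep[of y] by simp
    then show "rep e - combop m e \<in> pdiv p R (Suc k)" unfolding pdiv_def by blast
  next
    assume "rep e - combop m e \<in> pdiv p R (Suc k)"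
    then obtain y where "rep e - combop m e - of_nat p ^ Suc k * y \<in> R" unfolding pdiv_def by blast
    then have "g (pr (combo m e) (mul (p ^ Suc k) (f y))) = e" using * by blast
    then show "depd k m e" using f_univ[of y] unfolding depd_def by blast
  qed
qed

text \<open>The socle elements that are not, modulo height \<open>Suc k\<close>, combinations of
  smaller socle elements. Coefficients are base-\<open>p\<close> digits of \<open>m\<close>, so the
  search over combinations is bounded and only the existence of roots costs a jump.\<close>

definition Bk :: "nat \<Rightarrow> nat \<Rightarrow> bool" where
  "Bk k e \<longleftrightarrow> soc k e \<and> \<not> (\<exists>m<p ^ e. (\<forall>j<e. dig p m j \<noteq> 0 \<longrightarrow> soc k j) \<and> depd k m e)"

lemma decid_Bk: "clone.decid (jump C) (\<lambda>z. Bk (p1 z) (p2 z))"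
proof -
  interpret J: clone "jump C" by (rule clone_jump)
  have "decid (\<lambda>z. p1 z \<in> univ A \<and> mul (p ^ p1 (p2 z)) (p1 z) = p2 (p2 z))" by (intro rec_intros)
  from decid_jump_ex[of "\<lambda>x y. y \<in> univ A \<and> mul (p ^ p1 x) y = p2 x", OF this]
  have 1: "J.decid (\<lambda>x. \<exists>y. y \<in> univ A \<and> mul (p ^ p1 x) y = p2 x)" .
  have "decid (\<lambda>x. p2 x \<in> univ A \<and> mul p (p2 x) = f 0)" by (intro rec_intros)
  from J.decid_conj[OF decid_subset_jump[OF this] 1]
  have "J.decid (\<lambda>x. soc (p1 x) (p2 x))" by (simp add: soc_def)
  then have soc: "J.decid (\<lambda>x. soc (a x) (b x))" if "a \<in> jump C" "b \<in> jump C" for a b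
    using J.decid_app2[of soc] that by blast
  have "decid (\<lambda>z. p1 z \<in> univ A \<and> g (pr (combo (p1 (p2 (p2 z))) (p2 (p2 (p2 z)))) (mul (p ^ Suc (p1 (p2 z))) (p1 z))) = p2 (p2 (p2 z)))"
    by (intro rec_intros comp_in[OF g_in])
  from decid_jump_ex[of "\<lambda>x y. y \<in> univ A \<and> g (pr (combo (p1 (p2 x)) (p2 (p2 x))) (mul (p ^ Suc (p1 x)) y)) = p2 (p2 x)", OF this]
  have "J.decid (\<lambda>x. depd (p1 x) (p1 (p2 x)) (p2 (p2 x)))" by (simp add: depd_def)
  then have depd: "J.decid (\<lambda>x. depd (a x) (b x) (c x))" if "a \<in> jump C" "b \<in> jump C" "c \<in> jump C" for a b c
    using J.decid_app3[of depd] that by blast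
  show ?thesis unfolding Bk_def by (intro rec_intros J.dig_in soc depd)
qed

lemma ulm_quot_Bk: "ulm_quot p R k \<approx> finsupp p {e. Bk k e}"
proof (rule ulm_quot_eqpoll[OF p R, of _ rep])
  note D = subgrp_pdiv[OF R, of p]
  have Bk_univ: "e \<in> univ A" "rep e \<in> psocle p R k" if "Bk k e" for e
    using that soc_iff[of e k] by (auto simp: Bk_def soc_def)
  show "rep c \<in> psocle p R k" if "c \<in> {e. Bk k e}" for c using Bk_univ that by simp
  have socR: "of_int i * rep c \<in> pdiv p R (Suc k)" if "int p dvd i" "rep c \<in> psocle p R k" for i c
  proof -
    have "\<exists>q. i = int p * q" using that(1) unfolding dvd_def by blast
    then obtain q where q: "i = int p * q" by (elim exE)
    have "of_int q * (of_nat p * rep c) \<in> R"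
      using that(2) by (intro subgrp_of_int_mult[OF R]) (simp add: psocle_def)
    then show ?thesis using subset_pdiv[OF R] by (simp add: q ac_simps)
  qed
  {
    fix I h c assume I: "finite I" "I \<subseteq> {e. Bk k e}" "(\<Sum>c\<in>I. of_int (h c) * rep c) \<in> pdiv p R (Suc k)" and c: "c \<in> I"
    show "int p dvd h c"
    proof (rule ccontr)
      assume neg: "\<not> int p dvd h c"
      let ?N = "{c \<in> I. \<not> int p dvd h c}"
      have fin: "finite ?N" "?N \<noteq> {}" using I(1) c neg by auto
      \<comment> \<open>The greatest index whose coefficient is prime to \<open>p\<close>. Scaling
        by its inverse modulo \<open>p\<close> expresses \<open>e\<close> through smaller elements,
        with digits \<open>d\<close>, against the choice of \<open>e\<close>; coefficients beyond
        \<open>e\<close> are multiples of \<open>p\<close> and vanish on socle elements.\<close>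
      define e where "e = Max ?N"
      have e: "e \<in> I" "\<not> int p dvd h e" using Max_in[OF fin] by (auto simp: e_def)
      have Be: "Bk k e" using e(1) I(2) by blast
      have "coprime (h e) (int p)" using p e(2) by (simp add: prime_imp_coprime coprime_commute)
      then obtain x y where xy: "x * h e + y * int p = 1"
        using bezout_int[of "h e" "int p"] by (auto simp: coprime_iff_gcd_eq_1)
      define d where "d j = (if j \<in> I then nat ((- x * h j) mod int p) else 0)" for j
      have p0: "int p > 0" using prime_gt_0_nat[OF p] by simp
      have "d j < p" for j using p0 by (auto simp: d_def nat_less_iff)
      then obtain m where m: "m < p ^ e" "\<And>j. j < e \<Longrightarrow> dig p m j = d j" using ex_dig[of e d p] by blast
      have "soc k j" if "j < e" "dig p m j \<noteq> 0" for j
      proof -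
        have "j \<in> I" using that m(2)[of j] by (auto simp: d_def split: if_splits)
        then show ?thesis using I(2) by (auto simp: Bk_def)
      qed
      moreover have "depd k m e"
      proof -
        let ?L = "{j \<in> I. j < e}"
        have cm: "combop m e = (\<Sum>j\<in>?L. of_nat (d j) * rep j)"
        proof -
          have "combop m e = (\<Sum>j | j < e \<and> j \<in> univ A. of_nat (d j) * rep j)"
            unfolding combop_def using m(2) by (intro sum.cong) auto
          also have "\<dots> = (\<Sum>j\<in>?L. of_nat (d j) * rep j)"
            using I(2) Bk_univ by (intro sum.mono_neutral_right) (auto simp: d_def)
          finally show ?thesis .
        qed
        have "of_int x * (of_int (h j) * rep j) - (if j = e then rep e else if j < e then - (of_nat (d j) * rep j) else 0)
            \<in> pdiv p R (Suc k)" if j: "j \<in> I" for j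
        proof -
          have soc: "rep j \<in> psocle p R k" using Bk_univ I(2) j by blast
          consider "j = e" | "j < e" | "j > e" by linarith
          then show ?thesis
          proof cases
            case 1
            have "x * h j - 1 = int p * (- y)" using xy 1 by (simp add: algebra_simps)
            then have "int p dvd x * h j - 1" by simp
            from socR[OF this soc] show ?thesis using 1 by (simp add: algebra_simps)
          next
            case 2
            have "x * h j + int (d j) = - (- x * h j - (- x * h j) mod int p)" using p0 j by (simp add: d_def)
            then have "int p dvd x * h j + int (d j)" by (metis dvd_minus_iff dvd_minus_mod)
            from socR[OF this soc] show ?thesis using 2 by (simp add: algebra_simps)
          next
            case 3
            have "int p dvd h j"
            proof (rule ccontr)
              assume "\<not> int p dvd h j"
              then have "j \<le> e" using j fin(1) by (auto simp: e_def)
              then show False using 3 by simp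
            qed
            then have "int p dvd x * h j" by simp
            from socR[OF this soc] show ?thesis using 3 by (simp add: algebra_simps)
          qed
        qed
        then have "(\<Sum>j\<in>I. of_int x * (of_int (h j) * rep j) - (if j = e then rep e else if j < e then - (of_nat (d j) * rep j) else 0))
            \<in> pdiv p R (Suc k)" by (rule subgrp_sum[OF D])
        moreover have "(\<Sum>j\<in>I. of_int x * (of_int (h j) * rep j)) \<in> pdiv p R (Suc k)"
          using subgrp_of_int_mult[OF D I(3), of x] by (simp add: sum_distrib_left)
        moreover have "(\<Sum>j\<in>I. if j = e then rep e else if j < e then - (of_nat (d j) * rep j) else 0) = rep e - combop m e"
        proof -
          have "(\<Sum>j\<in>I. if j = e then rep e else if j < e then - (of_nat (d j) * rep j) else 0) =
              (\<Sum>j\<in>I. (if j = e then rep e else 0) + (if j \<in> {j. j < e} then - (of_nat (d j) * rep j) else 0))"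
            by (intro sum.cong) auto
          also have "\<dots> = rep e + (\<Sum>j\<in>I \<inter> {j. j < e}. - (of_nat (d j) * rep j))"
            using I(1) e(1) by (simp add: sum.distrib sum.inter_restrict)
          also have "I \<inter> {j. j < e} = ?L" by auto
          finally show ?thesis unfolding cm by (simp add: sum_negf)
        qed
        ultimately have "rep e - combop m e \<in> pdiv p R (Suc k)"
          using subgrp_diff[OF D] unfolding sum_subtractf by fastforce
        then show ?thesis using depd_iff[of e] Bk_univ[OF Be] by blast
      qed
      ultimately show False using Be m(1) unfolding Bk_def by blast
    qed
  }
  {
    fix v assume v: "v \<in> psocle p R k"
    define Sp where "Sp = {v. \<exists>I h. finite I \<and> I \<subseteq> {e. Bk k e} \<and> v - (\<Sum>c\<in>I. of_int (h c) * rep c) \<in> pdiv p R (Suc k)}"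
    have S: "subgrp Sp" unfolding Sp_def by (rule subgrp_combinations[OF D])
    have DS: "u \<in> Sp" if "u \<in> pdiv p R (Suc k)" for u
      unfolding Sp_def using that by (auto intro!: exI[of _ "{}"])
    have rep: "rep e \<in> Sp" if "soc k e" for e
      using that
    proof (induction e rule: less_induct)
      case (less e)
      have eu: "e \<in> univ A" using less.prems by (simp add: soc_def)
      show ?case
      proof (cases "Bk k e")
        case True
        then show ?thesis unfolding Sp_def using subgrp_zero[OF D]
          by (auto intro!: exI[of _ "{e}"] exI[of _ "\<lambda>_. 1"])
      next
        case False
        then obtain m where m: "\<forall>j<e. dig p m j \<noteq> 0 \<longrightarrow> soc k j" "depd k m e"
          using less.prems unfolding Bk_def by blast
        have "combop m e \<in> Sp" unfolding combop_def
        proof (rule subgrp_sum[OF S])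
          fix j assume "j \<in> {j. j < e \<and> j \<in> univ A}"
          then show "of_nat (dig p m j) * rep j \<in> Sp"
            using m(1) less.IH[of j] subgrp_of_nat_mult[OF S, of "rep j"] subgrp_zero[OF S]
            by (cases "dig p m j = 0") auto
        qed
        moreover have "rep e - combop m e \<in> Sp" using DS depd_iff[OF eu] m(2) by blast
        ultimately show ?thesis using subgrp_diff_cancel[OF S] by blast
      qed
    qed
    let ?e = "f v"
    have eu: "?e \<in> univ A" by (rule f_univ)
    have rv: "rep ?e - v \<in> R" using f_rep[OF eu] f_eq by blast
    have "of_nat p * rep ?e - of_nat p * v \<in> R" using subgrp_of_nat_mult[OF R rv, of p] by (simp add: algebra_simps)
    then have "rep ?e \<in> psocle p R k"
      using v subgrp_diff_cancel[OF R] subgrp_diff_cancel[OF D subset_pdiv[OF R rv]] unfolding psocle_def by blast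
    then have "rep ?e \<in> Sp" using rep soc_iff[OF eu] by blast
    then have "v \<in> Sp" using subgrp_diff_cancel[OF S DS[OF subset_pdiv[OF R rv]]] by blast
    then show "\<exists>I h. finite I \<and> I \<subseteq> {e. Bk k e} \<and> v - (\<Sum>c\<in>I. of_int (h c) * rep c) \<in> pdiv p R (Suc k)"
      unfolding Sp_def mem_Collect_eq .
  }
qed

end

text \<open>An element \<^term>\<open>xi\<close> of infinite height outside \<open>p\<close> times the elements of infinite height has \<open>p\<close>-th roots
  \<open>u k\<close> of finite but unbounded heights; those heights can be approximated from below.\<close>

locale cgroup_long = cgroup +
  fixes xi :: "int poly"
  assumes xi: "xi \<in> pdivw p R" "\<And>y. y \<in> pdivw p R \<Longrightarrow> xi - of_nat p * y \<notin> R"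
begin

definition yk :: "nat \<Rightarrow> nat" where "yk k = (LEAST y. y \<in> univ A \<and> mul (p ^ Suc k) y = f xi)"
definition u :: "nat \<Rightarrow> nat" where "u k = mul (p ^ k) (yk k)"
definition up :: "nat \<Rightarrow> int poly" where "up k = of_nat p ^ k * rep (yk k)"

lemma yk: "yk k \<in> univ A" "mul (p ^ Suc k) (yk k) = f xi"
proof -
  have "\<exists>y. y \<in> univ A \<and> mul (p ^ Suc k) y = f xi"
    unfolding ex_root using xi(1) by (auto simp: pdivw_def)
  then have "yk k \<in> univ A \<and> mul (p ^ Suc k) (yk k) = f xi" unfolding yk_def by (rule LeastI_ex)
  then show "yk k \<in> univ A" "mul (p ^ Suc k) (yk k) = f xi" by auto
qed

lemma u_up: "u k = f (up k)"
  using mul_f[of "p ^ k" "rep (yk k)"] f_rep[OF yk(1)] by (simp add: u_def up_def)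

lemma up_xi: "of_nat p * up k - xi \<in> R"
proof -
  have "f (of_nat (p ^ Suc k) * rep (yk k)) = f xi"
    using mul_f[of "p ^ Suc k" "rep (yk k)"] f_rep[OF yk(1)] yk(2) by simp
  then show ?thesis unfolding f_eq by (simp add: up_def mult.assoc)
qed

lemma up_height: "up k \<in> pdiv p R k" "up k \<notin> pdivw p R"
proof -
  show "up k \<in> pdiv p R k" unfolding up_def by (rule power_in_pdiv[OF R])
  show "up k \<notin> pdivw p R"
    using xi(2)[of "up k"] subgrp_uminus[OF R up_xi[of k]] by auto
qed

definition ht :: "nat \<Rightarrow> nat" where "ht k = (LEAST h. up k \<notin> pdiv p R (Suc h))"

lemma ht: "up k \<in> pdiv p R h \<longleftrightarrow> h \<le> ht k"
proof -
  obtain h0 where "up k \<notin> pdiv p R h0" using up_height(2) by (auto simp: pdivw_def)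
  then have "up k \<notin> pdiv p R (Suc h0)" using pdiv_antimono[OF R, of h0 "Suc h0"] by auto
  then have 1: "up k \<notin> pdiv p R (Suc (ht k))" unfolding ht_def by (rule LeastI)
  have 2: "up k \<in> pdiv p R (ht k)"
  proof (cases "ht k")
    case 0 then show ?thesis using pdiv_0[OF R] by simp
  next
    case (Suc h) then show ?thesis using not_less_Least[of h "\<lambda>h. up k \<notin> pdiv p R (Suc h)"] by (simp add: ht_def)
  qed
  show ?thesis using pdiv_antimono[OF R _ 2, of h] pdiv_antimono[OF R, of "Suc (ht k)" h "up k"] 1 by (meson not_less_eq_eq)
qed

lemma ht_ge: "k \<le> ht k" using up_height(1) ht by blast

text \<open>\<open>xi\<close> has infinite height, so it equals \<open>p ^ (h + 2) y\<close> modulo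
  \<open>R\<close>, where \<open>h\<close> is \<open>ht k\<close>. Then \<open>up k\<close> minus
  \<open>p ^ (h + 1) y\<close> is killed by \<open>p\<close> and has height exactly
  \<open>h\<close>, so the Ulm quotient at \<open>h\<close> is nonzero and has a basis
  element.\<close>

lemma ht_Bk: "\<exists>e. Bk (ht k) e"
proof (rule ccontr)
  assume neg: "\<nexists>e. Bk (ht k) e"
  let ?h = "ht k"
  note D = subgrp_pdiv[OF R, of p]
  have "xi \<in> pdiv p R (Suc (Suc ?h))" using xi(1) by (simp add: pdivw_def)
  then obtain y where y: "xi - of_nat p ^ Suc (Suc ?h) * y \<in> R" unfolding pdiv_def by blast
  let ?e = "up k - of_nat p ^ Suc ?h * y"
  have "(of_nat p * up k - xi) + (xi - of_nat p ^ Suc (Suc ?h) * y) \<in> R" by (rule subgrp_add[OF R up_xi y])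
  then have "of_nat p * ?e \<in> R" by (simp add: algebra_simps)
  moreover have py: "of_nat p ^ Suc ?h * y \<in> pdiv p R (Suc ?h)" by (rule power_in_pdiv[OF R])
  moreover have "?e \<in> pdiv p R ?h"
    using subgrp_diff[OF D _ pdiv_antimono[OF R _ py, of ?h]] ht[of k ?h] by simp
  ultimately have e: "?e \<in> psocle p R ?h" by (simp add: psocle_def)
  have ne: "?e \<notin> pdiv p R (Suc ?h)"
  proof
    assume "?e \<in> pdiv p R (Suc ?h)"
    from subgrp_add[OF D this py] have "up k \<in> pdiv p R (Suc ?h)" by simp
    then show False using ht[of k "Suc ?h"] by simp
  qed
  have "finsupp p {e. Bk ?h e} = {\<lambda>_. 0}" using neg prime_gt_0_nat[OF p] by (auto simp: finsupp_def fun_eq_iff)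
  then have "ulm_quot p R ?h \<approx> {\<lambda>_ :: nat. 0 :: nat}" using ulm_quot_Bk[of ?h] by simp
  then obtain q where "bij_betw q (ulm_quot p R ?h) {\<lambda>_ :: nat. 0 :: nat}" by (auto simp: eqpoll_def)
  then have "a = b" if "a \<in> ulm_quot p R ?h" "b \<in> ulm_quot p R ?h" for a b
    using that bij_betwE[of q] bij_betw_imp_inj_on[THEN inj_onD, of q _ _ a b] by force
  moreover have "pclass p R ?h ?e \<in> ulm_quot p R ?h" using e by (simp add: ulm_quot_def)
  moreover have "pclass p R ?h 0 \<in> ulm_quot p R ?h"
    using subgrp_zero[OF R] subgrp_zero[OF D] by (auto simp: ulm_quot_def psocle_def)
  ultimately have "pclass p R ?h ?e = pclass p R ?h 0" by blast
  then show False using ne pclass_eq_iff[OF R] by simp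
qed

section \<open>A strictly increasing sequence of such heights, approximated from below\<close>

definition mx :: "nat \<Rightarrow> nat \<Rightarrow> nat" where
  "mx k s = rec_nat 0 (\<lambda>h r. if \<exists>y<s. y \<in> univ A \<and> mul (p ^ Suc h) y = u k then Suc h else r) s"

text \<open>A running maximum of the height approximations. It is nondecreasing in the index as well
  as in the stage, so composing these approximations keeps them nondecreasing; its limit is still
  one of the heights \<open>ht j\<close>.\<close>

definition FF :: "nat \<Rightarrow> nat \<Rightarrow> nat" where
  "FF k s = rec_nat (mx 0 s) (\<lambda>j r. if r \<le> mx (Suc j) s then mx (Suc j) s else r) k"

text \<open>The index at each step is one more than the previous value. Since the
  \<open>k\<close>-th height is at least \<open>k\<close>, the limits \<open>qq\<close> increase
  strictly.\<close>

definition qs :: "nat \<Rightarrow> nat \<Rightarrow> nat" where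
  "qs m s = rec_nat (FF 0 s) (\<lambda>_ r. FF (Suc r) s) m"

lemma yk_in [rec_intros]: "h \<in> C \<Longrightarrow> (\<lambda>x. yk (h x)) \<in> C"
proof -
  have "yk \<in> C" unfolding yk_def
  proof (rule Least_in)
    show "decid (\<lambda>z. p1 z \<in> univ A \<and> mul (p ^ Suc (p2 z)) (p1 z) = f xi)" by (intro rec_intros)
    show "\<exists>y. y \<in> univ A \<and> mul (p ^ Suc k) y = f xi" for k using yk by blast
  qed
  then show "h \<in> C \<Longrightarrow> (\<lambda>x. yk (h x)) \<in> C" by (rule comp_in)
qed

lemma u_in [rec_intros]: "h \<in> C \<Longrightarrow> (\<lambda>x. u (h x)) \<in> C"
  unfolding u_def by (intro rec_intros)

lemma qs_in: "(\<lambda>z. qs (p1 z) (p2 z)) \<in> C"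
proof -
  have mx: "(\<lambda>x. mx (a x) (b x)) \<in> C" if "a \<in> C" "b \<in> C" for a b
    unfolding mx_def by (intro rec_intros that comp_in[OF that(1)] comp_in[OF that(2)])
  have FF: "(\<lambda>x. FF (a x) (b x)) \<in> C" if "a \<in> C" "b \<in> C" for a b
    unfolding FF_def by (intro rec_intros mx that comp_in[OF that(1)] comp_in[OF that(2)])
  show ?thesis unfolding qs_def by (intro rec_intros FF)
qed

lemma mx_char: "h \<le> mx k s \<longleftrightarrow> h = 0 \<or> (\<exists>j y. h \<le> Suc j \<and> j < s \<and> y < s \<and> y \<in> univ A \<and> mul (p ^ Suc j) y = u k)"
proof -
  have "h \<le> rec_nat 0 (\<lambda>h r. if \<exists>y<s. y \<in> univ A \<and> mul (p ^ Suc h) y = u k then Suc h else r) n \<longleftrightarrow>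
      h = 0 \<or> (\<exists>j y. h \<le> Suc j \<and> j < n \<and> y < s \<and> y \<in> univ A \<and> mul (p ^ Suc j) y = u k)" for n
  proof (induction n)
    case (Suc n)
    show ?case
    proof (cases "\<exists>y<s. y \<in> univ A \<and> mul (p ^ Suc n) y = u k")
      case True
      then show ?thesis using less_Suc_eq_le by auto
    next
      case False
      then show ?thesis using Suc by (auto simp: less_Suc_eq)
    qed
  qed simp
  then show ?thesis unfolding mx_def .
qed

lemma mx_mono: "s \<le> s' \<Longrightarrow> mx k s \<le> mx k s'"
proof -
  assume ss: "s \<le> s'"
  have "mx k s \<le> mx k s" by simp
  then have "mx k s = 0 \<or> (\<exists>j y. mx k s \<le> Suc j \<and> j < s \<and> y < s \<and> y \<in> univ A \<and> mul (p ^ Suc j) y = u k)"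
    unfolding mx_char[of "mx k s"] .
  then show ?thesis unfolding mx_char[of "mx k s" k s'] using ss by (meson less_le_trans)
qed

lemma mx_lim: "\<exists>s0. \<forall>s\<ge>s0. mx k s = ht k"
proof -
  have le: "mx k s \<le> ht k" for s
  proof (cases "mx k s")
    case (Suc h)
    then have "Suc h \<le> mx k s" by simp
    then obtain j y where j: "Suc h \<le> Suc j" "y \<in> univ A" "mul (p ^ Suc j) y = u k" unfolding mx_char by auto
    then have "up k \<in> pdiv p R (Suc j)" using ex_root[of "Suc j" "up k"] u_up by auto
    then show ?thesis using ht j(1) Suc by (metis le_trans)
  qed simp
  show ?thesis
  proof (cases "ht k")
    case 0
    then show ?thesis using le by auto
  next
    case (Suc h)
    then obtain y where y: "y \<in> univ A" "mul (p ^ Suc h) y = u k" using ht[of k "ht k"] ex_root[of "Suc h" "up k"] u_up by auto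
    have "ht k \<le> mx k s" if "s \<ge> Suc (max h y)" for s
      unfolding mx_char using y that Suc by (intro disjI2 exI[of _ h] exI[of _ y]) auto
    then show ?thesis using le by (intro exI[of _ "Suc (max h y)"]) (auto intro: antisym)
  qed
qed

definition FL :: "nat \<Rightarrow> nat" where "FL k = Max (ht ` {..k})"
definition qq :: "nat \<Rightarrow> nat" where "qq m = rec_nat (FL 0) (\<lambda>_ r. FL (Suc r)) m"

lemma FF_max: "FF k s = Max ((\<lambda>j. mx j s) ` {..k})"
proof (induction k)
  case (Suc k)
  have "FF (Suc k) s = max (mx (Suc k) s) (FF k s)" by (simp add: FF_def max_def)
  then show ?case using Suc by (simp add: atMost_Suc)
qed (simp add: FF_def)

lemma FF_mono: "k \<le> k' \<Longrightarrow> s \<le> s' \<Longrightarrow> FF k s \<le> FF k' s'"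
proof -
  assume ks: "k \<le> k'" "s \<le> s'"
  have "mx j s \<le> Max ((\<lambda>j. mx j s') ` {..k'})" if "j \<le> k" for j
  proof -
    have "mx j s \<le> mx j s'" by (rule mx_mono[OF ks(2)])
    also have "\<dots> \<le> Max ((\<lambda>j. mx j s') ` {..k'})" using that ks(1) by (intro Max_ge) auto
    finally show ?thesis .
  qed
  then show ?thesis unfolding FF_max by (subst Max_le_iff) auto
qed

lemma FF_lim: "\<exists>s0. \<forall>s\<ge>s0. FF k s = FL k"
proof (induction k)
  case 0
  then show ?case using mx_lim[of 0] by (simp add: FF_def FL_def)
next
  case (Suc k)
  obtain s0 where s0: "\<forall>s\<ge>s0. FF k s = FL k" using Suc by blast
  obtain s1 where s1: "\<forall>s\<ge>s1. mx (Suc k) s = ht (Suc k)" using mx_lim by blast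
  have "FF (Suc k) s = FL (Suc k)" if "s \<ge> max s0 s1" for s
  proof -
    have "FF (Suc k) s = max (mx (Suc k) s) (FF k s)" by (simp add: FF_def max_def)
    also have "\<dots> = max (ht (Suc k)) (FL k)" using s0 s1 that by simp
    finally show ?thesis by (simp add: FL_def atMost_Suc)
  qed
  then show ?case by blast
qed

lemma qs_mono: "s \<le> s' \<Longrightarrow> qs m s \<le> qs m s'"
  by (induction m) (auto simp: qs_def intro: FF_mono)

lemma qs_lim: "\<exists>s0. \<forall>s\<ge>s0. qs m s = qq m"
proof (induction m)
  case 0
  then show ?case using FF_lim[of 0] by (simp add: qs_def qq_def)
next
  case (Suc m)
  obtain s0 where s0: "\<forall>s\<ge>s0. qs m s = qq m" using Suc by blast
  obtain s1 where s1: "\<forall>s\<ge>s1. FF (Suc (qq m)) s = FL (Suc (qq m))" using FF_lim by blast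
  have "qs (Suc m) s = qq (Suc m)" if "s \<ge> max s0 s1" for s
  proof -
    have "qs (Suc m) s = FF (Suc (qs m s)) s" by (simp add: qs_def)
    then show ?thesis using s0 s1 that by (simp add: qq_def)
  qed
  then show ?case by blast
qed

lemma FL_in: "\<exists>j. FL k = ht j"
proof -
  have "FL k \<in> ht ` {..k}" unfolding FL_def by (rule Max_in) auto
  then show ?thesis by blast
qed

lemma FL_ge: "k \<le> FL k"
proof -
  have "ht k \<le> FL k" unfolding FL_def by (rule Max_ge) auto
  then show ?thesis using ht_ge[of k] by simp
qed

lemma qq_in: "\<exists>j. qq m = ht j"
  using FL_in by (cases m) (auto simp: qq_def)

lemma qq_less: "m < n \<Longrightarrow> qq m < qq n"
proof (rule lift_Suc_mono_less[of qq])
  fix m show "qq m < qq (Suc m)" using FL_ge[of "Suc (qq m)"] by (simp add: qq_def)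
qed

lemma qq_ge: "m \<le> qq m"
proof (induction m)
  case (Suc m) then show ?case using qq_less[of m "Suc m"] by simp
qed simp

text \<open>The least basis element is withheld at each order in the range of \<open>qq\<close>; the
  chain occupying the corresponding slot will supply that dimension. The bound on \<open>m\<close>
  loses nothing because \<open>m \<le> qq m\<close>, and it keeps the condition decidable in one
  jump.\<close>

definition Ek :: "nat \<Rightarrow> nat \<Rightarrow> bool" where
  "Ek k e \<longleftrightarrow> Bk k e \<and> \<not> ((\<exists>m<Suc k. qq m = k) \<and> (\<forall>e'<e. \<not> Bk k e'))"

lemma decid_Ek: "clone.decid (jump C) (\<lambda>z. Ek (p1 z) (p2 z))"
proof -
  interpret J: clone "jump C" by (rule clone_jump)
  have qq: "qq \<in> jump C" by (rule lim_seq_in_jump[OF qs_in qs_lim])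
  have Bk: "J.decid (\<lambda>x. Bk (a x) (b x))" if "a \<in> jump C" "b \<in> jump C" for a b
    using J.decid_app2[OF decid_Bk] that by blast
  show ?thesis unfolding Ek_def by (intro rec_intros Bk J.comp_in[OF qq])
qed

lemma Ek_cases:
  shows "(\<And>m. qq m \<noteq> k) \<Longrightarrow> Ek k e \<longleftrightarrow> Bk k e"
    and "qq m = k \<Longrightarrow> \<exists>e0. Bk k e0 \<and> (\<forall>e. Ek k e \<longleftrightarrow> Bk k e \<and> e \<noteq> e0)"
proof -
  show "(\<And>m. qq m \<noteq> k) \<Longrightarrow> Ek k e \<longleftrightarrow> Bk k e" by (simp add: Ek_def)
  assume m: "qq m = k"
  then have mk: "\<exists>m<Suc k. qq m = k" using qq_ge[of m] by (intro exI[of _ m]) simp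
  have "\<exists>e. Bk k e" using qq_in[of m] ht_Bk m by auto
  then have 1: "Bk k (LEAST e. Bk k e)" by (rule LeastI_ex)
  have "Ek k e \<longleftrightarrow> Bk k e \<and> e \<noteq> (LEAST e. Bk k e)" for e
  proof -
    have "Bk k e \<Longrightarrow> (\<forall>e'<e. \<not> Bk k e') \<longleftrightarrow> e = (LEAST e. Bk k e)"
      using not_less_Least[of _ "Bk k"] 1 Least_le[of "Bk k" e] by (metis le_neq_implies_less)
    then show ?thesis unfolding Ek_def using mk by blast
  qed
  then show "\<exists>e0. Bk k e0 \<and> (\<forall>e. Ek k e \<longleftrightarrow> Bk k e \<and> e \<noteq> e0)" using 1 by blast
qed

end

subsection \<open>Guessing a presentation computable in the double jump\<close>

text \<open>Row \<^term>\<open>i\<close> of the \<^term>\<open>n\<close>-th presentation is \<^term>\<open>row n i\<close>: zero for a dead generator, and otherwise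
  one more than a code of the coefficients.  It is a limit of limits of the computable function \<^term>\<open>G2\<close>.
  A string guesses the first rows together with the least moduli of convergence; being correct is a \<open>\<Pi>\<^sub>2\<close>
  property, and correct strings are exactly those which are prefixes of infinitely many visits.\<close>

locale stepc = cgroup_long C p A f R g xi for C p A f R g xi +
  fixes row :: "nat \<Rightarrow> nat \<Rightarrow> nat" and G1 :: "nat \<Rightarrow> nat \<Rightarrow> nat \<Rightarrow> nat" and G2 :: "nat \<Rightarrow> nat \<Rightarrow> nat \<Rightarrow> nat \<Rightarrow> nat"
    and Es :: "nat \<Rightarrow> nat \<Rightarrow> nat \<Rightarrow> bool"
  assumes G2_in: "(\<lambda>z. G2 (p1 z) (p1 (p2 z)) (p1 (p2 (p2 z))) (p2 (p2 (p2 z)))) \<in> C"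
    and G2_lim: "\<And>n i t. \<exists>s0. \<forall>s\<ge>s0. G2 n i t s = G1 n i t"
    and G1_lim: "\<And>n i. \<exists>t0. \<forall>t\<ge>t0. G1 n i t = row n i"
    and Es_in: "decid (\<lambda>z. Es (p1 z) (p1 (p2 z)) (p2 (p2 z)))"
    and Es_lim: "\<And>k e. \<exists>s0. \<forall>s\<ge>s0. Es k e s \<longleftrightarrow> Ek k e"
begin

lemma G2_comp [rec_intros]:
  assumes "a \<in> C" "b \<in> C" "c \<in> C" "d \<in> C" shows "(\<lambda>x. G2 (a x) (b x) (c x) (d x)) \<in> C"
  using comp_in[OF G2_in, of "\<lambda>x. pr (a x) (pr (b x) (pr (c x) (d x)))"] assms by (simp add: pair_in)

lemma Es_comp [rec_intros]:
  "a \<in> C \<Longrightarrow> b \<in> C \<Longrightarrow> c \<in> C \<Longrightarrow> decid (\<lambda>x. Es (a x) (b x) (c x))"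
  by (rule decid_app3[OF Es_in])

definition ent :: "nat \<Rightarrow> nat \<Rightarrow> nat" where "ent s i = nthc (p2 (p1 s)) i"
definition len :: "nat \<Rightarrow> nat" where "len s = p1 (p1 s)"

text \<open>An entry claims a row value and a modulus. The first test demands the value from the
  modulus onwards, the second a different value just before it, so only the least modulus passes in
  the limit and a correct prefix has uniquely determined entries.\<close>

definition okr :: "nat \<Rightarrow> nat \<Rightarrow> nat \<Rightarrow> nat \<Rightarrow> bool" where
  "okr n a t r \<longleftrightarrow> (\<forall>i<p1 a. (p2 (nthc (p2 a) i) \<le> t \<longrightarrow> G2 n i t r = p1 (nthc (p2 a) i)) \<and>
    (p2 (nthc (p2 a) i) = 0 \<or> G2 n i (p2 (nthc (p2 a) i) - 1) r \<noteq> p1 (nthc (p2 a) i)))"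

definition okT :: "nat \<Rightarrow> nat \<Rightarrow> nat \<Rightarrow> nat \<Rightarrow> bool" where
  "okT n a T r \<longleftrightarrow> T \<le> r \<and> (\<forall>t<T. okr n a t r)"

text \<open>A visit records the string, the number of tests passed and the least stage confirming
  this. Minimality makes a visit depend only on the first two, and
  \<open>p1 s \<le> p1 (p2 s)\<close> leaves finitely many strings for each number of tests. Hence a
  failing test bounds the visits to all extensions of a wrong prefix together.\<close>

definition visit :: "nat \<Rightarrow> nat \<Rightarrow> bool" where
  "visit n s \<longleftrightarrow> p1 s \<le> p1 (p2 s) \<and> okT n (p1 s) (p1 (p2 s)) (p2 (p2 s)) \<and>
    (\<forall>r<p2 (p2 s). \<not> okT n (p1 s) (p1 (p2 s)) r)"

definition agree :: "nat \<Rightarrow> nat \<Rightarrow> nat \<Rightarrow> bool" where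
  "agree j s s' \<longleftrightarrow> (\<forall>i<j. ent s i = ent s' i)"

definition modulus :: "nat \<Rightarrow> nat \<Rightarrow> nat" where
  "modulus n i = (LEAST m. \<forall>t\<ge>m. G1 n i t = row n i)"

definition correct :: "nat \<Rightarrow> nat \<Rightarrow> nat \<Rightarrow> bool" where
  "correct n j s \<longleftrightarrow> (\<forall>i<j. ent s i = pr (row n i) (modulus n i))"

lemma len_le: "len s \<le> s"
  unfolding len_def by (meson le_trans p1_le)

lemma modulus: "t \<ge> modulus n i \<Longrightarrow> G1 n i t = row n i"
  using LeastI_ex[OF G1_lim[of n i]] unfolding modulus_def by blast

lemma modulus_pred: "modulus n i = 0 \<or> G1 n i (modulus n i - 1) \<noteq> row n i"
proof (rule ccontr)
  assume neg: "\<not> ?thesis"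
  have "\<forall>t\<ge>modulus n i - 1. G1 n i t = row n i"
  proof (intro allI impI)
    fix t assume "modulus n i - 1 \<le> t"
    then show "G1 n i t = row n i" using neg modulus[of n i t] by (cases "t = modulus n i - 1") auto
  qed
  then have "modulus n i \<le> modulus n i - 1" unfolding modulus_def[of n i] by (rule Least_le)
  moreover have "modulus n i \<noteq> 0" using neg unfolding de_Morgan_disj by (rule conjunct1)
  ultimately show False by (cases "modulus n i") simp_all
qed

text \<open>For a correct string every test is eventually passed for good, so each sufficiently
  large number of tests yields a visit.\<close>

lemma infinite_visits: "infinite {s. visit n s \<and> len s = j \<and> correct n j s}"
proof -
  obtain z where z: "\<forall>i<j. nthc z i = pr (row n i) (modulus n i)" using ex_nthc[of j "\<lambda>i. pr (row n i) (modulus n i)"] by blast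
  define a where "a = pr j z"
  have okr: "\<exists>r0. \<forall>r\<ge>r0. okr n a t r" for t
  proof -
    have "\<exists>r0. \<forall>r\<ge>r0. G2 n i t r = G1 n i t \<and> G2 n i (modulus n i - 1) r = G1 n i (modulus n i - 1)" for i
    proof -
      obtain r0 where "\<forall>r\<ge>r0. G2 n i t r = G1 n i t" using G2_lim by blast
      moreover obtain r1 where "\<forall>r\<ge>r1. G2 n i (modulus n i - 1) r = G1 n i (modulus n i - 1)" using G2_lim by blast
      ultimately show ?thesis by (intro exI[of _ "max r0 r1"]) simp
    qed
    then obtain r0 where r0: "\<And>i r. r \<ge> r0 i \<Longrightarrow> G2 n i t r = G1 n i t \<and> G2 n i (modulus n i - 1) r = G1 n i (modulus n i - 1)"
      by metis
    let ?r = "Max (insert 0 (r0 ` {..<j}))"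
    have "okr n a t r" if r: "r \<ge> ?r" for r
      unfolding okr_def
    proof (intro allI impI)
      fix i assume "i < p1 a"
      then have i: "i < j" by (simp add: a_def)
      have "r0 i \<le> ?r" using i by simp
      then have G: "G2 n i t r = G1 n i t" "G2 n i (modulus n i - 1) r = G1 n i (modulus n i - 1)" using r0[of i r] r by auto
      have e: "nthc (p2 a) i = pr (row n i) (modulus n i)" using z i by (simp add: a_def)
      show "(p2 (nthc (p2 a) i) \<le> t \<longrightarrow> G2 n i t r = p1 (nthc (p2 a) i)) \<and>
          (p2 (nthc (p2 a) i) = 0 \<or> G2 n i (p2 (nthc (p2 a) i) - 1) r \<noteq> p1 (nthc (p2 a) i))"
        unfolding e using G modulus[of n i t] modulus_pred[of n i] by simp
    qed
    then show ?thesis by blast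
  qed
  have ex: "\<exists>r. okT n a T r" for T
  proof -
    obtain r0 where r0: "\<And>t r. r \<ge> r0 t \<Longrightarrow> okr n a t r" using okr by metis
    let ?r = "Max (insert T (r0 ` {..<T}))"
    have "okr n a t ?r" if "t < T" for t using that by (intro r0) simp
    then have "okT n a T ?r" unfolding okT_def by simp
    then show ?thesis by blast
  qed
  have v: "visit n (pr a (pr T (LEAST r. okT n a T r)))" if aT: "a \<le> T" for T
  proof -
    let ?r = "LEAST r. okT n a T r"
    have "okT n a T ?r" using ex[of T] by (rule LeastI_ex)
    moreover have "\<not> okT n a T r" if "r < ?r" for r using that by (rule not_less_Least)
    ultimately show ?thesis unfolding visit_def p1_pr p2_pr using aT by blast
  qed
  let ?F = "\<lambda>T. pr a (pr T (LEAST r. okT n a T r))"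
  have "inj_on ?F {a..}" by (auto simp: inj_on_def)
  then have "infinite (?F ` {a..})" by (simp add: finite_image_iff infinite_Ici)
  moreover have "?F ` {a..} \<subseteq> {s. visit n s \<and> len s = j \<and> correct n j s}"
  proof
    fix s assume "s \<in> ?F ` {a..}"
    then obtain T where s: "s = ?F T" "a \<le> T" by auto
    have "len s = j" "correct n j s" using z by (simp_all add: s(1) len_def correct_def ent_def a_def)
    then show "s \<in> {s. visit n s \<and> len s = j \<and> correct n j s}" using v[OF s(2)] s(1) by simp
  qed
  ultimately show ?thesis using finite_subset by blast
qed

lemma finite_visits:
  assumes "\<not> correct n j s0"
  shows "finite {s. visit n s \<and> j \<le> len s \<and> agree j s s0}"
proof -
  obtain i where i: "i < j" "ent s0 i \<noteq> pr (row n i) (modulus n i)" using assms by (auto simp: correct_def)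
  define v where "v = p1 (ent s0 i)"
  define m where "m = p2 (ent s0 i)"
  \<comment> \<open>A wrong entry either claims a value contradicted at some \<open>t\<close> from
    its modulus on, or is not the least modulus. Otherwise it would coincide with the true row and
    its least modulus.\<close>
  have "\<exists>t. m \<le> t \<and> G1 n i t \<noteq> v \<or> \<not> (m = 0 \<or> G1 n i (m - 1) \<noteq> v)"
  proof (rule ccontr)
    assume neg: "\<not> ?thesis"
    then have 1: "\<And>t. m \<le> t \<Longrightarrow> G1 n i t = v" and 2: "m = 0 \<or> G1 n i (m - 1) \<noteq> v" by auto
    have v: "v = row n i" using 1[of "max m (modulus n i)"] modulus[of n i "max m (modulus n i)"] by simp
    have "modulus n i \<le> m" unfolding modulus_def using 1 v by (intro Least_le) simp
    moreover have "\<not> modulus n i < m"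
    proof
      assume less: "modulus n i < m"
      then have "modulus n i \<le> m - 1" by (cases m) simp_all
      then have "G1 n i (m - 1) = v" using modulus v by simp
      then show False using 2 less by simp
    qed
    ultimately have "m = modulus n i" by simp
    then show False using i(2) v unfolding v_def m_def by (metis pr_p1_p2)
  qed
  then obtain t where t: "m \<le> t \<and> G1 n i t \<noteq> v \<or> \<not> (m = 0 \<or> G1 n i (m - 1) \<noteq> v)" by blast
  obtain r0 where r0: "\<forall>r\<ge>r0. G2 n i t r = G1 n i t" using G2_lim by blast
  obtain r1 where r1: "\<forall>r\<ge>r1. G2 n i (m - 1) r = G1 n i (m - 1)" using G2_lim by blast
  let ?r = "max r0 r1" let ?N = "Suc t + ?r"
  let ?V = "{s. visit n s \<and> j \<le> len s \<and> agree j s s0}"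
  have notok: "\<not> okr n (p1 s) t r" if s: "s \<in> ?V" "r \<ge> ?r" for s r
  proof -
    have "nthc (p2 (p1 s)) i = ent s0 i" using s i(1) by (auto simp: agree_def ent_def)
    moreover have "i < p1 (p1 s)" using s i(1) by (simp add: len_def)
    moreover have "G2 n i t r = G1 n i t" "G2 n i (m - 1) r = G1 n i (m - 1)" using r0 r1 s(2) by auto
    ultimately show ?thesis using t unfolding okr_def v_def m_def by auto
  qed
  have T: "p1 (p2 s) < ?N \<and> p1 s < ?N" if s: "s \<in> ?V" for s
  proof -
    have ok: "okT n (p1 s) (p1 (p2 s)) (p2 (p2 s))" and le: "p1 s \<le> p1 (p2 s)" using s by (auto simp: visit_def)
    have "p1 (p2 s) < ?N"
    proof (rule ccontr)
      assume big: "\<not> p1 (p2 s) < ?N"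
      then have "okr n (p1 s) t (p2 (p2 s))" "p2 (p2 s) \<ge> ?r" using ok by (auto simp: okT_def)
      then show False using notok[OF s] by blast
    qed
    then show ?thesis using le by simp
  qed
  have "inj_on (\<lambda>s. (p1 s, p1 (p2 s))) ?V"
  proof (rule inj_onI)
    fix s s' assume s: "s \<in> ?V" "s' \<in> ?V" and eq: "(p1 s, p1 (p2 s)) = (p1 s', p1 (p2 s'))"
    have "\<not> p2 (p2 s) < p2 (p2 s')" "\<not> p2 (p2 s') < p2 (p2 s)" using s eq unfolding visit_def by auto
    then have "p2 (p2 s) = p2 (p2 s')" by simp
    then show "s = s'" using eq by (metis pr_p1_p2 prod.inject)
  qed
  moreover have "(\<lambda>s. (p1 s, p1 (p2 s))) ` ?V \<subseteq> {..<?N} \<times> {..<?N}" using T by blast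
  ultimately show ?thesis by (rule inj_on_finite) simp
qed

definition isnode :: "nat \<Rightarrow> nat \<Rightarrow> nat \<Rightarrow> bool" where
  "isnode n s j \<longleftrightarrow> visit n s \<and> 1 \<le> j \<and> j \<le> len s \<and> p1 (ent s (j - 1)) \<noteq> 0"

text \<open>There are three kinds of chains.  \<open>3 * pr s j\<close> is attached to the prefix of length \<open>j\<close> of the string visited at
  \<open>s\<close>.  \<open>3 * pr k (pr e s0) + 1\<close> is created at a stage \<open>s0\<close> from which \<open>e\<close> looks like a basis element of the \<open>k\<close>-th
  Ulm quotient; if that guess is revised at \<open>s\<close>, the chain is dumped, that is, lengthened to the slot \<open>2 * x\<close>
  of \<open>qq\<close> where \<open>x\<close> codes the dump event.  The chains \<open>3 * x + 2\<close> fill the slots \<open>2 * x\<close> of the \<open>x\<close> which are not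
  dump events.\<close>

definition validd :: "nat \<Rightarrow> bool" where
  "validd d \<longleftrightarrow> Es (p1 d) (p1 (p2 d)) (p2 (p2 d)) \<and> (p2 (p2 d) = 0 \<or> \<not> Es (p1 d) (p1 (p2 d)) (p2 (p2 d) - 1))"

definition dumpev :: "nat \<Rightarrow> bool" where
  "dumpev x \<longleftrightarrow> validd (p1 x) \<and> p2 (p2 (p1 x)) < p2 x \<and> \<not> Es (p1 (p1 x)) (p1 (p2 (p1 x))) (p2 x) \<and>
    (\<forall>s<p2 x. p2 (p2 (p1 x)) \<le> s \<longrightarrow> Es (p1 (p1 x)) (p1 (p2 (p1 x))) s)"

definition Ch :: "nat \<Rightarrow> bool" where
  "Ch c \<longleftrightarrow> (if c mod 3 = 0 then p2 (c div 3) \<le> p1 (c div 3)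
    else if c mod 3 = 1 then validd (c div 3) else \<not> dumpev (c div 3))"

text \<open>A node is named by the first stage at which the same prefix was visited. Prefixes are
  compared entrywise because codes of sequences are not unique; the second disjunct only bounds the
  search, as the chain itself qualifies.\<close>

definition fsn :: "nat \<Rightarrow> nat \<Rightarrow> nat" where
  "fsn n c = (if c mod 3 = 0 \<and> isnode n (p1 (c div 3)) (p2 (c div 3))
    then 3 * pr (LEAST s. (isnode n s (p2 (c div 3)) \<and> agree (p2 (c div 3)) s (p1 (c div 3))) \<or> p1 (c div 3) \<le> s) (p2 (c div 3))
    else c)"

text \<open>Coefficients are read from the last row of the guessed prefix and attached to the nodes
  of shorter prefixes of the same string. A prefix of length \<open>j\<close> stands for generator
  \<open>j - 1\<close>, and a live row is one more than its code; hence the subtractions.\<close>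

definition wwn :: "nat \<Rightarrow> nat \<Rightarrow> nat \<Rightarrow> nat" where
  "wwn n c c' = (if c mod 3 = 0 \<and> isnode n (p1 (c div 3)) (p2 (c div 3)) \<and>
      c' mod 3 = 0 \<and> p2 (c' div 3) < p2 (c div 3) \<and> isnode n (p1 (c div 3)) (p2 (c' div 3)) \<and>
      c' = fsn n (3 * pr (p1 (c div 3)) (p2 (c' div 3)))
    then nthc (p1 (ent (p1 (c div 3)) (p2 (c div 3) - 1)) - 1) (p2 (c' div 3) - 1) else 0)"

text \<open>After a dump the approximation passes from the resting order to that of the slot. The
  maximum is taken so that it never decreases; in the limit the slot value is at least the resting
  order, because \<open>qq m \<ge> m\<close>.\<close>

definition Qt :: "nat \<Rightarrow> nat \<Rightarrow> nat" where
  "Qt c t = (if c mod 3 = 0 then qs (2 * pr (p1 (c div 3) - p2 (c div 3)) (p2 (c div 3)) + 1) t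
    else if c mod 3 = 1 then
      (if \<exists>s1\<le>t. dumpev (pr (c div 3) s1)
       then (if p1 (c div 3) \<le> qs (2 * pr (c div 3) (LEAST s1. dumpev (pr (c div 3) s1) \<or> t \<le> s1)) t
         then qs (2 * pr (c div 3) (LEAST s1. dumpev (pr (c div 3) s1) \<or> t \<le> s1)) t else p1 (c div 3))
       else p1 (c div 3))
    else qs (2 * (c div 3)) t)"

text \<open>Odd slots belong to string chains, even ones to dumps and fillers. Using
  \<open>s - j\<close> rather than \<open>s\<close> places all prefixes visited at \<open>s\<close>
  on one diagonal, where shorter ones get larger slots; the order condition between finite nodes
  requires this.\<close>

definition Q :: "nat \<Rightarrow> nat" where
  "Q c = (if c mod 3 = 0 then qq (2 * pr (p1 (c div 3) - p2 (c div 3)) (p2 (c div 3)) + 1)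
    else if c mod 3 = 1 then
      (if \<exists>s1. dumpev (pr (c div 3) s1) then qq (2 * pr (c div 3) (THE s1. dumpev (pr (c div 3) s1)))
       else p1 (c div 3))
    else qq (2 * (c div 3)))"

text \<open>The extra level of a non-last chain is granted once a later chain of its node has
  appeared, so lengths still only grow.\<close>

definition Ltn :: "nat \<Rightarrow> nat \<Rightarrow> nat \<Rightarrow> nat" where
  "Ltn n c t = Qt c t + (if \<exists>c'\<le>t. c < c' \<and> Ch c' \<and> fsn n c' = fsn n c then 1 else 0)"

definition trn :: "nat \<Rightarrow> nat \<Rightarrow> bool" where "trn n c \<longleftrightarrow> infinite {c'. Ch c' \<and> fsn n c' = c}"
definition lastn :: "nat \<Rightarrow> nat \<Rightarrow> nat" where "lastn n c = Max {c'. Ch c' \<and> fsn n c' = c}"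

section \<open>Computability of the guessed presentation\<close>

lemma ent_in [rec_intros]: "a \<in> C \<Longrightarrow> b \<in> C \<Longrightarrow> (\<lambda>x. ent (a x) (b x)) \<in> C"
  and len_in [rec_intros]: "a \<in> C \<Longrightarrow> (\<lambda>x. len (a x)) \<in> C"
  unfolding ent_def len_def by (intro rec_intros; assumption)+

lemma visit_in [rec_intros]:
  assumes "a \<in> C" "b \<in> C" shows "decid (\<lambda>x. visit (a x) (b x))"
proof -
  have okr: "decid (\<lambda>x. okr (a x) (b x) (c x) (d x))" if "a \<in> C" "b \<in> C" "c \<in> C" "d \<in> C" for a b c d
    unfolding okr_def
    by (intro rec_intros that that[THEN comp_in])
  have okT: "decid (\<lambda>x. okT (a x) (b x) (c x) (d x))" if "a \<in> C" "b \<in> C" "c \<in> C" "d \<in> C" for a b c d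
    unfolding okT_def
    by (intro rec_intros okr that that[THEN comp_in])
  show ?thesis unfolding visit_def by (intro rec_intros okT assms assms[THEN comp_in])
qed

lemma isnode_in [rec_intros]:
  assumes "a \<in> C" "b \<in> C" "c \<in> C" shows "decid (\<lambda>x. isnode (a x) (b x) (c x))"
  unfolding isnode_def by (intro rec_intros assms)

lemma agree_in [rec_intros]:
  assumes "a \<in> C" "b \<in> C" "c \<in> C" shows "decid (\<lambda>x. agree (a x) (b x) (c x))"
  unfolding agree_def by (intro rec_intros assms assms[THEN comp_in])

lemma validd_in [rec_intros]: assumes "a \<in> C" shows "decid (\<lambda>x. validd (a x))"
  unfolding validd_def by (intro rec_intros assms)

lemma dumpev_in [rec_intros]: assumes "a \<in> C" shows "decid (\<lambda>x. dumpev (a x))"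
  unfolding dumpev_def by (intro rec_intros assms assms[THEN comp_in])

lemma decid_If:
  assumes "decid P" "decid P'" "decid S" shows "decid (\<lambda>x. if P x then P' x else S x)"
proof -
  have "decid (\<lambda>x. (P x \<longrightarrow> P' x) \<and> (\<not> P x \<longrightarrow> S x))" by (intro rec_intros assms)
  then show ?thesis by (simp add: if_bool_eq_conj)
qed

lemma Ch_in [rec_intros]: assumes "a \<in> C" shows "decid (\<lambda>x. Ch (a x))"
  unfolding Ch_def by (intro decid_If rec_intros assms)

lemma fsn_in [rec_intros]: assumes "a \<in> C" "b \<in> C" shows "(\<lambda>x. fsn (a x) (b x)) \<in> C"
  unfolding fsn_def by (intro rec_intros bounded_Least_in assms assms[THEN comp_in])

lemma qs_comp [rec_intros]: "a \<in> C \<Longrightarrow> b \<in> C \<Longrightarrow> (\<lambda>x. qs (a x) (b x)) \<in> C"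
  by (rule app2_in[OF qs_in])

lemma wwn_in [rec_intros]: assumes "a \<in> C" "b \<in> C" "c \<in> C" shows "(\<lambda>x. wwn (a x) (b x) (c x)) \<in> C"
  unfolding wwn_def by (intro rec_intros assms)

lemma Ltn_in [rec_intros]: assumes "a \<in> C" "b \<in> C" "c \<in> C" shows "(\<lambda>x. Ltn (a x) (b x) (c x)) \<in> C"
proof -
  have Qt: "(\<lambda>x. Qt (b x) (c x)) \<in> C"
    unfolding Qt_def by (intro rec_intros bounded_Least_in assms assms[THEN comp_in])
  show ?thesis unfolding Ltn_def by (intro rec_intros Qt assms assms[THEN comp_in])
qed

lemma ch_live_in [rec_intros]:
  assumes "a \<in> C" "b \<in> C" shows "decid (\<lambda>x. ch_live Ch (fsn (a x)) (Ltn (a x)) (b x))"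
  unfolding ch_live_def by (intro decid_If rec_intros assms)

lemma ch_rel_in:
  assumes "a \<in> C" "b \<in> C" "c \<in> C" shows "(\<lambda>x. ch_rel Ch (fsn (a x)) (wwn (a x)) (Ltn (a x)) (b x) (c x)) \<in> C"
  unfolding ch_rel_def by (intro rec_intros assms)

end

context stepc
begin

section \<open>Nodes as equal prefixes, and the axioms of chains\<close>

definition node :: "nat \<Rightarrow> nat \<Rightarrow> bool" where
  "node n c \<longleftrightarrow> c mod 3 = 0 \<and> isnode n (p1 (c div 3)) (p2 (c div 3))"

definition fs0 :: "nat \<Rightarrow> nat \<Rightarrow> nat \<Rightarrow> nat" where
  "fs0 n s j = (LEAST s'. (isnode n s' j \<and> agree j s' s) \<or> s \<le> s')"

lemma div_mod_3 [simp]: "(3 * x) mod 3 = 0" "(3 * x) div 3 = (x::nat)"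
  "(3 * x + 1) mod 3 = 1" "(3 * x + 1) div 3 = x" "(3 * x + 2) mod 3 = 2" "(3 * x + 2) div 3 = x"
  "Suc (3 * x) mod 3 = 1" "Suc (3 * x) div 3 = x" "Suc (Suc (3 * x)) mod 3 = 2" "Suc (Suc (3 * x)) div 3 = x"
  by presburger+

lemma cases_mod_3:
  obtains s j where "c = 3 * pr s j" | d where "c = 3 * d + 1" | x where "c = 3 * x + (2::nat)"
proof -
  have "c mod 3 = 0 \<or> c mod 3 = 1 \<or> c mod 3 = 2" by presburger
  then have "c = 3 * (c div 3) \<or> c = 3 * (c div 3) + 1 \<or> c = 3 * (c div 3) + 2" by presburger
  moreover have "c div 3 = pr (p1 (c div 3)) (p2 (c div 3))" by simp
  ultimately show ?thesis using that by metis
qed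

lemma node_iff: "node n c \<longleftrightarrow> (\<exists>s j. c = 3 * pr s j \<and> isnode n s j)"
proof
  assume n: "node n c"
  then have "c mod 3 = 0" unfolding node_def by blast
  then have "c = 3 * (c div 3)" by presburger
  then have "c = 3 * pr (p1 (c div 3)) (p2 (c div 3))" by simp
  then show "\<exists>s j. c = 3 * pr s j \<and> isnode n s j" using n unfolding node_def by blast
qed (auto simp: node_def)

lemma node_pr: "node n (3 * pr s j) \<longleftrightarrow> isnode n s j"
  by (simp add: node_def)

lemma agree_refl: "agree j s s" and agree_sym: "agree j s s' \<Longrightarrow> agree j s' s"
  and agree_trans: "agree j s s' \<Longrightarrow> agree j s' s'' \<Longrightarrow> agree j s s''"
  and agree_mono: "i \<le> j \<Longrightarrow> agree j s s' \<Longrightarrow> agree i s s'"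
  by (auto simp: agree_def)

lemma isnode_le: "isnode n s j \<Longrightarrow> 1 \<le> j \<and> j \<le> s"
  using len_le[of s] by (auto simp: isnode_def)

lemma fs0:
  assumes "isnode n s j"
  shows "isnode n (fs0 n s j) j" "agree j (fs0 n s j) s" "fs0 n s j \<le> s"
    "\<And>s'. isnode n s' j \<Longrightarrow> agree j s' s \<Longrightarrow> fs0 n s j \<le> s'"
proof -
  let ?P = "\<lambda>s'. (isnode n s' j \<and> agree j s' s) \<or> s \<le> s'"
  have s: "?P s" using assms agree_refl by blast
  show le: "fs0 n s j \<le> s" unfolding fs0_def by (rule Least_le[of ?P, OF s])
  have "?P (fs0 n s j)" unfolding fs0_def by (rule LeastI[of ?P, OF s])
  then have "isnode n (fs0 n s j) j \<and> agree j (fs0 n s j) s"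
  proof
    assume "s \<le> fs0 n s j"
    then have "fs0 n s j = s" using le by simp
    then show ?thesis using assms agree_refl by simp
  qed
  then show "isnode n (fs0 n s j) j" "agree j (fs0 n s j) s" by blast+
  show "fs0 n s j \<le> s'" if "isnode n s' j" "agree j s' s" for s'
    unfolding fs0_def using that by (intro Least_le) blast
qed

lemma fs0_eq:
  assumes "isnode n s j" "isnode n s' j" "agree j s s'" shows "fs0 n s j = fs0 n s' j"
proof (rule antisym)
  show "fs0 n s j \<le> fs0 n s' j"
    using fs0(4)[OF assms(1) fs0(1)[OF assms(2)]] agree_trans[OF fs0(2)[OF assms(2)] agree_sym[OF assms(3)]] .
  show "fs0 n s' j \<le> fs0 n s j"
    using fs0(4)[OF assms(2) fs0(1)[OF assms(1)]] agree_trans[OF fs0(2)[OF assms(1)] assms(3)] .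
qed

lemma fsn_node: "isnode n s j \<Longrightarrow> fsn n (3 * pr s j) = 3 * pr (fs0 n s j) j"
  by (simp add: fsn_def fs0_def)

lemma fsn_not_node: "\<not> node n c \<Longrightarrow> fsn n c = c"
  unfolding fsn_def node_def by (rule if_not_P)

lemma fsn_is_node: "node n (fsn n c) \<longleftrightarrow> node n c"
proof (cases "node n c")
  case True
  then obtain s j where "c = 3 * pr s j" "isnode n s j" unfolding node_iff by blast
  then show ?thesis using True fsn_node fs0(1) by (simp add: node_pr)
next
  case False then show ?thesis by (simp add: fsn_not_node)
qed

lemma fsn_eq_node:
  assumes "isnode n s j"
  shows "fsn n c' = fsn n (3 * pr s j) \<longleftrightarrow> (\<exists>s'. c' = 3 * pr s' j \<and> isnode n s' j \<and> agree j s' s)"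
proof
  assume eq: "fsn n c' = fsn n (3 * pr s j)"
  then have "node n c'" using fsn_is_node[of n c'] fsn_is_node[of n "3 * pr s j"] assms by (simp add: node_pr)
  then obtain s' j' where c': "c' = 3 * pr s' j'" "isnode n s' j'" unfolding node_iff by blast
  have "pr (fs0 n s' j') j' = pr (fs0 n s j) j" using eq unfolding c'(1) fsn_node[OF assms] fsn_node[OF c'(2)] by linarith
  then have h: "fs0 n s' j' = fs0 n s j \<and> j' = j" unfolding pr_eq_iff .
  have "agree j s' (fs0 n s j)" using agree_sym[OF fs0(2)[OF c'(2)]] h by metis
  from agree_trans[OF this fs0(2)[OF assms]]
  show "\<exists>s'. c' = 3 * pr s' j \<and> isnode n s' j \<and> agree j s' s" using c' h by blast
next
  assume "\<exists>s'. c' = 3 * pr s' j \<and> isnode n s' j \<and> agree j s' s"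
  then show "fsn n c' = fsn n (3 * pr s j)" using fsn_node fs0_eq assms by auto
qed

lemma fsn_eq_not_node: "\<not> node n c \<Longrightarrow> fsn n c' = fsn n c \<Longrightarrow> c' = c"
  using fsn_is_node[of n c'] fsn_is_node[of n c] fsn_not_node by metis

lemma fsn_idem: "fsn n (fsn n c) = fsn n c"
proof (cases "node n c")
  case True
  then obtain s j where c: "c = 3 * pr s j" "isnode n s j" unfolding node_iff by blast
  show ?thesis unfolding c(1) fsn_node[OF c(2)] fsn_node[OF fs0(1)[OF c(2)]]
    using fs0_eq[OF fs0(1)[OF c(2)] c(2) fs0(2)[OF c(2)]] by simp
next
  case False then show ?thesis by (simp add: fsn_not_node)
qed

lemma node_Ch: "node n c \<Longrightarrow> Ch c"
  unfolding node_iff using isnode_le by (auto simp: Ch_def)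

lemma fsn_Ch: "Ch c \<Longrightarrow> Ch (fsn n c) \<and> fsn n c \<le> c \<and> fsn n (fsn n c) = fsn n c"
proof (cases "node n c")
  case True
  then obtain s j where c: "c = 3 * pr s j" "isnode n s j" unfolding node_iff by blast
  have "fsn n c \<le> c" unfolding c(1) fsn_node[OF c(2)] using fs0(3)[OF c(2)] by (simp add: pr_mono)
  moreover have "Ch (fsn n c)" using True fsn_is_node node_Ch by blast
  ultimately show ?thesis using fsn_idem by simp
next
  case False then show "Ch c \<Longrightarrow> ?thesis" by (simp add: fsn_not_node)
qed

lemma dump_unique: "dumpev (pr d s) \<Longrightarrow> dumpev (pr d s') \<Longrightarrow> s = s'"
proof (rule ccontr)
  assume d: "dumpev (pr d s)" "dumpev (pr d s')" and ne: "s \<noteq> s'"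
  show False
  proof (cases "s < s'")
    case True then show False using d unfolding dumpev_def by (auto dest: spec[of _ s])
  next
    case False
    then have "s' < s" using ne by simp
    then show False using d unfolding dumpev_def by (auto dest: spec[of _ s'])
  qed
qed

lemma Qt_dump:
  assumes "dumpev (pr d s1)"
  shows "Qt (3 * d + 1) t = (if s1 \<le> t then max (p1 d) (qs (2 * pr d s1) t) else p1 d)"
proof (cases "s1 \<le> t")
  case True
  have "(LEAST s. dumpev (pr d s) \<or> t \<le> s) = s1"
  proof (rule Least_equality)
    show "dumpev (pr d s1) \<or> t \<le> s1" using assms by simp
    fix y assume "dumpev (pr d y) \<or> t \<le> y"
    then show "s1 \<le> y" using dump_unique[OF assms] True by auto
  qed
  moreover have "\<exists>s1\<le>t. dumpev (pr d s1)" using assms True by blast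
  ultimately show ?thesis using True unfolding Qt_def div_mod_3 by (simp add: max_def)
next
  case False
  have nd: "\<not> (\<exists>s\<le>t. dumpev (pr d s))" using dump_unique[OF assms] False by blast
  show ?thesis unfolding Qt_def div_mod_3 if_not_P[OF nd] using False by simp
qed

lemma Qt_nodump: "(\<And>s. \<not> dumpev (pr d s)) \<Longrightarrow> Qt (3 * d + 1) t = p1 d"
  unfolding Qt_def div_mod_3 by simp

lemma Q_dump: assumes "dumpev (pr d s1)" shows "Q (3 * d + 1) = qq (2 * pr d s1)"
proof -
  have "(THE s. dumpev (pr d s)) = s1" using assms dump_unique by (intro the_equality) blast+
  moreover have "\<exists>s. dumpev (pr d s)" using assms by blast
  ultimately show ?thesis unfolding Q_def div_mod_3 by simp
qed

lemma Q_nodump: "(\<And>s. \<not> dumpev (pr d s)) \<Longrightarrow> Q (3 * d + 1) = p1 d"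
  unfolding Q_def div_mod_3 by simp

lemma Q_node: "Q (3 * pr s j) = qq (2 * pr (s - j) j + 1)" and Q_even: "Q (3 * x + 2) = qq (2 * x)"
  unfolding Q_def div_mod_3 by simp_all

lemma Qt_mono: "t \<le> t' \<Longrightarrow> Qt c t \<le> Qt c t'"
proof (cases c rule: cases_mod_3)
  case (1 s j)
  then show "t \<le> t' \<Longrightarrow> ?thesis" unfolding 1 Qt_def div_mod_3 by (simp add: qs_mono)
next
  case (2 d)
  assume t: "t \<le> t'"
  show ?thesis
  proof (cases "\<exists>s. dumpev (pr d s)")
    case True
    then obtain s1 where s1: "dumpev (pr d s1)" by blast
    show ?thesis unfolding 2 Qt_dump[OF s1] using t qs_mono[OF t, of "2 * pr d s1"] by auto
  next
    case False then show ?thesis unfolding 2 using Qt_nodump[of d] by simp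
  qed
next
  case (3 x)
  then show "t \<le> t' \<Longrightarrow> ?thesis" unfolding 3 Qt_def div_mod_3 by (simp add: qs_mono)
qed

lemma Qt_lim: "\<exists>t0. \<forall>t\<ge>t0. Qt c t = Q c"
proof (cases c rule: cases_mod_3)
  case (1 s j)
  then show ?thesis unfolding 1 Qt_def Q_def div_mod_3 using qs_lim by simp
next
  case (2 d)
  show ?thesis
  proof (cases "\<exists>s. dumpev (pr d s)")
    case True
    then obtain s1 where s1: "dumpev (pr d s1)" by blast
    obtain s0 where s0: "\<forall>s\<ge>s0. qs (2 * pr d s1) s = qq (2 * pr d s1)" using qs_lim by blast
    have "p1 d \<le> qq (2 * pr d s1)" using qq_ge[of "2 * pr d s1"] le_pr1[of d s1] p1_le[of d] by linarith
    then have "Qt c t = Q c" if "t \<ge> max s0 s1" for t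
      unfolding 2 Qt_dump[OF s1] Q_dump[OF s1] using that s0 by simp
    then show ?thesis by blast
  next
    case False then show ?thesis unfolding 2 using Qt_nodump[of d] Q_nodump[of d] by simp
  qed
next
  case (3 x)
  then show ?thesis unfolding 3 Qt_def Q_def div_mod_3 using qs_lim by simp
qed

lemma Ltn_mono: "t \<le> t' \<Longrightarrow> Ltn n c t \<le> Ltn n c t'"
proof -
  assume t: "t \<le> t'"
  have "(\<exists>c'\<le>t. c < c' \<and> Ch c' \<and> fsn n c' = fsn n c) \<Longrightarrow> (\<exists>c'\<le>t'. c < c' \<and> Ch c' \<and> fsn n c' = fsn n c)"
    using t order_trans by blast
  then show ?thesis unfolding Ltn_def using Qt_mono[OF t, of c] by auto
qed

lemma Ltn_lim: "\<exists>t0. \<forall>t\<ge>t0. Ltn n c t = Q c + (if \<exists>c'>c. Ch c' \<and> fsn n c' = fsn n c then 1 else 0)"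
proof -
  obtain t0 where t0: "\<forall>t\<ge>t0. Qt c t = Q c" using Qt_lim by blast
  show ?thesis
  proof (cases "\<exists>c'>c. Ch c' \<and> fsn n c' = fsn n c")
    case True
    then obtain c' where c': "c < c'" "Ch c'" "fsn n c' = fsn n c" by blast
    have "Ltn n c t = Q c + 1" if t: "t \<ge> max t0 c'" for t
    proof -
      have "\<exists>c'\<le>t. c < c' \<and> Ch c' \<and> fsn n c' = fsn n c" using c' t by (intro exI[of _ c']) simp
      then show ?thesis unfolding Ltn_def using t0 t by simp
    qed
    then show ?thesis unfolding if_P[OF True] by blast
  next
    case False
    have "Ltn n c t = Qt c t" for t unfolding Ltn_def by (subst if_not_P) (use False in blast, simp)
    then show ?thesis unfolding if_not_P[OF False] add_0_right using t0 by metis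
  qed
qed

lemma Q_less:
  assumes "fsn n c = fsn n c'" "c < c'" shows "Q c < Q c'"
proof -
  have "node n c"
  proof (rule ccontr)
    assume "\<not> node n c"
    then have "c' = c" using fsn_eq_not_node assms(1) by metis
    then show False using assms(2) by simp
  qed
  then obtain s j where c: "c = 3 * pr s j" "isnode n s j" unfolding node_iff by blast
  then obtain s' where c': "c' = 3 * pr s' j" "isnode n s' j" using fsn_eq_node[OF c(2), of c'] assms(1) by auto
  have "s < s'"
  proof (rule ccontr)
    assume "\<not> s < s'"
    then have "pr s' j \<le> pr s j" by (intro pr_mono) auto
    then show False using assms(2) c c' by simp
  qed
  moreover have "j \<le> s" "j \<le> s'" using isnode_le c(2) c'(2) by blast+
  ultimately have "pr (s - j) j < pr (s' - j) j" by (intro pr_less) auto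
  then show ?thesis unfolding c(1) c'(1) Q_node by (intro qq_less) simp
qed

lemma wwn_nz:
  assumes "wwn n c c' \<noteq> 0"
  shows "\<exists>s j j'. c = 3 * pr s j \<and> isnode n s j \<and> j' < j \<and> isnode n s j' \<and> c' = fsn n (3 * pr s j')"
proof -
  have h: "c mod 3 = 0 \<and> isnode n (p1 (c div 3)) (p2 (c div 3)) \<and>
      c' mod 3 = 0 \<and> p2 (c' div 3) < p2 (c div 3) \<and> isnode n (p1 (c div 3)) (p2 (c' div 3)) \<and>
      c' = fsn n (3 * pr (p1 (c div 3)) (p2 (c' div 3)))"
  proof (rule ccontr)
    assume "\<not> ?thesis"
    then have "wwn n c c' = 0" unfolding wwn_def by (rule if_not_P)
    then show False using assms by blast
  qed
  then have "c mod 3 = 0" by (rule conjunct1)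
  then have "c = 3 * (c div 3)" by presburger
  then have "c = 3 * pr (p1 (c div 3)) (p2 (c div 3))" by simp
  then show ?thesis using h by blast
qed

lemma isnode_agree:
  assumes "isnode n s j" "isnode n s' j'" "agree j' s' s" "j \<le> j'" shows "isnode n s' j"
proof -
  have "ent s' (j - 1) = ent s (j - 1)" using assms by (auto simp: agree_def isnode_def)
  then show ?thesis using assms by (auto simp: isnode_def)
qed

text \<open>The main point is the last axiom. A visit extending the longer prefix also extends the
  shorter one, so if the shorter prefix has a finite node, the longer one has too. At the last visit
  to the longer prefix, the chain of the shorter one lies further along the same diagonal and thus
  has a greater order.\<close>

lemma chains_n: "chains p Ch (fsn n) (wwn n) (Ltn n) Q (trn n) (lastn n)"
proof
  show "prime p" by (rule p)
  show "Ch c \<Longrightarrow> Ch (fsn n c) \<and> fsn n c \<le> c \<and> fsn n (fsn n c) = fsn n c" for c by (rule fsn_Ch)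
  show "trn n c \<longleftrightarrow> infinite {c'. Ch c' \<and> fsn n c' = c}" for c by (rule trn_def)
  show "lastn n c = Max {c'. Ch c' \<and> fsn n c' = c}" for c by (rule lastn_def)
  show "t \<le> t' \<Longrightarrow> Ltn n c t \<le> Ltn n c t'" for c t t' by (rule Ltn_mono)
  show "\<exists>t0. \<forall>t\<ge>t0. Ltn n c t = Q c + (if \<exists>c'>c. Ch c' \<and> fsn n c' = fsn n c then 1 else 0)" for c by (rule Ltn_lim)
  show "fsn n c = fsn n c' \<Longrightarrow> c < c' \<Longrightarrow> Q c < Q c'" for c c' by (rule Q_less)
  show "c' < c \<and> Ch c' \<and> fsn n c' = c'" if w: "wwn n c c' \<noteq> 0" for c c'
  proof -
    obtain s j j' where h: "c = 3 * pr s j" "isnode n s j" "j' < j" "isnode n s j'" "c' = fsn n (3 * pr s j')"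
      using wwn_nz[OF w] by (elim exE conjE)
    have "c' \<le> 3 * pr s j'" unfolding h(5) using fsn_Ch node_Ch node_pr h(4) by blast
    also have "\<dots> < c" unfolding h(1) using h(3) by (simp add: pr_less)
    finally show ?thesis unfolding h(5) using fsn_Ch node_Ch node_pr h(4) by blast
  qed
  show "\<not> trn n c \<and> Q (lastn n c) < Q (lastn n c')" if c: "Ch c" "fsn n c = c" and w: "wwn n c c' \<noteq> 0" and f: "\<not> trn n c'" for c c'
  proof -
    obtain s j j' where h: "c = 3 * pr s j" "isnode n s j" "j' < j" "isnode n s j'" "c' = fsn n (3 * pr s j')"
      using wwn_nz[OF w] by (elim exE conjE)
    let ?M = "{x. Ch x \<and> fsn n x = c}" and ?M' = "{x. Ch x \<and> fsn n x = c'}"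
    have in_M: "x \<in> ?M \<longleftrightarrow> (\<exists>s1. x = 3 * pr s1 j \<and> isnode n s1 j \<and> agree j s1 s)" for x
      using fsn_eq_node[OF h(2), of x] c(2) node_Ch node_iff unfolding h(1) mem_Collect_eq by metis
    have to_M': "3 * pr s1 j' \<in> ?M'" if "isnode n s1 j" "agree j s1 s" for s1
    proof -
      have n1: "isnode n s1 j'" by (rule isnode_agree[OF h(4) that]) (use h(3) in simp)
      moreover have "agree j' s1 s" using agree_mono[of j' j s1 s] that(2) h(3) by simp
      ultimately have "fsn n (3 * pr s1 j') = c'" unfolding h(5) fsn_eq_node[OF h(4)] by blast
      then show ?thesis using n1 node_Ch node_pr by blast
    qed
    have finM': "finite ?M'" using f unfolding trn_def by simp
    have "(\<lambda>x. 3 * pr (p1 (x div 3)) j') ` ?M \<subseteq> ?M'"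
    proof
      fix y assume "y \<in> (\<lambda>x. 3 * pr (p1 (x div 3)) j') ` ?M"
      then obtain x where x: "x \<in> ?M" "y = 3 * pr (p1 (x div 3)) j'" by blast
      obtain s1 where s1: "x = 3 * pr s1 j" "isnode n s1 j" "agree j s1 s" using x(1) unfolding in_M by blast
      show "y \<in> ?M'" using to_M'[OF s1(2,3)] unfolding x(2) s1(1) div_mod_3 p1_pr .
    qed
    moreover have "inj_on (\<lambda>x. 3 * pr (p1 (x div 3)) j') ?M"
    proof (rule inj_onI)
      fix x y assume xy: "x \<in> ?M" "y \<in> ?M" "3 * pr (p1 (x div 3)) j' = 3 * pr (p1 (y div 3)) j'"
      obtain s1 where s1: "x = 3 * pr s1 j" using xy(1) unfolding in_M by blast
      obtain s2 where s2: "y = 3 * pr s2 j" using xy(2) unfolding in_M by blast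
      have "pr s1 j' = pr s2 j'" using xy(3) unfolding s1 s2 div_mod_3 p1_pr by linarith
      then show "x = y" unfolding s1 s2 by simp
    qed
    ultimately have finM: "finite ?M" using finM' inj_on_finite by blast
    have "c \<in> ?M" using c by simp
    then have "lastn n c \<in> ?M" unfolding lastn_def using finM by (intro Max_in) auto
    then obtain s1 where s1: "lastn n c = 3 * pr s1 j" "isnode n s1 j" "agree j s1 s" using in_M by blast
    let ?x = "3 * pr s1 j'"
    have x: "?x \<in> ?M'" using to_M' s1 by blast
    then have le: "?x \<le> lastn n c'" unfolding lastn_def using finM' by (intro Max_ge)
    have last': "lastn n c' \<in> ?M'" unfolding lastn_def using finM' x by (intro Max_in) auto
    have jj: "j \<le> s1" using isnode_le s1(2) by blast
    have "pr (s1 - j) j < pr (s1 - j') j'" using jj h(3) by (intro pr_less_diagonal) auto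
    then have "Q (lastn n c) < Q ?x" unfolding s1(1) Q_node by (intro qq_less) simp
    also have "Q ?x \<le> Q (lastn n c')"
    proof (cases "?x = lastn n c'")
      case False
      then have "?x < lastn n c'" using le by simp
      moreover have "fsn n ?x = fsn n (lastn n c')" using x last' by simp
      ultimately show ?thesis using Q_less by (simp add: less_imp_le)
    qed simp
    finally show ?thesis using finM unfolding trn_def by simp
  qed
qed

text \<open>Resting chains with \<open>Q c = k\<close> correspond to the elements of \<open>Ek k\<close>; every other chain occupies its own slot of
  the strictly increasing sequence \<open>qq\<close> and stands for the one basis element that \<open>Ek k\<close> omits when \<open>k\<close> is in its range.\<close>

definition resting :: "nat \<Rightarrow> bool" where
  "resting c \<longleftrightarrow> c mod 3 = 1 \<and> (\<forall>s. \<not> dumpev (pr (c div 3) s))"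

definition slot :: "nat \<Rightarrow> nat" where
  "slot c = (if c mod 3 = 0 then 2 * pr (p1 (c div 3) - p2 (c div 3)) (p2 (c div 3)) + 1
    else if c mod 3 = 1 then 2 * pr (c div 3) (THE s. dumpev (pr (c div 3) s)) else 2 * (c div 3))"

lemma Q_slot: "\<not> resting c \<Longrightarrow> Q c = qq (slot c)"
  unfolding Q_def slot_def resting_def by auto

lemma slot_dump: "dumpev (pr d s1) \<Longrightarrow> slot (3 * d + 1) = 2 * pr d s1"
proof -
  assume s1: "dumpev (pr d s1)"
  have "(THE s. dumpev (pr d s)) = s1" using s1 dump_unique by (intro the_equality) blast+
  then show ?thesis unfolding slot_def div_mod_3 by simp
qed

section \<open>Counting chains of each order against the basis of the Ulm quotient\<close>

lemma slot_inj:
  assumes "Ch c" "\<not> resting c" "Ch c'" "\<not> resting c'" "slot c = slot c'" shows "c = c'"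
proof -
  have key: "(\<exists>s j. c = 3 * pr s j \<and> j \<le> s \<and> slot c = 2 * pr (s - j) j + 1) \<or>
      (\<exists>d s. c = 3 * d + 1 \<and> dumpev (pr d s) \<and> slot c = 2 * pr d s) \<or>
      (\<exists>x. c = 3 * x + 2 \<and> \<not> dumpev x \<and> slot c = 2 * x)" if ch: "Ch c" "\<not> resting c" for c
  proof (cases c rule: cases_mod_3)
    case (1 s j)
    then show ?thesis using ch(1) unfolding 1 Ch_def slot_def div_mod_3 by auto
  next
    case (2 d)
    then obtain s where s: "dumpev (pr d s)" using ch(2) by (auto simp: resting_def)
    then show ?thesis using slot_dump[OF s] unfolding 2 by blast
  next
    case (3 x)
    then show ?thesis using ch(1) unfolding 3 Ch_def slot_def div_mod_3 by auto
  qed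
  have par: "2 * a + 1 \<noteq> 2 * b" for a b :: nat by presburger
  from key[OF assms(1,2)] key[OF assms(3,4)] assms(5) show ?thesis
  proof (elim disjE exE conjE)
    fix s j s' j' assume h: "c = 3 * pr s j" "j \<le> s" "slot c = 2 * pr (s - j) j + 1"
      "c' = 3 * pr s' j'" "j' \<le> s'" "slot c' = 2 * pr (s' - j') j' + 1" "slot c = slot c'"
    have "2 * pr (s - j) j + 1 = 2 * pr (s' - j') j' + 1" using h(3,6,7) by (simp only:)
    then have "pr (s - j) j = pr (s' - j') j'" by linarith
    then have "s - j = s' - j' \<and> j = j'" unfolding pr_eq_iff .
    then have "s = s'" "j = j'" using h(2,5) by linarith+
    then show "c = c'" using h(1,4) by (simp only:)
  qed (use par par[symmetric] in \<open>simp_all only: mult_cancel1 pr_eq_iff\<close>, simp_all)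
qed

lemma slot_surj: "\<exists>c. Ch c \<and> \<not> resting c \<and> slot c = m"
proof (cases "odd m")
  case True
  then obtain y where y: "m = 2 * y + 1" by (rule oddE)
  let ?c = "3 * pr (p1 y + p2 y) (p2 y)"
  have "Ch ?c" "\<not> resting ?c" "slot ?c = m" unfolding Ch_def resting_def slot_def div_mod_3 using y by simp_all
  then show ?thesis by blast
next
  case False
  then obtain x where x: "m = 2 * x" by (auto elim: evenE)
  show ?thesis
  proof (cases "dumpev x")
    case True
    let ?c = "3 * p1 x + 1"
    have d: "dumpev (pr (p1 x) (p2 x))" using True by simp
    have "slot ?c = m" using slot_dump[OF d] x by simp
    moreover have "Ch ?c" using True unfolding Ch_def div_mod_3 dumpev_def by simp
    moreover have "\<not> resting ?c" using d unfolding resting_def div_mod_3 by blast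
    ultimately show ?thesis by blast
  next
    case False
    let ?c = "3 * x + 2"
    have "Ch ?c" "\<not> resting ?c" "slot ?c = m" unfolding Ch_def resting_def slot_def div_mod_3 using x False by simp_all
    then show ?thesis by blast
  qed
qed

lemma no_dump_iff:
  assumes "validd d"
  shows "(\<forall>s. \<not> dumpev (pr d s)) \<longleftrightarrow> (\<forall>s\<ge>p2 (p2 d). Es (p1 d) (p1 (p2 d)) s)"
proof
  assume nd: "\<forall>s. \<not> dumpev (pr d s)"
  show "\<forall>s\<ge>p2 (p2 d). Es (p1 d) (p1 (p2 d)) s"
  proof (rule ccontr)
    assume "\<not> ?thesis"
    then have ex: "\<exists>s. p2 (p2 d) \<le> s \<and> \<not> Es (p1 d) (p1 (p2 d)) s" by blast
    let ?P = "\<lambda>s. p2 (p2 d) \<le> s \<and> \<not> Es (p1 d) (p1 (p2 d)) s"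
    define s1 where "s1 = (LEAST s. ?P s)"
    have s1: "?P s1" unfolding s1_def by (rule LeastI_ex[OF ex])
    have "Es (p1 d) (p1 (p2 d)) s" if "s < s1" "p2 (p2 d) \<le> s" for s
      using not_less_Least[of s ?P] that unfolding s1_def by blast
    moreover have "p2 (p2 d) \<noteq> s1" using s1 assms unfolding validd_def by blast
    ultimately have "dumpev (pr d s1)" unfolding dumpev_def p1_pr p2_pr using assms s1 by simp
    then show False using nd by blast
  qed
next
  assume "\<forall>s\<ge>p2 (p2 d). Es (p1 d) (p1 (p2 d)) s"
  then show "\<forall>s. \<not> dumpev (pr d s)" unfolding dumpev_def p1_pr p2_pr by auto
qed

lemma resting_iff: "Ch c \<and> resting c \<longleftrightarrow>
  (\<exists>k e s0. c = 3 * pr k (pr e s0) + 1 \<and> (\<forall>s\<ge>s0. Es k e s) \<and> (s0 = 0 \<or> \<not> Es k e (s0 - 1)))"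
proof
  assume h: "Ch c \<and> resting c"
  then have "c mod 3 = 1" by (simp add: resting_def)
  then have "c = 3 * (c div 3) + 1" by presburger
  then obtain d where d: "c = 3 * d + 1" by blast
  have v: "validd d" and nd: "\<forall>s. \<not> dumpev (pr d s)" using h unfolding d Ch_def resting_def div_mod_3 by simp_all
  have "\<forall>s\<ge>p2 (p2 d). Es (p1 d) (p1 (p2 d)) s" using nd unfolding no_dump_iff[OF v] .
  moreover have "p2 (p2 d) = 0 \<or> \<not> Es (p1 d) (p1 (p2 d)) (p2 (p2 d) - 1)" using v unfolding validd_def by (rule conjunct2)
  moreover have "c = 3 * pr (p1 d) (pr (p1 (p2 d)) (p2 (p2 d))) + 1" using d by simp
  ultimately have "c = 3 * pr (p1 d) (pr (p1 (p2 d)) (p2 (p2 d))) + 1 \<and> (\<forall>s\<ge>p2 (p2 d). Es (p1 d) (p1 (p2 d)) s) \<and>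
      (p2 (p2 d) = 0 \<or> \<not> Es (p1 d) (p1 (p2 d)) (p2 (p2 d) - 1))" by (simp only:)
  then show "\<exists>k e s0. c = 3 * pr k (pr e s0) + 1 \<and> (\<forall>s\<ge>s0. Es k e s) \<and> (s0 = 0 \<or> \<not> Es k e (s0 - 1))"
    by (intro exI[of _ "p1 d"] exI[of _ "p1 (p2 d)"] exI[of _ "p2 (p2 d)"])
next
  assume "\<exists>k e s0. c = 3 * pr k (pr e s0) + 1 \<and> (\<forall>s\<ge>s0. Es k e s) \<and> (s0 = 0 \<or> \<not> Es k e (s0 - 1))"
  then obtain k e s0 where h: "c = 3 * pr k (pr e s0) + 1" "\<forall>s\<ge>s0. Es k e s" "s0 = 0 \<or> \<not> Es k e (s0 - 1)" by (elim exE conjE)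
  have "Es k e s0" using h(2) by blast
  then have v: "validd (pr k (pr e s0))" unfolding validd_def p1_pr p2_pr using h(3) by (rule conjI)
  have "\<forall>s. \<not> dumpev (pr (pr k (pr e s0)) s)" unfolding no_dump_iff[OF v] p1_pr p2_pr by (rule h(2))
  then show "Ch c \<and> resting c" unfolding h(1) Ch_def resting_def div_mod_3 using v by simp
qed

text \<open>A resting chain records the first stage of an uninterrupted final run of positive
  guesses. There is exactly one such stage for each element of \<open>Ek k\<close> and none for
  other numbers.\<close>

lemma resting_bij: "bij_betw (\<lambda>c. p1 (p2 (c div 3))) {c. Ch c \<and> resting c \<and> Q c = k} {e. Ek k e}"
proof (rule bij_betw_imageI)
  have key: "\<exists>e s0. c = 3 * pr k (pr e s0) + 1 \<and> (\<forall>s\<ge>s0. Es k e s) \<and> (s0 = 0 \<or> \<not> Es k e (s0 - 1))"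
    if c: "c \<in> {c. Ch c \<and> resting c \<and> Q c = k}" for c
  proof -
    have cr: "Ch c \<and> resting c" and qk: "Q c = k" using c by blast+
    obtain k' e s0 where h: "c = 3 * pr k' (pr e s0) + 1" "\<forall>s\<ge>s0. Es k' e s" "s0 = 0 \<or> \<not> Es k' e (s0 - 1)"
      using resting_iff[THEN iffD1, of c, OF cr] by (elim exE conjE)
    have "resting c" using c by blast
    then have "\<forall>s. \<not> dumpev (pr (pr k' (pr e s0)) s)" unfolding h(1) resting_def div_mod_3 by blast
    then have "Q c = k'" unfolding h(1) using Q_nodump[of "pr k' (pr e s0)"] by simp
    then have "k' = k" using qk by (rule subst)
    then have "c = 3 * pr k (pr e s0) + 1 \<and> (\<forall>s\<ge>s0. Es k e s) \<and> (s0 = 0 \<or> \<not> Es k e (s0 - 1))"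
      using h by (simp only:)
    then show ?thesis by (intro exI[of _ e] exI[of _ s0])
  qed
  show "inj_on (\<lambda>c. p1 (p2 (c div 3))) {c. Ch c \<and> resting c \<and> Q c = k}"
  proof (rule inj_onI)
    fix c c' assume c: "c \<in> {c. Ch c \<and> resting c \<and> Q c = k}" "c' \<in> {c. Ch c \<and> resting c \<and> Q c = k}"
      and eq: "p1 (p2 (c div 3)) = p1 (p2 (c' div 3))"
    obtain e s0 where h: "c = 3 * pr k (pr e s0) + 1" "\<forall>s\<ge>s0. Es k e s" "s0 = 0 \<or> \<not> Es k e (s0 - 1)"
      using key[OF c(1)] by (elim exE conjE)
    obtain e' s0' where h': "c' = 3 * pr k (pr e' s0') + 1" "\<forall>s\<ge>s0'. Es k e' s" "s0' = 0 \<or> \<not> Es k e' (s0' - 1)"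
      using key[OF c(2)] by (elim exE conjE)
    have e: "e' = e" using eq unfolding h(1) h'(1) div_mod_3 by simp
    have "\<not> s0 < s0'"
    proof
      assume "s0 < s0'"
      then have "s0 \<le> s0' - 1" "s0' \<noteq> 0" by (cases s0'; simp)+
      then show False using h(2) h'(3) e by blast
    qed
    moreover have "\<not> s0' < s0"
    proof
      assume "s0' < s0"
      then have "s0' \<le> s0 - 1" "s0 \<noteq> 0" by (cases s0; simp)+
      then show False using h'(2) h(3) e by blast
    qed
    ultimately show "c = c'" using h(1) h'(1) e by simp
  qed
  show "(\<lambda>c. p1 (p2 (c div 3))) ` {c. Ch c \<and> resting c \<and> Q c = k} = {e. Ek k e}"
  proof (intro equalityI subsetI)
    fix e assume "e \<in> (\<lambda>c. p1 (p2 (c div 3))) ` {c. Ch c \<and> resting c \<and> Q c = k}"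
    then obtain c where c: "c \<in> {c. Ch c \<and> resting c \<and> Q c = k}" "e = p1 (p2 (c div 3))" by blast
    obtain e' s0 where h: "c = 3 * pr k (pr e' s0) + 1" "\<forall>s\<ge>s0. Es k e' s"
      using key[OF c(1)] by (elim exE conjE)
    have "e = e'" using c(2) unfolding h(1) div_mod_3 by simp
    obtain s1 where "\<forall>s\<ge>s1. Es k e' s \<longleftrightarrow> Ek k e'" using Es_lim by blast
    then have "Es k e' (max s0 s1) \<longleftrightarrow> Ek k e'" by (auto dest: spec[of _ "max s0 s1"])
    moreover have "Es k e' (max s0 s1)" using h(2) by (auto dest: spec[of _ "max s0 s1"])
    ultimately have "Ek k e'" by (rule iffD1)
    then show "e \<in> {e. Ek k e}" using \<open>e = e'\<close> by simp
  next
    fix e assume "e \<in> {e. Ek k e}"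
    then have "\<exists>s0. \<forall>s\<ge>s0. Es k e s" using Es_lim[of k e] by auto
    define s0 where "s0 = (LEAST s0. \<forall>s\<ge>s0. Es k e s)"
    have s0: "\<forall>s\<ge>s0. Es k e s" unfolding s0_def by (rule LeastI_ex) fact
    have pred: "s0 = 0 \<or> \<not> Es k e (s0 - 1)"
    proof (cases s0)
      case (Suc s)
      have "\<not> (\<forall>s'\<ge>s. Es k e s')" using not_less_Least[of s "\<lambda>s0. \<forall>s\<ge>s0. Es k e s"] Suc unfolding s0_def by simp
      then obtain s' where "s' \<ge> s" "\<not> Es k e s'" by blast
      moreover have "s' \<noteq> s \<Longrightarrow> s' \<ge> s0" using \<open>s' \<ge> s\<close> Suc by simp
      ultimately have "\<not> Es k e s" using s0 by blast
      then show ?thesis using Suc by simp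
    qed simp
    let ?c = "3 * pr k (pr e s0) + 1"
    have r: "Ch ?c \<and> resting ?c" unfolding resting_iff
      using s0 pred by (intro exI[of _ k] exI[of _ e] exI[of _ s0] conjI refl)
    have "\<forall>s. \<not> dumpev (pr (pr k (pr e s0)) s)" using r unfolding resting_def div_mod_3 by blast
    then have "Q ?c = k" using Q_nodump[of "pr k (pr e s0)"] by simp
    moreover have "e = p1 (p2 (?c div 3))" unfolding div_mod_3 by simp
    ultimately show "e \<in> (\<lambda>c. p1 (p2 (c div 3))) ` {c. Ch c \<and> resting c \<and> Q c = k}" using r by blast
  qed
qed

lemma chains_Bk: "{c. Ch c \<and> Q c = k} \<approx> {e. Bk k e}"
proof -
  let ?r = "{c. Ch c \<and> resting c \<and> Q c = k}" and ?s = "{c. Ch c \<and> \<not> resting c \<and> Q c = k}"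
  have split: "{c. Ch c \<and> Q c = k} = ?r \<union> ?s" by blast
  show ?thesis
  proof (cases "\<exists>m. qq m = k")
    case True
    then obtain m where m: "qq m = k" by blast
    obtain e0 where e0: "Bk k e0" "\<forall>e. Ek k e \<longleftrightarrow> Bk k e \<and> e \<noteq> e0" using Ek_cases(2)[OF m] by blast
    obtain c0 where c0: "Ch c0" "\<not> resting c0" "slot c0 = m" using slot_surj by blast
    have s: "?s = {c0}"
    proof (intro equalityI subsetI)
      fix c assume c: "c \<in> ?s"
      then have "qq (slot c) = qq (slot c0)" using Q_slot[of c] c0 m by simp
      then have "slot c = slot c0" using qq_less[of "slot c" "slot c0"] qq_less[of "slot c0" "slot c"]
        by (cases "slot c" "slot c0" rule: linorder_cases) auto
      then show "c \<in> {c0}" using slot_inj[of c c0] c c0 by simp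
    qed (use c0 Q_slot[of c0] m in auto)
    let ?h = "\<lambda>c. if c = c0 then e0 else p1 (p2 (c div 3))"
    have c0r: "c0 \<notin> ?r" using c0 by simp
    have "bij_betw (\<lambda>c. p1 (p2 (c div 3))) ?r {e. Ek k e}" by (rule resting_bij)
    then have "bij_betw ?h ?r {e. Ek k e}" using c0r by (subst bij_betw_cong[of _ _ "\<lambda>c. p1 (p2 (c div 3))"]) auto
    moreover have "bij_betw ?h {c0} {e0}" by (simp add: bij_betw_def)
    moreover have "{e. Ek k e} \<inter> {e0} = {}" using e0 by auto
    ultimately have "bij_betw ?h (?r \<union> {c0}) ({e. Ek k e} \<union> {e0})" by (rule bij_betw_combine)
    moreover have "{e. Ek k e} \<union> {e0} = {e. Bk k e}" using e0 by auto
    ultimately show ?thesis unfolding split s eqpoll_def by auto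
  next
    case False
    then have "?s = {}" using Q_slot by auto
    then have r: "{c. Ch c \<and> Q c = k} = ?r" unfolding split by (simp only: Un_empty_right)
    have "{e. Ek k e} = {e. Bk k e}" using Ek_cases(1)[of k] False by blast
    then show ?thesis unfolding r eqpoll_def using resting_bij[of k] by metis
  qed
qed

end

subsection \<open>Lowering the complexity of a presentation by two jumps\<close>

lemma rels_subset:
  assumes "subgrp S" "\<And>i. relv p al w i \<in> S" "v \<in> rels p al w" shows "v \<in> S"
proof -
  obtain N z where v: "v = (\<Sum>i<N. of_int (z i) * relv p al w i)" using assms(3) unfolding rels_def by blast
  show ?thesis unfolding v by (intro subgrp_sum[OF assms(1)] subgrp_of_int_mult[OF assms(1)] assms(2))
qed

lemma lin_sum: "lin s (\<Sum>i\<in>I. F i) = (\<Sum>i\<in>I. lin s (F i))"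
  by (induction I rule: infinite_finite_induct) (simp_all add: lin_0 lin_add)

lemma lin_uminus: "lin s (- v) = - lin s v"
  using lin_diff[of s 0 v] by (simp add: lin_0)

lemma lin_of_int: "lin s (of_int i * v) = of_int i * lin s v"
proof (cases "i \<ge> 0")
  case True
  then obtain n where "i = int n" using nonneg_int_cases by blast
  then show ?thesis using lin_of_nat[of s n v] by simp
next
  case False
  then obtain n where "i = - int n" by (metis int_cases2 linorder_not_le nle_le of_nat_0_le_iff)
  then show ?thesis using lin_of_nat[of s n v] lin_uminus[of s "of_nat n * v"] by simp
qed

lemma presents_transfer:
  assumes f: "presents f A R" and h: "presents h B R1" and BA: "univ B \<subseteq> univ A" "plus B = plus A"
    and u: "f u = h u'" and v: "f v = h v'"
  shows "f (u - v) = h (u' - v')"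
proof -
  have f': "range f = univ A" "\<And>u v. f (u + v) = plus A (f u) (f v)" "\<And>u v. f u = f v \<longleftrightarrow> u - v \<in> R"
    using f by (simp_all add: presents_def)
  have h': "range h = univ B" "\<And>u v. h (u + v) = plus B (h u) (h v)" using h by (simp_all add: presents_def)
  have "h (u' - v') \<in> range f" using h'(1) f'(1) BA(1) by blast
  then obtain x where x: "h (u' - v') = f x" by blast
  have "f (x + v) = h ((u' - v') + v')" unfolding f'(2) h'(2) x v BA(2) by (rule refl)
  also have "\<dots> = f u" using u by simp
  finally have "x + v - u \<in> R" unfolding f'(3) .
  then have "f x = f (u - v)" unfolding f'(3) by (simp add: algebra_simps)
  then show ?thesis using x by simp
qed

context stepc
begin

section \<open>The guessed group as the elements of infinite height\<close>

abbreviation "Hal n \<equiv> ch_live Ch (fsn n) (Ltn n)"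
abbreviation "Hw n \<equiv> ch_rel Ch (fsn n) (wwn n) (Ltn n)"
abbreviation "RH n \<equiv> rels p (Hal n) (Hw n)"

definition alG :: "nat \<Rightarrow> nat \<Rightarrow> bool" where "alG n i \<longleftrightarrow> row n i \<noteq> 0"
definition wG :: "nat \<Rightarrow> nat \<Rightarrow> nat \<Rightarrow> nat" where "wG n i j = nthc (row n i - 1) j"
abbreviation "RG n \<equiv> rels p (alG n) (wG n)"

text \<open>The first visit whose first \<open>Suc i\<close> entries are correct; it names the node
  that represents generator \<open>i\<close> of the guessed group.\<close>

definition tns :: "nat \<Rightarrow> nat \<Rightarrow> nat" where
  "tns n i = (LEAST s. visit n s \<and> Suc i \<le> len s \<and> correct n (Suc i) s)"

definition tn :: "nat \<Rightarrow> nat \<Rightarrow> nat" where "tn n i = 3 * pr (tns n i) (Suc i)"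

lemma tns: "visit n (tns n i) \<and> Suc i \<le> len (tns n i) \<and> correct n (Suc i) (tns n i)"
proof -
  have "{s. visit n s \<and> len s = Suc i \<and> correct n (Suc i) s} \<noteq> {}" using infinite_visits[of n "Suc i"] by force
  then have "\<exists>s. visit n s \<and> Suc i \<le> len s \<and> correct n (Suc i) s" by auto
  then show ?thesis unfolding tns_def by (rule LeastI_ex)
qed

lemma tns_least: "visit n s \<Longrightarrow> Suc i \<le> len s \<Longrightarrow> correct n (Suc i) s \<Longrightarrow> tns n i \<le> s"
  unfolding tns_def by (rule Least_le) blast

lemma correct_ent: "correct n j s \<Longrightarrow> i < j \<Longrightarrow> p1 (ent s i) = row n i"
  by (simp add: correct_def)

lemma correct_mono: "correct n j s \<Longrightarrow> i \<le> j \<Longrightarrow> correct n i s"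
  by (simp add: correct_def)

lemma correct_agree: "correct n j s \<Longrightarrow> correct n j s' \<Longrightarrow> agree j s s'"
  by (simp add: correct_def agree_def)

lemma agree_correct: "correct n j s \<Longrightarrow> agree j s' s \<Longrightarrow> correct n j s'"
  by (simp add: correct_def agree_def)

lemma isnode_correct: "correct n (Suc i) s \<Longrightarrow> isnode n s (Suc i) \<longleftrightarrow> visit n s \<and> Suc i \<le> len s \<and> row n i \<noteq> 0"
  using correct_ent[of n "Suc i" s i] by (auto simp: isnode_def)

lemma tns_isnode: "row n i \<noteq> 0 \<Longrightarrow> isnode n (tns n i) (Suc i)"
  using tns[of n i] isnode_correct by blast

lemma fsn_tn:
  assumes "isnode n s (Suc i)" "correct n (Suc i) s" shows "fsn n (3 * pr s (Suc i)) = tn n i"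
proof -
  have "correct n (Suc i) (fs0 n s (Suc i))" by (rule agree_correct[OF assms(2) fs0(2)[OF assms(1)]])
  moreover have "visit n (fs0 n s (Suc i))" "Suc i \<le> len (fs0 n s (Suc i))"
    using fs0(1)[OF assms(1)] by (auto simp: isnode_def)
  ultimately have "tns n i \<le> fs0 n s (Suc i)" by (intro tns_least)
  moreover have "row n i \<noteq> 0" using assms isnode_correct by blast
  then have "fs0 n s (Suc i) \<le> tns n i"
    using tns[of n i] assms(2) by (intro fs0(4)[OF assms(1)] tns_isnode correct_agree[of n]) blast+
  ultimately show ?thesis unfolding fsn_node[OF assms(1)] tn_def by simp
qed

lemma tn_self: "row n i \<noteq> 0 \<Longrightarrow> Ch (tn n i) \<and> fsn n (tn n i) = tn n i"
  using fsn_tn[OF tns_isnode] tns[of n i] node_Ch[of n "tn n i"] tns_isnode[of n i] unfolding tn_def node_pr by blast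

lemma trn_tn: assumes "row n i \<noteq> 0" shows "trn n (tn n i)"
proof -
  let ?S = "{s. visit n s \<and> len s = Suc i \<and> correct n (Suc i) s}"
  have "(\<lambda>s. 3 * pr s (Suc i)) ` ?S \<subseteq> {c'. Ch c' \<and> fsn n c' = tn n i}"
  proof
    fix c assume "c \<in> (\<lambda>s. 3 * pr s (Suc i)) ` ?S"
    then obtain s where s: "c = 3 * pr s (Suc i)" "s \<in> ?S" by blast
    then have "isnode n s (Suc i)" "correct n (Suc i) s" using isnode_correct[of n i s] assms by auto
    then show "c \<in> {c'. Ch c' \<and> fsn n c' = tn n i}" unfolding s(1) using fsn_tn node_Ch node_pr by blast
  qed
  moreover have "inj_on (\<lambda>s. 3 * pr s (Suc i)) ?S" by (rule inj_onI) simp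
  ultimately show ?thesis unfolding trn_def using infinite_visits[of n "Suc i"] inj_on_finite by blast
qed

text \<open>Anything that is not a node has a single chain, and a wrong prefix has finitely many
  visits, so an infinite node comes from a correct prefix.\<close>

lemma trn_imp_tn:
  assumes "fsn n c = c" "trn n c" shows "\<exists>i. row n i \<noteq> 0 \<and> c = tn n i"
proof -
  have inf: "infinite {c'. Ch c' \<and> fsn n c' = c}" using assms(2) unfolding trn_def .
  have "node n c"
  proof (rule ccontr)
    assume nn: "\<not> node n c"
    have "{c'. Ch c' \<and> fsn n c' = c} \<subseteq> {c}"
    proof
      fix c' assume "c' \<in> {c'. Ch c' \<and> fsn n c' = c}"
      then have "fsn n c' = fsn n c" using assms(1) by simp
      then show "c' \<in> {c}" using fsn_eq_not_node[OF nn] by blast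
    qed
    then show False using inf finite_subset by blast
  qed
  then obtain s j where c: "c = 3 * pr s j" "isnode n s j" unfolding node_iff by blast
  have "{c'. Ch c' \<and> fsn n c' = c} \<subseteq> (\<lambda>s'. 3 * pr s' j) ` {s'. visit n s' \<and> j \<le> len s' \<and> agree j s' s}"
  proof
    fix c' assume "c' \<in> {c'. Ch c' \<and> fsn n c' = c}"
    then have "fsn n c' = fsn n (3 * pr s j)" using assms(1) c(1) by simp
    then obtain s' where "c' = 3 * pr s' j" "isnode n s' j" "agree j s' s" unfolding fsn_eq_node[OF c(2)] by blast
    then show "c' \<in> (\<lambda>s'. 3 * pr s' j) ` {s'. visit n s' \<and> j \<le> len s' \<and> agree j s' s}" by (auto simp: isnode_def)
  qed
  then have "correct n j s" using inf finite_visits[of n j s] finite_surj by blast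
  moreover obtain i where i: "j = Suc i" using isnode_le[OF c(2)] by (cases j) auto
  ultimately have "c = tn n i" "row n i \<noteq> 0"
    using fsn_tn[of n s i] c assms(1) isnode_correct[of n i s] by auto
  then show ?thesis by blast
qed

lemma tn_inj: "tn n i = tn n j \<Longrightarrow> i = j"
  unfolding tn_def by simp

lemma wwn_tn:
  assumes "row n i \<noteq> 0" "row n i' \<noteq> 0" "i' < i" shows "wwn n (tn n i) (tn n i') = wG n i i'"
proof -
  let ?s = "tns n i"
  have cor: "correct n (Suc i) ?s" "visit n ?s" "Suc i \<le> len ?s" using tns[of n i] by auto
  have c': "correct n (Suc i') ?s" using correct_mono[OF cor(1)] assms(3) by simp
  have n': "isnode n ?s (Suc i')" using isnode_correct[OF c'] cor assms by simp
  have "tn n i' = fsn n (3 * pr ?s (Suc i'))" using fsn_tn[OF n' c'] by simp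
  moreover have "tn n i mod 3 = 0" "tn n i div 3 = pr ?s (Suc i)" "tn n i' mod 3 = 0" "tn n i' div 3 = pr (tns n i') (Suc i')"
    unfolding tn_def div_mod_3 by (rule refl)+
  moreover have "p1 (ent ?s i) = row n i" using correct_ent[OF cor(1)] by simp
  ultimately show ?thesis unfolding wwn_def wG_def using tns_isnode[OF assms(1)] n' assms(3) by simp
qed

lemma wwn_tn_nz:
  assumes "row n i \<noteq> 0" "wwn n (tn n i) t \<noteq> 0" shows "\<exists>i'<i. row n i' \<noteq> 0 \<and> t = tn n i'"
proof -
  obtain s j j' where h: "tn n i = 3 * pr s j" "isnode n s j" "j' < j" "isnode n s j'" "t = fsn n (3 * pr s j')"
    using wwn_nz[OF assms(2)] by (elim exE conjE)
  have "pr (tns n i) (Suc i) = pr s j" using h(1) unfolding tn_def by linarith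
  then have sj: "s = tns n i" "j = Suc i" by simp_all
  obtain i' where i': "j' = Suc i'" using isnode_le[OF h(4)] by (cases j') auto
  have lt: "i' < i" using h(3) sj(2) i' by simp
  have c': "correct n (Suc i') s" using correct_mono[of n "Suc i" s "Suc i'"] tns[of n i] lt sj(1) by simp
  have "t = tn n i'" using fsn_tn[of n s i'] h(4,5) c' i' by simp
  moreover have "row n i' \<noteq> 0" using isnode_correct[OF c'] h(4) i' by simp
  ultimately show ?thesis using lt by blast
qed

definition xg :: "nat \<Rightarrow> nat \<Rightarrow> int poly" where
  "xg n i = (if row n i \<noteq> 0 then monom 1 (pr (tn n i) (pr 0 0)) else 0)"

text \<open>Generator \<open>i\<close> goes to the element \<open>X\<close> of its true node. The
  induced map is an embedding whose image is precisely the elements of infinite height.\<close>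

definition eta :: "nat \<Rightarrow> int poly \<Rightarrow> int poly" where "eta n = lin (xg n)"

lemma eta_rels: assumes "v \<in> RG n" shows "eta n v \<in> RH n"
proof -
  interpret H: chains p Ch "fsn n" "wwn n" "Ltn n" Q "trn n" "lastn n" by (rule chains_n)
  let ?S = "{v. eta n v \<in> RH n}"
  have "subgrp ?S" unfolding subgrp_def
    using subgrp_zero[OF H.R] subgrp_diff[OF H.R] by (simp add: eta_def lin_0 lin_diff)
  moreover have "relv p (alG n) (wG n) i \<in> ?S" for i
  proof (cases "row n i = 0")
    case True
    then show ?thesis using subgrp_zero[OF H.R] by (simp add: relv_def alG_def eta_def lin_monom xg_def)
  next
    case False
    let ?I = "{j. j < i \<and> row n j \<noteq> 0 \<and> wG n i j \<noteq> 0}"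
    have "(\<Sum>t | wwn n (tn n i) t \<noteq> 0. of_nat (wwn n (tn n i) t) * monom (1::int) (pr t (pr 0 0))) =
        (\<Sum>j\<in>?I. of_nat (wG n i j) * xg n j)"
    proof -
      have im: "{t. wwn n (tn n i) t \<noteq> 0} = tn n ` ?I"
      proof (intro equalityI subsetI)
        fix t assume t: "t \<in> {t. wwn n (tn n i) t \<noteq> 0}"
        then obtain j where j: "j < i" "row n j \<noteq> 0" "t = tn n j" using wwn_tn_nz[OF False] by blast
        then show "t \<in> tn n ` ?I" using t wwn_tn[OF False j(2,1)] by simp
      next
        fix t assume "t \<in> tn n ` ?I"
        then show "t \<in> {t. wwn n (tn n i) t \<noteq> 0}" using wwn_tn[OF False] by auto
      qed
      have inj: "inj_on (tn n) ?I" using tn_inj by (auto simp: inj_on_def)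
      show ?thesis unfolding im sum.reindex[OF inj] using wwn_tn[OF False] by (intro sum.cong) (auto simp: xg_def)
    qed
    also have "\<dots> = (\<Sum>j<i. of_nat (wG n i j) * xg n j)"
      by (intro sum.mono_neutral_left) (auto simp: xg_def)
    finally have "of_nat p * xg n i - (\<Sum>j<i. of_nat (wG n i j) * xg n j) \<in> RH n"
      using H.rel_X[of "tn n i"] tn_self[OF False] False by (simp add: xg_def)
    then show ?thesis using False
      by (simp add: relv_def alG_def eta_def lin_diff lin_sum lin_of_nat lin_monom)
  qed
  ultimately have "v \<in> ?S" using assms by (rule rels_subset)
  then show ?thesis by simp
qed

text \<open>After reduction to normal form the image is a combination of distinct live generators
  with digits below \<open>p\<close>; a leading digit would have to be a multiple of
  \<open>p\<close>, so all digits vanish.\<close>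

lemma eta_ker: assumes "eta n v \<in> RH n" shows "v \<in> RG n"
proof -
  interpret H: chains p Ch "fsn n" "wwn n" "Ltn n" Q "trn n" "lastn n" by (rule chains_n)
  let ?N = "Suc (degree v)"
  have p0: "p > 0" by (rule H.p0)
  have "\<exists>d. (\<forall>j. d j < p) \<and> (\<forall>j. d j \<noteq> 0 \<longrightarrow> alG n j \<and> j < ?N) \<and> v - (\<Sum>j<?N. of_nat (d j) * monom 1 j) \<in> RG n"
    by (rule normal_form_exists[OF p0]) (simp add: coeff_eq_0)
  then obtain d where d: "\<And>j. d j < p" "\<And>j. d j \<noteq> 0 \<Longrightarrow> alG n j \<and> j < ?N" "v - (\<Sum>j<?N. of_nat (d j) * monom 1 j) \<in> RG n" by auto
  let ?u = "\<Sum>j<?N. of_nat (d j) * monom (1::int) j"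
  have eu: "eta n ?u = (\<Sum>j<?N. of_nat (d j) * xg n j)"
    by (simp only: eta_def lin_sum lin_of_nat lin_monom)
  have "eta n v - eta n ?u \<in> RH n" using eta_rels[OF d(3)] by (simp only: eta_def lin_diff)
  then have uR: "eta n ?u \<in> RH n" using subgrp_diff_cancel[OF H.R] assms by blast
  have "d j = 0" for j
  proof (rule ccontr)
    assume dj: "d j \<noteq> 0"
    let ?J = "{j. d j \<noteq> 0}" and ?x = "\<lambda>j. pr (tn n j) (pr 0 0)"
    have fin: "finite ?J" by (rule finite_subset[of _ "{..<?N}"]) (use d(2) in auto)
    have rowJ: "row n j \<noteq> 0" if "j \<in> ?J" for j using d(2)[of j] that by (simp add: alG_def)
    have us: "eta n ?u = (\<Sum>j\<in>?J. of_nat (d j) * monom 1 (?x j))"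
    proof -
      have "eta n ?u = (\<Sum>j\<in>?J. of_nat (d j) * xg n j)" unfolding eu using d(2) by (intro sum.mono_neutral_right) auto
      also have "\<dots> = (\<Sum>j\<in>?J. of_nat (d j) * monom 1 (?x j))" using rowJ by (intro sum.cong) (auto simp: xg_def)
      finally show ?thesis .
    qed
    have cf: "coeff (eta n ?u) e = (\<Sum>j\<in>?J. if ?x j = e then int (d j) else 0)" for e
      unfolding us coeff_sum by (intro sum.cong) auto
    have "Max (?x ` ?J) \<in> ?x ` ?J" using fin dj by (intro Max_in) auto
    then obtain m where m: "m \<in> ?J" "?x m = Max (?x ` ?J)" by auto
    have "int p dvd coeff (eta n ?u) (?x m)"
    proof (rule rels_triangular[where rk = "\<lambda>i. i", OF _ _ uR _ _ p0])
      show "Hal n (?x m)" using tn_self[OF rowJ[OF m(1)]] by (simp add: ch_live_def)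
      show "coeff (eta n ?u) e = 0" if e: "?x m < e" for e
      proof -
        have "?x j \<noteq> e" if "j \<in> ?J" for j
        proof -
          have "?x j \<le> ?x m" unfolding m(2) using fin that by (intro Max_ge) auto
          then show ?thesis using e by simp
        qed
        then show ?thesis unfolding cf by (intro sum.neutral) auto
      qed
    qed (auto simp: inj_on_def)
    moreover have "coeff (eta n ?u) (?x m) = int (d m)"
    proof -
      have "coeff (eta n ?u) (?x m) = (\<Sum>j\<in>?J. if j = m then int (d j) else 0)"
        unfolding cf using tn_inj by (intro sum.cong) auto
      then show ?thesis using m(1) fin by simp
    qed
    ultimately have "int p dvd int (d m)" by simp
    then show False using d(1)[of m] m(1) by (simp add: nat_dvd_not_less)
  qed
  then show ?thesis using d(3) by simp
qed

lemma eta_pdivw: "eta n v \<in> pdivw p (RH n)"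
proof -
  interpret H: chains p Ch "fsn n" "wwn n" "Ltn n" Q "trn n" "lastn n" by (rule chains_n)
  show ?thesis unfolding H.pdivw_eq eta_def
  proof (rule lin_in[OF H.G])
    fix i show "xg n i \<in> H.G"
    proof (cases "row n i = 0")
      case True then show ?thesis using subgrp_zero[OF H.G] by (simp add: xg_def)
    next
      case False
      then have "H.inf_node (tn n i)" using tn_self trn_tn by (simp add: H.inf_node_def)
      then show ?thesis using H.X_G False by (simp add: xg_def)
    qed
  qed
qed

lemma eta_onto: assumes "y \<in> pdivw p (RH n)" shows "\<exists>v. y - eta n v \<in> RH n"
proof -
  interpret H: chains p Ch "fsn n" "wwn n" "Ltn n" Q "trn n" "lastn n" by (rule chains_n)
  have "y \<in> H.G" using assms H.pdivw_eq by simp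
  then obtain I k where I: "finite I" "I \<subseteq> {s. H.inf_node s}" "y - (\<Sum>s\<in>I. of_int (k s) * monom 1 (pr s (pr 0 0))) \<in> RH n"
    unfolding H.G_def by blast
  have "\<exists>i. row n i \<noteq> 0 \<and> s = tn n i" if "s \<in> I" for s
  proof -
    have "H.inf_node s" using that I(2) by blast
    then show ?thesis unfolding H.inf_node_def using trn_imp_tn by blast
  qed
  then obtain ix where ix: "\<And>s. s \<in> I \<Longrightarrow> row n (ix s) \<noteq> 0 \<and> s = tn n (ix s)" by metis
  let ?v = "\<Sum>s\<in>I. of_int (k s) * monom (1::int) (ix s)"
  have "eta n ?v = (\<Sum>s\<in>I. of_int (k s) * xg n (ix s))" by (simp only: eta_def lin_sum lin_of_int lin_monom)
  also have "\<dots> = (\<Sum>s\<in>I. of_int (k s) * monom 1 (pr s (pr 0 0)))"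
  proof (rule sum.cong[OF refl])
    fix s assume "s \<in> I"
    then have "row n (ix s) \<noteq> 0" "tn n (ix s) = s" using ix by auto
    then show "of_int (k s) * xg n (ix s) = of_int (k s) * monom 1 (pr s (pr 0 0))" by (simp add: xg_def)
  qed
  finally show ?thesis using I(3) by metis
qed

lemma step_pfix: "pfix p (RG n) k \<Longrightarrow> pfix p (RH n) (Suc k)"
  using uw_pullback(2)[of "eta n" "RH n" "RG n" p k] eta_rels eta_ker eta_onto eta_pdivw subgrp_rels
  by (simp add: eta_def lin_diff lin_of_nat) blast

lemma step_presents:
  assumes h: "presents h (A\<lparr>univ := ulm_omega p A (Suc 0)\<rparr>) (RG n)" and tor: "\<And>v. \<exists>k. of_nat p ^ k * v \<in> R"
  shows "\<exists>h'. presents h' A (RH n)"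
proof -
  interpret H: chains p Ch "fsn n" "wwn n" "Ltn n" Q "trn n" "lastn n" by (rule chains_n)
  let ?B = "A\<lparr>univ := ulm_omega p A (Suc 0)\<rparr>"
  have uB: "univ ?B = f ` pdivw p R" using ulm_omega_presents[OF pres, of p "Suc 0"] by (simp only: uw_Suc_0) simp
  have BA: "univ ?B \<subseteq> univ A" "plus ?B = plus A" using f_univ unfolding uB by auto
  have h': "range h = f ` pdivw p R" "\<And>u v. h u = h v \<longleftrightarrow> u - v \<in> RG n" using h uB by (auto simp: presents_def)
  note tf = presents_transfer[OF pres h BA]
  have h0: "f 0 = h 0"
  proof -
    have "h 0 \<in> f ` pdivw p R" unfolding h'(1)[symmetric] by (rule rangeI)
    then obtain x where "f x = h 0" by (elim imageE) simp
    from tf[OF this this] show ?thesis by simp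
  qed
  \<comment> \<open>The initial correspondence relates elements of infinite height naming the same
    element of the common subgroup, through \<open>eta\<close> on one side and \<open>h\<close> on
    the other. All heights in it are infinite, and its domain is finite modulo infinite height with
    \<open>{0}\<close> as witness.\<close>
  define T where "T = {(a, b). a \<in> pdivw p (RH n) \<and> b \<in> pdivw p R \<and> (\<exists>v. a - eta n v \<in> RH n \<and> f b = h v)}"
  note W = subgrp_pdivw[OF R, of p] and WH = subgrp_pdivw[OF H.R, of p]
  have eta0: "eta n 0 = 0" by (simp add: eta_def lin_0)
  have T: "corr p (RH n) R T"
    unfolding corr_def
  proof (intro conjI allI impI ballI)
    fix a b c d assume "(a, b) \<in> T" "(c, d) \<in> T"
    then obtain v w where vw: "a \<in> pdivw p (RH n)" "b \<in> pdivw p R" "c \<in> pdivw p (RH n)" "d \<in> pdivw p R"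
      "a - eta n v \<in> RH n" "c - eta n w \<in> RH n" "f b = h v" "f d = h w" unfolding T_def by blast
    have "(a - eta n v) - (c - eta n w) \<in> RH n" by (rule subgrp_diff[OF H.R vw(5,6)])
    also have "(a - eta n v) - (c - eta n w) = (a - c) - eta n (v - w)" by (simp add: eta_def lin_diff)
    finally have "(a - c) - eta n (v - w) \<in> RH n" .
    moreover have "f (b - d) = h (v - w)" by (rule tf[OF vw(7,8)])
    ultimately show "(a - c, b - d) \<in> T"
      unfolding T_def using subgrp_diff[OF WH vw(1,3)] subgrp_diff[OF W vw(2,4)] by blast
  next
    fix a b assume ab: "a \<in> RH n" "b \<in> R"
    have "f b = h 0" using f_eq[of b 0] ab(2) h0 by simp
    moreover have "a - eta n 0 \<in> RH n" using ab(1) eta0 by simp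
    ultimately show "(a, b) \<in> T" unfolding T_def using subset_pdivw[OF H.R ab(1)] subset_pdivw[OF R ab(2)] by blast
  next
    fix a b assume "(a, b) \<in> T"
    then obtain v where v: "a - eta n v \<in> RH n" "f b = h v" unfolding T_def by blast
    have "a \<in> RH n \<longleftrightarrow> eta n v \<in> RH n" by (rule subgrp_diff_cancel[OF H.R v(1)])
    also have "\<dots> \<longleftrightarrow> v \<in> RG n" using eta_rels eta_ker by blast
    also have "\<dots> \<longleftrightarrow> h v = h 0" using h'(2)[of v 0] by simp
    also have "\<dots> \<longleftrightarrow> b \<in> R" using f_eq[of b 0] h0 v(2) by simp
    finally show "a \<in> RH n \<longleftrightarrow> b \<in> R" .
  next
    fix a b k assume "(a, b) \<in> T"
    then show "a \<in> pdiv p (RH n) k \<longleftrightarrow> b \<in> pdiv p R k" unfolding T_def pdivw_def by blast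
  next
    fix a assume a: "a \<in> pdivw p (RH n)"
    obtain v where v: "a - eta n v \<in> RH n" using eta_onto[OF a] by blast
    have "h v \<in> f ` pdivw p R" using h'(1) by blast
    then obtain b where "b \<in> pdivw p R" "f b = h v" by auto
    then show "\<exists>b. (a, b) \<in> T" unfolding T_def using a v by blast
  next
    fix b assume b: "b \<in> pdivw p R"
    then have "f b \<in> range h" using h'(1) by blast
    then obtain v where v: "f b = h v" by blast
    have "eta n v - eta n v \<in> RH n" using subgrp_zero[OF H.R] by simp
    then show "\<exists>a. (a, b) \<in> T" unfolding T_def using b v eta_pdivw by blast
  next
    show "\<exists>F. finite F \<and> (\<forall>a b. (a, b) \<in> T \<longrightarrow> (\<exists>f\<in>F. a - f \<in> pdivw p (RH n)))"
      unfolding T_def by (intro exI[of _ "{0}"]) simp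
    show "\<exists>F. finite F \<and> (\<forall>a b. (a, b) \<in> T \<longrightarrow> (\<exists>f\<in>F. b - f \<in> pdivw p R))"
      unfolding T_def by (intro exI[of _ "{0}"]) simp
  qed
  have eq: "ulm_quot p (RH n) k \<approx> ulm_quot p R k" for k
  proof -
    have "ulm_quot p (RH n) k \<approx> finsupp p {c. Ch c \<and> Q c = k}" using H.ulm_quot_finsupp[of k] by simp
    also have "\<dots> \<approx> finsupp p {e. Bk k e}" by (rule finsupp_eqpoll[OF chains_Bk H.p0])
    also have "\<dots> \<approx> ulm_quot p R k" by (rule eqpoll_sym[OF ulm_quot_Bk])
    finally show ?thesis .
  qed
  interpret U: ulm_pair p "RH n" R by unfold_locales (rule p H.R R)+
  have tH: "\<exists>k. of_nat p ^ k * v \<in> RH n" for v by (rule rels_torsion)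
  obtain T' where T': "\<forall>a b c d. (a, b) \<in> T' \<longrightarrow> (c, d) \<in> T' \<longrightarrow> (a - c, b - d) \<in> T'"
    "\<forall>a b. (a, b) \<in> T' \<longrightarrow> (a \<in> RH n \<longleftrightarrow> b \<in> R)" "\<forall>a. \<exists>b. (a, b) \<in> T'" "\<forall>b. \<exists>a. (a, b) \<in> T'"
    using U.corr_total[OF eq T tH tor] by (elim exE conjE)
  obtain b where b: "\<And>a. (a, b a) \<in> T'" using T'(3) by metis
  have uniq: "f x = f y" if "(a, x) \<in> T'" "(a, y) \<in> T'" for a x y
  proof -
    have "(a - a, x - y) \<in> T'" using T'(1) that by blast
    then have "x - y \<in> R" using T'(2) subgrp_zero[OF H.R] by force
    then show ?thesis unfolding f_eq .
  qed
  have "presents (\<lambda>a. f (b a)) A (RH n)" unfolding presents_def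
  proof (intro conjI allI)
    show "range (\<lambda>a. f (b a)) = univ A"
    proof (intro equalityI subsetI)
      fix x assume "x \<in> univ A"
      then have x: "f (rep x) = x" by (rule f_rep)
      obtain a where "(a, rep x) \<in> T'" using T'(4) by blast
      then have "f (b a) = x" using uniq[OF b] x by simp
      then show "x \<in> range (\<lambda>a. f (b a))" by blast
    qed (use f_univ in auto)
    fix u v
    have "(0, 0) \<in> T'"
      using T'(1) b[of 0] by (metis diff_self)
    then have "(0 - v, 0 - b v) \<in> T'" using T'(1) b by blast
    then have "(u - (0 - v), b u - (0 - b v)) \<in> T'" using T'(1) b by blast
    then have "(u + v, b u + b v) \<in> T'" by simp
    then have "f (b (u + v)) = f (b u + b v)" using uniq[OF b] by blast
    then show "f (b (u + v)) = plus A (f (b u)) (f (b v))" using pres by (simp add: presents_def)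
    have "(u - v, b u - b v) \<in> T'" using T'(1) b by blast
    then show "f (b u) = f (b v) \<longleftrightarrow> u - v \<in> RH n" unfolding f_eq using T'(2) by blast
  qed
  then show ?thesis by blast
qed

end

subsection \<open>Induction on the number of double jumps\<close>

text \<open>In the enumeration \<open>ge\<close> of the elements \<open>p\<^sup>r a\<close> with \<open>a\<close> in the group, \<open>p\<close> times an element is zero or occurs earlier,
  so discarding the elements spanned by their predecessors leaves a triangular presentation.\<close>

locale cgroup_tor = cgroup +
  assumes tor: "\<And>v. \<exists>k. of_nat p ^ k * v \<in> R"
begin

definition od :: "nat \<Rightarrow> nat" where "od a = (LEAST e. a \<notin> univ A \<or> mul (p ^ e) a = f 0)"

definition ge :: "nat \<Rightarrow> nat" where
  "ge i = (if p1 i \<in> univ A \<and> p2 i < od (p1 i) then mul (p ^ (od (p1 i) - 1 - p2 i)) (p1 i) else f 0)"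

definition gp :: "nat \<Rightarrow> int poly" where
  "gp i = (if p1 i \<in> univ A \<and> p2 i < od (p1 i) then of_nat p ^ (od (p1 i) - 1 - p2 i) * rep (p1 i) else 0)"

lemma p0: "p > 0" using p by (simp add: prime_gt_0_nat)

lemma mul_eq_0: "a \<in> univ A \<Longrightarrow> mul (p ^ e) a = f 0 \<longleftrightarrow> of_nat p ^ e * rep a \<in> R"
  using mul_f[of "p ^ e" "rep a"] f_rep[of a] f_eq[of "of_nat (p ^ e) * rep a" 0] by simp

lemma ex_od: "\<exists>e. a \<notin> univ A \<or> mul (p ^ e) a = f 0"
  using tor[of "rep a"] mul_eq_0 by blast

lemma od: "a \<in> univ A \<Longrightarrow> of_nat p ^ od a * rep a \<in> R"
  using LeastI_ex[OF ex_od[of a]] mul_eq_0 unfolding od_def by blast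

lemma ge_gp: "ge i = f (gp i)"
proof (cases "p1 i \<in> univ A \<and> p2 i < od (p1 i)")
  case True
  then have "mul (p ^ (od (p1 i) - 1 - p2 i)) (p1 i) = f (of_nat p ^ (od (p1 i) - 1 - p2 i) * rep (p1 i))"
    using mul_f[of "p ^ (od (p1 i) - 1 - p2 i)" "rep (p1 i)"] f_rep[of "p1 i"] by simp
  then show ?thesis using True by (simp add: ge_def gp_def)
next
  case False
  then show ?thesis unfolding ge_def gp_def by (simp only: if_False)
qed

primrec sb :: "nat \<Rightarrow> int poly set" where
  "sb 0 = R"
| "sb (Suc i) = {v. \<exists>z. v - of_int z * gp i \<in> sb i}"

lemma sb: "subgrp (sb i)"
proof (induction i)
  case 0 then show ?case by (simp add: R)
next
  case (Suc i)
  show ?case unfolding subgrp_def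
  proof (intro conjI ballI)
    show "0 \<in> sb (Suc i)" using subgrp_zero[OF Suc] by (auto intro: exI[of _ 0])
    fix a b assume "a \<in> sb (Suc i)" "b \<in> sb (Suc i)"
    then obtain y z where "a - of_int y * gp i \<in> sb i" "b - of_int z * gp i \<in> sb i" by auto
    from subgrp_diff[OF Suc this] have "(a - b) - of_int (y - z) * gp i \<in> sb i" by (simp add: algebra_simps)
    then show "a - b \<in> sb (Suc i)" by (auto simp del: of_int_diff)
  qed
qed

lemma sb_mono: "i \<le> j \<Longrightarrow> sb i \<subseteq> sb j"
proof (rule lift_Suc_mono_le[of sb])
  fix i show "sb i \<subseteq> sb (Suc i)" by (auto intro: exI[of _ 0])
qed

lemma R_sb: "v \<in> R \<Longrightarrow> v \<in> sb i"
  using sb_mono[of 0 i] by auto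

lemma gp_sb: "j < i \<Longrightarrow> gp j \<in> sb i"
proof -
  assume "j < i"
  have "gp j \<in> sb (Suc j)" using subgrp_zero[OF sb] by (auto intro: exI[of _ 1])
  then show ?thesis using sb_mono[of "Suc j" i] \<open>j < i\<close> by auto
qed

lemma p_gp_sb: "of_nat p * gp i \<in> sb i"
proof (cases "p1 i \<in> univ A \<and> p2 i < od (p1 i)")
  case True
  show ?thesis
  proof (cases "p2 i")
    case 0
    obtain e where e: "od (p1 i) = Suc e" using True by (cases "od (p1 i)") auto
    have "of_nat p * gp i = of_nat p ^ od (p1 i) * rep (p1 i)" using True 0 e by (simp add: gp_def mult.assoc)
    then show ?thesis using od True R_sb by simp
  next
    case (Suc r)
    let ?j = "pr (p1 i) r"
    have "pr (p1 i) r < pr (p1 i) (p2 i)" using Suc by (intro pr_less) auto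
    then have lt: "?j < i" by simp
    have e: "od (p1 i) - 1 - r = Suc (od (p1 i) - 1 - p2 i)" using conjunct2[OF True] Suc by linarith
    have "gp ?j = of_nat p ^ (od (p1 i) - 1 - r) * rep (p1 i)" using True Suc by (simp add: gp_def)
    also have "\<dots> = of_nat p * gp i" unfolding e using True by (simp add: gp_def mult.assoc)
    finally show ?thesis using gp_sb[OF lt] by simp
  qed
next
  case False
  then have "gp i = 0" unfolding gp_def by (rule if_not_P)
  then show ?thesis using subgrp_zero[OF sb] by simp
qed

definition cmb :: "nat \<Rightarrow> nat \<Rightarrow> nat" where
  "cmb m i = rec_nat (f 0) (\<lambda>j r. g (pr r (mul (dig p m j) (ge j)))) i"

lemma cmb: "cmb m i = f (\<Sum>j<i. of_nat (dig p m j) * gp j)"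
  by (induction i) (simp_all add: cmb_def ge_gp mul_f g_f)

text \<open>Digits below \<open>p\<close> suffice because \<open>p\<close> times each listed element
  is in the span of its predecessors; therefore a bounded search decides liveness.\<close>

definition bl :: "nat \<Rightarrow> bool" where "bl i \<longleftrightarrow> \<not> (\<exists>m<p ^ i. cmb m i = ge i)"

text \<open>Only live generators may occur, since dead ones are zero in the presentation; the least
  code makes the choice computable.\<close>

definition bm :: "nat \<Rightarrow> nat" where
  "bm i = (LEAST m. cmb m i = mul p (ge i) \<and> (\<forall>j<i. dig p m j \<noteq> 0 \<longrightarrow> bl j))"

definition bw :: "nat \<Rightarrow> nat \<Rightarrow> nat" where "bw i j = dig p (bm i) j"

lemma not_bl: "\<not> bl i \<Longrightarrow> gp i \<in> sb i"
proof -
  assume "\<not> bl i"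
  then obtain m where "cmb m i = ge i" unfolding bl_def by blast
  then have "gp i - (\<Sum>j<i. of_nat (dig p m j) * gp j) \<in> R" unfolding cmb ge_gp f_eq
    using subgrp_uminus[OF R] by (metis minus_diff_eq)
  moreover have "(\<Sum>j<i. of_nat (dig p m j) * gp j) \<in> sb i"
    by (intro subgrp_sum[OF sb] subgrp_of_nat_mult[OF sb] gp_sb) simp
  ultimately show ?thesis using subgrp_add_cancel[OF sb R_sb] subgrp_diff_cancel[OF sb R_sb] by blast
qed

lemma sb_digits:
  "v \<in> sb i \<Longrightarrow> \<exists>d. (\<forall>j. d j < p) \<and> (\<forall>j. d j \<noteq> 0 \<longrightarrow> bl j \<and> j < i) \<and> v - (\<Sum>j<i. of_nat (d j) * gp j) \<in> R"
proof (induction i arbitrary: v)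
  case 0
  then show ?case using p0 by (intro exI[of _ "\<lambda>_. 0"]) simp
next
  case (Suc i)
  then obtain z where z: "v - of_int z * gp i \<in> sb i" by auto
  show ?case
  proof (cases "gp i \<in> sb i")
    case True
    then have "v \<in> sb i" using subgrp_diff_cancel[OF sb z] subgrp_of_int_mult[OF sb] by blast
    then obtain d where d: "\<And>j. d j < p" "\<And>j. d j \<noteq> 0 \<Longrightarrow> bl j \<and> j < i" "v - (\<Sum>j<i. of_nat (d j) * gp j) \<in> R"
      using Suc.IH by blast
    have "d i = 0" using d(2)[of i] by blast
    then have "v - (\<Sum>j<Suc i. of_nat (d j) * gp j) \<in> R" using d(3) by simp
    then show ?thesis using d(1,2) less_SucI by (intro exI[of _ d]) blast
  next
    case False
    then have bl: "bl i" using not_bl by blast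
    define q where "q = z div int p"
    define r where "r = nat (z mod int p)"
    have r: "r < p" using p0 by (simp add: r_def nat_less_iff)
    have zqr: "z = q * int p + int r" using p0 by (simp add: q_def r_def)
    have "of_int q * (of_nat p * gp i) \<in> sb i" by (intro subgrp_of_int_mult[OF sb] p_gp_sb)
    from subgrp_add[OF sb z this] have "v - of_nat r * gp i \<in> sb i" unfolding zqr by (simp add: algebra_simps)
    then obtain d where d: "\<And>j. d j < p" "\<And>j. d j \<noteq> 0 \<Longrightarrow> bl j \<and> j < i"
      "v - of_nat r * gp i - (\<Sum>j<i. of_nat (d j) * gp j) \<in> R" using Suc.IH by blast
    have "v - (\<Sum>j<Suc i. of_nat ((d(i := r)) j) * gp j) \<in> R" using d(3) by (simp add: algebra_simps)
    moreover have "(d(i := r)) j < p" "(d(i := r)) j \<noteq> 0 \<longrightarrow> bl j \<and> j < Suc i" for j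
      using d(1)[of j] d(2)[of j] r bl by auto
    ultimately show ?thesis by (intro exI[of _ "d(i := r)"]) blast
  qed
qed

lemma sb_dig:
  assumes "v \<in> sb i"
  shows "\<exists>m<p ^ i. (\<forall>j<i. dig p m j \<noteq> 0 \<longrightarrow> bl j) \<and> v - (\<Sum>j<i. of_nat (dig p m j) * gp j) \<in> R"
proof -
  obtain d where d: "\<And>j. d j < p" "\<And>j. d j \<noteq> 0 \<Longrightarrow> bl j \<and> j < i" "v - (\<Sum>j<i. of_nat (d j) * gp j) \<in> R"
    using sb_digits[OF assms] by blast
  obtain m where m: "m < p ^ i" "\<And>j. j < i \<Longrightarrow> dig p m j = d j" using ex_dig[of i d p] d(1) by blast
  have "(\<Sum>j<i. of_nat (dig p m j) * gp j) = (\<Sum>j<i. of_nat (d j) * gp j)" using m(2) by (intro sum.cong) simp_all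
  then show ?thesis using m d by (intro exI[of _ m]) auto
qed

lemma bl: "bl i \<Longrightarrow> gp i \<notin> sb i"
proof
  assume bl: "bl i" and "gp i \<in> sb i"
  then obtain m where m: "m < p ^ i" "gp i - (\<Sum>j<i. of_nat (dig p m j) * gp j) \<in> R" using sb_dig by blast
  then have "ge i = cmb m i" unfolding cmb ge_gp f_eq by simp
  then show False using bl m(1) unfolding bl_def by (metis (lifting))
qed

lemma ex_bm: "\<exists>m. cmb m i = mul p (ge i) \<and> (\<forall>j<i. dig p m j \<noteq> 0 \<longrightarrow> bl j)"
proof -
  obtain m where m: "\<forall>j<i. dig p m j \<noteq> 0 \<longrightarrow> bl j" "of_nat p * gp i - (\<Sum>j<i. of_nat (dig p m j) * gp j) \<in> R"
    using sb_dig[OF p_gp_sb] by blast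
  have "mul p (ge i) = cmb m i" unfolding cmb ge_gp mul_f f_eq by (rule m(2))
  then show ?thesis using m(1) by (intro exI[of _ m]) simp
qed

lemma bw: "of_nat p * gp i - (\<Sum>j<i. of_nat (bw i j) * gp j) \<in> R" "j < i \<Longrightarrow> bw i j \<noteq> 0 \<Longrightarrow> bl j"
proof -
  have "cmb (bm i) i = mul p (ge i) \<and> (\<forall>j<i. dig p (bm i) j \<noteq> 0 \<longrightarrow> bl j)"
    unfolding bm_def by (rule LeastI_ex[OF ex_bm])
  then have h: "mul p (ge i) = cmb (bm i) i" "\<forall>j<i. bw i j \<noteq> 0 \<longrightarrow> bl j" by (simp_all add: bw_def)
  show "of_nat p * gp i - (\<Sum>j<i. of_nat (bw i j) * gp j) \<in> R"
    using h(1) unfolding cmb ge_gp mul_f f_eq bw_def .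
  show "j < i \<Longrightarrow> bw i j \<noteq> 0 \<Longrightarrow> bl j" using h(2) by blast
qed

definition bs :: "nat \<Rightarrow> int poly" where "bs i = (if bl i then gp i else 0)"

lemma lin_bs_digits:
  assumes "\<And>j. d j \<noteq> 0 \<Longrightarrow> bl j \<and> j < n"
  shows "lin bs (\<Sum>j<n. of_nat (d j) * monom 1 j) = (\<Sum>j<n. of_nat (d j) * gp j)"
  unfolding lin_sum lin_of_nat lin_monom using assms by (intro sum.cong) (auto simp: bs_def)

lemma lin_bs_rels: assumes "v \<in> rels p bl bw" shows "lin bs v \<in> R"
proof -
  let ?S = "{v. lin bs v \<in> R}"
  have "subgrp ?S" unfolding subgrp_def using subgrp_zero[OF R] subgrp_diff[OF R] by (simp add: lin_0 lin_diff)
  moreover have "relv p bl bw i \<in> ?S" for i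
  proof (cases "bl i")
    case True
    have "(\<Sum>j<i. of_nat (bw i j) * bs j) = (\<Sum>j<i. of_nat (bw i j) * gp j)"
      using bw(2)[of _ i] by (intro sum.cong) (auto simp: bs_def)
    then show ?thesis using bw(1)[of i] True
      by (simp add: relv_def lin_diff lin_sum lin_of_nat lin_monom bs_def[of i])
  next
    case False
    then show ?thesis using subgrp_zero[OF R] by (simp add: relv_def lin_monom bs_def)
  qed
  ultimately have "v \<in> ?S" using assms by (rule rels_subset)
  then show ?thesis by simp
qed

text \<open>In normal form, a nonzero leading digit is invertible modulo \<open>p\<close>. With
  \<open>p\<close> times the generator already in the span of its predecessors, the generator itself
  would be there, contrary to liveness.\<close>

lemma rels_lin_bs: assumes "lin bs v \<in> R" shows "v \<in> rels p bl bw"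
proof -
  let ?N = "Suc (degree v)"
  have "\<exists>d. (\<forall>j. d j < p) \<and> (\<forall>j. d j \<noteq> 0 \<longrightarrow> bl j \<and> j < ?N) \<and> v - (\<Sum>j<?N. of_nat (d j) * monom 1 j) \<in> rels p bl bw"
    by (rule normal_form_exists[OF p0]) (simp add: coeff_eq_0)
  then obtain d where d: "\<And>j. d j < p" "\<And>j. d j \<noteq> 0 \<Longrightarrow> bl j \<and> j < ?N"
    "v - (\<Sum>j<?N. of_nat (d j) * monom 1 j) \<in> rels p bl bw" by auto
  have "lin bs (\<Sum>j<?N. of_nat (d j) * monom 1 j) = (\<Sum>j<?N. of_nat (d j) * gp j)"
    by (rule lin_bs_digits) (rule d(2))
  then have "lin bs v - (\<Sum>j<?N. of_nat (d j) * gp j) \<in> R"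
    using lin_bs_rels[OF d(3)] by (simp only: lin_diff)
  then have s: "(\<Sum>j<?N. of_nat (d j) * gp j) \<in> R" using subgrp_diff_cancel[OF R] assms by blast
  have "d j = 0" for j
  proof (rule ccontr)
    assume dj: "d j \<noteq> 0"
    let ?J = "{j. d j \<noteq> 0}"
    have fin: "finite ?J" by (rule finite_subset[of _ "{..<?N}"]) (use d(2) in auto)
    define e where "e = Max ?J"
    have e: "e \<in> ?J" unfolding e_def using fin dj by (intro Max_in) auto
    have le: "j \<le> e" if "d j \<noteq> 0" for j unfolding e_def using fin that by (intro Max_ge) auto
    have gt: "d j = 0" if "\<not> j < Suc e" for j using le[of j] that by (cases "d j = 0") simp_all
    have "e < ?N" using e d(2)[of e] by blast
    then have "(\<Sum>j<?N. of_nat (d j) * gp j) = (\<Sum>j<Suc e. of_nat (d j) * gp j)"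
      using gt by (intro sum.mono_neutral_right) auto
    then have "of_nat (d e) * gp e + (\<Sum>j<e. of_nat (d j) * gp j) \<in> R" using s by (simp add: add.commute)
    moreover have "(\<Sum>j<e. of_nat (d j) * gp j) \<in> sb e"
      by (intro subgrp_sum[OF sb] subgrp_of_nat_mult[OF sb] gp_sb) simp
    ultimately have de: "of_nat (d e) * gp e \<in> sb e"
      using R_sb subgrp_diff[OF sb, of "of_nat (d e) * gp e + (\<Sum>j<e. of_nat (d j) * gp j)" e] by force
    have "\<not> p dvd d e" using d(1)[of e] e by (simp add: nat_dvd_not_less)
    then have "coprime (int (d e)) (int p)" using p prime_imp_coprime_nat[of p "d e"] by (simp add: coprime_commute)
    then obtain x y where xy: "x * int (d e) + y * int p = 1" using bezout_int[of "int (d e)" "int p"] by auto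
    have "of_int x * (of_nat (d e) * gp e) + of_int y * (of_nat p * gp e) \<in> sb e"
      by (intro subgrp_add[OF sb] subgrp_of_int_mult[OF sb] de p_gp_sb)
    also have "of_int x * (of_nat (d e) * gp e) + of_int y * (of_nat p * gp e) = of_int (x * int (d e) + y * int p) * gp e"
      by (simp add: algebra_simps)
    finally have "gp e \<in> sb e" unfolding xy by simp
    then show False using bl e d(2)[of e] by blast
  qed
  then show ?thesis using d(3) by simp
qed

lemma presents_base: "presents (\<lambda>v. f (lin bs v)) A (rels p bl bw)"
  unfolding presents_def
proof (intro conjI allI)
  show "range (\<lambda>v. f (lin bs v)) = univ A"
  proof (intro equalityI subsetI)
    fix x assume x: "x \<in> univ A"
    let ?i = "pr x (od x - 1)"
    have "rep x \<in> sb (Suc ?i)"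
    proof (cases "od x")
      case 0
      then have "rep x \<in> R" using od[OF x] by simp
      then show ?thesis by (rule R_sb)
    next
      case (Suc r)
      then have "gp ?i = rep x" using x by (simp add: gp_def)
      then show ?thesis using gp_sb[of ?i "Suc ?i"] by simp
    qed
    from sb_digits[OF this] obtain d where d: "\<And>j. d j \<noteq> 0 \<Longrightarrow> bl j \<and> j < Suc ?i"
      "rep x - (\<Sum>j<Suc ?i. of_nat (d j) * gp j) \<in> R" by auto
    have "lin bs (\<Sum>j<Suc ?i. of_nat (d j) * monom 1 j) = (\<Sum>j<Suc ?i. of_nat (d j) * gp j)"
      by (rule lin_bs_digits) (rule d(1))
    then have "f (rep x) = f (lin bs (\<Sum>j<Suc ?i. of_nat (d j) * monom 1 j))" unfolding f_eq using d(2) by (simp only:)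
    then show "x \<in> range (\<lambda>v. f (lin bs v))" using f_rep[OF x] by (metis rangeI)
  qed (use f_univ in auto)
  fix u v
  show "f (lin bs (u + v)) = plus A (f (lin bs u)) (f (lin bs v))" using pres by (simp add: presents_def lin_add)
  show "f (lin bs u) = f (lin bs v) \<longleftrightarrow> u - v \<in> rels p bl bw"
    unfolding f_eq lin_diff[symmetric] using lin_bs_rels rels_lin_bs by blast
qed

lemma od_in [rec_intros]: "h \<in> C \<Longrightarrow> (\<lambda>x. od (h x)) \<in> C"
proof -
  have "od \<in> C" unfolding od_def by (rule Least_in) (intro rec_intros, rule ex_od)
  then show "h \<in> C \<Longrightarrow> (\<lambda>x. od (h x)) \<in> C" by (rule comp_in)
qed

lemma ge_in [rec_intros]: assumes "h \<in> C" shows "(\<lambda>x. ge (h x)) \<in> C"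
  unfolding ge_def by (intro rec_intros assms)

lemma cmb_in [rec_intros]: assumes "h \<in> C" "k \<in> C" shows "(\<lambda>x. cmb (h x) (k x)) \<in> C"
  unfolding cmb_def by (intro rec_intros comp_in[OF g_in] comp_in[OF assms(1)] assms)

lemma bl_in [rec_intros]: assumes "h \<in> C" shows "decid (\<lambda>x. bl (h x))"
  unfolding bl_def by (intro rec_intros assms comp_in[OF assms])

lemma bw_in [rec_intros]: assumes "h \<in> C" "k \<in> C" shows "(\<lambda>x. bw (h x) (k x)) \<in> C"
proof -
  have bm: "bm \<in> C" unfolding bm_def by (rule Least_in) (intro rec_intros, rule ex_bm)
  show ?thesis unfolding bw_def by (intro rec_intros comp_in[OF bm] assms)
qed

end

section \<open>Families of presentations and the descent to the subgroup of infinite height\<close>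

lemma pfix_all_dead: "pfix p (rels p (\<lambda>i. False) w) 0"
proof -
  have "v \<in> rels p (\<lambda>i. False) w" for v
    by (rule subgrp_UNIV[OF subgrp_rels]) (rule rels_dead, simp)
  then show ?thesis by (auto simp: pfix_def)
qed

lemma rels_cong:
  assumes "\<And>i. al i \<longleftrightarrow> al' i" "\<And>i j. al i \<Longrightarrow> j < i \<Longrightarrow> w i j = w' i j" shows "rels p al w = rels p al' w'"
proof -
  have "relv p al w i = relv p al' w' i" for i
    using assms by (auto simp: relv_def intro!: sum.cong)
  then show ?thesis unfolding rels_def by simp
qed

text \<open>The statement carried by the induction. It speaks of triangular presentations computable
  in \<open>C\<close>, uniformly in \<open>n\<close>, and not of structures, because rows are what
  the guessing procedure approximates.\<close>

definition good :: "(nat \<Rightarrow> nat) set \<Rightarrow> nat \<Rightarrow> struc \<Rightarrow> nat \<Rightarrow> nat set \<Rightarrow> (nat \<Rightarrow> nat \<Rightarrow> bool) \<Rightarrow> (nat \<Rightarrow> nat \<Rightarrow> nat \<Rightarrow> nat) \<Rightarrow> bool" where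
  "good C p A M S al w \<longleftrightarrow> clone.decid C (\<lambda>z. al (p1 z) (p2 z)) \<and> (\<lambda>z. w (p1 z) (p1 (p2 z)) (p2 (p2 z))) \<in> C \<and>
    (\<forall>n. (n \<in> S \<longrightarrow> (\<exists>h. presents h A (rels p (al n) (w n)))) \<and> (n \<notin> S \<longrightarrow> pfix p (rels p (al n) (w n)) M))"

lemma (in cgroup_tor) good_base:
  assumes "decid (\<lambda>x. x \<in> S)" shows "\<exists>al w. good C p A 0 S al w"
proof (intro exI)
  show "good C p A 0 S (\<lambda>n i. n \<in> S \<and> bl i) (\<lambda>n. bw)" unfolding good_def
  proof (intro conjI allI impI)
    show "decid (\<lambda>z. p1 z \<in> S \<and> bl (p2 z))" by (intro rec_intros decid_app[OF assms])
    show "(\<lambda>z. bw (p1 (p2 z)) (p2 (p2 z))) \<in> C" by (intro rec_intros)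
    fix n
    show "\<exists>h. presents h A (rels p (\<lambda>i. n \<in> S \<and> bl i) bw)" if n: "n \<in> S"
      using presents_base n by (intro exI[of _ "\<lambda>v. f (lin bs v)"]) simp
    show "pfix p (rels p (\<lambda>i. n \<in> S \<and> bl i) bw) 0" if n: "n \<notin> S"
      using n pfix_all_dead by simp
  qed
qed

text \<open>Elements of infinite height are numbers with decidable membership in the double jump,
  and the same \<open>g\<close> adds them. Generators outside this subgroup are mapped to
  zero.\<close>

lemma (in cgroup) ex_omega_presents:
  assumes tor: "\<And>v. \<exists>k. of_nat p ^ k * v \<in> R"
  shows "\<exists>f1 R1. cgroup_tor (jump (jump C)) p (A\<lparr>univ := ulm_omega p A (Suc 0)\<rparr>) f1 R1 g \<and>
    (\<forall>k. pfix p R1 k \<longleftrightarrow> pfix p R (Suc k))"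
proof -
  interpret J: clone "jump C" by (rule clone_jump)
  interpret J2: clone "jump (jump C)" by (rule J.clone_jump)
  let ?A1 = "A\<lparr>univ := ulm_omega p A (Suc 0)\<rparr>"
  define s where "s a = (if a \<in> f ` pdivw p R then rep a else 0)" for a
  let ?R1 = "{v. lin s v \<in> R}"
  note W = subgrp_pdivw[OF R, of p]
  have rep_f: "v - rep (f v) \<in> R" for v using f_rep[OF f_univ[of v]] f_eq[of v "rep (f v)"] by simp
  have rep_W: "rep (f v) \<in> pdivw p R" if "v \<in> pdivw p R" for v
    using that subgrp_diff_cancel[OF W subset_pdivw[OF R rep_f]] by blast
  have sW: "s a \<in> pdivw p R" for a using rep_W subgrp_zero[OF W] by (auto simp: s_def)
  have into: "lin s v \<in> pdivw p R" for v by (rule lin_in[OF W sW])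
  have onto: "\<exists>v. u - lin s v \<in> R" if "u \<in> pdivw p R" for u
    using that rep_f[of u] by (intro exI[of _ "monom 1 (f u)"]) (simp add: lin_monom s_def)
  have omega: "ulm_omega p A (Suc 0) = f ` pdivw p R"
    using ulm_omega_presents[OF pres, of p "Suc 0"] by (simp only: uw_Suc_0)
  have uA1: "univ ?A1 = f ` pdivw p R" unfolding omega by simp
  have pr1: "presents (\<lambda>v. f (lin s v)) ?A1 ?R1" unfolding presents_def
  proof (intro conjI allI)
    show "range (\<lambda>v. f (lin s v)) = univ ?A1"
    proof (intro equalityI subsetI)
      fix x assume "x \<in> univ ?A1"
      then obtain u where u: "u \<in> pdivw p R" "x = f u" unfolding uA1 by blast
      obtain v where "u - lin s v \<in> R" using onto[OF u(1)] by blast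
      then have "x = f (lin s v)" using u(2) f_eq by simp
      then show "x \<in> range (\<lambda>v. f (lin s v))" by blast
    next
      fix x assume "x \<in> range (\<lambda>v. f (lin s v))"
      then show "x \<in> univ ?A1" unfolding uA1 using into by blast
    qed
    fix u v
    show "f (lin s (u + v)) = plus ?A1 (f (lin s u)) (f (lin s v))" using pres by (simp add: presents_def lin_add)
    show "f (lin s u) = f (lin s v) \<longleftrightarrow> u - v \<in> ?R1" unfolding f_eq by (simp add: lin_diff)
  qed
  have "cgroup_tor (jump (jump C)) p ?A1 (\<lambda>v. f (lin s v)) ?R1 g"
  proof unfold_locales
    show "prime p" by (rule p)
    show "presents (\<lambda>v. f (lin s v)) ?A1 ?R1" by (rule pr1)
    show "J2.decid (\<lambda>x. x \<in> univ ?A1)" using decid_ulm_omega unfolding omega by simp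
    show "g \<in> jump (jump C)" by (intro J.subset_jump subset_jump g_in)
    show "g (pr x y) = plus ?A1 x y" if "x \<in> univ ?A1" "y \<in> univ ?A1" for x y
    proof -
      have "x \<in> univ A" "y \<in> univ A" using that f_univ unfolding uA1 by auto
      then show ?thesis using g_plus by simp
    qed
    show "\<exists>k. of_nat p ^ k * v \<in> ?R1" for v
    proof -
      obtain k where "of_nat p ^ k * lin s v \<in> R" using tor by blast
      then have "of_nat p ^ k * v \<in> ?R1" using lin_of_nat[of s "p ^ k" v] by simp
      then show ?thesis by blast
    qed
  qed
  moreover have "pfix p ?R1 k \<longleftrightarrow> pfix p R (Suc k)" for k
    by (rule uw_pullback(2)[of "lin s" R ?R1 p k]) (simp_all add: lin_diff lin_of_nat R onto into)
  ultimately show ?thesis by blast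
qed

lemma good_step:
  assumes "cgroup_tor C p A f R g" "\<not> pfix p R (Suc M)"
    and good: "good (jump (jump C)) p (A\<lparr>univ := ulm_omega p A (Suc 0)\<rparr>) M S al w"
  shows "\<exists>al w. good C p A (Suc M) S al w"
proof -
  interpret cgroup_tor C p A f R g by fact
  interpret J: clone "jump C" by (rule clone_jump)
  interpret J2: clone "jump (jump C)" by (rule J.clone_jump)
  let ?A1 = "A\<lparr>univ := ulm_omega p A (Suc 0)\<rparr>"
  \<comment> \<open>Only an obstruction to divisibility at \<omega> is needed to obtain
    \<open>xi\<close>; it follows from the one at the later multiple.\<close>
  have "\<not> pfix p R (Suc 0)" using pfix_stable[OF R, of p M] assms(2) by blast
  then obtain xi where xi: "xi \<in> pdivw p R" "\<And>y. y \<in> pdivw p R \<Longrightarrow> xi - of_nat p * y \<notin> R"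
    unfolding pfix_def uw_Suc_0 by blast
  interpret L: cgroup_long C p A f R g xi by unfold_locales (fact xi)+
  have al: "J2.decid (\<lambda>z. al (p1 z) (p2 z))" and w: "(\<lambda>z. w (p1 z) (p1 (p2 z)) (p2 (p2 z))) \<in> jump (jump C)"
    using good by (auto simp: good_def)
  \<comment> \<open>Each row of coefficients is packed into one number, the least code, since codes
    of a sequence are not unique. The successor in \<open>row\<close> reserves 0 for dead
    generators.\<close>
  define cd where "cd z = (LEAST v. \<forall>j<p2 z. nthc v j = w (p1 z) (p2 z) j)" for z
  have cd_in: "cd \<in> jump (jump C)" unfolding cd_def
  proof (rule J2.Least_in)
    show "J2.decid (\<lambda>z. \<forall>j<p2 (p2 z). nthc (p1 z) j = w (p1 (p2 z)) (p2 (p2 z)) j)"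
      by (intro rec_intros J2.app3_in[OF w])
    show "\<exists>y. \<forall>j<p2 x. nthc y j = w (p1 x) (p2 x) j" for x by (rule ex_nthc)
  qed
  have cd: "nthc (cd (pr n i)) j = w n i j" if "j < i" for n i j
    using LeastI_ex[OF ex_nthc[of i "w n i"]] that unfolding cd_def by simp
  define row where "row n i = (if al n i then Suc (cd (pr n i)) else 0)" for n i
  have "(\<lambda>z. row (p1 z) (p2 z)) \<in> jump (jump C)" unfolding row_def
    by (intro rec_intros al J2.comp_in[OF cd_in])
  \<comment> \<open>The double jump is unfolded into its two limits: \<open>h1\<close> is computable
    in the single jump, \<open>h2\<close> in \<open>C\<close> itself.\<close>
  then obtain h1 where h1: "h1 \<in> jump C" "\<And>x. \<exists>s0. \<forall>s\<ge>s0. h1 (pr x s) = row (p1 x) (p2 x)" by (rule jumpE) blast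
  obtain h2 where h2: "h2 \<in> C" "\<And>x. \<exists>s0. \<forall>s\<ge>s0. h2 (pr x s) = h1 x" using h1(1) by (rule jumpE) blast
  have "(\<lambda>z. if L.Ek (p1 z) (p2 z) then 1 else 0) \<in> jump C" using L.decid_Ek unfolding J.decid_def .
  then obtain h3 where h3: "h3 \<in> C" "\<And>x. \<exists>s0. \<forall>s\<ge>s0. h3 (pr x s) = (if L.Ek (p1 x) (p2 x) then 1 else 0)"
    by (rule jumpE) blast
  interpret T: stepc C p A f R g xi row "\<lambda>n i t. h1 (pr (pr n i) t)" "\<lambda>n i t s. h2 (pr (pr (pr n i) t) s)"
    "\<lambda>k e s. h3 (pr (pr k e) s) = 1"
  proof unfold_locales
    show "(\<lambda>z. h2 (pr (pr (pr (p1 z) (p1 (p2 z))) (p1 (p2 (p2 z)))) (p2 (p2 (p2 z))))) \<in> C"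
      by (intro rec_intros comp_in[OF h2(1)])
    show "\<exists>s0. \<forall>s\<ge>s0. h2 (pr (pr (pr n i) t) s) = h1 (pr (pr n i) t)" for n i t by (rule h2(2))
    show "\<exists>t0. \<forall>t\<ge>t0. h1 (pr (pr n i) t) = row n i" for n i using h1(2)[of "pr n i"] by simp
    show "decid (\<lambda>z. h3 (pr (pr (p1 z) (p1 (p2 z))) (p2 (p2 z))) = 1)" by (intro rec_intros comp_in[OF h3(1)])
    show "\<exists>s0. \<forall>s\<ge>s0. (h3 (pr (pr k e) s) = 1) = L.Ek k e" for k e
    proof -
      obtain s0 where "\<And>s. s \<ge> s0 \<Longrightarrow> h3 (pr (pr k e) s) = (if L.Ek k e then 1 else 0)" using h3(2)[of "pr k e"] by auto
      then show ?thesis by (intro exI[of _ s0]) auto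
    qed
  qed
  have RG: "rels p (T.alG n) (T.wG n) = rels p (al n) (w n)" for n
    by (rule rels_cong) (auto simp: T.alG_def T.wG_def row_def cd split: if_splits)
  have "good C p A (Suc M) S T.Hal T.Hw" unfolding good_def
  proof (intro conjI allI impI)
    show "decid (\<lambda>z. T.Hal (p1 z) (p2 z))" by (intro T.ch_live_in rec_intros)
    show "(\<lambda>z. T.Hw (p1 z) (p1 (p2 z)) (p2 (p2 z))) \<in> C" by (intro T.ch_rel_in rec_intros)
    fix n
    show "\<exists>h. presents h A (T.RH n)" if n: "n \<in> S"
    proof -
      obtain h where "presents h ?A1 (rels p (al n) (w n))" using good n unfolding good_def by blast
      then have "presents h ?A1 (rels p (T.alG n) (T.wG n))" unfolding RG .
      then show ?thesis using tor by (rule T.step_presents)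
    qed
    show "pfix p (T.RH n) (Suc M)" if n: "n \<notin> S"
    proof -
      have "pfix p (rels p (al n) (w n)) M" using good n unfolding good_def by blast
      then show ?thesis using T.step_pfix[of n M] unfolding RG by blast
    qed
  qed
  then show ?thesis by blast
qed

lemma ex_good:
  assumes "cgroup_tor C p A f R g" "\<not> pfix p R M" "clone.decid (((jump \<circ> jump) ^^ M) C) (\<lambda>x. x \<in> S)"
  shows "\<exists>al w. good C p A M S al w"
  using assms
proof (induction M arbitrary: C A f R)
  case 0
  then show ?case using cgroup_tor.good_base by simp
next
  case (Suc M)
  interpret cgroup_tor C p A f R g by fact
  obtain f1 R1 where 1: "cgroup_tor (jump (jump C)) p (A\<lparr>univ := ulm_omega p A (Suc 0)\<rparr>) f1 R1 g"
    "\<forall>k. pfix p R1 k \<longleftrightarrow> pfix p R (Suc k)" using ex_omega_presents[OF tor] by blast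
  have eq: "((jump \<circ> jump) ^^ Suc M) C = ((jump \<circ> jump) ^^ M) (jump (jump C))"
    unfolding funpow_Suc_right by (simp only: comp_apply)
  have "\<exists>al w. good (jump (jump C)) p (A\<lparr>univ := ulm_omega p A (Suc 0)\<rparr>) M S al w"
  proof (rule Suc.IH[OF 1(1)])
    show "\<not> pfix p R1 M" using 1(2) Suc.prems(2) by blast
    show "clone.decid (((jump \<circ> jump) ^^ M) (jump (jump C))) (\<lambda>x. x \<in> S)" using Suc.prems(3) unfolding eq .
  qed
  then show ?case using good_step[OF Suc.prems(1,2)] by blast
qed

section \<open>Digits in base \<open>p\<close>\<close>

lemma dig_beyond: assumes "p \<ge> 2" "m < p ^ n" "n \<le> j" shows "dig p m j = 0"
proof -
  have "p ^ n \<le> p ^ j" using assms by (intro power_increasing) auto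
  then show ?thesis using assms(2) by (simp add: dig_def)
qed

lemma less_power_self: "p \<ge> 2 \<Longrightarrow> m < p ^ (m::nat)"
  by (rule order.strict_trans2[OF less_exp power_mono]) simp_all

lemma dig_Suc: "dig p m (Suc j) = dig p (m div p) j"
  by (simp add: dig_def div_mult2_eq)

lemma dig_inject: "m < p ^ n \<Longrightarrow> m' < p ^ n \<Longrightarrow> (\<And>j. j < n \<Longrightarrow> dig p m j = dig p m' j) \<Longrightarrow> m = m'"
proof (induction n arbitrary: m m')
  case (Suc n)
  have "m div p = m' div p"
  proof (rule Suc.IH)
    show "m div p < p ^ n" "m' div p < p ^ n" using Suc.prems(1,2) by (simp_all add: less_mult_imp_div_less mult.commute)
    show "dig p (m div p) j = dig p (m' div p) j" if "j < n" for j
      using Suc.prems(3)[of "Suc j"] that by (simp add: dig_Suc)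
  qed
  moreover have "m mod p = m' mod p" using Suc.prems(3)[of 0] by (simp add: dig_def)
  ultimately show ?case by (metis mult_div_mod_eq)
qed simp

subsection \<open>Groups on digit strings\<close>

locale digit_group =
  fixes p :: nat and al :: "nat \<Rightarrow> bool" and w :: "nat \<Rightarrow> nat \<Rightarrow> nat"
  assumes p: "prime p"
begin

lemma p2: "p \<ge> 2" and p0: "p > 0" using p by (simp_all add: prime_ge_2_nat prime_gt_0_nat)

definition val :: "nat \<Rightarrow> int poly" where "val m = (\<Sum>j<m. of_nat (dig p m j) * monom 1 j)"
text \<open>Numbers whose base-\<open>p\<close> digits form a normal form. Positions below
  \<open>m\<close> suffice because \<open>m < p ^ m\<close>, so higher digits vanish.\<close>

definition U :: "nat set" where "U = {m. \<forall>j<m. dig p m j \<noteq> 0 \<longrightarrow> al j}"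

lemma val_bound: assumes "m < p ^ N" shows "val m = (\<Sum>j<N. of_nat (dig p m j) * monom 1 j)"
proof -
  have "val m = (\<Sum>j<max m N. of_nat (dig p m j) * monom 1 j)" unfolding val_def
    using dig_beyond[OF p2 less_power_self[OF p2], of m] by (intro sum.mono_neutral_left) (auto simp: not_less)
  also have "\<dots> = (\<Sum>j<N. of_nat (dig p m j) * monom 1 j)"
    using dig_beyond[OF p2 assms] by (intro sum.mono_neutral_right) (auto simp: not_less)
  finally show ?thesis .
qed

lemma less_power: "m \<le> N \<Longrightarrow> m < p ^ N"
  using less_power_self[OF p2, of m] power_increasing[of m N p] p2 by linarith

lemma coeff_val: "coeff (val m) j = int (dig p m j)"
proof -
  have "coeff (val m) j = (\<Sum>i<m. if i = j then int (dig p m i) else 0)"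
    unfolding val_def coeff_sum by (intro sum.cong) auto
  then show ?thesis using dig_beyond[OF p2 less_power_self[OF p2], of m j] by simp
qed

lemma ex_nf: "\<exists>m\<in>U. v - val m \<in> rels p al w"
proof -
  let ?N = "Suc (degree v)"
  have "\<exists>d. (\<forall>j. d j < p) \<and> (\<forall>j. d j \<noteq> 0 \<longrightarrow> al j \<and> j < ?N) \<and> v - (\<Sum>j<?N. of_nat (d j) * monom 1 j) \<in> rels p al w"
    by (rule normal_form_exists[OF p0]) (simp add: coeff_eq_0)
  then obtain d where d: "\<And>j. d j < p" "\<And>j. d j \<noteq> 0 \<Longrightarrow> al j \<and> j < ?N"
    "v - (\<Sum>j<?N. of_nat (d j) * monom 1 j) \<in> rels p al w" by auto
  obtain m where m: "m < p ^ ?N" "\<And>j. j < ?N \<Longrightarrow> dig p m j = d j" using ex_dig[of ?N d p] d(1) by blast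
  have "val m = (\<Sum>j<?N. of_nat (d j) * monom 1 j)" unfolding val_bound[OF m(1)] using m(2) by (intro sum.cong) simp_all
  moreover have "m \<in> U" unfolding U_def
  proof (intro CollectI allI impI)
    fix j assume nz: "dig p m j \<noteq> 0"
    then have "j < ?N" using dig_beyond[OF p2 m(1), of j] by linarith
    then have "d j \<noteq> 0" using m(2) nz by simp
    then show "al j" using d(2) by blast
  qed
  ultimately show ?thesis using d(3) by (intro bexI[of _ m]) (simp_all only:)
qed

lemma nf_unique:
  assumes "m \<in> U" "m' \<in> U" "val m - val m' \<in> rels p al w" shows "m = m'"
proof -
  let ?N = "max m m'"
  have b: "m < p ^ ?N" "m' < p ^ ?N" by (simp_all add: less_power)
  have supp: "al j \<and> j < ?N" if x: "x \<in> U" "x \<le> ?N" "dig p x j \<noteq> 0" for x j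
  proof -
    have "j < x" using dig_beyond[OF p2 less_power_self[OF p2, of x], of j] x(3) by linarith
    then show ?thesis using x unfolding U_def by auto
  qed
  have z: "(\<Sum>j<?N. of_nat (dig p m j) * monom 1 j) - (\<Sum>j<?N. of_nat (dig p m' j) * monom 1 j) \<in> rels p al w"
    using assms(3) unfolding val_bound[OF b(1)] val_bound[OF b(2)] .
  have "dig p m = dig p m'"
  proof (rule normal_form_unique[OF _ _ z _ _ p0])
    show "dig p m j < p" "dig p m' j < p" for j using p0 by (simp_all add: dig_def)
    show "al j \<and> j < ?N" if "dig p m j \<noteq> 0" for j by (rule supp[OF assms(1) _ that]) simp
    show "al j \<and> j < ?N" if "dig p m' j \<noteq> 0" for j by (rule supp[OF assms(2) _ that]) simp
  qed
  then show ?thesis using dig_inject[OF b] by simp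
qed

definition nf :: "int poly \<Rightarrow> nat" where "nf v = (SOME m. m \<in> U \<and> v - val m \<in> rels p al w)"

lemma nf: "nf v \<in> U" "v - val (nf v) \<in> rels p al w"
proof -
  have "nf v \<in> U \<and> v - val (nf v) \<in> rels p al w" unfolding nf_def by (rule someI_ex) (use ex_nf[of v] in blast)
  then show "nf v \<in> U" "v - val (nf v) \<in> rels p al w" by auto
qed

lemma nf_eqI:
  assumes "m \<in> U" "v - val m \<in> rels p al w" shows "nf v = m"
proof (rule nf_unique[OF nf(1) assms(1)])
  show "val (nf v) - val m \<in> rels p al w"
    using subgrp_diff[OF subgrp_rels assms(2) nf(2)[of v]] by simp
qed

definition dstruc :: struc where "dstruc = \<lparr>univ = U, plus = \<lambda>a b. nf (val a + val b)\<rparr>"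

lemma dstruc_presents: "presents nf dstruc (rels p al w)"
  unfolding presents_def
proof (intro conjI allI)
  note R = subgrp_rels[of p al w]
  have eq: "nf u = nf v" if "u - v \<in> rels p al w" for u v
  proof (rule nf_eqI[OF nf(1)])
    show "u - val (nf v) \<in> rels p al w" using subgrp_add[OF R that nf(2)[of v]] by simp
  qed
  show "range nf = univ dstruc"
  proof (intro equalityI subsetI)
    fix m assume "m \<in> univ dstruc"
    then have "nf (val m) = m" using nf_eqI[of m "val m"] subgrp_zero[OF R] by (simp add: dstruc_def)
    then show "m \<in> range nf" by (metis rangeI)
  qed (use nf(1) in \<open>auto simp: dstruc_def\<close>)
  fix u v
  have "(u + v) - (val (nf u) + val (nf v)) \<in> rels p al w"
    using subgrp_add[OF R nf(2)[of u] nf(2)[of v]] by (simp add: algebra_simps)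
  then show "nf (u + v) = plus dstruc (nf u) (nf v)" using eq by (simp add: dstruc_def)
  show "nf u = nf v \<longleftrightarrow> u - v \<in> rels p al w"
  proof
    assume "nf u = nf v"
    then show "u - v \<in> rels p al w" using subgrp_diff[OF R nf(2)[of u] nf(2)[of v]] by simp
  qed (rule eq)
qed

definition cp :: "nat \<Rightarrow> nat \<Rightarrow> nat" where "cp i j = (if i = j then if al i then p else 1 else 0)"
definition cm :: "nat \<Rightarrow> nat \<Rightarrow> nat" where "cm i j = (if al i \<and> j < i then w i j else 0)"

lemma coeff_relv_diff: "coeff (relv p al w i) j = int (cp i j) - int (cm i j)"
proof -
  have "coeff (\<Sum>j<i. of_nat (w i j) * monom (1::int) j) j = (\<Sum>j'<i. if j' = j then int (w i j') else 0)"
    unfolding coeff_sum by (intro sum.cong) auto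
  also have "\<dots> = (if j < i then int (w i j) else 0)" by simp
  finally show ?thesis by (auto simp: relv_def cp_def cm_def)
qed

text \<open>A sum is verified by a certificate \<open>(m, ((a, b), N))\<close>: the combination of the relations with the integer
  coefficients \<open>a\<^sub>i - b\<^sub>i\<close>, rearranged so that no subtraction occurs.\<close>

definition cert :: "nat \<Rightarrow> nat \<Rightarrow> nat \<Rightarrow> nat \<Rightarrow> nat \<Rightarrow> nat \<Rightarrow> bool" where
  "cert x y m a b N \<longleftrightarrow> m \<in> U \<and> x \<le> N \<and> y \<le> N \<and> m \<le> N \<and>
    (\<forall>j<N. dig p x j + dig p y j + (\<Sum>i<N. nthc b i * cp i j + nthc a i * cm i j) =
      dig p m j + (\<Sum>i<N. nthc a i * cp i j + nthc b i * cm i j))"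

lemma cert_iff:
  assumes N: "x \<le> N" "y \<le> N" "m \<le> N"
  shows "(\<forall>j<N. dig p x j + dig p y j + (\<Sum>i<N. nthc b i * cp i j + nthc a i * cm i j) =
      dig p m j + (\<Sum>i<N. nthc a i * cp i j + nthc b i * cm i j)) \<longleftrightarrow>
    val x + val y - val m = (\<Sum>i<N. of_int (int (nthc a i) - int (nthc b i)) * relv p al w i)" (is "?L \<longleftrightarrow> ?l = ?r")
proof -
  have r: "coeff ?r j = int (\<Sum>i<N. nthc a i * cp i j + nthc b i * cm i j) - int (\<Sum>i<N. nthc b i * cp i j + nthc a i * cm i j)" for j
    unfolding coeff_sum coeff_of_int_mult coeff_relv_diff of_nat_sum sum_subtractf[symmetric]
    by (intro sum.cong) (simp_all add: algebra_simps)
  have l: "coeff ?l j = int (dig p x j) + int (dig p y j) - int (dig p m j)" for j by (simp add: coeff_val)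
  have lz: "coeff ?l j = 0" if "j \<ge> N" for j unfolding l using that N
      dig_beyond[OF p2 less_power[OF N(1)], of j] dig_beyond[OF p2 less_power[OF N(2)], of j]
      dig_beyond[OF p2 less_power[OF N(3)], of j] by simp
  have rz: "coeff ?r j = 0" if "j \<ge> N" for j
    unfolding r using that by (simp add: cp_def cm_def)
  have "(dig p x j + dig p y j + (\<Sum>i<N. nthc b i * cp i j + nthc a i * cm i j) =
      dig p m j + (\<Sum>i<N. nthc a i * cp i j + nthc b i * cm i j)) \<longleftrightarrow> coeff ?l j = coeff ?r j" for j
    unfolding l r by linarith
  then have "?L \<longleftrightarrow> (\<forall>j<N. coeff ?l j = coeff ?r j)" by (simp only:)
  also have "\<dots> \<longleftrightarrow> (\<forall>j. coeff ?l j = coeff ?r j)" 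
  proof (intro iffI allI)
    fix j assume "\<forall>j<N. coeff ?l j = coeff ?r j"
    then show "coeff ?l j = coeff ?r j" using lz[of j] rz[of j] by (cases "j < N") simp_all
  qed simp
  also have "\<dots> \<longleftrightarrow> ?l = ?r" by (simp only: poly_eq_iff)
  finally show ?thesis .
qed

lemma cert_sound: assumes "cert x y m a b N" shows "nf (val x + val y) = m"
proof -
  have "m \<in> U" "x \<le> N" "y \<le> N" "m \<le> N" using assms unfolding cert_def by auto
  moreover from this have "val x + val y - val m = (\<Sum>i<N. of_int (int (nthc a i) - int (nthc b i)) * relv p al w i)"
    using assms cert_iff[of x N y m b a] unfolding cert_def by blast
  then have "val x + val y - val m \<in> rels p al w" unfolding rels_def mem_Collect_eq by (intro exI)
  ultimately show ?thesis by (intro nf_eqI)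
qed

lemma cert_complete: "\<exists>m a b N. cert x y m a b N"
proof -
  let ?m = "nf (val x + val y)"
  have "\<exists>N z. val x + val y - val ?m = (\<Sum>i<N. of_int (z i) * relv p al w i)"
    by (rule nf(2)[of "val x + val y", unfolded rels_def mem_Collect_eq])
  then obtain N0 z where z: "val x + val y - val ?m = (\<Sum>i<N0. of_int (z i) * relv p al w i)" by (elim exE)
  define N where "N = N0 + x + y + ?m"
  obtain a where a: "\<forall>i<N. nthc a i = (if i < N0 then nat (z i) else 0)"
    using ex_nthc[of N "\<lambda>i. if i < N0 then nat (z i) else 0"] by (elim exE)
  obtain b where b: "\<forall>i<N. nthc b i = (if i < N0 then nat (- z i) else 0)"
    using ex_nthc[of N "\<lambda>i. if i < N0 then nat (- z i) else 0"] by (elim exE)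
  have ab: "int (nthc a i) - int (nthc b i) = (if i < N0 then z i else 0)" if "i < N" for i using a b that by simp
  have "(\<Sum>i<N0. of_int (z i) * relv p al w i) = (\<Sum>i<N. of_int (int (nthc a i) - int (nthc b i)) * relv p al w i)"
  proof -
    have "(\<Sum>i<N0. of_int (z i) * relv p al w i) = (\<Sum>i<N. of_int (if i < N0 then z i else 0) * relv p al w i)"
      unfolding N_def by (intro sum.mono_neutral_cong_left) auto
    also have "\<dots> = (\<Sum>i<N. of_int (int (nthc a i) - int (nthc b i)) * relv p al w i)"
      by (rule sum.cong[OF refl]) (simp only: ab lessThan_iff)
    finally show ?thesis .
  qed
  then have "val x + val y - val ?m = (\<Sum>i<N. of_int (int (nthc a i) - int (nthc b i)) * relv p al w i)" using z by (simp only:)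
  moreover have le: "x \<le> N" "y \<le> N" "?m \<le> N" unfolding N_def by simp_all
  ultimately have "cert x y ?m a b N" unfolding cert_def using cert_iff[OF le, of b a] nf(1) by blast
  then show ?thesis by blast
qed

end

section \<open>From presentations back to structures\<close>

lemma presents_iso:
  assumes f: "presents f A R" and h: "presents h B R" shows "struc_iso A B"
proof -
  have f': "range f = univ A" "\<And>u v. f (u + v) = plus A (f u) (f v)" "\<And>u v. f u = f v \<longleftrightarrow> u - v \<in> R"
    using f by (simp_all add: presents_def)
  have h': "range h = univ B" "\<And>u v. h (u + v) = plus B (h u) (h v)" "\<And>u v. h u = h v \<longleftrightarrow> u - v \<in> R"
    using h by (simp_all add: presents_def)
  define k where "k x = h (SOME v. f v = x)" for x
  have kf: "k (f v) = h v" for v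
  proof -
    have "f (SOME u. f u = f v) = f v" by (rule someI[of "\<lambda>u. f u = f v" v]) simp
    then show ?thesis unfolding k_def f'(3) h'(3) .
  qed
  have "bij_betw k (univ A) (univ B)"
  proof (rule bij_betw_imageI)
    show "inj_on k (univ A)" unfolding f'(1)[symmetric] by (rule inj_onI) (use kf f'(3) h'(3) in auto)
    show "k ` univ A = univ B" unfolding f'(1)[symmetric] h'(1)[symmetric] image_image kf ..
  qed
  moreover have "k (plus A x y) = plus B (k x) (k y)" if xy: "x \<in> univ A" "y \<in> univ A" for x y
  proof -
    obtain u v where "x = f u" "y = f v" using xy unfolding f'(1)[symmetric] by blast
    then show ?thesis by (simp only: f'(2)[symmetric] kf h'(2))
  qed
  ultimately show ?thesis unfolding struc_iso_def by blast
qed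

lemma presents_iso_transfer:
  assumes f: "presents f A R" and iso: "struc_iso A B" shows "\<exists>h. presents h B R"
proof -
  have f': "range f = univ A" "\<And>u v. f (u + v) = plus A (f u) (f v)" "\<And>u v. f u = f v \<longleftrightarrow> u - v \<in> R"
    using f by (simp_all add: presents_def)
  obtain k where k: "bij_betw k (univ A) (univ B)" "\<forall>x\<in>univ A. \<forall>y\<in>univ A. k (plus A x y) = plus B (k x) (k y)"
    using iso unfolding struc_iso_def by blast
  have fA: "f v \<in> univ A" for v using f'(1) by blast
  have "presents (\<lambda>v. k (f v)) B R" unfolding presents_def
  proof (intro conjI allI)
    show "range (\<lambda>v. k (f v)) = univ B" using bij_betw_imp_surj_on[OF k(1)] unfolding f'(1)[symmetric] by (simp only: image_image)
    fix u v
    show "k (f (u + v)) = plus B (k (f u)) (k (f v))" using k(2) fA by (simp only: f'(2))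
    show "k (f u) = k (f v) \<longleftrightarrow> u - v \<in> R" using inj_on_eq_iff[OF bij_betw_imp_inj_on[OF k(1)] fA fA] f'(3) by simp
  qed
  then show ?thesis by blast
qed

lemma presents_is_struc: assumes "presents f A R" shows "is_struc A"
  unfolding is_struc_def
proof (intro ballI)
  have f': "range f = univ A" "\<And>u v. f (u + v) = plus A (f u) (f v)" using assms by (simp_all add: presents_def)
  fix x y assume "x \<in> univ A" "y \<in> univ A"
  then obtain u v where "x = f u" "y = f v" unfolding f'(1)[symmetric] by blast
  then have "plus A x y = f (u + v)" by (simp only: f'(2))
  then show "plus A x y \<in> univ A" unfolding f'(1)[symmetric] by blast
qed

lemma computable_struc_comp_fns:
  assumes "computable_struc A"
  shows "clone.decid comp_fns (\<lambda>x. x \<in> univ A)"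
    "\<exists>g\<in>comp_fns. \<forall>x\<in>univ A. \<forall>y\<in>univ A. g (pr x y) = plus A x y"
proof -
  interpret clone comp_fns by (rule clone_comp_fns)
  have "(\<lambda>x. if hd (dlist 1 x) \<in> univ A then 1 else 0) \<in> comp_fns"
    using assms unfolding computable_struc_def decidable_rel_def by (intro comp_fns_dlist) blast
  then have 1: "(\<lambda>x. if p1 x \<in> univ A then 1 else 0) \<in> comp_fns" by simp
  have "(\<lambda>x. pr x 0) \<in> comp_fns" by (intro rec_intros)
  from comp_in[OF 1 this] show "decid (\<lambda>x. x \<in> univ A)" unfolding decid_def by simp
  obtain g where g: "computable_fn 2 g" "\<forall>x\<in>univ A. \<forall>y\<in>univ A. g [x, y] = plus A x y"
    using assms unfolding computable_struc_def by blast
  have 2: "(\<lambda>x. g [p1 x, p1 (p2 x)]) \<in> comp_fns" using comp_fns_dlist[OF g(1)] by (simp add: numeral_2_eq_2)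
  have "(\<lambda>z. pr (p1 z) (pr (p2 z) 0)) \<in> comp_fns" by (intro rec_intros)
  from comp_in[OF 2 this] have "(\<lambda>z. g [p1 z, p2 z]) \<in> comp_fns" by simp
  then show "\<exists>g\<in>comp_fns. \<forall>x\<in>univ A. \<forall>y\<in>univ A. g (pr x y) = plus A x y"
    using g(2) by (intro bexI[of _ "\<lambda>z. g [p1 z, p2 z]"]) simp_all
qed

text \<open>Normal forms are chosen noncomputably, but a sum can be found by unbounded search for a
  certificate. One always exists, and by uniqueness of normal forms any certificate shows the right
  result.\<close>

lemma unif_computable_digits:
  assumes p: "prime p" and al: "clone.decid comp_fns (\<lambda>z. al (p1 z) (p2 z))"
    and w: "(\<lambda>z. w (p1 z) (p1 (p2 z)) (p2 (p2 z))) \<in> comp_fns"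
  shows "unif_computable (\<lambda>n. digit_group.dstruc p (al n) (w n))"
proof -
  interpret clone comp_fns by (rule clone_comp_fns)
  have D: "digit_group p" by unfold_locales (rule p)
  have al': "decid (\<lambda>x. al (a x) (b x))" if "a \<in> comp_fns" "b \<in> comp_fns" for a b by (rule decid_app2[OF al that])
  have w': "(\<lambda>x. w (a x) (b x) (c x)) \<in> comp_fns" if "a \<in> comp_fns" "b \<in> comp_fns" "c \<in> comp_fns" for a b c
    by (rule app3_in[OF w that])
  have U: "decid (\<lambda>x. a x \<in> digit_group.U p (al (n x)))" if "n \<in> comp_fns" "a \<in> comp_fns" for n a
    unfolding digit_group.U_def[OF D] mem_Collect_eq
    by (intro rec_intros al' comp_in[OF that(1)] comp_in[OF that(2)] that)
  let ?cert = "\<lambda>n. digit_group.cert p (al n) (w n)"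
  let ?P = "\<lambda>x y. ?cert (p1 x) (p1 (p2 x)) (p2 (p2 x)) (p1 y) (p1 (p1 (p2 y))) (p2 (p1 (p2 y))) (p2 (p2 y))"
  have "decid (\<lambda>z. ?P (p2 z) (p1 z))"
    unfolding digit_group.cert_def[OF D] digit_group.cp_def[OF D] digit_group.cm_def[OF D]
    by (intro rec_intros U al' w')
  moreover have "\<exists>y. ?P x y" for x
  proof -
    obtain m a b N where "?cert (p1 x) (p1 (p2 x)) (p2 (p2 x)) m a b N" using digit_group.cert_complete[OF D] by blast
    then have "?P x (pr m (pr (pr a b) N))" by simp
    then show ?thesis by blast
  qed
  ultimately have L: "(\<lambda>x. LEAST y. ?P x y) \<in> comp_fns" by (rule Least_in)
  have G: "(\<lambda>x. p1 (LEAST y. ?P x y)) \<in> comp_fns" by (rule p1_comp_in[OF L])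
  have sound: "p1 (LEAST y. ?P x y) = plus (digit_group.dstruc p (al (p1 x)) (w (p1 x))) (p1 (p2 x)) (p2 (p2 x))" for x
  proof -
    have "?P x (LEAST y. ?P x y)" by (rule LeastI_ex) fact
    from digit_group.cert_sound[OF D this] show ?thesis by (simp add: digit_group.dstruc_def[OF D])
  qed
  let ?g = "\<lambda>xs. p1 (LEAST y. ?P (pr (xs ! 0) (pr (xs ! 1) (xs ! 2))) y)"
  have "computable_fn 3 ?g"
    by (rule computable_fn_comp_fns[OF G]) (intro computable_fn_pr computable_fn_nth; simp)
  moreover have "?g [n, x, y] = plus (digit_group.dstruc p (al n) (w n)) x y" for n x y
    using sound[of "pr n (pr x y)"] by simp
  ultimately have 1: "\<exists>g. computable_fn 3 g \<and> (\<forall>n. \<forall>x\<in>univ (digit_group.dstruc p (al n) (w n)).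
      \<forall>y\<in>univ (digit_group.dstruc p (al n) (w n)). g [n, x, y] = plus (digit_group.dstruc p (al n) (w n)) x y)"
    by (intro exI[of _ ?g]) blast
  have "(\<lambda>z. if p2 z \<in> digit_group.U p (al (p1 z)) then 1 else 0) \<in> comp_fns"
    using U[OF p1_in p2_in] unfolding decid_def .
  from computable_fn_comp_fns[OF this, of 2 "\<lambda>xs. pr (xs ! 0) (xs ! 1)"]
  have "decidable_rel 2 (\<lambda>xs. xs ! 1 \<in> univ (digit_group.dstruc p (al (xs ! 0)) (w (xs ! 0))))"
    unfolding decidable_rel_def by (simp add: digit_group.dstruc_def[OF D] computable_fn_pr computable_fn_nth)
  then show ?thesis unfolding unif_computable_def using 1 by blast
qed

theorem theorem5p16:
  fixes p M :: nat and A :: struc and S :: "nat set"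
  assumes "prime p"
    and "computable_struc A"
    and "abelian_p_group p A"
    and "reduced p A"
    and "length_gt_omega_times p A M"
    and "Delta_set (2 * M + 1) S"
  shows "\<exists>As. unif_computable As \<and> (\<forall>n. is_struc (As n) \<and> (struc_iso (As n) A \<longleftrightarrow> n \<in> S))"
proof -
  interpret clone comp_fns by (rule clone_comp_fns)
  obtain f R where f: "presents f A R" and tor: "\<And>v. \<exists>n. of_nat p ^ n * v \<in> R"
    using abelian_p_group_presents[OF assms(3)] by blast
  obtain g where g: "g \<in> comp_fns" "\<forall>x\<in>univ A. \<forall>y\<in>univ A. g (pr x y) = plus A x y"
    using computable_struc_comp_fns(2)[OF assms(2)] by blast
  have "cgroup_tor comp_fns p A f R g"
    by unfold_locales (use assms(1) f tor g computable_struc_comp_fns(1)[OF assms(2)] in auto)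
  from ex_good[OF this length_gt_pfix[OF f assms(5)] Delta_set_decid[OF assms(6)]]
  obtain al w where good: "good comp_fns p A M S al w" by (elim exE)
  have D: "digit_group p" by unfold_locales (rule assms(1))
  let ?As = "\<lambda>n. digit_group.dstruc p (al n) (w n)"
  have pres: "presents (digit_group.nf p (al n) (w n)) (?As n) (rels p (al n) (w n))" for n
    by (rule digit_group.dstruc_presents[OF D])
  have "unif_computable ?As"
    using good unfolding good_def by (intro unif_computable_digits[OF assms(1)]) blast+
  moreover have "is_struc (?As n)" for n by (rule presents_is_struc[OF pres])
  moreover have "struc_iso (?As n) A \<longleftrightarrow> n \<in> S" for n
  proof
    assume iso: "struc_iso (?As n) A"
    show "n \<in> S"
    proof (rule ccontr)
      assume "n \<notin> S"
      then have fx: "pfix p (rels p (al n) (w n)) M" using good unfolding good_def by blast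
      \<comment> \<open>The isomorphism transports the presentation to \<open>A\<close>, so
        divisibility at \<omega>\<open>M\<close> would be a property of \<open>A\<close>, against
        its length.\<close>
      obtain h where "presents h A (rels p (al n) (w n))" using presents_iso_transfer[OF pres iso] by blast
      then show False using length_gt_pfix[OF _ assms(5)] fx by blast
    qed
  next
    assume "n \<in> S"
    then obtain h where "presents h A (rels p (al n) (w n))" using good unfolding good_def by blast
    then show "struc_iso (?As n) A" by (rule presents_iso[OF pres])
  qed
  ultimately show ?thesis by (intro exI[of _ ?As]) blast
qed

end
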